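(* Let $\Pi=\{\mathcal H_0\oplus\mathcal H_1,\Gamma_0,\Gamma_1\}$ be a decomposing $D$-triplet for $L$ with Weyl function $M_+(\cdot)$, let $\tau=\{\tau_+,\tau_-\}\in\widetilde R(\mathcal H_0,\mathcal H_1)$ with $\tau_+(\lambda)=\{(C_0(\lambda),C_1(\lambda));\mathcal K_+\}$, and let $\tau_+(\lambda)=\{K_0(\lambda),K_1(\lambda);\mathcal K_+'\}$, $\lambda\in\mathbb C_+$, be the equivalent representation of $\tau_+$ by a holomorphic pair $(K_0(\lambda)\;K_1(\lambda))^\top:\mathcal K_+'\to\mathcal H_0\oplus\mathcal H_1$, with $K_0(\lambda)=(K_{01}(\lambda)\;K_{02}(\lambda))^\top:\mathcal K_+'\to\mathcal H_1\oplus\mathcal H_2$. Let $u_{j\tau}(\cdot,\lambda)$, $j\in\{1,2\}$, be the operator solutions defined in the context, let $$U_\tau(t,\lambda)=(u_{2\tau}(t,\lambda)\;\;u_{1\tau}(t,\lambda)):H^n\oplus H^n\to H,\qquad\lambda\in\mathbb C_+,$$ and let $\beta(\lambda)\in[H^n\oplus H^n,\mathcal K_+']$, $\lambda\in\mathbb C_+$, be given by $$\beta(\lambda)=\big(-(K_1(\lambda)+M_+(\lambda)K_0(\lambda))^{-1}M_+(\lambda)\upharpoonright H^n\;\;\;(K_1(\lambda)+M_+(\lambda)K_0(\lambda))^{-1}\upharpoonright H^n\big).$$ Then: 1) the characteristic matrix $\Omega_\tau(\cdot)$ corresponding to $\tau$ obeys the identity $$\Omega_\tau(\mu)-\Omega_\tau^*(\lambda)=(\mu-\overline\lambda)\int_0^bU_\tau^*(t,\lambda)U_\tau(t,\mu)\,dt+\beta^*(\lambda)\big(K_{01}^*(\lambda)K_1(\mu)-K_1^*(\lambda)K_{01}(\mu)-iK_{02}^*(\lambda)K_{02}(\mu)\big)\beta(\mu),\quad\mu,\lambda\in\mathbb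 C_+,$$ where the integral converges strongly: $\int_0^bU_\tau^*(t,\lambda)U_\tau(t,\mu)\,dt=\operatorname{s-lim}_{\eta\uparrow b}\int_0^\eta U_\tau^*(t,\lambda)U_\tau(t,\mu)\,dt$; 2) $\Omega_\tau(\cdot)$ satisfies the inequality $$\frac{\mathrm{Im}\,\Omega_\tau(\mu)}{\mathrm{Im}\,\mu}\ge\int_0^bU_\tau^*(t,\mu)U_\tau(t,\mu)\,dt,\qquad\mu\in\mathbb C_+,$$ which turns into an equality for canonical characteristic matrices (i.e. for $\tau\in\widetilde R^0(\mathcal H_0,\mathcal H_1)$). This implies that $\Omega_\tau(\cdot)$ is a Nevanlinna operator function.
   Context: **Setting.** $[X,Y]$ is the set of bounded linear operators from a Hilbert space $X$ to a Hilbert space $Y$, $[X]=[X,X]$; for $T\in[X,Y]$, $0\in\rho(T)$ means $T^{-1}\in[Y,X]$; $\mathrm{Im}\,T=(T-T^* )/2i$. $\mathbb C_\pm$ are the open upper/lower half-planes. $\Delta=[0,b\rangle$ with $0<b\le\infty$ (if $b<\infty$, $b$ may or may not belong to $\Delta$), $H$ is a separable complex Hilbert space ($\dim H\le\infty$), $D=d/dt$, and $$l[y]=\sum_{k=1}^n(-1)^k\Big(D^k(p_{n-k}D^ky)-\tfrac i2\big[D^{k-1}(q_{n-k}^*D^ky)+D^k(q_{n-k}D^{k-1}y)\big]\Big)+p_ny$$ with sufficiently smooth coefficients $p_k,q_k:\Delta\to[H]$, $p_k(t)=p_k^*(t)$, $0\in\rho(p_0(t))$. Quasi-derivatives: $y^{[k]}=D^ky$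 ($0\le k\le n-1$), $y^{[n]}=p_0D^ny-\frac i2q_0D^{n-1}y$, $y^{[n+k]}=-Dy^{[n+k-1]}+p_kD^{n-k}y+\frac i2(q_{k-1}^*D^{n-k+1}y-q_kD^{n-k-1}y)$ ($1\le k\le n-1$), $y^{[2n]}=-Dy^{[2n-1]}+p_ny+\frac i2q_{n-1}^*Dy=l[y]$; the same formulas apply to operator functions $Y:\Delta\to[\mathcal K,H]$. Put $y^{(1)}(t)=(y^{[0]}(t),\dots,y^{[n-1]}(t))$, $y^{(2)}(t)=(y^{[2n-1]}(t),\dots,y^{[n]}(t))$ (columns), $\widetilde y(t)=\{y^{(1)}(t),y^{(2)}(t)\}$. $\mathfrak H=L_2(\Delta;H)$; $L_2'[\mathcal K,H]$ is the set of $Y:\Delta\to[\mathcal K,H]$ with $Y(\cdot)h\in\mathfrak H$ for all $h\in\mathcal K$. The maximal operator $L$ has domain $\mathcal D=\{y\in\mathfrak H:\ y^{[k]}\ (0\le k\le2n-2)$ continuously differentiable, $y^{[2n-1]}$ (locally) absolutely continuous, $l[y]\in\mathfrak H\}$ and $Ly=l[y]$. Put $[y,z](t)=(y^{(1)}(t),z^{(2)}(t))-(y^{(2)}(t),z^{(1)}(t))$, $[y,z](b)=\lim_{t\uparrow b}[y,z](t)$. The minimal operator $L_0$ is the restriction of $L$ to $\{y\in\mathcal D:\widetilde y(0)=0,\ [y,z](b)=0\ \forall z\in\mathcal D\}$; $L_0^*=L$. $\mathfrak N_\lambda(L_0)=\mathrm{Ker}(L-\lambda)$. **Decomposing $D$-triplet.**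 $\mathcal H_1'$ is a subspace of a Hilbert space $\mathcal H_0'$, $\mathcal H_2'=\mathcal H_0'\ominus\mathcal H_1'$, $P_2'$ is the orthoprojector in $\mathcal H_0'$ onto $\mathcal H_2'$, $\Gamma_j':\mathcal D\to\mathcal H_j'$ ($j=0,1$) are linear, $\mathcal H_j=H^n\oplus\mathcal H_j'$, $\Gamma_0y=\{y^{(2)}(0),\Gamma_0'y\}$, $\Gamma_1y=\{-y^{(1)}(0),\Gamma_1'y\}$. $\Pi=\{\mathcal H_0\oplus\mathcal H_1,\Gamma_0,\Gamma_1\}$ is a decomposing $D$-triplet for $L$ if $(\Gamma_0'\;\Gamma_1')^\top:\mathcal D\to\mathcal H_0'\oplus\mathcal H_1'$ is surjective and $[y,z](b)=(\Gamma_1'y,\Gamma_0'z)-(\Gamma_0'y,\Gamma_1'z)+i(P_2'\Gamma_0'y,P_2'\Gamma_0'z)$, $y,z\in\mathcal D$. Put $\mathcal H_2=\mathcal H_0\ominus\mathcal H_1$ and let $P_j$ be the orthoprojector in $\mathcal H_0$ onto $\mathcal H_j$, $j=1,2$. The Weyl function $M_+(\lambda)\in[\mathcal H_0,\mathcal H_1]$, $\lambda\in\mathbb C_+$, is defined by $\Gamma_1y=M_+(\lambda)\Gamma_0y$, $y\in\mathfrak N_\lambda(L_0)$. **Class $\widetilde R(\mathcal H_0,\mathcal H_1)$.** It consists of collections $\tau=\{\tau_+,\tau_-\}$, $\tau_+(\lambda)=\{(C_0(\lambda),C_1(\lambda));\mathcal K_+\}$ ($\lambda\in\mathbb C_+$),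 $\tau_-(\lambda)=\{(D_0(\lambda),D_1(\lambda));\mathcal K_-\}$ ($\lambda\in\mathbb C_-$), of (equivalence classes of) holomorphic operator pairs $C_j(\lambda)\in[\mathcal H_j,\mathcal K_+]$, $D_j(\lambda)\in[\mathcal H_j,\mathcal K_-]$ with $(C_0\;C_1)$ and $(D_0\;D_1)$ surjective such that, with $C_0=(C_{01}\;C_{02})$, $D_0=(D_{01}\;D_{02})$ relative to $\mathcal H_0=\mathcal H_1\oplus\mathcal H_2$: $2\mathrm{Im}(C_1C_{01}^* )(\lambda)+C_{02}(\lambda)C_{02}^*(\lambda)\ge0$, $0\in\rho(C_0(\lambda)-iC_1(\lambda)P_1)$ for $\lambda\in\mathbb C_+$; $2\mathrm{Im}(D_1D_{01}^* )(\lambda)+D_{02}(\lambda)D_{02}^*(\lambda)\le0$, $0\in\rho(D_{01}(\lambda)+iD_1(\lambda))$ for $\lambda\in\mathbb C_-$; $C_1(\lambda)D_{01}^*(\overline\lambda)-C_{01}(\lambda)D_1^*(\overline\lambda)+iC_{02}(\lambda)D_{02}^*(\overline\lambda)=0$ for $\lambda\in\mathbb C_+$. Pairs differing by left multiplication by a holomorphic family of isomorphisms are identified; a pair is identified with the linear relation $\tau_+(\lambda)=\{\{h_0,h_1\}\in\mathcal H_0\oplus\mathcal H_1:C_0(\lambda)h_0+C_1(\lambda)h_1=0\}$ (resp. $\tau_-$ with $D_j$). The equivalent representation $\tau_+(\lambda)=\{K_0(\lambda),K_1(\lambda);\mathcal K_+'\}$ means that $K_j:\mathbb C_+\to[\mathcal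 K_+',\mathcal H_j]$ are holomorphic, $\mathrm{Ker}K_0(\lambda)\cap\mathrm{Ker}K_1(\lambda)=\{0\}$ and $\tau_+(\lambda)=\{\{K_0(\lambda)h,K_1(\lambda)h\}:h\in\mathcal K_+'\}$ (such a representation always exists and satisfies $2\mathrm{Im}(K_{01}^*K_1)-K_{02}^*K_{02}\ge0$ and $0\in\rho(K_1(\lambda)+iK_{01}(\lambda))$). For $\lambda\in\mathbb C_+$ the operators $C_0-C_1M_+$ and $K_1+M_+K_0$ are boundedly invertible and $(\tau_++M_+)^{-1}=K_0(K_1+M_+K_0)^{-1}=-(C_0-C_1M_+)^{-1}C_1\in[\mathcal H_1,\mathcal H_0]$. $\widetilde R^0(\mathcal H_0,\mathcal H_1)$: those $\tau$ with $\tau_+(\lambda)\equiv\tau_-(\lambda)\equiv\theta$ and $(-\theta)^\times=-\theta$, where $\theta^\times=\{\{k_0,k_1\}\in\mathcal H_0\oplus\mathcal H_1:(k_1,h_0)-(k_0,h_1)+i(P_2k_0,P_2h_0)=0\ \forall\{h_0,h_1\}\in\theta\}$. **Solutions $u_{j\tau}$.** Write $C_0(\lambda)=(\hat C_2(\lambda)\;C_0'(\lambda))$ on $H^n\oplus\mathcal H_0'$, $C_1(\lambda)=(\hat C_1(\lambda)\;C_1'(\lambda))$ on $H^n\oplus\mathcal H_1'$. For $\lambda\in\mathbb C_+$, $u_{j\tau}(\cdot,\lambda)\in L_2'[H^n,H]$, $j=1,2$, is the unique operator solution of $l[y]-\lambda y=0$ such that $(\hat C_1(\lambda)u_{j\tau}^{(1)}(0,\lambda)+\hat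 C_2(\lambda)u_{j\tau}^{(2)}(0,\lambda))\hat h+(C_0'(\lambda)\Gamma_0'-C_1'(\lambda)\Gamma_1')(u_{j\tau}(\cdot,\lambda)\hat h)=(-1)^{j-1}\hat C_j(\lambda)\hat h$ for all $\hat h\in H^n$. **Characteristic matrix.** Omitting $\lambda$, $$\widetilde\Omega_{\tau+}(\lambda)=\begin{pmatrix}M_+-M_+(\tau_++M_+)^{-1}M_+&-\frac12I_{\mathcal H_1}+M_+(\tau_++M_+)^{-1}\\-\frac12I_{\mathcal H_0}+(\tau_++M_+)^{-1}M_+&-(\tau_++M_+)^{-1}\end{pmatrix}:\mathcal H_0\oplus\mathcal H_1\to\mathcal H_1\oplus\mathcal H_0,\ \lambda\in\mathbb C_+,$$ $\Omega_\tau(\lambda)=P_{H^n\oplus H^n}\widetilde\Omega_{\tau+}(\lambda)\upharpoonright(H^n\oplus H^n)\in[H^n\oplus H^n]$ for $\lambda\in\mathbb C_+$, and $\Omega_\tau(\lambda)=\Omega_\tau^*(\overline\lambda)$ for $\lambda\in\mathbb C_-$. It is canonical if $\tau\in\widetilde R^0(\mathcal H_0,\mathcal H_1)$. A Nevanlinna operator function is a holomorphic $\Omega:\mathbb C_+\cup\mathbb C_-\to[X]$ with $\mathrm{Im}\lambda\cdot\mathrm{Im}\,\Omega(\lambda)\ge0$ and $\Omega^*(\overline\lambda)=\Omega(\lambda)$. *)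

theory Defs
  imports "HOL-Analysis.Analysis"
begin

section \<open>Complex Hilbert spaces\<close>

text \<open>
  The complex scalar product is linear in the first and antilinear in the second argument.
  It is tied to the real inner product (hence to norm and topology) by
  \<open>Re (cinner x y) = x \<bullet> y\<close>.
\<close>

class complex_inner = real_inner +
  fixes scaleC :: "complex \<Rightarrow> 'a \<Rightarrow> 'a" (infixr \<open>*\<^sub>C\<close> 75)
    and cinner :: "'a \<Rightarrow> 'a \<Rightarrow> complex"
  assumes scaleC_add_right: "c *\<^sub>C (x + y) = c *\<^sub>C x + c *\<^sub>C y"
    and scaleC_add_left: "(c + d) *\<^sub>C x = c *\<^sub>C x + d *\<^sub>C x"
    and scaleC_scaleC: "c *\<^sub>C (d *\<^sub>C x) = (c * d) *\<^sub>C x"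
    and scaleC_of_real: "complex_of_real r *\<^sub>C x = r *\<^sub>R x"
    and cinner_add_left: "cinner (x + y) z = cinner x z + cinner y z"
    and cinner_scaleC_left: "cinner (c *\<^sub>C x) y = c * cinner x y"
    and cinner_commute: "cinner x y = cnj (cinner y x)"
    and Re_cinner: "Re (cinner x y) = x \<bullet> y"

class chilbert_space = complex_inner + banach

instantiation prod :: (complex_inner, complex_inner) complex_inner
begin

definition scaleC_prod :: "complex \<Rightarrow> 'a \<times> 'b \<Rightarrow> 'a \<times> 'b" where
  "scaleC_prod c x = (c *\<^sub>C fst x, c *\<^sub>C snd x)"

definition cinner_prod :: "'a \<times> 'b \<Rightarrow> 'a \<times> 'b \<Rightarrow> complex" where
  "cinner_prod x y = cinner (fst x) (fst y) + cinner (snd x) (snd y)"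

instance
proof
  fix x y z :: "'a \<times> 'b" and c d :: complex and r :: real
  show "cinner x y = cnj (cinner y x)"
    unfolding cinner_prod_def
    by (metis cinner_commute complex_cnj_add)
qed (auto simp: scaleC_prod_def cinner_prod_def scaleC_add_right scaleC_add_left scaleC_scaleC
      scaleC_of_real cinner_add_left cinner_scaleC_left Re_cinner inner_prod_def algebra_simps
      prod_eq_iff)

end

instance prod :: (chilbert_space, chilbert_space) chilbert_space ..

instantiation vec :: (complex_inner, finite) complex_inner
begin

definition scaleC_vec :: "complex \<Rightarrow> ('a, 'b) vec \<Rightarrow> ('a, 'b) vec" where
  "scaleC_vec c x = (\<chi> i. c *\<^sub>C (x $ i))"

definition cinner_vec :: "('a, 'b) vec \<Rightarrow> ('a, 'b) vec \<Rightarrow> complex" where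
  "cinner_vec x y = (\<Sum>i\<in>UNIV. cinner (x $ i) (y $ i))"

instance
proof
  fix x y z :: "('a, 'b) vec" and c d :: complex and r :: real
  have "cnj (cinner y x) = (\<Sum>i\<in>UNIV. cnj (cinner (y $ i) (x $ i)))"
    by (simp add: cinner_vec_def)
  also have "\<dots> = cinner x y"
    unfolding cinner_vec_def by (intro sum.cong refl) (metis cinner_commute)
  finally show "cinner x y = cnj (cinner y x)" by simp
qed (auto simp: scaleC_vec_def cinner_vec_def scaleC_add_right scaleC_add_left scaleC_scaleC
      scaleC_of_real cinner_add_left cinner_scaleC_left Re_cinner inner_vec_def sum.distrib
      sum_distrib_left vec_eq_iff)

end

instance vec :: (chilbert_space, finite) chilbert_space ..


section \<open>Bounded operators between closed subspaces\<close>

text \<open>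
  A Hilbert space is either a whole type of class \<open>chilbert_space\<close> (carrier \<open>UNIV\<close>) or a closed
  subspace of one.  An operator with domain \<open>X\<close> is a function whose values outside \<open>X\<close> are
  irrelevant; accordingly every notion below refers to \<open>X\<close> explicitly, and the restriction of an
  operator to a smaller subspace is the same function considered with the smaller domain.
\<close>

definition closed_csubspace :: "'a::complex_inner set \<Rightarrow> bool" where
  "closed_csubspace S \<longleftrightarrow> closed S \<and> 0 \<in> S \<and> (\<forall>x\<in>S. \<forall>y\<in>S. x + y \<in> S) \<and>
     (\<forall>c. \<forall>x\<in>S. c *\<^sub>C x \<in> S)"

definition ocompl :: "'a::complex_inner set \<Rightarrow> 'a set" where
  "ocompl S = {x. \<forall>z\<in>S. cinner x z = 0}"

definition oproj :: "'a::complex_inner set \<Rightarrow> 'a \<Rightarrow> 'a" where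
  "oproj S x = (THE y. y \<in> S \<and> x - y \<in> ocompl S)"

definition bounded_op ::
  "'a::complex_inner set \<Rightarrow> 'b::complex_inner set \<Rightarrow> ('a \<Rightarrow> 'b) \<Rightarrow> bool" where
  "bounded_op X Y T \<longleftrightarrow> (\<forall>x\<in>X. T x \<in> Y) \<and> (\<forall>x\<in>X. \<forall>y\<in>X. T (x + y) = T x + T y) \<and>
     (\<forall>c. \<forall>x\<in>X. T (c *\<^sub>C x) = c *\<^sub>C T x) \<and> (\<exists>B. \<forall>x\<in>X. norm (T x) \<le> B * norm x)"

text \<open>\<open>0 \<in> \<rho>(T)\<close>, i.e. \<open>T \<in> [X,Y]\<close> and \<open>T\<^sup>-\<^sup>1 \<in> [Y,X]\<close>.\<close>

definition boundedly_invertible ::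
  "'a::complex_inner set \<Rightarrow> 'b::complex_inner set \<Rightarrow> ('a \<Rightarrow> 'b) \<Rightarrow> bool" where
  "boundedly_invertible X Y T \<longleftrightarrow> bounded_op X Y T \<and>
     (\<exists>S. bounded_op Y X S \<and> (\<forall>x\<in>X. S (T x) = x) \<and> (\<forall>y\<in>Y. T (S y) = y))"

text \<open>
  The adjoint of \<open>T \<in> [X,Y]\<close>, an operator \<open>Y \<rightarrow> X\<close>.  It does not depend on the carrier \<open>Y\<close>, so
  only the domain \<open>X\<close> is an argument.
\<close>

definition hadj :: "'a::complex_inner set \<Rightarrow> ('a \<Rightarrow> 'b::complex_inner) \<Rightarrow> 'b \<Rightarrow> 'a" where
  "hadj X T y = (THE x. x \<in> X \<and> (\<forall>z\<in>X. cinner (T z) y = cinner z x))"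

definition op_Im :: "'a::complex_inner set \<Rightarrow> ('a \<Rightarrow> 'a) \<Rightarrow> 'a \<Rightarrow> 'a" where
  "op_Im X T x = (1 / (2 * \<i>)) *\<^sub>C (T x - hadj X T x)"

definition nonneg_op :: "'a::complex_inner set \<Rightarrow> ('a \<Rightarrow> 'a) \<Rightarrow> bool" where
  "nonneg_op X T \<longleftrightarrow> (\<forall>x\<in>X. Im (cinner (T x) x) = 0 \<and> 0 \<le> Re (cinner (T x) x))"

definition op_tendsto :: "'a::complex_inner set \<Rightarrow> ('p \<Rightarrow> 'a \<Rightarrow> 'b::complex_inner) \<Rightarrow>
    ('a \<Rightarrow> 'b) \<Rightarrow> 'p filter \<Rightarrow> bool" where
  "op_tendsto X T T0 F \<longleftrightarrow> (\<forall>\<epsilon>>0. \<forall>\<^sub>F s in F. \<forall>x\<in>X. norm (T s x - T0 x) \<le> \<epsilon> * norm x)"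

definition op_holomorphic :: "complex set \<Rightarrow> 'a::complex_inner set \<Rightarrow> 'b::complex_inner set \<Rightarrow>
    (complex \<Rightarrow> 'a \<Rightarrow> 'b) \<Rightarrow> bool" where
  "op_holomorphic S X Y T \<longleftrightarrow> (\<forall>z\<in>S. bounded_op X Y (T z) \<and>
     (\<exists>T'. bounded_op X Y T' \<and>
        op_tendsto X (\<lambda>w x. (1 / (w - z)) *\<^sub>C (T w x - T z x)) T' (at z within S)))"

text \<open>\<open>F \<in> C\<^sup>m(\<Delta>;[H])\<close> in the operator norm; \<open>G j\<close> is the \<open>j\<close>-th derivative.\<close>

definition op_Ck :: "nat \<Rightarrow> real set \<Rightarrow> (real \<Rightarrow> 'a::complex_inner \<Rightarrow> 'a) \<Rightarrow> bool" where
  "op_Ck m \<Delta> F \<longleftrightarrow> (\<exists>G. (\<forall>t\<in>\<Delta>. G 0 t = F t) \<and>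
     (\<forall>j\<le>m. \<forall>t\<in>\<Delta>. bounded_op UNIV UNIV (G j t) \<and> op_tendsto UNIV (G j) (G j t) (at t within \<Delta>)) \<and>
     (\<forall>j<m. \<forall>t\<in>\<Delta>. op_tendsto UNIV (\<lambda>s x. (1 / (s - t)) *\<^sub>R (G j s x - G j t x)) (G (Suc j) t)
                      (at t within \<Delta>)))"

definition nevanlinna_op :: "(complex \<Rightarrow> 'a::complex_inner \<Rightarrow> 'a) \<Rightarrow> bool" where
  "nevanlinna_op \<Omega> \<longleftrightarrow> op_holomorphic {z. Im z \<noteq> 0} UNIV UNIV \<Omega> \<and>
     (\<forall>z. Im z \<noteq> 0 \<longrightarrow> nonneg_op UNIV (\<lambda>x. Im z *\<^sub>R op_Im UNIV (\<Omega> z) x) \<and>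
                        hadj UNIV (\<Omega> (cnj z)) = \<Omega> z)"


section \<open>The differential expression and the maximal operator\<close>

definition interval_upto :: "ereal \<Rightarrow> real set \<Rightarrow> bool" where
  "interval_upto b \<Delta> \<longleftrightarrow> 0 < b \<and>
     (\<Delta> = {t. 0 \<le> t \<and> ereal t < b} \<or> b < \<infinity> \<and> \<Delta> = {t. 0 \<le> t \<and> ereal t \<le> b})"

definition left_of :: "ereal \<Rightarrow> real filter" where
  "left_of b = (if b = \<infinity> then at_top else at_left (real_of_ereal b))"

text \<open>Derivatives are relative to \<open>\<Delta>\<close>, i.e. one-sided at end points belonging to \<open>\<Delta>\<close>.\<close>

definition Dt :: "real set \<Rightarrow> (real \<Rightarrow> 'h::real_normed_vector) \<Rightarrow> real \<Rightarrow> 'h" where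
  "Dt \<Delta> f t = vector_derivative f (at t within \<Delta>)"

abbreviation Dpow :: "real set \<Rightarrow> nat \<Rightarrow> (real \<Rightarrow> 'h::real_normed_vector) \<Rightarrow> real \<Rightarrow> 'h" where
  "Dpow \<Delta> k f \<equiv> (Dt \<Delta> ^^ k) f"

text \<open>Order \<open>2n\<close>; \<open>p 0, \<dots>, p n\<close> and \<open>q 0, \<dots>, q (n - 1)\<close> are used.\<close>

definition admissible_coeffs :: "nat \<Rightarrow> real set \<Rightarrow> (nat \<Rightarrow> real \<Rightarrow> 'h \<Rightarrow> 'h) \<Rightarrow>
    (nat \<Rightarrow> real \<Rightarrow> 'h::complex_inner \<Rightarrow> 'h) \<Rightarrow> bool" where
  "admissible_coeffs n \<Delta> p q \<longleftrightarrow>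
     (\<forall>k\<le>n. op_Ck (n - k) \<Delta> (p k)) \<and> (\<forall>k<n. op_Ck (n - k) \<Delta> (q k)) \<and>
     (\<forall>k\<le>n. \<forall>t\<in>\<Delta>. hadj UNIV (p k t) = p k t) \<and>
     (\<forall>t\<in>\<Delta>. boundedly_invertible UNIV UNIV (p 0 t))"

definition lexpr :: "nat \<Rightarrow> real set \<Rightarrow> (nat \<Rightarrow> real \<Rightarrow> 'h \<Rightarrow> 'h) \<Rightarrow>
    (nat \<Rightarrow> real \<Rightarrow> 'h::complex_inner \<Rightarrow> 'h) \<Rightarrow> (real \<Rightarrow> 'h) \<Rightarrow> real \<Rightarrow> 'h" where
  "lexpr n \<Delta> p q y t =
     (\<Sum>k=1..n. (-1) ^ k *\<^sub>R
        (Dpow \<Delta> k (\<lambda>s. p (n - k) s (Dpow \<Delta> k y s)) t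
         - (\<i> / 2) *\<^sub>C (Dpow \<Delta> (k - 1) (\<lambda>s. hadj UNIV (q (n - k) s) (Dpow \<Delta> k y s)) t
                       + Dpow \<Delta> k (\<lambda>s. q (n - k) s (Dpow \<Delta> (k - 1) y s)) t)))
     + p n t (y t)"

text \<open>\<open>quasi_upper n \<Delta> p q k y\<close> is \<open>y\<^sup>[\<^sup>n\<^sup>+\<^sup>k\<^sup>]\<close> for \<open>k \<le> n - 1\<close>.\<close>

primrec quasi_upper :: "nat \<Rightarrow> real set \<Rightarrow> (nat \<Rightarrow> real \<Rightarrow> 'h \<Rightarrow> 'h) \<Rightarrow>
    (nat \<Rightarrow> real \<Rightarrow> 'h::complex_inner \<Rightarrow> 'h) \<Rightarrow> nat \<Rightarrow> (real \<Rightarrow> 'h) \<Rightarrow> real \<Rightarrow> 'h" where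
  "quasi_upper n \<Delta> p q 0 y =
     (\<lambda>t. p 0 t (Dpow \<Delta> n y t) - (\<i> / 2) *\<^sub>C q 0 t (Dpow \<Delta> (n - 1) y t))"
| "quasi_upper n \<Delta> p q (Suc k) y =
     (\<lambda>t. - Dt \<Delta> (quasi_upper n \<Delta> p q k y) t + p (Suc k) t (Dpow \<Delta> (n - Suc k) y t)
          + (\<i> / 2) *\<^sub>C (hadj UNIV (q k t) (Dpow \<Delta> (n - Suc k + 1) y t)
                        - q (Suc k) t (Dpow \<Delta> (n - Suc k - 1) y t)))"

definition quasi_deriv :: "nat \<Rightarrow> real set \<Rightarrow> (nat \<Rightarrow> real \<Rightarrow> 'h \<Rightarrow> 'h) \<Rightarrow>
    (nat \<Rightarrow> real \<Rightarrow> 'h::complex_inner \<Rightarrow> 'h) \<Rightarrow> nat \<Rightarrow> (real \<Rightarrow> 'h) \<Rightarrow> real \<Rightarrow> 'h" where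
  "quasi_deriv n \<Delta> p q k y = (if k < n then Dpow \<Delta> k y else quasi_upper n \<Delta> p q (k - n) y)"

text \<open>
  \<open>H\<^sup>n\<close> is the type \<open>'h ^ 'n\<close>, \<open>n = CARD('n)\<close>; the linear order of \<open>'n\<close> only serves to number the
  components by \<open>0, \<dots>, n - 1\<close>.
\<close>

definition idx :: "'n::{finite,linorder} \<Rightarrow> nat" where
  "idx i = card {j. j < i}"

definition qvec1 :: "real set \<Rightarrow> (nat \<Rightarrow> real \<Rightarrow> 'h \<Rightarrow> 'h) \<Rightarrow>
    (nat \<Rightarrow> real \<Rightarrow> 'h::complex_inner \<Rightarrow> 'h) \<Rightarrow> (real \<Rightarrow> 'h) \<Rightarrow> real \<Rightarrow> ('h, 'n::{finite,linorder}) vec"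
  where "qvec1 \<Delta> p q y t = (\<chi> i. quasi_deriv CARD('n) \<Delta> p q (idx i) y t)"

definition qvec2 :: "real set \<Rightarrow> (nat \<Rightarrow> real \<Rightarrow> 'h \<Rightarrow> 'h) \<Rightarrow>
    (nat \<Rightarrow> real \<Rightarrow> 'h::complex_inner \<Rightarrow> 'h) \<Rightarrow> (real \<Rightarrow> 'h) \<Rightarrow> real \<Rightarrow> ('h, 'n::{finite,linorder}) vec"
  where "qvec2 \<Delta> p q y t = (\<chi> i. quasi_deriv CARD('n) \<Delta> p q (2 * CARD('n) - 1 - idx i) y t)"

definition L2 :: "real set \<Rightarrow> (real \<Rightarrow> 'h::complex_inner) \<Rightarrow> bool" where
  "L2 \<Delta> f \<longleftrightarrow> f \<in> borel_measurable (lebesgue_on \<Delta>) \<and>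
     integrable (lebesgue_on \<Delta>) (\<lambda>t. (norm (f t))\<^sup>2)"

definition C1_on :: "real set \<Rightarrow> (real \<Rightarrow> 'h::real_normed_vector) \<Rightarrow> bool" where
  "C1_on \<Delta> f \<longleftrightarrow> (\<forall>t\<in>\<Delta>. f differentiable (at t within \<Delta>)) \<and> continuous_on \<Delta> (Dt \<Delta> f)"

definition locally_AC :: "real set \<Rightarrow> (real \<Rightarrow> 'h::real_normed_vector) \<Rightarrow> bool" where
  "locally_AC \<Delta> f \<longleftrightarrow> (\<forall>c d. {c..d} \<subseteq> \<Delta> \<longrightarrow> (\<forall>\<epsilon>>0. \<exists>\<delta>>0. \<forall>I. finite I \<and>
      (\<forall>(x, y)\<in>I. c \<le> x \<and> x \<le> y \<and> y \<le> d) \<and>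
      pairwise (\<lambda>(x, y) (x', y'). {x<..<y} \<inter> {x'<..<y'} = {}) I \<and>
      (\<Sum>(x, y)\<in>I. y - x) < \<delta> \<longrightarrow> (\<Sum>(x, y)\<in>I. norm (f y - f x)) < \<epsilon>))"

text \<open>
  The domain of the maximal operator.  Only the values of \<open>y\<close> on \<open>\<Delta>\<close> matter.  Since derivatives are
  total functions here, it has to be said explicitly that \<open>l[y]\<close> exists almost everywhere, i.e. that
  \<open>y\<^sup>[\<^sup>2\<^sup>n\<^sup>-\<^sup>1\<^sup>]\<close> is differentiable almost everywhere (which for Hilbert space valued functions is a
  consequence of absolute continuity).
\<close>

definition maxdom :: "nat \<Rightarrow> real set \<Rightarrow> (nat \<Rightarrow> real \<Rightarrow> 'h \<Rightarrow> 'h) \<Rightarrow>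
    (nat \<Rightarrow> real \<Rightarrow> 'h::complex_inner \<Rightarrow> 'h) \<Rightarrow> (real \<Rightarrow> 'h) set" where
  "maxdom n \<Delta> p q = {y. L2 \<Delta> y \<and> (\<forall>k\<le>2 * n - 2. C1_on \<Delta> (quasi_deriv n \<Delta> p q k y)) \<and>
     locally_AC \<Delta> (quasi_deriv n \<Delta> p q (2 * n - 1) y) \<and>
     (AE t in lebesgue_on \<Delta>. quasi_deriv n \<Delta> p q (2 * n - 1) y differentiable (at t within \<Delta>)) \<and>
     L2 \<Delta> (lexpr n \<Delta> p q y)}"

definition defect_space :: "nat \<Rightarrow> real set \<Rightarrow> (nat \<Rightarrow> real \<Rightarrow> 'h \<Rightarrow> 'h) \<Rightarrow>
    (nat \<Rightarrow> real \<Rightarrow> 'h::complex_inner \<Rightarrow> 'h) \<Rightarrow> complex \<Rightarrow> (real \<Rightarrow> 'h) set" where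
  "defect_space n \<Delta> p q lam =
     {y. y \<in> maxdom n \<Delta> p q \<and>
        (AE t in lebesgue_on \<Delta>. lexpr n \<Delta> p q y t = lam *\<^sub>C y t)}"

text \<open>
  The Lagrange bracket \<open>[y,z](t)\<close>.  The type argument fixes \<open>'n\<close>, which does not occur in the types
  of the other arguments.
\<close>

definition lagrange :: "'n::{finite,linorder} itself \<Rightarrow> real set \<Rightarrow> (nat \<Rightarrow> real \<Rightarrow> 'h \<Rightarrow> 'h) \<Rightarrow>
    (nat \<Rightarrow> real \<Rightarrow> 'h::complex_inner \<Rightarrow> 'h) \<Rightarrow> (real \<Rightarrow> 'h) \<Rightarrow> (real \<Rightarrow> 'h) \<Rightarrow> real \<Rightarrow> complex" where
  "lagrange N \<Delta> p q y z t =
     cinner (qvec1 \<Delta> p q y t :: ('h, 'n) vec) (qvec2 \<Delta> p q z t)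
     - cinner (qvec2 \<Delta> p q y t :: ('h, 'n) vec) (qvec1 \<Delta> p q z t)"


section \<open>Decomposing D-triplets and the Weyl function\<close>

text \<open>
  \<open>\<H>\<^sub>0' = UNIV :: 'g set\<close>, \<open>\<H>\<^sub>1' = H1'\<close>, \<open>\<H>\<^sub>2' = ocompl H1'\<close>, and \<open>\<H>\<^sub>0\<close> is the type
  \<open>('h, 'n) vec \<times> 'g\<close>.  The Lagrange bracket at \<open>b\<close> is a limit; its existence is part of the last
  clause.
\<close>

definition decomposing_D_triplet :: "'n::{finite,linorder} itself \<Rightarrow> ereal \<Rightarrow> real set \<Rightarrow>
    (nat \<Rightarrow> real \<Rightarrow> 'h \<Rightarrow> 'h) \<Rightarrow> (nat \<Rightarrow> real \<Rightarrow> 'h::complex_inner \<Rightarrow> 'h) \<Rightarrow> 'g::complex_inner set \<Rightarrow>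
    ((real \<Rightarrow> 'h) \<Rightarrow> 'g) \<Rightarrow> ((real \<Rightarrow> 'h) \<Rightarrow> 'g) \<Rightarrow> bool" where
  "decomposing_D_triplet N b \<Delta> p q H1' \<Gamma>0' \<Gamma>1' \<longleftrightarrow>
     (let D = maxdom CARD('n) \<Delta> p q; P2' = oproj (ocompl H1') in
       closed_csubspace H1' \<and>
       (\<forall>\<Gamma>\<in>{\<Gamma>0', \<Gamma>1'}. \<forall>y\<in>D. (\<forall>z\<in>D. \<Gamma> (\<lambda>t. y t + z t) = \<Gamma> y + \<Gamma> z) \<and>
                                (\<forall>c. \<Gamma> (\<lambda>t. c *\<^sub>C y t) = c *\<^sub>C \<Gamma> y)) \<and>
       (\<forall>y\<in>D. \<Gamma>1' y \<in> H1') \<and>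
       (\<forall>h0. \<forall>h1\<in>H1'. \<exists>y\<in>D. \<Gamma>0' y = h0 \<and> \<Gamma>1' y = h1) \<and>
       (\<forall>y\<in>D. \<forall>z\<in>D. (lagrange N \<Delta> p q y z \<longlongrightarrow>
          cinner (\<Gamma>1' y) (\<Gamma>0' z) - cinner (\<Gamma>0' y) (\<Gamma>1' z)
          + \<i> * cinner (P2' (\<Gamma>0' y)) (P2' (\<Gamma>0' z))) (left_of b)))"

definition Gam0 :: "real set \<Rightarrow> (nat \<Rightarrow> real \<Rightarrow> 'h \<Rightarrow> 'h) \<Rightarrow>
    (nat \<Rightarrow> real \<Rightarrow> 'h::complex_inner \<Rightarrow> 'h) \<Rightarrow> ((real \<Rightarrow> 'h) \<Rightarrow> 'g) \<Rightarrow> (real \<Rightarrow> 'h) \<Rightarrow>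
    ('h, 'n::{finite,linorder}) vec \<times> 'g" where
  "Gam0 \<Delta> p q \<Gamma>0' y = (qvec2 \<Delta> p q y 0, \<Gamma>0' y)"

definition Gam1 :: "real set \<Rightarrow> (nat \<Rightarrow> real \<Rightarrow> 'h \<Rightarrow> 'h) \<Rightarrow>
    (nat \<Rightarrow> real \<Rightarrow> 'h::complex_inner \<Rightarrow> 'h) \<Rightarrow> ((real \<Rightarrow> 'h) \<Rightarrow> 'g) \<Rightarrow> (real \<Rightarrow> 'h) \<Rightarrow>
    ('h, 'n::{finite,linorder}) vec \<times> 'g" where
  "Gam1 \<Delta> p q \<Gamma>1' y = (- qvec1 \<Delta> p q y 0, \<Gamma>1' y)"

text \<open>\<open>\<H>\<^sub>1 = H\<^sup>n \<oplus> \<H>\<^sub>1'\<close> as a subspace of \<open>\<H>\<^sub>0\<close>.\<close>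

definition bspace1 :: "'g set \<Rightarrow> (('h, 'n) vec \<times> 'g) set" where
  "bspace1 H1' = UNIV \<times> H1'"

text \<open>
  \<open>M \<lambda> \<in> [\<H>\<^sub>0,\<H>\<^sub>1]\<close> is defined by \<open>\<Gamma>\<^sub>1 y = M \<lambda> (\<Gamma>\<^sub>0 y)\<close> for \<open>y \<in> Ker (L - \<lambda>)\<close>, that is, it is the
  only bounded operator with this property.
\<close>

definition weyl_function :: "real set \<Rightarrow> (nat \<Rightarrow> real \<Rightarrow> 'h \<Rightarrow> 'h) \<Rightarrow>
    (nat \<Rightarrow> real \<Rightarrow> 'h::complex_inner \<Rightarrow> 'h) \<Rightarrow> 'g::complex_inner set \<Rightarrow>
    ((real \<Rightarrow> 'h) \<Rightarrow> 'g) \<Rightarrow> ((real \<Rightarrow> 'h) \<Rightarrow> 'g) \<Rightarrow>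
    (complex \<Rightarrow> ('h, 'n::{finite,linorder}) vec \<times> 'g \<Rightarrow> ('h, 'n) vec \<times> 'g) \<Rightarrow> bool" where
  "weyl_function \<Delta> p q H1' \<Gamma>0' \<Gamma>1' M \<longleftrightarrow> (\<forall>lam. Im lam > 0 \<longrightarrow>
     (let defines = (\<lambda>T. bounded_op UNIV (bspace1 H1') T \<and>
            (\<forall>y\<in>defect_space CARD('n) \<Delta> p q lam. Gam1 \<Delta> p q \<Gamma>1' y = T (Gam0 \<Delta> p q \<Gamma>0' y)))
      in defines (M lam) \<and> (\<forall>T. defines T \<longrightarrow> T = M lam)))"


section \<open>The classes of boundary parameters\<close>

text \<open>
  Throughout, \<open>\<H>\<^sub>0 = UNIV :: 'e set\<close>, \<open>\<H>\<^sub>1 = H1\<close> is a closed subspace and \<open>\<H>\<^sub>2 = ocompl H1\<close>.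
  The blocks \<open>C\<^sub>0\<^sub>1\<close>, \<open>C\<^sub>0\<^sub>2\<close> are the restrictions of \<open>C\<^sub>0\<close> to \<open>\<H>\<^sub>1\<close>, \<open>\<H>\<^sub>2\<close>; their adjoints are
  \<open>hadj H1 C0\<close>, \<open>hadj (ocompl H1) C0\<close>.  A collection \<open>\<tau>\<close> is given by representing operator pairs.
\<close>

definition R_class :: "'e::complex_inner set \<Rightarrow>
    (complex \<Rightarrow> 'e \<Rightarrow> 'k::complex_inner) \<Rightarrow> (complex \<Rightarrow> 'e \<Rightarrow> 'k) \<Rightarrow>
    (complex \<Rightarrow> 'e \<Rightarrow> 'm::complex_inner) \<Rightarrow> (complex \<Rightarrow> 'e \<Rightarrow> 'm) \<Rightarrow> bool" where
  "R_class H1 C0 C1 D0 D1 \<longleftrightarrow>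
     (let H2 = ocompl H1; P1 = oproj H1 in
       op_holomorphic {z. Im z > 0} UNIV UNIV C0 \<and> op_holomorphic {z. Im z > 0} H1 UNIV C1 \<and>
       op_holomorphic {z. Im z < 0} UNIV UNIV D0 \<and> op_holomorphic {z. Im z < 0} H1 UNIV D1 \<and>
       (\<forall>lam. Im lam > 0 \<longrightarrow>
          (\<forall>k. \<exists>h0. \<exists>h1\<in>H1. C0 lam h0 + C1 lam h1 = k) \<and>
          nonneg_op UNIV (\<lambda>k. 2 *\<^sub>R op_Im UNIV (\<lambda>k. C1 lam (hadj H1 (C0 lam) k)) k
                               + C0 lam (hadj H2 (C0 lam) k)) \<and>
          boundedly_invertible UNIV UNIV (\<lambda>h. C0 lam h - \<i> *\<^sub>C C1 lam (P1 h)) \<and>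
          (\<forall>k. C1 lam (hadj H1 (D0 (cnj lam)) k) - C0 lam (hadj H1 (D1 (cnj lam)) k)
               + \<i> *\<^sub>C C0 lam (hadj H2 (D0 (cnj lam)) k) = 0)) \<and>
       (\<forall>lam. Im lam < 0 \<longrightarrow>
          (\<forall>k. \<exists>h0. \<exists>h1\<in>H1. D0 lam h0 + D1 lam h1 = k) \<and>
          nonneg_op UNIV (\<lambda>k. - (2 *\<^sub>R op_Im UNIV (\<lambda>k. D1 lam (hadj H1 (D0 lam) k)) k
                                  + D0 lam (hadj H2 (D0 lam) k))) \<and>
          boundedly_invertible H1 UNIV (\<lambda>h. D0 lam h + \<i> *\<^sub>C D1 lam h)))"

definition pair_rel :: "'e::complex_inner set \<Rightarrow> ('e \<Rightarrow> 'k::complex_inner) \<Rightarrow> ('e \<Rightarrow> 'k) \<Rightarrow> ('e \<times> 'e) set"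
  where "pair_rel H1 C0 C1 = {(h0, h1). h1 \<in> H1 \<and> C0 h0 + C1 h1 = 0}"

definition neg_rel :: "('e::complex_inner \<times> 'e) set \<Rightarrow> ('e \<times> 'e) set" where
  "neg_rel \<theta> = {(h0, - h1) |h0 h1. (h0, h1) \<in> \<theta>}"

definition cross_adj :: "'e::complex_inner set \<Rightarrow> ('e \<times> 'e) set \<Rightarrow> ('e \<times> 'e) set" where
  "cross_adj H1 \<theta> = {(k0, k1). k1 \<in> H1 \<and> (\<forall>(h0, h1)\<in>\<theta>.
     cinner k1 h0 - cinner k0 h1 + \<i> * cinner (oproj (ocompl H1) k0) (oproj (ocompl H1) h0) = 0)}"

definition R0_class :: "'e::complex_inner set \<Rightarrow>
    (complex \<Rightarrow> 'e \<Rightarrow> 'k::complex_inner) \<Rightarrow> (complex \<Rightarrow> 'e \<Rightarrow> 'k) \<Rightarrow>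
    (complex \<Rightarrow> 'e \<Rightarrow> 'm::complex_inner) \<Rightarrow> (complex \<Rightarrow> 'e \<Rightarrow> 'm) \<Rightarrow> bool" where
  "R0_class H1 C0 C1 D0 D1 \<longleftrightarrow> R_class H1 C0 C1 D0 D1 \<and>
     (\<exists>\<theta>. (\<forall>lam. Im lam > 0 \<longrightarrow> pair_rel H1 (C0 lam) (C1 lam) = \<theta>) \<and>
          (\<forall>lam. Im lam < 0 \<longrightarrow> pair_rel H1 (D0 lam) (D1 lam) = \<theta>) \<and>
          cross_adj H1 (neg_rel \<theta>) = neg_rel \<theta>)"

definition range_representation :: "'e::complex_inner set \<Rightarrow> (complex \<Rightarrow> ('e \<times> 'e) set) \<Rightarrow>
    (complex \<Rightarrow> 'l::complex_inner \<Rightarrow> 'e) \<Rightarrow> (complex \<Rightarrow> 'l \<Rightarrow> 'e) \<Rightarrow> bool" where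
  "range_representation H1 \<tau> K0 K1 \<longleftrightarrow>
     op_holomorphic {z. Im z > 0} UNIV UNIV K0 \<and> op_holomorphic {z. Im z > 0} UNIV H1 K1 \<and>
     (\<forall>lam. Im lam > 0 \<longrightarrow> {h. K0 lam h = 0} \<inter> {h. K1 lam h = 0} = {0} \<and>
                        \<tau> lam = {(K0 lam h, K1 lam h) |h. True})"

text \<open>\<open>rel_add_op \<theta> M\<close> is \<open>\<theta> + M\<close>; a relation that is the graph of an operator is turned into it
  by \<open>rel_op\<close>.\<close>

definition rel_add_op :: "('e \<times> 'e::complex_inner) set \<Rightarrow> ('e \<Rightarrow> 'e) \<Rightarrow> ('e \<times> 'e) set" where
  "rel_add_op \<theta> M = {(h0, h1 + M h0) |h0 h1. (h0, h1) \<in> \<theta>}"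

definition rel_op :: "('a \<times> 'b) set \<Rightarrow> 'a \<Rightarrow> 'b" where
  "rel_op R x = (THE y. (x, y) \<in> R)"


section \<open>The solutions \<open>u\<^sub>j\<^sub>\<tau>\<close> and the characteristic matrix\<close>

text \<open>
  Operator solutions \<open>Y\<close> of \<open>l[y] - \<lambda>y = 0\<close> with \<open>Y \<in> L\<^sub>2'[H\<^sup>n,H]\<close>: for every \<open>h\<close> the function
  \<open>Y(\<cdot>)h\<close> is a solution in \<open>L\<^sub>2(\<Delta>;H)\<close>, that is, it belongs to \<open>Ker (L - \<lambda>)\<close>.
\<close>

definition op_solution :: "real set \<Rightarrow> (nat \<Rightarrow> real \<Rightarrow> 'h \<Rightarrow> 'h) \<Rightarrow>
    (nat \<Rightarrow> real \<Rightarrow> 'h::complex_inner \<Rightarrow> 'h) \<Rightarrow> complex \<Rightarrow>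
    (real \<Rightarrow> ('h, 'n::{finite,linorder}) vec \<Rightarrow> 'h) \<Rightarrow> bool" where
  "op_solution \<Delta> p q lam Y \<longleftrightarrow> (\<forall>t\<in>\<Delta>. bounded_op UNIV UNIV (Y t)) \<and>
     (\<forall>h. (\<lambda>t. Y t h) \<in> defect_space CARD('n) \<Delta> p q lam)"

text \<open>
  The boundary condition determining \<open>u\<^sub>j\<^sub>\<tau>\<close>, with right-hand side \<open>rhs\<close>;
  \<open>\<lambda>h. C1 (h, 0)\<close>, \<open>\<lambda>g. C1 (0, g)\<close> are the blocks of \<open>C1\<close> on \<open>H\<^sup>n \<oplus> \<H>\<^sub>1'\<close>, similarly for \<open>C0\<close>.
\<close>

definition u_boundary_condition :: "real set \<Rightarrow> (nat \<Rightarrow> real \<Rightarrow> 'h \<Rightarrow> 'h) \<Rightarrow>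
    (nat \<Rightarrow> real \<Rightarrow> 'h::complex_inner \<Rightarrow> 'h) \<Rightarrow> ((real \<Rightarrow> 'h) \<Rightarrow> 'g::complex_inner) \<Rightarrow> ((real \<Rightarrow> 'h) \<Rightarrow> 'g) \<Rightarrow>
    (('h, 'n::{finite,linorder}) vec \<times> 'g \<Rightarrow> 'k::complex_inner) \<Rightarrow> (('h, 'n) vec \<times> 'g \<Rightarrow> 'k) \<Rightarrow>
    (('h, 'n) vec \<Rightarrow> 'k) \<Rightarrow> (real \<Rightarrow> ('h, 'n) vec \<Rightarrow> 'h) \<Rightarrow> bool" where
  "u_boundary_condition \<Delta> p q \<Gamma>0' \<Gamma>1' C0 C1 rhs u \<longleftrightarrow>
     (\<forall>h. let y = (\<lambda>t. u t h) in
        C1 (qvec1 \<Delta> p q y 0, 0) + C0 (qvec2 \<Delta> p q y 0, 0) + (C0 (0, \<Gamma>0' y) - C1 (0, \<Gamma>1' y))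
        = rhs h)"

text \<open>
  \<open>Omega_ext M T\<close> is the extended block operator \<open>\<H>\<^sub>0 \<oplus> \<H>\<^sub>1 \<rightarrow> \<H>\<^sub>1 \<oplus> \<H>\<^sub>0\<close> with \<open>T = (\<tau>\<^sub>+ + M)\<^sup>-\<^sup>1\<close>.
\<close>

definition Omega_ext :: "('e::complex_inner \<Rightarrow> 'e) \<Rightarrow> ('e \<Rightarrow> 'e) \<Rightarrow> 'e \<times> 'e \<Rightarrow> 'e \<times> 'e" where
  "Omega_ext M T = (\<lambda>(h0, h1).
     ((M h0 - M (T (M h0))) + (- (1 / 2) *\<^sub>R h1 + M (T h1)),
      (- (1 / 2) *\<^sub>R h0 + T (M h0)) - T h1))"

definition char_matrix :: "'g::complex_inner set \<Rightarrow>
    (complex \<Rightarrow> ('h::complex_inner, 'n::finite) vec \<times> 'g \<Rightarrow> ('h, 'n) vec \<times> 'g) \<Rightarrow>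
    (complex \<Rightarrow> ('h, 'n) vec \<times> 'g \<Rightarrow> 'k::complex_inner) \<Rightarrow> (complex \<Rightarrow> ('h, 'n) vec \<times> 'g \<Rightarrow> 'k) \<Rightarrow>
    complex \<Rightarrow> ('h, 'n) vec \<times> ('h, 'n) vec \<Rightarrow> ('h, 'n) vec \<times> ('h, 'n) vec" where
  "char_matrix H1' M C0 C1 lam =
     (let \<Omega> = (\<lambda>lam (x1, x2).
            let T = rel_op ((rel_add_op (pair_rel (bspace1 H1') (C0 lam) (C1 lam)) (M lam))\<inverse>);
                (w1, w2) = Omega_ext (M lam) T ((x1, 0), (x2, 0))
            in (fst w1, fst w2))
      in if Im lam > 0 then \<Omega> lam else hadj UNIV (\<Omega> (cnj lam)))"

definition U_sol :: "(complex \<Rightarrow> real \<Rightarrow> ('h, 'n) vec \<Rightarrow> 'h) \<Rightarrow> (complex \<Rightarrow> real \<Rightarrow> ('h, 'n) vec \<Rightarrow> 'h::plus) \<Rightarrow>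
    complex \<Rightarrow> real \<Rightarrow> ('h, 'n) vec \<times> ('h, 'n) vec \<Rightarrow> 'h" where
  "U_sol u1 u2 lam t = (\<lambda>(x1, x2). u2 lam t x1 + u1 lam t x2)"

definition beta_op ::
    "(complex \<Rightarrow> ('h::complex_inner, 'n::finite) vec \<times> 'g::complex_inner \<Rightarrow> ('h, 'n) vec \<times> 'g) \<Rightarrow>
     (complex \<Rightarrow> 'l::complex_inner \<Rightarrow> ('h, 'n) vec \<times> 'g) \<Rightarrow> (complex \<Rightarrow> 'l \<Rightarrow> ('h, 'n) vec \<times> 'g) \<Rightarrow>
     complex \<Rightarrow> ('h, 'n) vec \<times> ('h, 'n) vec \<Rightarrow> 'l" where
  "beta_op M K0 K1 lam =
     (let B = inv (\<lambda>k. K1 lam k + M lam (K0 lam k))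
      in (\<lambda>(x1, x2). - B (M lam (x1, 0)) + B (x2, 0)))"

text \<open>
  The middle factor \<open>K\<^sub>0\<^sub>1\<^sup>*(\<lambda>)K\<^sub>1(\<mu>) - K\<^sub>1\<^sup>*(\<lambda>)K\<^sub>0\<^sub>1(\<mu>) - i K\<^sub>0\<^sub>2\<^sup>*(\<lambda>)K\<^sub>0\<^sub>2(\<mu>)\<close>, where
  \<open>K\<^sub>0\<^sub>j = P\<^sub>j K\<^sub>0\<close>.
\<close>

definition K_form :: "'e::complex_inner set \<Rightarrow> (complex \<Rightarrow> 'l::complex_inner \<Rightarrow> 'e) \<Rightarrow>
    (complex \<Rightarrow> 'l \<Rightarrow> 'e) \<Rightarrow> complex \<Rightarrow> complex \<Rightarrow> 'l \<Rightarrow> 'l" where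
  "K_form H1 K0 K1 lam \<mu> k =
     (let K01 = (\<lambda>lam k. oproj H1 (K0 lam k)); K02 = (\<lambda>lam k. oproj (ocompl H1) (K0 lam k)) in
       hadj UNIV (K01 lam) (K1 \<mu> k) - hadj UNIV (K1 lam) (K01 \<mu> k)
       - \<i> *\<^sub>C hadj UNIV (K02 lam) (K02 \<mu> k))"

text \<open>
  Strongly convergent operator integrals: \<open>\<integral>\<^sub>0\<^sup>b F(t) dt = s-lim\<^bsub>\<eta>\<up>b\<^esub> \<integral>\<^sub>0\<^sup>\<eta> F(t) dt\<close>, the integrals over
  \<open>[0,\<eta>]\<close> being evaluated on vectors.
\<close>

definition strongly_integrable :: "ereal \<Rightarrow> (real \<Rightarrow> 'a::banach \<Rightarrow> 'a) \<Rightarrow> bool" where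
  "strongly_integrable b F \<longleftrightarrow> (\<forall>x.
     (\<forall>\<eta>\<ge>0. ereal \<eta> < b \<longrightarrow> (\<lambda>t. F t x) integrable_on {0..\<eta>}) \<and>
     (\<exists>v. ((\<lambda>\<eta>. integral {0..\<eta>} (\<lambda>t. F t x)) \<longlongrightarrow> v) (left_of b)))"

definition strong_integral :: "ereal \<Rightarrow> (real \<Rightarrow> 'a::banach \<Rightarrow> 'a) \<Rightarrow> 'a \<Rightarrow> 'a" where
  "strong_integral b F x = Lim (left_of b) (\<lambda>\<eta>. integral {0..\<eta>} (\<lambda>t. F t x))"

end

theory Submission
  imports Defs
begin

text \<open>
  For \<open>x \<in> H\<^sup>n \<oplus> H\<^sup>n\<close> the function \<open>y = U\<^sub>\<tau>(\<cdot>,\<mu>) x\<close> lies in \<open>Ker (L - \<mu>)\<close>, and its boundary condition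
  says \<open>(C\<^sub>0 - C\<^sub>1 M\<^sub>+) \<Gamma>\<^sub>0 y = C\<^sub>1 (x\<^sub>2,0) - C\<^sub>0 (x\<^sub>1,0)\<close>.  Solving it gives
  \<open>\<Gamma>\<^sub>0 y = (\<tau>\<^sub>+ + M\<^sub>+)\<^sup>-\<^sup>1 (M\<^sub>+ (x\<^sub>1,0) - (x\<^sub>2,0)) - (x\<^sub>1,0)\<close>, so that \<open>\<Omega>\<^sub>\<tau>(\<mu>) x\<close> and \<open>\<beta>(\<mu>) x\<close> can be read off from
  \<open>\<Gamma>\<^sub>0 y\<close> and \<open>\<Gamma>\<^sub>1 y = M\<^sub>+ \<Gamma>\<^sub>0 y\<close>.  The identity is then Green's formula
  \<open>(\<mu> - cnj \<lambda>) (y,z) = (\<Gamma>\<^sub>1 y, \<Gamma>\<^sub>0 z) - (\<Gamma>\<^sub>0 y, \<Gamma>\<^sub>1 z) + \<i> (P\<^sub>2 \<Gamma>\<^sub>0 y, P\<^sub>2 \<Gamma>\<^sub>0 z)\<close> for two such functions \<open>y\<close>, \<open>z\<close>.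
  Since \<open>\<tau>\<^sub>+\<close> is dissipative, the remainder on the diagonal is nonnegative, and it vanishes for
  canonical \<open>\<tau>\<close>.  Green's formula on the half-line comes from the Lagrange identity on \<open>[0,\<eta>]\<close>; that
  \<open>\<Gamma>\<^sub>0\<close> and \<open>\<Gamma>\<^sub>1\<close> are jointly surjective follows by adding test functions that vanish near \<open>b\<close> and have
  arbitrary quasi-derivatives at \<open>0\<close>.
\<close>

text \<open>No solution of the differential equation is ever constructed. The solutions
  \<open>u1\<close>, \<open>u2\<close> are given, and the only other information on the defect
  spaces is that \<open>M\<close> is the unique operator with \<open>G1 y = M (G0 y)\<close>.
  Uniqueness makes the values \<open>G0 y\<close> dense; together with Green's identity this
  replaces resolvents, and both the invertibility of \<open>C0 - C1 M\<close> and the holomorphy of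
  \<open>M\<close> come from a priori estimates. These need boundary maps that are bounded in the
  graph norm. The triplet assumes no continuity, so uniform boundedness has to supply it. Three
  obstacles shape the analytic part. Only quasi-derivatives are known to be smooth, so ordinary
  derivatives of order n and more must be recovered by inverting \<open>p 0\<close> before the two
  forms of l[y] can be compared. The last quasi-derivative is absolutely continuous and
  differentiable only almost everywhere, which calls for a vector-valued fundamental theorem of
  calculus. And U(t) is regular only when applied to fixed vectors, whereas the integral contains
  its adjoint; strong continuity does not pass to adjoints.\<close>

section \<open>Algebra of the complex scalar product\<close>

lemma cinner_zero_left [simp]: "cinner 0 x = 0"
  using cinner_add_left[of 0 0 x] by simp

lemma cinner_zero_right [simp]: "cinner x 0 = 0"
  using cinner_commute[of x 0] by simp

lemma cinner_add_right: "cinner x (y + z) = cinner x y + cinner x z"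
  by (metis cinner_add_left cinner_commute complex_cnj_add)

lemma cinner_scaleC_right: "cinner x (c *\<^sub>C y) = cnj c * cinner x y"
  by (metis cinner_scaleC_left cinner_commute complex_cnj_mult)

lemma scaleC_minus_one: "(-1) *\<^sub>C x = - (x :: 'a::complex_inner)"
  using scaleC_of_real[of "-1" x] by simp

lemma scaleC_one [simp]: "1 *\<^sub>C (x :: 'a::complex_inner) = x"
  using scaleC_of_real[of 1 x] by simp

lemma scaleC_zero_left [simp]: "0 *\<^sub>C (x :: 'a::complex_inner) = 0"
  using scaleC_of_real[of 0 x] by simp

lemma scaleC_zero_right [simp]: "c *\<^sub>C (0 :: 'a::complex_inner) = 0"
  using scaleC_add_right[of c 0 "0::'a"] by simp

lemma scaleC_minus_right: "c *\<^sub>C (- x) = - (c *\<^sub>C (x :: 'a::complex_inner))"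
  using scaleC_add_right[of c x "- x"] by (simp add: eq_neg_iff_add_eq_0 add.commute)

lemma scaleC_minus_left: "(- c) *\<^sub>C x = - (c *\<^sub>C (x :: 'a::complex_inner))"
  using scaleC_add_left[of c "- c" x] by (simp add: eq_neg_iff_add_eq_0 add.commute)

lemma scaleC_diff_right: "c *\<^sub>C (x - y) = c *\<^sub>C x - c *\<^sub>C (y :: 'a::complex_inner)"
  using scaleC_add_right[of c x "- y"] by (simp add: scaleC_minus_right)

lemma scaleC_diff_left: "(c - d) *\<^sub>C x = c *\<^sub>C x - d *\<^sub>C (x :: 'a::complex_inner)"
  using scaleC_add_left[of c "- d" x] by (simp add: scaleC_minus_left)

lemma scaleC_scaleR: "c *\<^sub>C (r *\<^sub>R x) = r *\<^sub>R (c *\<^sub>C (x :: 'a::complex_inner))"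
  by (simp flip: scaleC_of_real add: scaleC_scaleC mult.commute)

lemma cinner_scaleR_left: "cinner (r *\<^sub>R x) y = of_real r * cinner x y"
  by (metis cinner_scaleC_left scaleC_of_real)

lemma cinner_scaleR_right: "cinner x (r *\<^sub>R y) = of_real r * cinner x y"
  by (metis cinner_scaleC_right complex_cnj_complex_of_real scaleC_of_real)

lemma cinner_minus_left: "cinner (- x) y = - cinner x y"
  using cinner_add_left[of x "- x" y] by (simp add: eq_neg_iff_add_eq_0 add.commute)

lemma cinner_minus_right: "cinner x (- y) = - cinner x y"
  using cinner_add_right[of x y "- y"] by (simp add: eq_neg_iff_add_eq_0 add.commute)

lemma cinner_diff_left: "cinner (x - y) z = cinner x z - cinner y z"
  using cinner_add_left[of x "- y" z] by (simp add: cinner_minus_left)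

lemma cinner_diff_right: "cinner x (y - z) = cinner x y - cinner x z"
  using cinner_add_right[of x y "- z"] by (simp add: cinner_minus_right)

lemmas cinner_simps = cinner_add_left cinner_add_right cinner_diff_left cinner_diff_right
  cinner_scaleC_left cinner_scaleC_right cinner_scaleR_left cinner_scaleR_right
  cinner_minus_left cinner_minus_right

lemma cnj_cinner [simp]: "cnj (cinner x y) = cinner y x"
  by (metis cinner_commute)

lemma cinner_self: "cinner x x = of_real ((norm x)\<^sup>2)"
proof -
  have "Im (cinner x x) = - Im (cinner x x)"
    by (metis cinner_commute cnj.sel(2))
  then show ?thesis
    by (intro complex_eqI) (simp_all add: Re_cinner power2_norm_eq_inner)
qed

lemma norm_cinner_self: "cmod (cinner x x) = (norm x)\<^sup>2"
  by (simp only: cinner_self norm_of_real) simp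

lemma norm_scaleC [simp]: "norm (c *\<^sub>C (x :: 'a::complex_inner)) = cmod c * norm x"
proof -
  have "complex_of_real ((norm (c *\<^sub>C x))\<^sup>2) = of_real ((cmod c * norm x)\<^sup>2)"
    unfolding cinner_self[symmetric] cinner_scaleC_left cinner_scaleC_right
    by (simp add: cinner_self power_mult_distrib complex_norm_square mult.assoc[symmetric] mult.commute[of "cnj c"]
        del: of_real_power)
  then have "(norm (c *\<^sub>C x))\<^sup>2 = (cmod c * norm x)\<^sup>2"
    by (simp only: of_real_eq_iff)
  then show ?thesis
    by simp
qed

text \<open>\<open>real_inner\<close> gives the inequality for the real part only; multiplying
  \<open>x\<close> by the phase \<open>c\<close> makes the scalar product real and equal to its
  modulus.\<close>

lemma cinner_Cauchy_Schwarz: "cmod (cinner x y) \<le> norm x * norm y"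
proof (cases "cinner x y = 0")
  case False
  define c where "c = cnj (cinner x y) / cmod (cinner x y)"
  have c: "cmod c = 1" using False by (simp add: c_def norm_divide del: cnj_cinner)
  have "c * cinner x y = of_real (cmod (cinner x y))"
  proof -
    have "cnj (cinner x y) * cinner x y = of_real (cmod (cinner x y)) * of_real (cmod (cinner x y))"
      by (simp only: mult.commute[of "cnj _"] complex_norm_square[symmetric] power2_eq_square of_real_mult)
    then show ?thesis using False by (simp add: c_def del: cnj_cinner)
  qed
  then have "cmod (cinner x y) = Re (cinner (c *\<^sub>C x) y)"
    by (simp add: cinner_scaleC_left)
  also have "\<dots> \<le> norm (c *\<^sub>C x) * norm y"
    unfolding Re_cinner by (rule norm_cauchy_schwarz)
  finally show ?thesis by (simp add: c)
qed simp

lemma bounded_bilinear_cinner: "bounded_bilinear (cinner :: 'a::complex_inner \<Rightarrow> 'a \<Rightarrow> complex)"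
proof
  show "\<exists>K. \<forall>a b :: 'a. norm (cinner a b) \<le> norm a * norm b * K"
    by (rule exI[of _ 1]) (simp add: cinner_Cauchy_Schwarz)
qed (simp_all add: cinner_simps scaleR_conv_of_real)

lemma bounded_linear_scaleC: "bounded_linear (\<lambda>x :: 'a::complex_inner. c *\<^sub>C x)"
  by (rule bounded_linear_intro[where K = "cmod c"])
     (simp_all add: scaleC_add_right scaleC_scaleR mult.commute)

lemma norm_add_sq:
  fixes x :: "'a::complex_inner"
  shows "(norm (x + y))\<^sup>2 = (norm x)\<^sup>2 + 2 * Re (cinner x y) + (norm y)\<^sup>2"
  by (simp add: power2_norm_eq_inner Re_cinner inner_add inner_commute)

subsection \<open>Orthogonal projections and the Riesz representation\<close>

lemma closed_csubspaceD:
  assumes "closed_csubspace S"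
  shows "closed S" "0 \<in> S" "x \<in> S \<Longrightarrow> y \<in> S \<Longrightarrow> x + y \<in> S" "x \<in> S \<Longrightarrow> c *\<^sub>C x \<in> S"
    "x \<in> S \<Longrightarrow> r *\<^sub>R x \<in> S" "x \<in> S \<Longrightarrow> - x \<in> S" "x \<in> S \<Longrightarrow> y \<in> S \<Longrightarrow> x - y \<in> S"
proof -
  show *: "closed S" "0 \<in> S" "x \<in> S \<Longrightarrow> y \<in> S \<Longrightarrow> x + y \<in> S" "x \<in> S \<Longrightarrow> c *\<^sub>C x \<in> S" for x y c
    using assms by (auto simp: closed_csubspace_def)
  show "x \<in> S \<Longrightarrow> r *\<^sub>R x \<in> S" using *(4)[of x "of_real r"] by (simp add: scaleC_of_real)
  show "x \<in> S \<Longrightarrow> - x \<in> S" for x using *(4)[of x "-1"] by (simp add: scaleC_minus_one)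
  then show "x \<in> S \<Longrightarrow> y \<in> S \<Longrightarrow> x - y \<in> S" using *(3)[of x "- y"] by simp
qed

lemma closed_csubspace_UNIV: "closed_csubspace UNIV"
  by (simp add: closed_csubspace_def)

lemma closed_csubspace_ocompl: "closed_csubspace (ocompl S)"
proof -
  have "closed (\<Inter>z\<in>S. {x. cinner x z = 0})"
    by (intro closed_INT ballI closed_Collect_eq continuous_intros
        bounded_linear.continuous_on[OF bounded_bilinear.bounded_linear_left[OF bounded_bilinear_cinner]])
  also have "(\<Inter>z\<in>S. {x. cinner x z = 0}) = ocompl S" by (auto simp: ocompl_def)
  finally show ?thesis
    by (auto simp: closed_csubspace_def ocompl_def cinner_simps)
qed

text \<open>The closest point of \<open>S\<close>. A minimizing sequence is Cauchy by the
  parallelogram law, because midpoints stay in \<open>S\<close> and so keep distance at least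
  \<open>d\<close> from \<open>x\<close>.\<close>

lemma ex_projection:
  fixes S :: "'a::chilbert_space set"
  assumes S: "closed_csubspace S"
  shows "\<exists>y\<in>S. x - y \<in> ocompl S"
proof -
  note [intro] = closed_csubspaceD[OF S]
  define d where "d = infdist x S"
  have d0: "0 \<le> d" by (simp add: d_def infdist_nonneg)
  have S_ne: "S \<noteq> {}" using closed_csubspaceD(2)[OF S] by auto
  have d_le: "d \<le> norm (x - y)" if "y \<in> S" for y
    using infdist_le[OF that, of x] by (simp add: d_def dist_norm)
  have "\<exists>y\<in>S. norm (x - y) < d + inverse (real (Suc k))" for k
    using cInf_lessD[of "(\<lambda>a. dist x a) ` S" "d + inverse (real (Suc k))"] S_ne
    by (auto simp: d_def infdist_notempty dist_norm)
  then obtain Y where Y: "\<And>k. Y k \<in> S" "\<And>k. norm (x - Y k) < d + inverse (real (Suc k))"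
    by metis
  have key: "(norm (Y i - Y j))\<^sup>2 \<le> 4 * ((d + e)\<^sup>2 - d\<^sup>2)"
    if "norm (x - Y i) \<le> d + e" "norm (x - Y j) \<le> d + e" for i j e
  proof -
    have "(1/2) *\<^sub>R (Y i + Y j) \<in> S" using Y by blast
    then have "d \<le> norm (x - (1/2) *\<^sub>R (Y i + Y j))" by (rule d_le)
    then have "d\<^sup>2 \<le> (norm (x - (1/2) *\<^sub>R (Y i + Y j)))\<^sup>2" using d0 by (rule power_mono)
    moreover have "(norm (x - Y i))\<^sup>2 \<le> (d + e)\<^sup>2" "(norm (x - Y j))\<^sup>2 \<le> (d + e)\<^sup>2"
      using that by (auto intro!: power_mono)
    moreover have "(norm (Y i - Y j))\<^sup>2 + 4 * (norm (x - (1/2) *\<^sub>R (Y i + Y j)))\<^sup>2 =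
       2 * (norm (x - Y i))\<^sup>2 + 2 * (norm (x - Y j))\<^sup>2"
      by (simp add: power2_norm_eq_inner inner_diff inner_add inner_commute algebra_simps)
    ultimately show ?thesis unfolding right_diff_distrib by argo
  qed
  have "Cauchy Y"
  proof (rule metric_CauchyI)
    fix r :: real assume r: "0 < r"
    have "(\<lambda>k. 4 * ((d + inverse (real (Suc k)))\<^sup>2 - d\<^sup>2)) \<longlonglongrightarrow> 4 * ((d + 0)\<^sup>2 - d\<^sup>2)"
      by (intro tendsto_intros LIMSEQ_inverse_real_of_nat)
    then have "\<forall>\<^sub>F k in sequentially. 4 * ((d + inverse (real (Suc k)))\<^sup>2 - d\<^sup>2) < r\<^sup>2"
      by (rule order_tendstoD) (use r in simp)
    then obtain N where N: "4 * ((d + inverse (real (Suc N)))\<^sup>2 - d\<^sup>2) < r\<^sup>2"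
      by (auto simp: eventually_sequentially)
    have "dist (Y i) (Y j) < r" if ij: "i \<ge> N" "j \<ge> N" for i j
    proof -
      have "norm (x - Y k) \<le> d + inverse (real (Suc N))" if "k \<ge> N" for k
      proof -
        have "inverse (real (Suc k)) \<le> inverse (real (Suc N))" using that by (intro le_imp_inverse_le) auto
        then show ?thesis using Y(2)[of k] by linarith
      qed
      then have "(norm (Y i - Y j))\<^sup>2 < r\<^sup>2" using key[of i _ j] ij N by fastforce
      then show ?thesis using r by (simp add: dist_norm power2_less_imp_less)
    qed
    then show "\<exists>M. \<forall>m\<ge>M. \<forall>n\<ge>M. dist (Y m) (Y n) < r" by blast
  qed
  then obtain y where y: "Y \<longlonglongrightarrow> y" by (auto simp: Cauchy_convergent_iff convergent_def)
  have yS: "y \<in> S" using closed_sequentially[OF closed_csubspaceD(1)[OF S]] Y(1) y by blast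
  have "norm (x - y) \<le> d + 0"
    by (rule tendsto_le[OF trivial_limit_sequentially, of "\<lambda>k. d + inverse (real (Suc k))" _ "\<lambda>k. norm (x - Y k)"])
       (intro tendsto_intros y LIMSEQ_inverse_real_of_nat always_eventually allI less_imp_le Y(2))+
  then have ny: "norm (x - y) \<le> d" by simp
  have "cinner (x - y) z = 0" if z: "z \<in> S" for z
  proof (rule ccontr)
    define c where "c = cinner (x - y) z"
    assume "cinner (x - y) z \<noteq> 0"
    then have c: "cmod c > 0" by (simp add: c_def)
    \<comment> \<open>Moving \<open>y\<close> by \<open>t c z\<close> changes the squared distance
      by \<open>- 2 t |c|^2 + t^2 |c|^2 |z|^2\<close>, since the factor \<open>c\<close> makes the
      linear term real. At \<open>t = 1 / |z|^2\<close> the linear term wins, which contradicts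
      minimality.\<close>
    have le: "2 * t * (cmod c)\<^sup>2 \<le> t\<^sup>2 * (cmod c)\<^sup>2 * (norm z)\<^sup>2" if "t > 0" for t :: real
    proof -
      have "y + (of_real t * c) *\<^sub>C z \<in> S" using yS z by blast
      then have "norm (x - y) \<le> norm (x - (y + (of_real t * c) *\<^sub>C z))" using d_le ny order_trans by blast
      then have "(norm (x - y))\<^sup>2 \<le> (norm ((x - y) + (- (of_real t * c)) *\<^sub>C z))\<^sup>2"
        by (intro power_mono) (simp_all add: scaleC_minus_left algebra_simps)
      also have "\<dots> = (norm (x - y))\<^sup>2 - 2 * t * Re (cnj c * c) + t\<^sup>2 * (cmod c)\<^sup>2 * (norm z)\<^sup>2"
        unfolding norm_add_sq
        by (simp add: cinner_scaleC_right c_def[symmetric] norm_mult power_mult_distrib algebra_simps)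
      finally have "(norm (x - y))\<^sup>2 \<le> (norm (x - y))\<^sup>2 - 2 * t * Re (cnj c * c) + t\<^sup>2 * (cmod c)\<^sup>2 * (norm z)\<^sup>2" .
      moreover have "Re (cnj c * c) = (cmod c)\<^sup>2" unfolding cmod_power2 by (simp add: power2_eq_square)
      ultimately show ?thesis by simp
    qed
    show False
    proof (cases "norm z = 0")
      case True then show False using le[of 1] c by simp
    next
      case False
      then have "0 < 1 / (norm z)\<^sup>2" by simp
      from le[OF this] False c show False
        by (simp add: power2_eq_square field_simps)
    qed
  qed
  then show ?thesis using yS by (auto simp: ocompl_def)
qed

lemma oproj_unique:
  assumes "closed_csubspace S" "y \<in> S" "x - y \<in> ocompl S"
  shows "oproj S x = y"
  unfolding oproj_def
proof (rule the_equality)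
  fix y' assume y': "y' \<in> S \<and> x - y' \<in> ocompl S"
  have "y' - y \<in> S" using assms(2) y' closed_csubspaceD(7)[OF assms(1)] by blast
  then have "cinner (x - y) (y' - y) = 0" "cinner (x - y') (y' - y) = 0"
    using assms y' by (auto simp: ocompl_def)
  then have "cinner (y' - y) (y' - y) = 0" using cinner_diff_left[of "x - y" "x - y'" "y' - y"] by simp
  then show "y' = y" by (simp add: cinner_self)
qed (use assms in auto)

context
  fixes S :: "'a::chilbert_space set"
  assumes S: "closed_csubspace S"
begin

lemma oproj_mem: "oproj S x \<in> S" and oproj_diff_mem: "x - oproj S x \<in> ocompl S"
proof -
  obtain y where "y \<in> S" "x - y \<in> ocompl S" using ex_projection[OF S] by blast
  then show "oproj S x \<in> S" "x - oproj S x \<in> ocompl S" using oproj_unique[OF S] by auto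
qed

lemma oproj_add: "oproj S (x + y) = oproj S x + oproj S y"
proof (rule oproj_unique[OF S])
  show "x + y - (oproj S x + oproj S y) \<in> ocompl S"
    unfolding add_diff_add by (intro closed_csubspaceD(3)[OF closed_csubspace_ocompl] oproj_diff_mem)
qed (intro closed_csubspaceD(3)[OF S] oproj_mem)

lemma oproj_scaleC: "oproj S (c *\<^sub>C x) = c *\<^sub>C oproj S x"
proof (rule oproj_unique[OF S])
  show "c *\<^sub>C x - c *\<^sub>C oproj S x \<in> ocompl S"
    unfolding scaleC_diff_right[symmetric] by (intro closed_csubspaceD(4)[OF closed_csubspace_ocompl] oproj_diff_mem)
qed (intro closed_csubspaceD(4)[OF S] oproj_mem)

lemma oproj_id: "x \<in> S \<Longrightarrow> oproj S x = x"
  by (rule oproj_unique[OF S]) (auto simp: ocompl_def)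

lemma cinner_oproj_left: "cinner (oproj S x) y = cinner (oproj S x) (oproj S y)"
proof -
  have "cinner (y - oproj S y) (oproj S x) = 0"
    using oproj_diff_mem oproj_mem by (auto simp: ocompl_def)
  then have "cinner (oproj S x) (y - oproj S y) = 0" by (metis cnj_cinner complex_cnj_zero)
  then show ?thesis by (simp add: cinner_simps)
qed

lemma cinner_oproj_right: "cinner x (oproj S y) = cinner (oproj S x) (oproj S y)"
  by (metis cinner_oproj_left cnj_cinner)

lemma oproj_ocompl: "oproj (ocompl S) x = x - oproj S x"
proof (rule oproj_unique[OF closed_csubspace_ocompl oproj_diff_mem])
  show "x - (x - oproj S x) \<in> ocompl (ocompl S)"
    using oproj_mem[of x] by (auto simp: ocompl_def) (metis cnj_cinner complex_cnj_zero)
qed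

lemma norm_oproj_le: "norm (oproj S x) \<le> norm x"
proof -
  have "cmod (cinner (oproj S x) (oproj S x)) \<le> norm (oproj S x) * norm x"
    using cinner_Cauchy_Schwarz[of "oproj S x" x] by (simp add: cinner_oproj_left[symmetric])
  then show ?thesis
    by (cases "oproj S x = 0") (auto simp: norm_cinner_self power2_eq_square)
qed

lemma bounded_op_oproj: "bounded_op UNIV S (oproj S)"
  unfolding bounded_op_def using oproj_mem oproj_add oproj_scaleC norm_oproj_le
  by (metis UNIV_I mult_1)

end

text \<open>The component \<open>u\<close> of \<open>x0\<close> orthogonal to the kernel spans the
  whole complement of the kernel: \<open>x - (f x / f u) u\<close> lies in the kernel and is
  therefore orthogonal to \<open>u\<close>. The representative is a multiple of
  \<open>u\<close>.\<close>

lemma Riesz_representation: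
  fixes f :: "'a::chilbert_space \<Rightarrow> complex"
  assumes add: "\<And>x y. f (x + y) = f x + f y" and scale: "\<And>c x. f (c *\<^sub>C x) = c * f x"
    and bd: "\<And>x. cmod (f x) \<le> B * norm x"
  shows "\<exists>y. \<forall>x. f x = cinner x y"
proof (cases "\<forall>x. f x = 0")
  case False
  then obtain x0 where x0: "f x0 \<noteq> 0" by blast
  have f_diff: "f (x - y) = f x - f y" for x y
    using add[of x "- y"] scale[of "-1" y] by (simp add: scaleC_minus_one)
  have f_bl: "bounded_linear f"
  proof (rule bounded_linear_intro[where K = B])
    show "f (r *\<^sub>R x) = r *\<^sub>R f x" for r x
      using scale[of "of_real r" x] by (simp add: scaleC_of_real scaleR_conv_of_real)
  qed (use add bd in \<open>auto simp: mult.commute\<close>)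
  have K: "closed_csubspace {x. f x = 0}"
    using scale[of 0 0] unfolding closed_csubspace_def
    by (auto simp: add scale intro!: closed_Collect_eq continuous_intros bounded_linear.continuous_on[OF f_bl])
  obtain y0 where y0: "f y0 = 0" "x0 - y0 \<in> ocompl {x. f x = 0}" using ex_projection[OF K, of x0] by auto
  define u where "u = x0 - y0"
  have fu: "f u \<noteq> 0" using x0 y0 by (simp add: u_def f_diff)
  then have u0: "cinner u u \<noteq> 0" using scale[of 0 0] by (auto simp: cinner_self)
  have "f x = cinner x ((cnj (f u) / cinner u u) *\<^sub>C u)" for x
  proof -
    have "f (x - (f x / f u) *\<^sub>C u) = 0" using fu by (simp add: f_diff scale)
    then have "cinner u (x - (f x / f u) *\<^sub>C u) = 0" using y0(2) by (simp add: ocompl_def u_def)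
    then have "cinner (x - (f x / f u) *\<^sub>C u) u = 0" by (metis cnj_cinner complex_cnj_zero)
    then have "cinner x u = (f x / f u) * cinner u u" by (simp add: cinner_simps)
    then show ?thesis using fu u0 by (simp add: cinner_scaleC_right)
  qed
  then show ?thesis by blast
qed (auto intro: exI[of _ 0])

subsection \<open>Bounded operators and adjoints\<close>

lemma bounded_opD:
  assumes "bounded_op X Y T"
  shows "x \<in> X \<Longrightarrow> T x \<in> Y" "x \<in> X \<Longrightarrow> y \<in> X \<Longrightarrow> T (x + y) = T x + T y"
    "x \<in> X \<Longrightarrow> T (c *\<^sub>C x) = c *\<^sub>C T x"
  using assms by (auto simp: bounded_op_def)

text \<open>A positive constant, since later estimates divide by it.\<close>

lemma bounded_op_bound:
  assumes "bounded_op X Y T"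
  obtains B where "0 < B" "\<And>x. x \<in> X \<Longrightarrow> norm (T x) \<le> B * norm x"
proof -
  obtain B where B: "\<And>x. x \<in> X \<Longrightarrow> norm (T x) \<le> B * norm x" using assms unfolding bounded_op_def by metis
  show ?thesis
  proof (rule that[of "max B 1"])
    show "norm (T x) \<le> max B 1 * norm x" if "x \<in> X" for x
      using B[OF that] mult_right_mono[of B "max B 1" "norm x"] by simp
  qed simp
qed

lemma bounded_opI:
  assumes "\<And>x. x \<in> X \<Longrightarrow> T x \<in> Y" "\<And>x y. x \<in> X \<Longrightarrow> y \<in> X \<Longrightarrow> T (x + y) = T x + T y"
    "\<And>c x. x \<in> X \<Longrightarrow> T (c *\<^sub>C x) = c *\<^sub>C T x" "\<And>x. x \<in> X \<Longrightarrow> norm (T x) \<le> B * norm x"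
  shows "bounded_op X Y T"
  unfolding bounded_op_def using assms by (intro conjI ballI allI exI[of _ B])

text \<open>Ties operators on whole spaces to \<open>bounded_linear\<close>, so that the limit and
  continuity rules for real-linear maps apply.\<close>

lemma bounded_op_UNIV_iff:
  "bounded_op UNIV UNIV T \<longleftrightarrow> bounded_linear T \<and> (\<forall>c x. T (c *\<^sub>C x) = c *\<^sub>C T x)"
proof
  assume *: "bounded_op UNIV UNIV T"
  obtain B where B: "\<And>x. norm (T x) \<le> B * norm x" using bounded_op_bound[OF *] by auto
  have "bounded_linear T"
  proof (rule bounded_linear_intro[where K = B])
    show "T (r *\<^sub>R x) = r *\<^sub>R T x" for r x
      using bounded_opD(3)[OF *, of x "of_real r"] by (simp add: scaleC_of_real)
  qed (use B bounded_opD[OF *] in \<open>auto simp: mult.commute\<close>)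
  then show "bounded_linear T \<and> (\<forall>c x. T (c *\<^sub>C x) = c *\<^sub>C T x)" using bounded_opD[OF *] by auto
next
  assume *: "bounded_linear T \<and> (\<forall>c x. T (c *\<^sub>C x) = c *\<^sub>C T x)"
  then obtain K where "\<And>x. norm (T x) \<le> norm x * K" using bounded_linear.bounded by blast
  then show "bounded_op UNIV UNIV T"
    using * by (intro bounded_opI[where B = K]) (auto simp: linear_simps mult.commute)
qed

lemma bounded_op_lin:
  assumes "bounded_op UNIV UNIV T"
  shows "bounded_linear T" "T (x + y) = T x + T y" "T (x - y) = T x - T y" "T (- x) = - T x"
    "T 0 = 0" "T (c *\<^sub>C x) = c *\<^sub>C T x" "T (r *\<^sub>R x) = r *\<^sub>R T x"
  using assms unfolding bounded_op_UNIV_iff by (auto simp: linear_simps)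

lemma bounded_op_subset:
  "bounded_op X Y T \<Longrightarrow> X' \<subseteq> X \<Longrightarrow> Y \<subseteq> Y' \<Longrightarrow> bounded_op X' Y' T"
  unfolding bounded_op_def by blast

lemma bounded_op_compose:
  assumes S: "bounded_op Y Z S" and T: "bounded_op X Y T"
  shows "bounded_op X Z (\<lambda>x. S (T x))"
proof -
  obtain A where A: "0 < A" "\<And>y. y \<in> Y \<Longrightarrow> norm (S y) \<le> A * norm y" using bounded_op_bound[OF S] by metis
  obtain B where B: "0 < B" "\<And>x. x \<in> X \<Longrightarrow> norm (T x) \<le> B * norm x" using bounded_op_bound[OF T] by metis
  show ?thesis
  proof (rule bounded_opI[where B = "A * B"])
    fix x assume "x \<in> X"
    have "norm (S (T x)) \<le> A * norm (T x)" using A bounded_opD(1)[OF T \<open>x \<in> X\<close>] by blast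
    also have "\<dots> \<le> A * (B * norm x)" using A B \<open>x \<in> X\<close> by (intro mult_left_mono) auto
    finally show "norm (S (T x)) \<le> A * B * norm x" by simp
  qed (auto simp: bounded_opD[OF S] bounded_opD[OF T])
qed

lemma bounded_op_add:
  assumes "bounded_op X UNIV S" "bounded_op X UNIV T"
  shows "bounded_op X UNIV (\<lambda>x. S x + T x)"
proof -
  obtain A where A: "0 < A" "\<And>x. x \<in> X \<Longrightarrow> norm (S x) \<le> A * norm x" using bounded_op_bound[OF assms(1)] by metis
  obtain B where B: "0 < B" "\<And>x. x \<in> X \<Longrightarrow> norm (T x) \<le> B * norm x" using bounded_op_bound[OF assms(2)] by metis
  show ?thesis
  proof (rule bounded_opI[where B = "A + B"])
    show "norm (S x + T x) \<le> (A + B) * norm x" if "x \<in> X" for x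
      using norm_triangle_le[of "S x" "T x" "(A + B) * norm x"] A(2)[OF that] B(2)[OF that]
      by (simp add: algebra_simps)
  qed (auto simp: bounded_opD[OF assms(1)] bounded_opD[OF assms(2)] scaleC_add_right)
qed

lemma bounded_op_scaleC_const: "bounded_op UNIV UNIV (\<lambda>x. c *\<^sub>C x)"
  by (rule bounded_opI[where B = "cmod c"]) (auto simp: scaleC_add_right scaleC_scaleC mult.commute)

lemma bounded_op_scaleC:
  assumes "bounded_op X UNIV T"
  shows "bounded_op X UNIV (\<lambda>x. c *\<^sub>C T x)"
  by (rule bounded_op_compose[OF bounded_op_scaleC_const assms])

lemma bounded_op_minus: "bounded_op X UNIV T \<Longrightarrow> bounded_op X UNIV (\<lambda>x. - T x)"
  using bounded_op_scaleC[of X T "-1"] by (simp add: scaleC_minus_one)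

lemma bounded_op_diff:
  "bounded_op X UNIV S \<Longrightarrow> bounded_op X UNIV T \<Longrightarrow> bounded_op X UNIV (\<lambda>x. S x - T x)"
  using bounded_op_add[of X S "\<lambda>x. - T x"] bounded_op_minus[of X T] by simp

lemma bounded_op_id: "bounded_op X X (\<lambda>x. x)"
  by (rule bounded_opI[where B = 1]) auto

lemma bounded_op_zero: "bounded_op X UNIV (\<lambda>x. 0)"
  by (rule bounded_opI[where B = 1]) auto

lemma hadj_eqI:
  assumes "closed_csubspace X" "x \<in> X" "\<And>z. z \<in> X \<Longrightarrow> cinner (T z) y = cinner z x"
  shows "hadj X T y = x"
  unfolding hadj_def
proof (rule the_equality)
  fix x' assume x': "x' \<in> X \<and> (\<forall>z\<in>X. cinner (T z) y = cinner z x')"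
  have mem: "x' - x \<in> X" using assms(2) x' closed_csubspaceD(7)[OF assms(1)] by blast
  have "cinner (x' - x) (x' - x) = 0"
    using x' assms(3)[OF mem] mem by (simp add: cinner_diff_right)
  then show "x' = x" by (simp add: cinner_self)
qed (use assms in auto)

text \<open>The Riesz representation is available on a whole type only. The functional is therefore
  extended by composing \<open>T\<close> with the projection onto \<open>X\<close>, and its
  representative is projected back into \<open>X\<close>.\<close>

lemma hadj_props:
  fixes T :: "'a::chilbert_space \<Rightarrow> 'b::complex_inner"
  assumes X: "closed_csubspace X" and T: "bounded_op X Y T"
  shows hadj_mem: "hadj X T y \<in> X"
    and cinner_hadj_right: "z \<in> X \<Longrightarrow> cinner z (hadj X T y) = cinner (T z) y"
proof -
  obtain B where B: "0 < B" "\<And>x. x \<in> X \<Longrightarrow> norm (T x) \<le> B * norm x" using bounded_op_bound[OF T] by metis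
  have "cmod (cinner (T (oproj X x)) y) \<le> (B * norm y) * norm x" for x
  proof -
    have "cmod (cinner (T (oproj X x)) y) \<le> norm (T (oproj X x)) * norm y" by (rule cinner_Cauchy_Schwarz)
    also have "\<dots> \<le> (B * norm (oproj X x)) * norm y"
      using B oproj_mem[OF X] by (intro mult_right_mono) auto
    also have "\<dots> \<le> (B * norm x) * norm y"
      using B norm_oproj_le[OF X] by (intro mult_right_mono mult_left_mono) auto
    finally show ?thesis by (simp add: ac_simps)
  qed
  then obtain w where w: "\<And>x. cinner (T (oproj X x)) y = cinner x w"
    using Riesz_representation[of "\<lambda>x. cinner (T (oproj X x)) y" "B * norm y"]
    by (auto simp: oproj_add[OF X] oproj_scaleC[OF X] bounded_opD[OF T] oproj_mem[OF X] cinner_simps)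
  have *: "cinner (T z) y = cinner z (oproj X w)" if "z \<in> X" for z
    using w[of z] that cinner_oproj_left[OF X, of z w] by (simp add: oproj_id[OF X])
  have "hadj X T y = oproj X w" by (rule hadj_eqI[OF X oproj_mem[OF X] *])
  then show "hadj X T y \<in> X" "z \<in> X \<Longrightarrow> cinner z (hadj X T y) = cinner (T z) y"
    using oproj_mem[OF X] * by auto
qed

lemma cinner_hadj_left:
  fixes T :: "'a::chilbert_space \<Rightarrow> 'b::complex_inner"
  assumes "closed_csubspace X" "bounded_op X Y T" "z \<in> X"
  shows "cinner (hadj X T y) z = cinner y (T z)"
  by (metis cinner_hadj_right[OF assms] cnj_cinner)

lemmas hadj_UNIV_right = cinner_hadj_right[OF closed_csubspace_UNIV _ UNIV_I]
lemmas hadj_UNIV_left = cinner_hadj_left[OF closed_csubspace_UNIV _ UNIV_I]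

lemma hadj_norm_le:
  fixes T :: "'a::chilbert_space \<Rightarrow> 'b::complex_inner"
  assumes X: "closed_csubspace X" and T: "bounded_op X Y T"
    and B: "\<And>x. x \<in> X \<Longrightarrow> norm (T x) \<le> B * norm x" and B0: "0 \<le> B"
  shows "norm (hadj X T y) \<le> B * norm y"
proof -
  let ?w = "hadj X T y"
  have w: "?w \<in> X" by (rule hadj_mem[OF X T])
  have "(norm ?w)\<^sup>2 = cmod (cinner (T ?w) y)"
    by (simp add: cinner_hadj_right[OF X T w, symmetric] cinner_self norm_power)
  also have "\<dots> \<le> norm (T ?w) * norm y" by (rule cinner_Cauchy_Schwarz)
  also have "\<dots> \<le> (B * norm ?w) * norm y" by (intro mult_right_mono B w) auto
  finally have "norm ?w * norm ?w \<le> (B * norm y) * norm ?w" by (simp add: power2_eq_square ac_simps)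
  then show ?thesis using B0 by (cases "?w = 0") auto
qed

lemma bounded_op_hadj:
  fixes T :: "'a::chilbert_space \<Rightarrow> 'b::complex_inner"
  assumes X: "closed_csubspace X" and T: "bounded_op X Y T"
  shows "bounded_op UNIV X (hadj X T)"
proof -
  obtain B where B: "0 < B" "\<And>x. x \<in> X \<Longrightarrow> norm (T x) \<le> B * norm x" using bounded_op_bound[OF T] by metis
  show ?thesis
  proof (rule bounded_opI[where B = B])
    show "hadj X T (x + y) = hadj X T x + hadj X T y" for x y
      by (rule hadj_eqI[OF X])
         (auto simp: cinner_hadj_right[OF X T] cinner_simps intro: closed_csubspaceD[OF X] hadj_mem[OF X T])
    show "hadj X T (c *\<^sub>C x) = c *\<^sub>C hadj X T x" for x c
      by (rule hadj_eqI[OF X])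
         (auto simp: cinner_hadj_right[OF X T] cinner_simps intro: closed_csubspaceD[OF X] hadj_mem[OF X T])
    show "norm (hadj X T x) \<le> B * norm x" for x
      using hadj_norm_le[OF X T B(2), of x] B by simp
  qed (rule hadj_mem[OF X T])
qed

lemma hadj_hadj:
  fixes T :: "'a::chilbert_space \<Rightarrow> 'b::chilbert_space"
  assumes T: "bounded_op UNIV UNIV T"
  shows "hadj UNIV (hadj UNIV T) = T"
proof
  fix x
  show "hadj UNIV (hadj UNIV T) x = T x"
    by (rule hadj_eqI[OF closed_csubspace_UNIV]) (auto simp: hadj_UNIV_left[OF T])
qed

text \<open>If \<open>S\<close> is the inverse, \<open>hadj UNIV S u\<close> is a preimage of
  \<open>u\<close>. This supplies the test vector \<open>k\<close> in
  \<open>boundary_pair_dissipative\<close>.\<close>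

lemma hadj_compose_invertible:
  fixes X :: "'a::chilbert_space \<Rightarrow> 'b::chilbert_space"
  assumes "boundedly_invertible UNIV UNIV X"
  shows "\<exists>k. hadj UNIV X k = u"
proof -
  obtain S where X: "bounded_op UNIV UNIV X" and S: "bounded_op UNIV UNIV S" and SX: "\<And>x. S (X x) = x"
    using assms by (auto simp: boundedly_invertible_def)
  have "hadj UNIV X (hadj UNIV S u) = u"
    by (rule hadj_eqI[OF closed_csubspace_UNIV]) (auto simp: hadj_UNIV_right[OF S] SX)
  then show ?thesis by blast
qed

subsection \<open>The principle of uniform boundedness\<close>

text \<open>Since \<open>2 T v = T (x + v) - T (x - v)\<close>, one of the points
  \<open>x + v\<close>, \<open>x - v\<close> does at least as well as \<open>v\<close>. The factor
  2/3 is below 1, because the norm need not be attained, and above the 1/2 that is lost in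
  \<open>uniform_boundedness\<close>.\<close>

lemma bounded_linear_large_on_ball:
  assumes T: "bounded_linear T" and r: "0 < r"
  shows "\<exists>x'. norm (x' - x) \<le> r \<and> 2 / 3 * (r * onorm T) \<le> norm (T x')"
proof -
  interpret bounded_linear T by fact
  have "\<exists>v. norm v \<le> r \<and> 2 / 3 * (r * onorm T) \<le> norm (T v)"
  proof (rule ccontr)
    assume "\<not> ?thesis"
    then have *: "norm (T v) < 2 / 3 * (r * onorm T)" if "norm v \<le> r" for v
      using that by (metis not_le)
    have pos: "0 < onorm T" using *[of 0] r by (simp add: zero zero_less_mult_iff)
    have "onorm T \<le> 2 / 3 * onorm T"
    proof (rule onorm_bound)
      fix v
      show "norm (T v) \<le> 2 / 3 * onorm T * norm v"
      proof (cases "v = 0")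
        case False
        have "norm (T ((r / norm v) *\<^sub>R v)) < 2 / 3 * (r * onorm T)"
          by (rule *) (use False r in simp)
        then show ?thesis using False r by (simp add: scaleR field_simps)
      qed (simp add: zero)
    qed (use pos in simp)
    then show False using pos by simp
  qed
  then obtain v where v: "norm v \<le> r" "2 / 3 * (r * onorm T) \<le> norm (T v)" by blast
  have "2 *\<^sub>R T v = T (x + v) - T (x - v)" by (simp add: add diff scaleR_2)
  then have "2 * norm (T v) = norm (T (x + v) - T (x - v))" by (metis norm_scaleR abs_numeral)
  also have "\<dots> \<le> norm (T (x + v)) + norm (T (x - v))" by (rule norm_triangle_ineq4)
  finally have "norm (T v) \<le> norm (T (x + v)) \<or> norm (T v) \<le> norm (T (x - v))" by linarith
  then show ?thesis
    using v order_trans[OF v(2)]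
    by (metis add_diff_cancel_left' norm_minus_commute diff_add_cancel)
qed

text \<open>Sokal's gliding hump argument, which avoids the Baire category theorem.\<close>

lemma uniform_boundedness:
  fixes T :: "'i \<Rightarrow> 'a::banach \<Rightarrow> 'b::real_normed_vector"
  assumes T: "\<And>i. i \<in> I \<Longrightarrow> bounded_linear (T i)"
    and ptw: "\<And>x. \<exists>B. \<forall>i\<in>I. norm (T i x) \<le> B"
  shows "\<exists>B\<ge>0. \<forall>i\<in>I. \<forall>x. norm (T i x) \<le> B * norm x"
proof (rule ccontr)
  assume neg: "\<not> ?thesis"
  have "\<exists>i\<in>I. B < onorm (T i)" for B
  proof (rule ccontr)
    assume "\<not> ?thesis"
    then have *: "onorm (T i) \<le> max B 0" if "i \<in> I" for i using that by force
    have "norm (T i x) \<le> max B 0 * norm x" if "i \<in> I" for i x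
      using onorm[OF T[OF that], of x] mult_right_mono[OF *[OF that] norm_ge_zero[of x]] by linarith
    then show False using neg by (metis max.cobounded2)
  qed
  then have "\<forall>k. \<exists>i. i \<in> I \<and> 4 ^ k < onorm (T i)" by blast
  then obtain i where i: "\<And>k. i k \<in> I" "\<And>k. 4 ^ k < onorm (T (i k))" by metis
  \<comment> \<open>With radii 3^-k all later corrections together move the point by at most
    \<open>r k / 2\<close>, and norms above 4^k outgrow the radii.\<close>
  define r where "r = (\<lambda>k. (1 / 3 :: real) ^ k)"
  have r: "0 < r k" for k by (simp add: r_def)
  have "\<exists>X. \<forall>k. norm (X (Suc k) - X k) \<le> r k \<and> 2 / 3 * (r k * onorm (T (i k))) \<le> norm (T (i k) (X (Suc k)))"
    using dependent_nat_choice[of "\<lambda>k x. True"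
        "\<lambda>k x x'. norm (x' - x) \<le> r k \<and> 2 / 3 * (r k * onorm (T (i k))) \<le> norm (T (i k) x')"]
      bounded_linear_large_on_ball[OF T[OF i(1)] r] by auto
  then obtain X where X: "\<And>k. norm (X (Suc k) - X k) \<le> r k"
    "\<And>k. 2 / 3 * (r k * onorm (T (i k))) \<le> norm (T (i k) (X (Suc k)))" by blast
  have tail: "norm (X (Suc k + m) - X (Suc k)) \<le> r k * (1 / 2 - (1 / 2) * (1 / 3) ^ m)" for k m
  proof (induction m)
    case (Suc m)
    have "norm (X (Suc k + Suc m) - X (Suc k))
       \<le> norm (X (Suc (Suc k + m)) - X (Suc k + m)) + norm (X (Suc k + m) - X (Suc k))"
      using norm_triangle_ineq[of "X (Suc (Suc k + m)) - X (Suc k + m)" "X (Suc k + m) - X (Suc k)"] by simp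
    also have "\<dots> \<le> r (Suc k + m) + r k * (1 / 2 - (1 / 2) * (1 / 3) ^ m)"
      using X(1) Suc by (rule add_mono)
    finally show ?case by (simp add: r_def power_add field_simps)
  qed simp
  have tail': "norm (X (Suc k + m) - X (Suc k)) \<le> r k / 2" for k m
  proof -
    have "r k * (1 / 2 - (1 / 2) * (1 / 3) ^ m) \<le> r k * (1 / 2)" by (intro mult_left_mono less_imp_le[OF r]) simp
    then show ?thesis using tail[of k m] by linarith
  qed
  have "Cauchy X"
  proof (rule metric_CauchyI)
    fix e :: real assume e: "0 < e"
    have "r \<longlonglongrightarrow> 0" unfolding r_def by (rule LIMSEQ_realpow_zero) auto
    then have "\<forall>\<^sub>F k in sequentially. r k < e" by (rule order_tendstoD) (rule e)
    then obtain N where N: "r N < e" by (auto simp: eventually_sequentially)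
    have "dist (X a) (X b) < e" if ab: "Suc N \<le> a" "Suc N \<le> b" for a b
    proof -
      have "dist (X a) (X (Suc N)) \<le> r N / 2" "dist (X b) (X (Suc N)) \<le> r N / 2"
        using tail'[of N "a - Suc N"] tail'[of N "b - Suc N"] ab by (auto simp: dist_norm)
      then show ?thesis using dist_triangle2[of "X a" "X b" "X (Suc N)"] N by linarith
    qed
    then show "\<exists>M. \<forall>m\<ge>M. \<forall>n\<ge>M. dist (X m) (X n) < e" by blast
  qed
  then obtain x where x: "X \<longlonglongrightarrow> x" by (auto simp: Cauchy_convergent_iff convergent_def)
  have close: "norm (x - X (Suc k)) \<le> r k / 2" for k
  proof (rule LIMSEQ_le_const2)
    show "(\<lambda>m. norm (X (m + Suc k) - X (Suc k))) \<longlonglongrightarrow> norm (x - X (Suc k))"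
      by (intro tendsto_intros LIMSEQ_ignore_initial_segment x)
    show "\<exists>N. \<forall>m\<ge>N. norm (X (m + Suc k) - X (Suc k)) \<le> r k / 2"
      using tail'[of k] by (metis add.commute)
  qed
  obtain B where B: "\<And>j. j \<in> I \<Longrightarrow> norm (T j x) \<le> B" using ptw by blast
  \<comment> \<open>Of the gain 2/3 the tail takes at most 1/2, which leaves one sixth of
    \<open>r k * 4 ^ k\<close>.\<close>
  have le: "(4 / 3) ^ k / 6 \<le> B" for k
  proof -
    interpret bounded_linear "T (i k)" using T i(1) by blast
    have "norm (T (i k) (X (Suc k))) \<le> norm (T (i k) x) + norm (T (i k) (x - X (Suc k)))"
      unfolding diff by (metis norm_triangle_sub norm_minus_commute)
    also have "norm (T (i k) (x - X (Suc k))) \<le> onorm (T (i k)) * (r k / 2)"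
      by (rule order_trans[OF onorm[OF bounded_linear_axioms]])
         (intro mult_left_mono close onorm_pos_le bounded_linear_axioms)
    finally have "2 / 3 * (r k * onorm (T (i k))) \<le> B + onorm (T (i k)) * (r k / 2)"
      using X(2)[of k] B[OF i(1), of k] by linarith
    then have "r k * onorm (T (i k)) / 6 \<le> B" by (simp add: field_simps)
    moreover have "r k * 4 ^ k \<le> r k * onorm (T (i k))" using i(2)[of k] r[of k] by (intro mult_left_mono) auto
    moreover have "r k * 4 ^ k = (4 / 3) ^ k" by (simp add: r_def flip: power_mult_distrib)
    ultimately show ?thesis by linarith
  qed
  obtain k where "6 * B < (4 / 3 :: real) ^ k" using real_arch_pow[of "4/3" "6 * B"] by auto
  with le[of k] show False by simp
qed

text \<open>Uniform boundedness for \<open>T i\<close> divided by \<open>a i\<close>, over the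
  indices of positive weight; where the weight is zero the pointwise bound already forces
  \<open>T i = 0\<close>. The weights will be a graph norm and a distance
  \<open>|s - t|\<close>.\<close>

lemma uniform_boundedness_weighted:
  fixes T :: "'i \<Rightarrow> 'a::banach \<Rightarrow> 'b::real_normed_vector"
  assumes T: "\<And>i. i \<in> I \<Longrightarrow> bounded_linear (T i)" and a: "\<And>i. i \<in> I \<Longrightarrow> 0 \<le> a i"
    and ptw: "\<And>x. \<exists>B. \<forall>i\<in>I. norm (T i x) \<le> B * a i"
  shows "\<exists>B\<ge>0. \<forall>i\<in>I. \<forall>x. norm (T i x) \<le> B * a i * norm x"
proof -
  have "\<exists>B\<ge>0. \<forall>i\<in>{i\<in>I. 0 < a i}. \<forall>x. norm (inverse (a i) *\<^sub>R T i x) \<le> B * norm x"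
  proof (rule uniform_boundedness)
    fix x
    obtain B where "\<forall>i\<in>I. norm (T i x) \<le> B * a i" using ptw by blast
    then show "\<exists>B. \<forall>i\<in>{i\<in>I. 0 < a i}. norm (inverse (a i) *\<^sub>R T i x) \<le> B"
      by (intro exI[of _ B]) (auto simp: field_simps)
  qed (auto intro: bounded_linear_compose[OF bounded_linear_scaleR_right] T)
  then obtain B where B: "0 \<le> B" "\<And>i x. i \<in> I \<Longrightarrow> 0 < a i \<Longrightarrow> norm (inverse (a i) *\<^sub>R T i x) \<le> B * norm x"
    by auto
  have "norm (T i x) \<le> B * a i * norm x" if i: "i \<in> I" for i x
  proof (cases "a i = 0")
    case True
    obtain B where "\<forall>i\<in>I. norm (T i x) \<le> B * a i" using ptw by blast
    then show ?thesis using i True by auto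
  next
    case False
    then have "0 < a i" using a[OF i] by simp
    then show ?thesis using B(2)[OF i, of x] by (simp add: field_simps)
  qed
  then show ?thesis using B(1) by blast
qed

subsection \<open>Holomorphic operator functions\<close>

lemma op_tendstoD:
  assumes "op_tendsto X T T0 F" "0 < \<epsilon>"
  shows "\<forall>\<^sub>F s in F. \<forall>x\<in>X. norm (T s x - T0 x) \<le> \<epsilon> * norm x"
  using assms by (auto simp: op_tendsto_def)

lemma op_tendsto_const: "op_tendsto X (\<lambda>s. T) T F"
  by (auto simp: op_tendsto_def)

lemma op_tendsto_cong:
  assumes "op_tendsto X T T0 F" "\<forall>\<^sub>F s in F. \<forall>x\<in>X. T' s x = T s x" "\<And>x. x \<in> X \<Longrightarrow> T0' x = T0 x"
  shows "op_tendsto X T' T0' F"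
  unfolding op_tendsto_def
proof (intro allI impI)
  fix \<epsilon> :: real assume "0 < \<epsilon>"
  with assms(1) have "\<forall>\<^sub>F s in F. \<forall>x\<in>X. norm (T s x - T0 x) \<le> \<epsilon> * norm x" by (rule op_tendstoD)
  with assms(2) show "\<forall>\<^sub>F s in F. \<forall>x\<in>X. norm (T' s x - T0' x) \<le> \<epsilon> * norm x"
    by eventually_elim (use assms(3) in simp)
qed

lemma op_tendsto_add:
  assumes "op_tendsto X S S0 F" "op_tendsto X T T0 F"
  shows "op_tendsto X (\<lambda>s x. S s x + T s x) (\<lambda>x. S0 x + T0 x) F"
  unfolding op_tendsto_def
proof (intro allI impI)
  fix \<epsilon> :: real assume "0 < \<epsilon>"
  then have "0 < \<epsilon> / 2" by simp
  from op_tendstoD[OF assms(1) this] op_tendstoD[OF assms(2) this]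
  show "\<forall>\<^sub>F s in F. \<forall>x\<in>X. norm (S s x + T s x - (S0 x + T0 x)) \<le> \<epsilon> * norm x"
  proof eventually_elim
    case (elim s)
    show ?case
    proof
      fix x assume "x \<in> X"
      then have "norm (S s x - S0 x) + norm (T s x - T0 x) \<le> \<epsilon> * norm x"
        using elim by (fastforce simp: field_simps)
      then show "norm (S s x + T s x - (S0 x + T0 x)) \<le> \<epsilon> * norm x"
        using norm_triangle_ineq[of "S s x - S0 x" "T s x - T0 x"] by (simp add: algebra_simps)
    qed
  qed
qed

lemma op_tendsto_compose:
  assumes G: "op_tendsto UNIV G G0 F" and T: "op_tendsto X T T0 F"
    and G0: "bounded_op UNIV UNIV G0" and T0: "bounded_op X UNIV T0"
  shows "op_tendsto X (\<lambda>s x. G s (T s x)) (\<lambda>x. G0 (T0 x)) F"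
  unfolding op_tendsto_def
proof (intro allI impI)
  fix \<epsilon> :: real assume e: "0 < \<epsilon>"
  obtain A where A: "0 < A" "\<And>x. x \<in> X \<Longrightarrow> norm (T0 x) \<le> A * norm x" using bounded_op_bound[OF T0] by metis
  obtain B where B: "0 < B" "\<And>x. norm (G0 x) \<le> B * norm x" using bounded_op_bound[OF G0] by (metis UNIV_I)
  have "0 < min 1 (\<epsilon> / (2 * B))" "0 < \<epsilon> / (2 * (A + 1))" using e A B by auto
  from op_tendstoD[OF T this(1)] op_tendstoD[OF G this(2)]
  show "\<forall>\<^sub>F s in F. \<forall>x\<in>X. norm (G s (T s x) - G0 (T0 x)) \<le> \<epsilon> * norm x"
  proof eventually_elim
    case (elim s)
    show ?case
    proof
      fix x assume x: "x \<in> X"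
      have 1: "norm (T s x - T0 x) \<le> min 1 (\<epsilon> / (2 * B)) * norm x" using elim x by blast
      have "norm (T s x) \<le> norm (T0 x) + norm (T s x - T0 x)" by (metis norm_triangle_sub)
      also have "\<dots> \<le> A * norm x + 1 * norm x"
        using 1 A(2)[OF x] mult_right_mono[of "min 1 (\<epsilon> / (2 * B))" 1 "norm x"] by simp
      finally have 2: "norm (T s x) \<le> (A + 1) * norm x" by (simp add: algebra_simps)
      have "norm (G s (T s x) - G0 (T s x)) \<le> \<epsilon> / (2 * (A + 1)) * norm (T s x)" using elim by blast
      also have "\<dots> \<le> \<epsilon> / (2 * (A + 1)) * ((A + 1) * norm x)" using e A 2 by (intro mult_left_mono) auto
      also have "\<dots> = \<epsilon> / 2 * norm x" using A by (simp add: field_simps)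
      finally have 3: "norm (G s (T s x) - G0 (T s x)) \<le> \<epsilon> / 2 * norm x" .
      have "norm (G0 (T s x) - G0 (T0 x)) \<le> B * norm (T s x - T0 x)"
        using B(2) by (simp flip: bounded_op_lin(3)[OF G0])
      also have "\<dots> \<le> B * (\<epsilon> / (2 * B) * norm x)"
        using 1 B(1) mult_right_mono[of "min 1 (\<epsilon> / (2 * B))" "\<epsilon> / (2 * B)" "norm x"] by (intro mult_left_mono) auto
      also have "\<dots> = \<epsilon> / 2 * norm x" using B by (simp add: field_simps)
      finally show "norm (G s (T s x) - G0 (T0 x)) \<le> \<epsilon> * norm x"
        using 3 norm_triangle_ineq[of "G s (T s x) - G0 (T s x)" "G0 (T s x) - G0 (T0 x)"] by simp
    qed
  qed
qed

lemma op_tendsto_compose_filterlim: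
  assumes "op_tendsto X T T0 F" "filterlim g F F'"
  shows "op_tendsto X (\<lambda>s. T (g s)) T0 F'"
  unfolding op_tendsto_def
  using eventually_compose_filterlim[OF op_tendstoD[OF assms(1)] assms(2)] by blast

text \<open>The adjoint of a difference is the difference of the adjoints and obeys the same norm
  bound. Nothing of the kind holds for strong limits, which is why operator limits are taken in
  norm.\<close>

lemma op_tendsto_hadj:
  fixes T :: "'p \<Rightarrow> 'a::chilbert_space \<Rightarrow> 'b::complex_inner"
  assumes T: "op_tendsto UNIV T T0 F" and T0: "bounded_op UNIV UNIV T0"
    and ev: "\<forall>\<^sub>F s in F. bounded_op UNIV UNIV (T s)"
  shows "op_tendsto UNIV (\<lambda>s. hadj UNIV (T s)) (hadj UNIV T0) F"
  unfolding op_tendsto_def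
proof (intro allI impI)
  fix \<epsilon> :: real assume e: "0 < \<epsilon>"
  from op_tendstoD[OF T e] ev
  show "\<forall>\<^sub>F s in F. \<forall>y\<in>UNIV. norm (hadj UNIV (T s) y - hadj UNIV T0 y) \<le> \<epsilon> * norm y"
  proof eventually_elim
    case (elim s)
    have D: "bounded_op UNIV UNIV (\<lambda>x. T s x - T0 x)" by (rule bounded_op_diff[OF elim(2) T0])
    have "hadj UNIV (\<lambda>x. T s x - T0 x) y = hadj UNIV (T s) y - hadj UNIV T0 y" for y
      by (rule hadj_eqI[OF closed_csubspace_UNIV])
         (simp_all add: cinner_simps hadj_UNIV_right[OF elim(2)] hadj_UNIV_right[OF T0])
    then show ?case
      using hadj_norm_le[OF closed_csubspace_UNIV D, of \<epsilon>] elim(1) e by (metis UNIV_I less_imp_le)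
  qed
qed

lemma op_holomorphicD:
  assumes "op_holomorphic S X Y T" "z \<in> S"
  obtains T' where "bounded_op X Y (T z)" "bounded_op X Y T'"
    "op_tendsto X (\<lambda>w x. (1 / (w - z)) *\<^sub>C (T w x - T z x)) T' (at z within S)"
  using assms unfolding op_holomorphic_def by blast

lemma op_holomorphic_bounded: "op_holomorphic S X Y T \<Longrightarrow> z \<in> S \<Longrightarrow> bounded_op X Y (T z)"
  by (simp add: op_holomorphic_def)

lemma eventually_at_in_set: "\<forall>\<^sub>F w in at z within S. w \<in> S \<and> w \<noteq> z"
  by (simp add: eventually_at_filter)

lemma op_holomorphic_continuous:
  assumes "op_holomorphic S X Y T" "z \<in> S" "Y = UNIV"
  shows "op_tendsto X T (T z) (at z within S)"
  unfolding op_tendsto_def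
proof (intro allI impI)
  fix \<epsilon> :: real assume e: "0 < \<epsilon>"
  obtain T' where T': "bounded_op X Y T'"
    "op_tendsto X (\<lambda>w x. (1 / (w - z)) *\<^sub>C (T w x - T z x)) T' (at z within S)"
    by (rule op_holomorphicD[OF assms(1,2)])
  obtain A where A: "0 < A" "\<And>x. x \<in> X \<Longrightarrow> norm (T' x) \<le> A * norm x" using bounded_op_bound[OF T'(1)] by metis
  have "\<forall>\<^sub>F w in at z within S. dist w z < \<epsilon> / (A + 1)"
    by (rule tendstoD[OF tendsto_ident_at]) (use e A in simp)
  with op_tendstoD[OF T'(2) zero_less_one] eventually_at_in_set[of S z]
  show "\<forall>\<^sub>F w in at z within S. \<forall>x\<in>X. norm (T w x - T z x) \<le> \<epsilon> * norm x"
  proof eventually_elim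
    case (elim w)
    show ?case
    proof
      fix x assume x: "x \<in> X"
      have "norm ((1 / (w - z)) *\<^sub>C (T w x - T z x)) \<le> norm (T' x) + norm ((1 / (w - z)) *\<^sub>C (T w x - T z x) - T' x)"
        by (metis norm_triangle_sub)
      also have "\<dots> \<le> A * norm x + 1 * norm x" using elim x A by (intro add_mono) auto
      finally have "norm (T w x - T z x) \<le> cmod (w - z) * ((A + 1) * norm x)"
        using elim by (simp add: norm_divide field_simps)
      also have "\<dots> \<le> (\<epsilon> / (A + 1)) * ((A + 1) * norm x)"
        using elim A by (intro mult_right_mono) (auto simp: dist_norm)
      finally show "norm (T w x - T z x) \<le> \<epsilon> * norm x" using A by simp
    qed
  qed
qed

lemma op_holomorphic_const: "bounded_op X UNIV T \<Longrightarrow> op_holomorphic S X UNIV (\<lambda>z. T)"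
  unfolding op_holomorphic_def
  by (auto intro!: exI[of _ "\<lambda>x. 0"] bounded_op_zero simp: op_tendsto_def)

lemma op_holomorphic_add:
  assumes "op_holomorphic S X UNIV F" "op_holomorphic S X UNIV G"
  shows "op_holomorphic S X UNIV (\<lambda>z x. F z x + G z x)"
  unfolding op_holomorphic_def
proof (intro ballI conjI)
  fix z assume z: "z \<in> S"
  obtain F' where F': "bounded_op X UNIV (F z)" "bounded_op X UNIV F'"
    "op_tendsto X (\<lambda>w x. (1 / (w - z)) *\<^sub>C (F w x - F z x)) F' (at z within S)"
    by (rule op_holomorphicD[OF assms(1) z])
  obtain G' where G': "bounded_op X UNIV (G z)" "bounded_op X UNIV G'"
    "op_tendsto X (\<lambda>w x. (1 / (w - z)) *\<^sub>C (G w x - G z x)) G' (at z within S)"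
    by (rule op_holomorphicD[OF assms(2) z])
  show "bounded_op X UNIV (\<lambda>x. F z x + G z x)" using F' G' by (intro bounded_op_add)
  have "op_tendsto X (\<lambda>w x. (1 / (w - z)) *\<^sub>C (F w x + G w x - (F z x + G z x))) (\<lambda>x. F' x + G' x) (at z within S)"
    by (rule op_tendsto_cong[OF op_tendsto_add[OF F'(3) G'(3)]])
       (auto simp: scaleC_diff_right scaleC_add_right)
  then show "\<exists>T'. bounded_op X UNIV T' \<and>
      op_tendsto X (\<lambda>w x. (1 / (w - z)) *\<^sub>C (F w x + G w x - (F z x + G z x))) T' (at z within S)"
    using bounded_op_add[OF F'(2) G'(2)] by blast
qed

lemma op_holomorphic_compose:
  assumes G: "op_holomorphic S UNIV UNIV G" and F: "op_holomorphic S X UNIV F"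
  shows "op_holomorphic S X UNIV (\<lambda>z x. G z (F z x))"
  unfolding op_holomorphic_def
proof (intro ballI conjI)
  fix z assume z: "z \<in> S"
  obtain F' where F': "bounded_op X UNIV (F z)" "bounded_op X UNIV F'"
    "op_tendsto X (\<lambda>w x. (1 / (w - z)) *\<^sub>C (F w x - F z x)) F' (at z within S)"
    by (rule op_holomorphicD[OF F z])
  obtain G' where G': "bounded_op UNIV UNIV (G z)" "bounded_op UNIV UNIV G'"
    "op_tendsto UNIV (\<lambda>w x. (1 / (w - z)) *\<^sub>C (G w x - G z x)) G' (at z within S)"
    by (rule op_holomorphicD[OF G z])
  show "bounded_op X UNIV (\<lambda>x. G z (F z x))" by (rule bounded_op_compose[OF G'(1) F'(1)])
  have Gc: "op_tendsto UNIV G (G z) (at z within S)" by (rule op_holomorphic_continuous[OF G z refl])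
  have *: "op_tendsto X (\<lambda>w x. G w ((1 / (w - z)) *\<^sub>C (F w x - F z x)) + (1 / (w - z)) *\<^sub>C (G w (F z x) - G z (F z x)))
     (\<lambda>x. G z (F' x) + G' (F z x)) (at z within S)"
    by (intro op_tendsto_add op_tendsto_compose[OF Gc F'(3) G'(1) F'(2)]
        op_tendsto_compose[OF G'(3) op_tendsto_const G'(2) F'(1)])
  have "op_tendsto X (\<lambda>w x. (1 / (w - z)) *\<^sub>C (G w (F w x) - G z (F z x))) (\<lambda>x. G z (F' x) + G' (F z x)) (at z within S)"
  proof (rule op_tendsto_cong[OF * eventually_mono[OF eventually_at_in_set]])
    fix w assume w: "w \<in> S \<and> w \<noteq> z"
    have Gw: "bounded_op UNIV UNIV (G w)" using G w by (simp add: op_holomorphic_def)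
    show "\<forall>x\<in>X. (1 / (w - z)) *\<^sub>C (G w (F w x) - G z (F z x)) =
      G w ((1 / (w - z)) *\<^sub>C (F w x - F z x)) + (1 / (w - z)) *\<^sub>C (G w (F z x) - G z (F z x))"
      by (simp add: bounded_op_lin[OF Gw] flip: scaleC_add_right)
  qed simp
  then show "\<exists>T'. bounded_op X UNIV T' \<and>
      op_tendsto X (\<lambda>w x. (1 / (w - z)) *\<^sub>C (G w (F w x) - G z (F z x))) T' (at z within S)"
    using bounded_op_add[OF bounded_op_compose[OF G'(1) F'(2)] bounded_op_compose[OF G'(2) F'(1)]] by blast
qed

lemma op_holomorphic_scaleC:
  "op_holomorphic S X UNIV F \<Longrightarrow> op_holomorphic S X UNIV (\<lambda>z x. c *\<^sub>C F z x)"
  by (rule op_holomorphic_compose[OF op_holomorphic_const[OF bounded_op_scaleC_const]])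

lemma op_holomorphic_minus:
  "op_holomorphic S X UNIV F \<Longrightarrow> op_holomorphic S X UNIV (\<lambda>z x. - F z x)"
  using op_holomorphic_scaleC[of S X F "-1"] by (simp add: scaleC_minus_one)

lemma op_holomorphic_diff:
  "op_holomorphic S X UNIV F \<Longrightarrow> op_holomorphic S X UNIV G \<Longrightarrow> op_holomorphic S X UNIV (\<lambda>z x. F z x - G z x)"
  using op_holomorphic_add[of S X F "\<lambda>z x. - G z x"] op_holomorphic_minus[of S X G] by simp

text \<open>Extends operators on a closed subspace to the whole type, where the rules for
  composition and inversion are stated.\<close>

lemma op_holomorphic_oproj:
  fixes X :: "'a::chilbert_space set"
  assumes X: "closed_csubspace X" and T: "op_holomorphic S X UNIV T"
  shows "op_holomorphic S UNIV UNIV (\<lambda>z x. T z (oproj X x))"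
  unfolding op_holomorphic_def
proof (intro ballI conjI)
  fix z assume z: "z \<in> S"
  obtain T' where T': "bounded_op X UNIV (T z)" "bounded_op X UNIV T'"
    "op_tendsto X (\<lambda>w x. (1 / (w - z)) *\<^sub>C (T w x - T z x)) T' (at z within S)"
    by (rule op_holomorphicD[OF T z])
  note P = bounded_op_oproj[OF X]
  show "bounded_op UNIV UNIV (\<lambda>x. T z (oproj X x))" by (rule bounded_op_compose[OF T'(1) P])
  have "op_tendsto UNIV (\<lambda>w x. (1 / (w - z)) *\<^sub>C (T w (oproj X x) - T z (oproj X x))) (\<lambda>x. T' (oproj X x)) (at z within S)"
    unfolding op_tendsto_def
  proof (intro allI impI)
    fix \<epsilon> :: real assume e: "0 < \<epsilon>"
    from op_tendstoD[OF T'(3) e]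
    show "\<forall>\<^sub>F w in at z within S. \<forall>x\<in>UNIV. norm ((1 / (w - z)) *\<^sub>C (T w (oproj X x) - T z (oproj X x)) - T' (oproj X x)) \<le> \<epsilon> * norm x"
    proof eventually_elim
      case (elim w)
      then show ?case
        using oproj_mem[OF X] mult_left_mono[OF norm_oproj_le[OF X], of \<epsilon>] e by (meson less_imp_le order_trans)
    qed
  qed
  then show "\<exists>T'. bounded_op UNIV UNIV T' \<and>
     op_tendsto UNIV (\<lambda>w x. (1 / (w - z)) *\<^sub>C (T w (oproj X x) - T z (oproj X x))) T' (at z within S)"
    using bounded_op_compose[OF T'(2) P] by blast
qed

text \<open>The identity \<open>R w - R z = - R w (Z w - Z z) R z\<close> gives the derivative once
  \<open>R\<close> is known to be continuous at \<open>z\<close>, and continuity comes from a lower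
  bound for \<open>Z w\<close> that is uniform near \<open>z\<close>.\<close>

lemma op_holomorphic_inverse:
  fixes Z :: "complex \<Rightarrow> 'a::complex_inner \<Rightarrow> 'b::complex_inner"
  assumes Z: "op_holomorphic S UNIV UNIV Z"
    and R: "\<And>w. w \<in> S \<Longrightarrow> bounded_op UNIV UNIV (R w)" "\<And>w x. w \<in> S \<Longrightarrow> R w (Z w x) = x"
      "\<And>w y. w \<in> S \<Longrightarrow> Z w (R w y) = y"
  shows "op_holomorphic S UNIV UNIV R"
  unfolding op_holomorphic_def
proof (intro ballI conjI)
  fix z assume z: "z \<in> S"
  note lz = bounded_op_lin[OF R(1)[OF z]]
  obtain Z' where Z': "bounded_op UNIV UNIV (Z z)" "bounded_op UNIV UNIV Z'"
    "op_tendsto UNIV (\<lambda>w x. (1 / (w - z)) *\<^sub>C (Z w x - Z z x)) Z' (at z within S)"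
    by (rule op_holomorphicD[OF Z z])
  show "bounded_op UNIV UNIV (R z)" by (rule R[OF z])
  obtain C where C: "0 < C" "\<And>y. norm (R z y) \<le> C * norm y" using bounded_op_bound[OF R(1)[OF z]] by (metis UNIV_I)
  have Zc: "op_tendsto UNIV Z (Z z) (at z within S)" by (rule op_holomorphic_continuous[OF Z z refl])
  have Rc: "op_tendsto UNIV R (R z) (at z within S)"
    unfolding op_tendsto_def
  proof (intro allI impI)
    fix \<epsilon> :: real assume e: "0 < \<epsilon>"
    define e' where "e' = min (1 / (2 * C)) (\<epsilon> / (2 * C * C))"
    have e': "0 < e'" "e' \<le> 1 / (2 * C)" "e' \<le> \<epsilon> / (2 * C * C)" using e C by (auto simp: e'_def)
    from op_tendstoD[OF Zc e'(1)] eventually_at_in_set[of S z]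
    show "\<forall>\<^sub>F w in at z within S. \<forall>y\<in>UNIV. norm (R w y - R z y) \<le> \<epsilon> * norm y"
    proof eventually_elim
      case (elim w)
      then have w: "w \<in> S" by simp
      \<comment> \<open>The deviation of \<open>Z w\<close> from \<open>Z z\<close> costs at most
        half of \<open>norm g\<close> and is absorbed on the left, hence the factor 2.\<close>
      have bd: "norm g \<le> 2 * C * norm (Z w g)" for g
      proof -
        have "norm g \<le> C * norm (Z z g)" using C(2)[of "Z z g"] by (simp add: R(2)[OF z])
        also have "\<dots> \<le> C * (norm (Z w g) + norm (Z w g - Z z g))"
          using C(1) norm_triangle_sub[of "Z z g" "Z w g"] by (intro mult_left_mono) (auto simp: norm_minus_commute)
        also have "\<dots> \<le> C * (norm (Z w g) + 1 / (2 * C) * norm g)"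
          using C(1) elim mult_right_mono[OF e'(2) norm_ge_zero[of g]] by (intro mult_left_mono add_left_mono) (auto intro: order_trans)
        finally show ?thesis using C(1) by (simp add: field_simps)
      qed
      show ?case
      proof
        fix y
        have "norm (R w y - R z y) \<le> 2 * C * norm (Z w (R w y - R z y))" by (rule bd)
        also have "Z w (R w y - R z y) = - (Z w (R z y) - Z z (R z y))"
          using Z w by (simp add: op_holomorphic_def bounded_op_lin R(3)[OF w] R(3)[OF z])
        also have "norm \<dots> \<le> e' * norm (R z y)" using elim by (simp del: minus_diff_eq)
        also have "\<dots> \<le> (\<epsilon> / (2 * C * C)) * (C * norm y)" using e' C e by (intro mult_mono) auto
        finally show "norm (R w y - R z y) \<le> \<epsilon> * norm y" using C(1) by (simp add: field_simps mult_left_mono)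
      qed
    qed
  qed
  have *: "op_tendsto UNIV (\<lambda>w y. R w (((1 / (w - z)) *\<^sub>C (Z w (R z y) - Z z (R z y))))) (\<lambda>y. R z (Z' (R z y))) (at z within S)"
    by (intro op_tendsto_compose[OF Rc] op_tendsto_compose[OF Z'(3) op_tendsto_const]
        R(1)[OF z] Z'(2) bounded_op_compose[OF Z'(2) R(1)[OF z]])
  have "op_tendsto UNIV (\<lambda>w y. (- 1) *\<^sub>C R w (((1 / (w - z)) *\<^sub>C (Z w (R z y) - Z z (R z y))))) (\<lambda>y. (- 1) *\<^sub>C R z (Z' (R z y))) (at z within S)"
    by (intro op_tendsto_compose[OF op_tendsto_const * bounded_op_scaleC_const]
        bounded_op_compose[OF R(1)[OF z] bounded_op_compose[OF Z'(2) R(1)[OF z]]])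
  then have "op_tendsto UNIV (\<lambda>w y. (1 / (w - z)) *\<^sub>C (R w y - R z y)) (\<lambda>y. (- 1) *\<^sub>C R z (Z' (R z y))) (at z within S)"
  proof (rule op_tendsto_cong[OF _ eventually_mono[OF eventually_at_in_set]])
    fix w assume w: "w \<in> S \<and> w \<noteq> z"
    then have Rw: "bounded_op UNIV UNIV (R w)" "\<And>x. R w (Z w x) = x" using R by auto
    show "\<forall>y\<in>UNIV. (1 / (w - z)) *\<^sub>C (R w y - R z y) = (- 1) *\<^sub>C R w (((1 / (w - z)) *\<^sub>C (Z w (R z y) - Z z (R z y))))"
      by (simp only: bounded_op_lin[OF Rw(1)] Rw(2) R(3)[OF z])
         (simp add: scaleC_minus_one flip: scaleC_minus_right)
  qed simp
  then show "\<exists>T'. bounded_op UNIV UNIV T' \<and>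
     op_tendsto UNIV (\<lambda>w y. (1 / (w - z)) *\<^sub>C (R w y - R z y)) T' (at z within S)"
    using bounded_op_scaleC[OF bounded_op_compose[OF R(1)[OF z] bounded_op_compose[OF Z'(2) R(1)[OF z]]], of "-1"]
    by blast
qed

text \<open>Taking adjoints is antilinear, and conjugating the argument undoes the conjugation of
  the factor \<open>1 / (w - z)\<close>: the quotient at \<open>w\<close> is the adjoint of the
  quotient at \<open>cnj w\<close>.\<close>

lemma op_holomorphic_hadj_cnj:
  fixes T :: "complex \<Rightarrow> 'a::chilbert_space \<Rightarrow> 'b::chilbert_space"
  assumes T: "op_holomorphic S UNIV UNIV T"
  shows "op_holomorphic (cnj ` S) UNIV UNIV (\<lambda>z. hadj UNIV (T (cnj z)))"
  unfolding op_holomorphic_def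
proof (intro ballI conjI)
  fix z assume "z \<in> cnj ` S"
  then have z: "cnj z \<in> S" by auto
  obtain T' where T': "bounded_op UNIV UNIV (T (cnj z))" "bounded_op UNIV UNIV T'"
    "op_tendsto UNIV (\<lambda>w x. (1 / (w - cnj z)) *\<^sub>C (T w x - T (cnj z) x)) T' (at (cnj z) within S)"
    by (rule op_holomorphicD[OF T z])
  show "bounded_op UNIV UNIV (hadj UNIV (T (cnj z)))" by (rule bounded_op_hadj[OF closed_csubspace_UNIV T'(1)])
  have lim: "filterlim cnj (at (cnj z) within S) (at z within cnj ` S)"
    unfolding filterlim_at
    by (auto intro!: tendsto_intros eventually_mono[OF eventually_at_in_set])
  let ?Q = "\<lambda>w x. (1 / (w - cnj z)) *\<^sub>C (T w x - T (cnj z) x)"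
  have ev: "\<forall>\<^sub>F w in at z within cnj ` S. bounded_op UNIV UNIV (?Q (cnj w))"
    by (rule eventually_mono[OF eventually_at_in_set])
       (use T T'(1) in \<open>auto simp: op_holomorphic_def intro!: bounded_op_scaleC bounded_op_diff\<close>)
  have "op_tendsto UNIV (\<lambda>w. hadj UNIV (?Q (cnj w))) (hadj UNIV T') (at z within cnj ` S)"
    by (rule op_tendsto_hadj[OF op_tendsto_compose_filterlim[OF T'(3) lim] T'(2) ev])
  then have "op_tendsto UNIV (\<lambda>w x. (1 / (w - z)) *\<^sub>C (hadj UNIV (T (cnj w)) x - hadj UNIV (T (cnj z)) x))
     (hadj UNIV T') (at z within cnj ` S)"
  proof (rule op_tendsto_cong[OF _ eventually_mono[OF eventually_at_in_set]])
    fix w assume w: "w \<in> cnj ` S \<and> w \<noteq> z"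
    then have Tw: "bounded_op UNIV UNIV (T (cnj w))" using T by (auto simp: op_holomorphic_def)
    have "hadj UNIV (?Q (cnj w)) x = (1 / (w - z)) *\<^sub>C (hadj UNIV (T (cnj w)) x - hadj UNIV (T (cnj z)) x)" for x
      by (rule hadj_eqI[OF closed_csubspace_UNIV])
         (simp_all add: cinner_simps hadj_UNIV_right[OF Tw] hadj_UNIV_right[OF T'(1)])
    then show "\<forall>x\<in>UNIV. (1 / (w - z)) *\<^sub>C (hadj UNIV (T (cnj w)) x - hadj UNIV (T (cnj z)) x) = hadj UNIV (?Q (cnj w)) x"
      by simp
  qed simp
  then show "\<exists>T'. bounded_op UNIV UNIV T' \<and>
     op_tendsto UNIV (\<lambda>w x. (1 / (w - z)) *\<^sub>C (hadj UNIV (T (cnj w)) x - hadj UNIV (T (cnj z)) x)) T' (at z within cnj ` S)"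
    using bounded_op_hadj[OF closed_csubspace_UNIV T'(2)] by blast
qed

text \<open>Differentiability depends only on a neighbourhood. This permits gluing the two
  half-planes and replacing a function by an explicit formula.\<close>

lemma op_holomorphic_local:
  assumes F: "op_holomorphic U X Y F" and U: "open U" "U \<subseteq> S"
    and eq: "\<And>w x. w \<in> U \<Longrightarrow> G w = F w" and z: "z \<in> U"
  shows "bounded_op X Y (G z) \<and> (\<exists>T'. bounded_op X Y T' \<and>
    op_tendsto X (\<lambda>w x. (1 / (w - z)) *\<^sub>C (G w x - G z x)) T' (at z within S))"
proof -
  have "at z within S = at z within U" using U z by (intro at_within_nhd[of z U S U]) auto
  moreover have "\<forall>\<^sub>F w in at z within U. \<forall>x\<in>X. (1 / (w - z)) *\<^sub>C (G w x - G z x) = (1 / (w - z)) *\<^sub>C (F w x - F z x)"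
    by (rule eventually_mono[OF eventually_at_in_set]) (use eq z in auto)
  moreover obtain T' where T': "bounded_op X Y (F z)" "bounded_op X Y T'"
    "op_tendsto X (\<lambda>w x. (1 / (w - z)) *\<^sub>C (F w x - F z x)) T' (at z within U)"
    by (rule op_holomorphicD[OF F z])
  ultimately have "op_tendsto X (\<lambda>w x. (1 / (w - z)) *\<^sub>C (G w x - G z x)) T' (at z within S)"
    using op_tendsto_cong[OF T'(3)] by simp
  moreover have "G z = F z" using eq[OF z] by blast
  ultimately show ?thesis using T'(1,2) by (intro conjI exI[of _ T']) simp_all
qed

text \<open>A criterion for differentiability without a formula for the derivative. The limit is
  found pointwise along one sequence of arguments, and the Lipschitz bound, being proportional to
  \<open>norm x\<close>, turns this into convergence in operator norm.\<close>

lemma op_tendsto_of_Lipschitz: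
  fixes Q :: "complex \<Rightarrow> 'a::complex_inner \<Rightarrow> 'b::chilbert_space"
  assumes r: "0 < r" and Q: "\<And>w. w \<in> ball z r - {z} \<Longrightarrow> bounded_op UNIV UNIV (Q w)"
    and L: "\<And>w k x. w \<in> ball z r - {z} \<Longrightarrow> k \<in> ball z r - {z} \<Longrightarrow> norm (Q w x - Q k x) \<le> C * dist w k * norm x"
  shows "\<exists>T'. bounded_op UNIV UNIV T' \<and> op_tendsto UNIV Q T' (at z within S)"
proof -
  \<comment> \<open>The denominators start at 2, so that the first point already lies inside the
    open ball of radius \<open>r\<close>.\<close>
  define a :: "nat \<Rightarrow> complex" where "a = (\<lambda>j. z + of_real (r * inverse (real (Suc (Suc j)))))"
  have a_lim: "a \<longlonglongrightarrow> z"
  proof -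
    have "(\<lambda>j. z + of_real (r * inverse (real (Suc (Suc j))))) \<longlonglongrightarrow> z + of_real (r * 0)"
      by (intro tendsto_intros LIMSEQ_Suc[OF LIMSEQ_inverse_real_of_nat])
    then show ?thesis by (simp add: a_def)
  qed
  have a: "a j \<in> ball z r - {z}" for j
  proof -
    have "dist z (a j) = r * inverse (real (Suc (Suc j)))"
      using r by (simp add: a_def dist_norm abs_of_pos del: of_real_mult of_nat_Suc)
    moreover have "inverse (real (Suc (Suc j))) < 1" by (simp add: field_simps)
    ultimately show ?thesis using r by auto
  qed
  have C0: "0 \<le> max C 0" by simp
  have L': "norm (Q w x - Q k x) \<le> max C 0 * dist w k * norm x"
    if "w \<in> ball z r - {z}" "k \<in> ball z r - {z}" for w k x
    using L[OF that, of x] mult_right_mono[of C "max C 0" "dist w k * norm x"] by (simp add: mult.assoc)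
  have "Cauchy (\<lambda>j. Q (a j) x)" for x
  proof (rule metric_CauchyI)
    fix e :: real assume e: "0 < e"
    have pos: "0 < e / (max C 0 * norm x + 1)" using e C0 by (simp add: add_nonneg_pos)
    obtain N where N: "\<And>i j. i \<ge> N \<Longrightarrow> j \<ge> N \<Longrightarrow> dist (a i) (a j) < e / (max C 0 * norm x + 1)"
      using metric_CauchyD[OF LIMSEQ_imp_Cauchy[OF a_lim] pos] by blast
    have "dist (Q (a i) x) (Q (a j) x) < e" if "i \<ge> N" "j \<ge> N" for i j
    proof -
      have "dist (Q (a i) x) (Q (a j) x) \<le> dist (a i) (a j) * (max C 0 * norm x)"
        using L'[OF a[of i] a[of j], of x] by (simp add: dist_norm ac_simps)
      also have "\<dots> \<le> e / (max C 0 * norm x + 1) * (max C 0 * norm x)"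
        using N[OF that] by (intro mult_right_mono) auto
      also have "\<dots> < e"
      proof -
        have "0 \<le> max C 0 * norm x" using C0 by (rule mult_nonneg_nonneg) simp
        then have "0 < max C 0 * norm x + 1" by linarith
        then have "e / (max C 0 * norm x + 1) * (max C 0 * norm x) * (max C 0 * norm x + 1) < e * (max C 0 * norm x + 1)"
          using e by simp
        then show ?thesis using \<open>0 < max C 0 * norm x + 1\<close> by (simp only: mult_less_cancel_right_pos)
      qed
      finally show ?thesis .
    qed
    then show "\<exists>M. \<forall>m\<ge>M. \<forall>n\<ge>M. dist (Q (a m) x) (Q (a n) x) < e" by blast
  qed
  then have "\<forall>x. \<exists>y. (\<lambda>j. Q (a j) x) \<longlonglongrightarrow> y" by (auto simp: Cauchy_convergent_iff convergent_def)
  then obtain T' where T': "\<And>x. (\<lambda>j. Q (a j) x) \<longlonglongrightarrow> T' x" by metis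
  have close: "norm (Q w x - T' x) \<le> max C 0 * dist w z * norm x" if w: "w \<in> ball z r - {z}" for w x
    by (rule tendsto_le[OF trivial_limit_sequentially _ tendsto_norm[OF tendsto_diff[OF tendsto_const T']],
          of "\<lambda>j. max C 0 * dist w (a j) * norm x"])
       (auto intro!: tendsto_intros a_lim always_eventually L' w a)
  have "bounded_op UNIV UNIV T'"
  proof -
    obtain B where B: "\<And>x. norm (Q (a 0) x) \<le> B * norm x" using bounded_op_bound[OF Q[OF a]] by (metis UNIV_I)
    show ?thesis
    proof (rule bounded_opI[where B = "B + max C 0 * dist (a 0) z"])
      show "T' (x + y) = T' x + T' y" for x y
        using LIMSEQ_unique[OF T'[of "x + y"]] tendsto_add[OF T'[of x] T'[of y]] Q[OF a] by (simp add: bounded_op_lin)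
      show "T' (c *\<^sub>C x) = c *\<^sub>C T' x" for c x
        using LIMSEQ_unique[OF T'[of "c *\<^sub>C x"]] bounded_linear.tendsto[OF bounded_linear_scaleC T'[of x], of c] Q[OF a]
        by (simp add: bounded_op_lin)
      show "norm (T' x) \<le> (B + max C 0 * dist (a 0) z) * norm x" for x
        using B[of x] close[OF a[of 0], of x] norm_triangle_sub[of "T' x" "Q (a 0) x"]
        by (simp add: norm_minus_commute algebra_simps)
    qed simp
  qed
  moreover have "op_tendsto UNIV Q T' (at z within S)"
    unfolding op_tendsto_def
  proof (intro allI impI)
    fix \<epsilon> :: real assume e: "0 < \<epsilon>"
    have "\<forall>\<^sub>F w in at z within S. dist w z < min r (\<epsilon> / (max C 0 + 1))"
      by (rule tendstoD[OF tendsto_ident_at]) (use e r C0 in \<open>simp add: add_nonneg_pos\<close>)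
    with eventually_at_in_set[of S z] show "\<forall>\<^sub>F w in at z within S. \<forall>x\<in>UNIV. norm (Q w x - T' x) \<le> \<epsilon> * norm x"
    proof eventually_elim
      case (elim w)
      show ?case
      proof
        fix x
        have "norm (Q w x - T' x) \<le> max C 0 * dist w z * norm x" using elim by (intro close) (auto simp: dist_commute)
        also have "\<dots> \<le> \<epsilon> * norm x"
        proof (rule mult_right_mono)
          have "max C 0 * dist w z \<le> max C 0 * (\<epsilon> / (max C 0 + 1))" using elim by (intro mult_left_mono) auto
          also have "\<dots> \<le> \<epsilon>" using e C0 by (simp add: field_simps add_nonneg_pos)
          finally show "max C 0 * dist w z \<le> \<epsilon>" .
        qed simp
        finally show "norm (Q w x - T' x) \<le> \<epsilon> * norm x" .
      qed
    qed
  qed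
  ultimately show ?thesis by blast
qed

subsection \<open>Derivatives relative to an interval\<close>

text \<open>Without isolated points the derivative within the set is unique, so \<open>Dt\<close>
  can be computed from \<open>has_vector_derivative\<close>.\<close>

locale nontrivial_interval =
  fixes \<Delta> :: "real set"
  assumes no_isolated: "\<And>t. t \<in> \<Delta> \<Longrightarrow> at t within \<Delta> \<noteq> bot"
begin

lemma Dt_has_derivative:
  "f differentiable (at t within \<Delta>) \<Longrightarrow> (f has_vector_derivative Dt \<Delta> f t) (at t within \<Delta>)"
  by (simp add: Dt_def vector_derivative_works)

lemma Dt_eqI:
  assumes "(f has_vector_derivative d) (at t within \<Delta>)" "t \<in> \<Delta>"
  shows "Dt \<Delta> f t = d"
  using vector_derivative_within[OF no_isolated assms(1)] assms(2) by (simp add: Dt_def)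

lemma differentiableI_vd: "(f has_vector_derivative d) F \<Longrightarrow> f differentiable F"
  by (rule differentiableI_vector)

lemma differentiable_cong:
  assumes "\<And>s. s \<in> \<Delta> \<Longrightarrow> f s = g s" "t \<in> \<Delta>"
  shows "f differentiable (at t within \<Delta>) \<longleftrightarrow> g differentiable (at t within \<Delta>)"
  unfolding differentiable_def
  using has_derivative_transform[of t \<Delta> f g] has_derivative_transform[of t \<Delta> g f] assms by force

lemma has_vector_derivative_cong:
  assumes "\<And>s. s \<in> \<Delta> \<Longrightarrow> f s = g s" "t \<in> \<Delta>" "(f has_vector_derivative d) (at t within \<Delta>)"
  shows "(g has_vector_derivative d) (at t within \<Delta>)"
  using has_vector_derivative_transform[of t \<Delta> g f d] assms by auto

text \<open>This includes points without a derivative: the predicates from which the value is chosen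
  are the same.\<close>

lemma Dt_cong:
  assumes "\<And>s. s \<in> \<Delta> \<Longrightarrow> f s = g s" "t \<in> \<Delta>"
  shows "Dt \<Delta> f t = Dt \<Delta> g t"
proof -
  have "(\<lambda>d. (f has_vector_derivative d) (at t within \<Delta>)) = (\<lambda>d. (g has_vector_derivative d) (at t within \<Delta>))"
    using has_vector_derivative_cong[of f g t] has_vector_derivative_cong[of g f t] assms by (intro ext iffI) simp_all
  then show ?thesis by (simp add: Dt_def vector_derivative_def)
qed

lemma Dpow_cong:
  assumes "\<And>s. s \<in> \<Delta> \<Longrightarrow> f s = g s" "t \<in> \<Delta>"
  shows "Dpow \<Delta> k f t = Dpow \<Delta> k g t"
  using assms(2) by (induction k arbitrary: t) (auto intro: Dt_cong assms(1))

lemma Dpow_Suc_shift: "Dpow \<Delta> (Suc k) f = Dpow \<Delta> k (Dt \<Delta> f)"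
  by (simp add: funpow_swap1)

lemma Dpow_Dpow: "Dpow \<Delta> k (Dpow \<Delta> j f) = Dpow \<Delta> (k + j) f"
  by (simp add: funpow_add)

text \<open>
  \<open>reg P m f\<close>: the function has \<open>m\<close> derivatives everywhere on \<open>\<Delta>\<close>, and the \<open>m\<close>-th one satisfies \<open>P\<close>.
  With \<open>P\<close> being differentiability at almost every point this is the regularity of elements of the
  domain of the maximal operator; with \<open>P\<close> being continuity it is \<open>C\<^sup>m\<close>.
\<close>

primrec reg :: "((real \<Rightarrow> 'h::complex_inner) \<Rightarrow> bool) \<Rightarrow> nat \<Rightarrow> (real \<Rightarrow> 'h) \<Rightarrow> bool" where
  "reg P 0 f = P f"
| "reg P (Suc m) f = ((\<forall>t\<in>\<Delta>. f differentiable (at t within \<Delta>)) \<and> reg P m (Dt \<Delta> f))"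

text \<open>\<open>T\<close> will be the set, of full measure for elements of the maximal domain, on
  which the last quasi-derivative is differentiable.\<close>

definition diff_at :: "real set \<Rightarrow> (real \<Rightarrow> 'h::complex_inner) \<Rightarrow> bool" where
  "diff_at T f \<longleftrightarrow> (\<forall>t\<in>T. f differentiable (at t within \<Delta>))"

text \<open>\<open>s\<close> counts the derivatives of an operator coefficient that \<open>P\<close> consumes.\<close>

definition base_class :: "((real \<Rightarrow> 'h::complex_inner) \<Rightarrow> bool) \<Rightarrow> nat \<Rightarrow> bool" where
  "base_class P s \<longleftrightarrow>
     (\<forall>f g. (\<forall>t\<in>\<Delta>. f t = g t) \<longrightarrow> P f \<longrightarrow> P g) \<and>
     (\<forall>f g. P f \<longrightarrow> P g \<longrightarrow> P (\<lambda>t. f t + g t)) \<and>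
     (\<forall>F f. op_Ck s \<Delta> F \<longrightarrow> P f \<longrightarrow> P (\<lambda>t. F t (f t))) \<and>
     (\<forall>f. (\<forall>t\<in>\<Delta>. f differentiable (at t within \<Delta>)) \<longrightarrow> P f)"

lemma op_CkE:
  assumes "op_Ck m \<Delta> F"
  obtains G where "\<And>t. t \<in> \<Delta> \<Longrightarrow> G 0 t = F t"
    "\<And>j t. j \<le> m \<Longrightarrow> t \<in> \<Delta> \<Longrightarrow> bounded_op UNIV UNIV (G j t)"
    "\<And>j t. j \<le> m \<Longrightarrow> t \<in> \<Delta> \<Longrightarrow> op_tendsto UNIV (G j) (G j t) (at t within \<Delta>)"
    "\<And>j t. j < m \<Longrightarrow> t \<in> \<Delta> \<Longrightarrow> op_tendsto UNIV (\<lambda>s x. (1 / (s - t)) *\<^sub>R (G j s x - G j t x)) (G (Suc j) t)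
                      (at t within \<Delta>)"
proof -
  obtain G where G: "\<forall>t\<in>\<Delta>. G 0 t = F t"
    "\<forall>j\<le>m. \<forall>t\<in>\<Delta>. bounded_op UNIV UNIV (G j t) \<and> op_tendsto UNIV (G j) (G j t) (at t within \<Delta>)"
    "\<forall>j<m. \<forall>t\<in>\<Delta>. op_tendsto UNIV (\<lambda>s x. (1 / (s - t)) *\<^sub>R (G j s x - G j t x)) (G (Suc j) t) (at t within \<Delta>)"
    using assms unfolding op_Ck_def by (elim exE conjE)
  show thesis by (rule that[of G]) (use G in simp_all)
qed

lemma op_Ck_bounded:
  assumes "op_Ck m \<Delta> F" "t \<in> \<Delta>"
  shows "bounded_op UNIV UNIV (F t)"
  by (rule op_CkE[OF assms(1)]) (use assms(2) in force)

lemma op_Ck_continuous: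
  assumes F: "op_Ck m \<Delta> F" and t: "t \<in> \<Delta>"
  shows "op_tendsto UNIV F (F t) (at t within \<Delta>)"
proof (rule op_CkE[OF F])
  fix G
  assume G: "\<And>t. t \<in> \<Delta> \<Longrightarrow> G 0 t = F t"
    "\<And>j t. j \<le> m \<Longrightarrow> t \<in> \<Delta> \<Longrightarrow> op_tendsto UNIV (G j) (G j t) (at t within \<Delta>)"
  show ?thesis
    by (rule op_tendsto_cong[OF G(2)[OF le0 t] eventually_mono[OF eventually_at_in_set]]) (auto simp: G(1) t)
qed

lemma op_Ck_mono:
  assumes "op_Ck m \<Delta> F" "k \<le> m"
  shows "op_Ck k \<Delta> F"
proof (rule op_CkE[OF assms(1)])
  fix G
  assume G: "\<And>t. t \<in> \<Delta> \<Longrightarrow> G 0 t = F t"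
    "\<And>j t. j \<le> m \<Longrightarrow> t \<in> \<Delta> \<Longrightarrow> bounded_op UNIV UNIV (G j t)"
    "\<And>j t. j \<le> m \<Longrightarrow> t \<in> \<Delta> \<Longrightarrow> op_tendsto UNIV (G j) (G j t) (at t within \<Delta>)"
    "\<And>j t. j < m \<Longrightarrow> t \<in> \<Delta> \<Longrightarrow> op_tendsto UNIV (\<lambda>s x. (1 / (s - t)) *\<^sub>R (G j s x - G j t x)) (G (Suc j) t)
                      (at t within \<Delta>)"
  show ?thesis
    unfolding op_Ck_def by (rule exI[of _ G]) (use G assms(2) in simp)
qed

lemma op_Ck_Suc:
  assumes F: "op_Ck (Suc m) \<Delta> F"
  obtains F' where "op_Ck m \<Delta> F'"
    "\<And>t. t \<in> \<Delta> \<Longrightarrow> op_tendsto UNIV (\<lambda>s x. (1 / (s - t)) *\<^sub>R (F s x - F t x)) (F' t) (at t within \<Delta>)"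
proof (rule op_CkE[OF F])
  fix G
  assume G: "\<And>t. t \<in> \<Delta> \<Longrightarrow> G 0 t = F t"
    "\<And>j t. j \<le> Suc m \<Longrightarrow> t \<in> \<Delta> \<Longrightarrow> bounded_op UNIV UNIV (G j t)"
    "\<And>j t. j \<le> Suc m \<Longrightarrow> t \<in> \<Delta> \<Longrightarrow> op_tendsto UNIV (G j) (G j t) (at t within \<Delta>)"
    "\<And>j t. j < Suc m \<Longrightarrow> t \<in> \<Delta> \<Longrightarrow> op_tendsto UNIV (\<lambda>s x. (1 / (s - t)) *\<^sub>R (G j s x - G j t x)) (G (Suc j) t)
                      (at t within \<Delta>)"
  show thesis
  proof (rule that[of "G 1"])
    show "op_Ck m \<Delta> (G 1)"
      unfolding op_Ck_def by (rule exI[of _ "\<lambda>j. G (Suc j)"]) (use G in simp)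
    fix t assume t: "t \<in> \<Delta>"
    have "op_tendsto UNIV (\<lambda>s x. (1 / (s - t)) *\<^sub>R (G 0 s x - G 0 t x)) (G 1 t) (at t within \<Delta>)"
      using G(4)[of 0 t] t by simp
    then show "op_tendsto UNIV (\<lambda>s x. (1 / (s - t)) *\<^sub>R (F s x - F t x)) (G 1 t) (at t within \<Delta>)"
      by (rule op_tendsto_cong[OF _ eventually_mono[OF eventually_at_in_set]]) (auto simp: G(1) t)
  qed
qed

end

text \<open>Puts derivatives in the form of difference quotients, in which \<open>op_Ck\<close> is
  stated.\<close>

lemma has_vector_derivative_iff_quotient:
  "(f has_vector_derivative d) (at t within S) \<longleftrightarrow>
     ((\<lambda>s. (1 / (s - t)) *\<^sub>R (f s - f t)) \<longlongrightarrow> d) (at t within S)"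
proof -
  have "(f has_vector_derivative d) (at t within S) \<longleftrightarrow>
     ((\<lambda>y. (1 / norm (y - t)) *\<^sub>R (f y - (f t + (y - t) *\<^sub>R d))) \<longlongrightarrow> 0) (at t within S)"
    by (simp add: has_vector_derivative_def has_derivative_within bounded_linear_scaleR_left)
  also have "\<dots> \<longleftrightarrow> ((\<lambda>y. norm ((1 / norm (y - t)) *\<^sub>R (f y - (f t + (y - t) *\<^sub>R d)))) \<longlongrightarrow> 0) (at t within S)"
    by (simp only: tendsto_norm_zero_iff)
  also have "\<dots> \<longleftrightarrow> ((\<lambda>s. norm ((1 / (s - t)) *\<^sub>R (f s - f t) - d)) \<longlongrightarrow> 0) (at t within S)"
  proof (rule filterlim_cong[OF refl refl eventually_mono[OF eventually_at_in_set]])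
    fix y assume y: "y \<in> S \<and> y \<noteq> t"
    have "(1 / (y - t)) *\<^sub>R (f y - f t) - d = (1 / (y - t)) *\<^sub>R (f y - (f t + (y - t) *\<^sub>R d))"
      using y by (simp add: scaleR_diff_right scaleR_add_right)
    then show "norm ((1 / norm (y - t)) *\<^sub>R (f y - (f t + (y - t) *\<^sub>R d))) = norm ((1 / (y - t)) *\<^sub>R (f y - f t) - d)"
      by simp
  qed
  also have "\<dots> \<longleftrightarrow> ((\<lambda>s. (1 / (s - t)) *\<^sub>R (f s - f t)) \<longlongrightarrow> d) (at t within S)"
    by (simp only: tendsto_norm_zero_iff LIM_zero_iff)
  finally show ?thesis .
qed

context nontrivial_interval
begin

lemma op_tendsto_apply:
  assumes F: "op_tendsto UNIV F F0 A" and F0: "bounded_op UNIV UNIV F0" and f: "(f \<longlongrightarrow> v) A"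
  shows "((\<lambda>s. F s (f s)) \<longlongrightarrow> F0 v) A"
proof (rule tendstoI)
  fix e :: real assume e: "0 < e"
  have half: "0 < e / 2" using e by simp
  have pos: "0 < e / (2 * (norm v + 1))" using e by (simp add: add_nonneg_pos)
  have "((\<lambda>s. F0 (f s)) \<longlongrightarrow> F0 v) A"
    using bounded_linear.tendsto[OF bounded_op_lin(1)[OF F0] f] .
  from op_tendstoD[OF F pos] tendstoD[OF f zero_less_one] tendstoD[OF this half]
  show "\<forall>\<^sub>F s in A. dist (F s (f s)) (F0 v) < e"
  proof eventually_elim
    case (elim s)
    have "norm (f s) \<le> norm v + 1"
      using elim(2) norm_triangle_sub[of "f s" v] by (simp add: dist_norm)
    then have "norm (F s (f s) - F0 (f s)) \<le> e / (2 * (norm v + 1)) * (norm v + 1)"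
      using elim(1) pos by (meson UNIV_I mult_left_mono less_imp_le order_trans)
    also have "\<dots> = e / 2" by (simp add: field_simps add_nonneg_eq_0_iff)
    finally have "dist (F s (f s)) (F0 (f s)) \<le> e / 2" by (simp add: dist_norm)
    moreover have "dist (F0 (f s)) (F0 v) < e / 2" using elim e by blast
    ultimately show ?case using dist_triangle[of "F s (f s)" "F0 v" "F0 (f s)"] by linarith
  qed
qed

text \<open>The product rule: the quotient splits into that of \<open>F\<close> at the fixed vector
  \<open>f t\<close> and \<open>F s\<close> applied to that of \<open>f\<close>.\<close>

lemma has_vector_derivative_op_apply:
  assumes F: "op_tendsto UNIV (\<lambda>s x. (1 / (s - t)) *\<^sub>R (F s x - F t x)) F' (at t within \<Delta>)"
    and Fc: "op_tendsto UNIV F (F t) (at t within \<Delta>)"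
    and b: "bounded_op UNIV UNIV (F t)" "bounded_op UNIV UNIV F'" "\<And>s. s \<in> \<Delta> \<Longrightarrow> bounded_op UNIV UNIV (F s)"
    and f: "(f has_vector_derivative f') (at t within \<Delta>)"
  shows "((\<lambda>s. F s (f s)) has_vector_derivative (F' (f t) + F t f')) (at t within \<Delta>)"
proof -
  have q: "((\<lambda>s. (1 / (s - t)) *\<^sub>R (f s - f t)) \<longlongrightarrow> f') (at t within \<Delta>)"
    using f by (simp add: has_vector_derivative_iff_quotient)
  have "((\<lambda>s. (1 / (s - t)) *\<^sub>R (F s (f t) - F t (f t)) + F s ((1 / (s - t)) *\<^sub>R (f s - f t)))
     \<longlongrightarrow> F' (f t) + F t f') (at t within \<Delta>)"
    by (intro tendsto_add op_tendsto_apply[OF F b(2) tendsto_const] op_tendsto_apply[OF Fc b(1) q])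
  then have "((\<lambda>s. (1 / (s - t)) *\<^sub>R (F s (f s) - F t (f t))) \<longlongrightarrow> F' (f t) + F t f') (at t within \<Delta>)"
  proof (rule Lim_transform_eventually)
    show "\<forall>\<^sub>F s in at t within \<Delta>. (1 / (s - t)) *\<^sub>R (F s (f t) - F t (f t)) + F s ((1 / (s - t)) *\<^sub>R (f s - f t)) =
      (1 / (s - t)) *\<^sub>R (F s (f s) - F t (f t))"
      by (rule eventually_mono[OF eventually_at_in_set])
         (use b(3) in \<open>simp add: bounded_op_lin scaleR_diff_right\<close>)
  qed
  then show ?thesis by (simp add: has_vector_derivative_iff_quotient)
qed

lemma base_classD:
  assumes "base_class P s"
  shows "(\<And>t. t \<in> \<Delta> \<Longrightarrow> f t = g t) \<Longrightarrow> P f \<Longrightarrow> P g"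
    "P f \<Longrightarrow> P g \<Longrightarrow> P (\<lambda>t. f t + g t)"
    "op_Ck s \<Delta> F \<Longrightarrow> P f \<Longrightarrow> P (\<lambda>t. F t (f t))"
    "(\<And>t. t \<in> \<Delta> \<Longrightarrow> f differentiable (at t within \<Delta>)) \<Longrightarrow> P f"
  using assms unfolding base_class_def by blast+

lemma Dt_add:
  assumes "f differentiable (at t within \<Delta>)" "g differentiable (at t within \<Delta>)" "t \<in> \<Delta>"
  shows "Dt \<Delta> (\<lambda>t. f t + g t) t = Dt \<Delta> f t + Dt \<Delta> g t"
  by (rule Dt_eqI[OF has_vector_derivative_add]) (use assms Dt_has_derivative in auto)

lemma Dt_linear:
  assumes "bounded_linear h" "f differentiable (at t within \<Delta>)" "t \<in> \<Delta>"
  shows "Dt \<Delta> (\<lambda>t. h (f t)) t = h (Dt \<Delta> f t)"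
  by (rule Dt_eqI[OF bounded_linear.has_vector_derivative[OF assms(1)]]) (use assms Dt_has_derivative in auto)

lemma differentiable_linear:
  assumes "bounded_linear h" "f differentiable (at t within \<Delta>)"
  shows "(\<lambda>t. h (f t)) differentiable (at t within \<Delta>)"
  by (rule differentiableI_vd[OF bounded_linear.has_vector_derivative[OF assms(1) Dt_has_derivative[OF assms(2)]]])

lemma op_apply_differentiable:
  assumes F: "op_Ck (Suc 0) \<Delta> F" and f: "f differentiable (at t within \<Delta>)" and t: "t \<in> \<Delta>"
  shows "(\<lambda>t. F t (f t)) differentiable (at t within \<Delta>)"
proof -
  obtain F' where F': "op_Ck 0 \<Delta> F'"
    "\<And>t. t \<in> \<Delta> \<Longrightarrow> op_tendsto UNIV (\<lambda>s x. (1 / (s - t)) *\<^sub>R (F s x - F t x)) (F' t) (at t within \<Delta>)"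
    using op_Ck_Suc[OF F] by blast
  show ?thesis
    using has_vector_derivative_op_apply[OF F'(2)[OF t] op_Ck_continuous[OF F t] op_Ck_bounded[OF F t]
        op_Ck_bounded[OF F'(1) t] op_Ck_bounded[OF F] Dt_has_derivative[OF f]] differentiableI_vd by blast
qed

lemma continuous_on_op_apply:
  assumes F: "op_Ck 0 \<Delta> F" and f: "continuous_on \<Delta> f"
  shows "continuous_on \<Delta> (\<lambda>t. F t (f t))"
  unfolding continuous_on_def
proof
  fix t assume t: "t \<in> \<Delta>"
  then have "(f \<longlongrightarrow> f t) (at t within \<Delta>)" using f by (simp add: continuous_on_def)
  then show "((\<lambda>t. F t (f t)) \<longlongrightarrow> F t (f t)) (at t within \<Delta>)"
    by (rule op_tendsto_apply[OF op_Ck_continuous[OF F t] op_Ck_bounded[OF F t]])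
qed

lemma base_classI:
  assumes "\<And>f g. (\<And>t. t \<in> \<Delta> \<Longrightarrow> f t = g t) \<Longrightarrow> P f \<Longrightarrow> P g"
    "\<And>f g. P f \<Longrightarrow> P g \<Longrightarrow> P (\<lambda>t. f t + g t)"
    "\<And>F f. op_Ck s \<Delta> F \<Longrightarrow> P f \<Longrightarrow> P (\<lambda>t. F t (f t))"
    "\<And>f. (\<And>t. t \<in> \<Delta> \<Longrightarrow> f differentiable (at t within \<Delta>)) \<Longrightarrow> P f"
  shows "base_class P s"
  unfolding base_class_def using assms by blast

lemma base_class_diff_at:
  assumes T: "T \<subseteq> \<Delta>"
  shows "base_class (diff_at T :: (real \<Rightarrow> 'h::complex_inner) \<Rightarrow> bool) (Suc 0)"
proof (rule base_classI)
  fix f g :: "real \<Rightarrow> 'h"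
  assume *: "\<And>t. t \<in> \<Delta> \<Longrightarrow> f t = g t" "diff_at T f"
  show "diff_at T g"
    unfolding diff_at_def
  proof
    fix t assume t: "t \<in> T"
    then have "t \<in> \<Delta>" using T by blast
    moreover have "f differentiable (at t within \<Delta>)" using *(2) t by (simp add: diff_at_def)
    ultimately show "g differentiable (at t within \<Delta>)" using differentiable_cong[of f g t] *(1) by simp
  qed
next
  fix F :: "real \<Rightarrow> 'h \<Rightarrow> 'h" and f :: "real \<Rightarrow> 'h"
  assume "op_Ck (Suc 0) \<Delta> F" "diff_at T f"
  then show "diff_at T (\<lambda>t. F t (f t))" using T unfolding diff_at_def by (blast intro: op_apply_differentiable)
qed (use T in \<open>auto simp: diff_at_def\<close>)

lemma base_class_continuous: "base_class (continuous_on \<Delta> :: (real \<Rightarrow> 'h::complex_inner) \<Rightarrow> bool) 0"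
proof (rule base_classI)
  fix f :: "real \<Rightarrow> 'h"
  assume "\<And>t. t \<in> \<Delta> \<Longrightarrow> f differentiable (at t within \<Delta>)"
  then show "continuous_on \<Delta> f"
    unfolding continuous_on_eq_continuous_within by (blast intro: differentiable_imp_continuous_within)
next
  fix f g :: "real \<Rightarrow> 'h"
  assume "\<And>t. t \<in> \<Delta> \<Longrightarrow> f t = g t" "continuous_on \<Delta> f"
  then show "continuous_on \<Delta> g" using continuous_on_cong[of \<Delta> \<Delta> f g] by simp
next
  fix F :: "real \<Rightarrow> 'h \<Rightarrow> 'h" and f :: "real \<Rightarrow> 'h"
  assume "op_Ck 0 \<Delta> F" "continuous_on \<Delta> f"
  then show "continuous_on \<Delta> (\<lambda>t. F t (f t))" by (rule continuous_on_op_apply)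
qed (rule continuous_on_add)

context
  fixes P :: "(real \<Rightarrow> 'h::complex_inner) \<Rightarrow> bool" and s :: nat
  assumes P: "base_class P s"
begin

lemma reg_cong:
  assumes "\<And>t. t \<in> \<Delta> \<Longrightarrow> f t = g t" "reg P m f"
  shows "reg P m g"
  using assms
proof (induction m arbitrary: f g)
  case 0
  then show ?case using base_classD(1)[OF P] by auto
next
  case (Suc m)
  have "\<And>t. t \<in> \<Delta> \<Longrightarrow> Dt \<Delta> f t = Dt \<Delta> g t" using Suc.prems(1) Dt_cong by blast
  with Suc show ?case using differentiable_cong[OF Suc.prems(1)] by (auto)
qed

lemma reg_SucD: "reg P (Suc m) f \<Longrightarrow> reg P m f"
proof (induction m arbitrary: f)
  case 0
  then show ?case using base_classD(4)[OF P] by simp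
qed auto

lemma reg_mono: "reg P m f \<Longrightarrow> k \<le> m \<Longrightarrow> reg P k f"
  by (induction m) (auto simp: le_Suc_eq dest: reg_SucD simp del: reg.simps(2))

lemma reg_add: "reg P m f \<Longrightarrow> reg P m g \<Longrightarrow> reg P m (\<lambda>t. f t + g t)"
proof (induction m arbitrary: f g)
  case 0
  then show ?case using base_classD(2)[OF P] by simp
next
  case (Suc m)
  have "reg P m (\<lambda>t. Dt \<Delta> f t + Dt \<Delta> g t)" using Suc by simp
  then have "reg P m (Dt \<Delta> (\<lambda>t. f t + g t))"
    by (rule reg_cong[rotated]) (use Suc.prems in \<open>auto simp: Dt_add\<close>)
  then show ?case using Suc.prems by auto
qed

text \<open>The derivative is \<open>F' f + F f'\<close>. Each summand has one order less in both
  the operator and the function, so the induction runs over all \<open>F\<close> and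
  \<open>f\<close>.\<close>

lemma reg_op: "op_Ck (m + s) \<Delta> F \<Longrightarrow> reg P m f \<Longrightarrow> reg P m (\<lambda>t. F t (f t))"
proof (induction m arbitrary: F f)
  case 0
  then show ?case using base_classD(3)[OF P] by simp
next
  case (Suc m)
  have F: "op_Ck (Suc (m + s)) \<Delta> F" using Suc.prems by simp
  obtain F' where F': "op_Ck (m + s) \<Delta> F'"
    "\<And>t. t \<in> \<Delta> \<Longrightarrow> op_tendsto UNIV (\<lambda>s x. (1 / (s - t)) *\<^sub>R (F s x - F t x)) (F' t) (at t within \<Delta>)"
    using op_Ck_Suc[OF F] by blast
  have d: "((\<lambda>t. F t (f t)) has_vector_derivative F' t (f t) + F t (Dt \<Delta> f t)) (at t within \<Delta>)" if t: "t \<in> \<Delta>" for t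
    using has_vector_derivative_op_apply[OF F'(2)[OF t] op_Ck_continuous[OF F t] op_Ck_bounded[OF F t]
        op_Ck_bounded[OF F'(1) t] op_Ck_bounded[OF F] Dt_has_derivative] Suc.prems(2) t by simp
  have "reg P m (\<lambda>t. F' t (f t) + F t (Dt \<Delta> f t))"
    using Suc.prems(2) Suc.IH[OF F'(1) reg_SucD[OF Suc.prems(2)]] Suc.IH[OF op_Ck_mono[OF F], of "Dt \<Delta> f"]
    by (intro reg_add) auto
  then have "reg P m (Dt \<Delta> (\<lambda>t. F t (f t)))"
    by (rule reg_cong[rotated]) (simp add: Dt_eqI[OF d])
  then show ?case using d differentiableI_vd by auto
qed

lemma reg_Dpow: "reg P (m + k) f \<Longrightarrow> reg P m (Dpow \<Delta> k f)"
proof (induction k arbitrary: f)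
  case (Suc k)
  then have "reg P m (Dpow \<Delta> k (Dt \<Delta> f))" by auto
  then show ?case by (simp only: Dpow_Suc_shift)
qed simp

end

lemma Dpow_differentiable:
  assumes "reg P m f" "k < m" "t \<in> \<Delta>"
  shows "Dpow \<Delta> k f differentiable (at t within \<Delta>)"
  using assms
proof (induction m arbitrary: f k)
  case (Suc m)
  then show ?case by (cases k) (auto simp: Dpow_Suc_shift simp del: funpow.simps)
qed simp

lemma reg_base: "reg P m f \<Longrightarrow> P (Dpow \<Delta> m f)"
proof (induction m arbitrary: f)
  case (Suc m)
  then show ?case by (simp only: Dpow_Suc_shift reg.simps)
qed simp

lemma reg_iff: "reg P m f \<longleftrightarrow> (\<forall>k<m. \<forall>t\<in>\<Delta>. Dpow \<Delta> k f differentiable (at t within \<Delta>)) \<and> P (Dpow \<Delta> m f)"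
proof
  assume "(\<forall>k<m. \<forall>t\<in>\<Delta>. Dpow \<Delta> k f differentiable (at t within \<Delta>)) \<and> P (Dpow \<Delta> m f)"
  then show "reg P m f"
  proof (induction m arbitrary: f)
    case (Suc m)
    have "(\<forall>k<m. \<forall>t\<in>\<Delta>. Dpow \<Delta> k (Dt \<Delta> f) differentiable (at t within \<Delta>)) \<and> P (Dpow \<Delta> m (Dt \<Delta> f))"
      using Suc.prems unfolding Dpow_Suc_shift[symmetric] by blast
    moreover have "\<forall>t\<in>\<Delta>. f differentiable (at t within \<Delta>)" using Suc.prems by (auto dest: spec[of _ 0])
    ultimately show ?case using Suc.IH by simp
  qed simp
qed (auto intro: Dpow_differentiable reg_base)

lemma reg_Suc_of_Dt: "(\<And>t. t \<in> \<Delta> \<Longrightarrow> f differentiable (at t within \<Delta>)) \<Longrightarrow> reg P m (Dt \<Delta> f) \<Longrightarrow> reg P (Suc m) f"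
  by simp

text \<open>The top differentiation is required at \<open>t\<close> only, the lower ones on all of
  \<Delta>. So the sum rule can be used at single points where the last derivative happens to
  exist.\<close>

lemma Dpow_add:
  assumes "\<And>j. j < k \<Longrightarrow> Dpow \<Delta> j f differentiable (at t within \<Delta>)" "\<And>j. j < k \<Longrightarrow> Dpow \<Delta> j g differentiable (at t within \<Delta>)"
    "\<And>j s. Suc j < k \<Longrightarrow> s \<in> \<Delta> \<Longrightarrow> Dpow \<Delta> j f differentiable (at s within \<Delta>)"
    "\<And>j s. Suc j < k \<Longrightarrow> s \<in> \<Delta> \<Longrightarrow> Dpow \<Delta> j g differentiable (at s within \<Delta>)" and t: "t \<in> \<Delta>"
  shows "Dpow \<Delta> k (\<lambda>t. f t + g t) t = Dpow \<Delta> k f t + Dpow \<Delta> k g t"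
  using assms
proof (induction k arbitrary: t)
  case (Suc k)
  have eq: "Dpow \<Delta> k (\<lambda>t. f t + g t) s = Dpow \<Delta> k f s + Dpow \<Delta> k g s" if "s \<in> \<Delta>" for s
    by (rule Suc.IH) (use Suc.prems that in auto)
  have "Dpow \<Delta> (Suc k) (\<lambda>t. f t + g t) t = Dt \<Delta> (\<lambda>t. Dpow \<Delta> k f t + Dpow \<Delta> k g t) t"
    unfolding funpow.simps o_apply by (rule Dt_cong[OF eq Suc.prems(5)])
  also have "\<dots> = Dt \<Delta> (Dpow \<Delta> k f) t + Dt \<Delta> (Dpow \<Delta> k g) t"
    by (rule Dt_add) (use Suc.prems in auto)
  finally show ?case by simp
qed simp

lemma Dpow_linear:
  assumes h: "bounded_linear h" and "\<And>j. j < k \<Longrightarrow> Dpow \<Delta> j f differentiable (at t within \<Delta>)"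
    "\<And>j s. Suc j < k \<Longrightarrow> s \<in> \<Delta> \<Longrightarrow> Dpow \<Delta> j f differentiable (at s within \<Delta>)" and t: "t \<in> \<Delta>"
  shows "Dpow \<Delta> k (\<lambda>t. h (f t)) t = h (Dpow \<Delta> k f t)"
  using assms(2-)
proof (induction k arbitrary: t)
  case (Suc k)
  have eq: "Dpow \<Delta> k (\<lambda>t. h (f t)) s = h (Dpow \<Delta> k f s)" if "s \<in> \<Delta>" for s
    by (rule Suc.IH) (use Suc.prems that in auto)
  have "Dpow \<Delta> (Suc k) (\<lambda>t. h (f t)) t = Dt \<Delta> (\<lambda>t. h (Dpow \<Delta> k f t)) t"
    unfolding funpow.simps o_apply by (rule Dt_cong[OF eq Suc.prems(3)])
  also have "\<dots> = h (Dt \<Delta> (Dpow \<Delta> k f) t)"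
    by (rule Dt_linear[OF h]) (use Suc.prems in auto)
  finally show ?case by simp
qed simp

lemma op_Ck_const:
  assumes "bounded_op UNIV UNIV A"
  shows "op_Ck m \<Delta> (\<lambda>t. A)"
  unfolding op_Ck_def
  by (rule exI[of _ "\<lambda>j t. if j = 0 then A else (\<lambda>x. 0)"])
     (use assms in \<open>auto simp: op_tendsto_def bounded_op_zero\<close>)

lemma op_Ck_hadj:
  fixes F :: "real \<Rightarrow> 'h::chilbert_space \<Rightarrow> 'h"
  assumes "op_Ck m \<Delta> F"
  shows "op_Ck m \<Delta> (\<lambda>t. hadj UNIV (F t))"
proof (rule op_CkE[OF assms])
  fix G
  assume G: "\<And>t. t \<in> \<Delta> \<Longrightarrow> G 0 t = F t"
    "\<And>j t. j \<le> m \<Longrightarrow> t \<in> \<Delta> \<Longrightarrow> bounded_op UNIV UNIV (G j t)"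
    "\<And>j t. j \<le> m \<Longrightarrow> t \<in> \<Delta> \<Longrightarrow> op_tendsto UNIV (G j) (G j t) (at t within \<Delta>)"
    "\<And>j t. j < m \<Longrightarrow> t \<in> \<Delta> \<Longrightarrow> op_tendsto UNIV (\<lambda>s x. (1 / (s - t)) *\<^sub>R (G j s x - G j t x)) (G (Suc j) t)
                      (at t within \<Delta>)"
  show ?thesis
    unfolding op_Ck_def
  proof (intro exI[of _ "\<lambda>j t. hadj UNIV (G j t)"] conjI ballI allI impI)
    fix j t assume jt: "j \<le> m" "t \<in> \<Delta>"
    show "bounded_op UNIV UNIV (hadj UNIV (G j t))" by (rule bounded_op_hadj[OF closed_csubspace_UNIV G(2)[OF jt]])
    show "op_tendsto UNIV (\<lambda>t. hadj UNIV (G j t)) (hadj UNIV (G j t)) (at t within \<Delta>)"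
      by (rule op_tendsto_hadj[OF G(3)[OF jt] G(2)[OF jt] eventually_mono[OF eventually_at_in_set]])
         (use G(2) jt in auto)
  next
    fix j t assume jt: "j < m" "t \<in> \<Delta>"
    note b = G(2)[OF less_imp_le[OF jt(1)]]
    have q: "bounded_op UNIV UNIV (\<lambda>x. (1 / (s - t)) *\<^sub>R (G j s x - G j t x))" if "s \<in> \<Delta>" for s
      using bounded_op_scaleC[OF bounded_op_diff[OF b[OF that] b[OF jt(2)]], of "of_real (1 / (s - t))"]
      unfolding scaleC_of_real .
    have "op_tendsto UNIV (\<lambda>s. hadj UNIV (\<lambda>x. (1 / (s - t)) *\<^sub>R (G j s x - G j t x))) (hadj UNIV (G (Suc j) t)) (at t within \<Delta>)"
      by (rule op_tendsto_hadj[OF G(4)[OF jt] G(2) eventually_mono[OF eventually_at_in_set]]) (use jt q in auto)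
    then show "op_tendsto UNIV (\<lambda>s x. (1 / (s - t)) *\<^sub>R (hadj UNIV (G j s) x - hadj UNIV (G j t) x))
      (hadj UNIV (G (Suc j) t)) (at t within \<Delta>)"
    proof (rule op_tendsto_cong[OF _ eventually_mono[OF eventually_at_in_set]])
      fix s assume s: "s \<in> \<Delta> \<and> s \<noteq> t"
      have "hadj UNIV (\<lambda>x. (1 / (s - t)) *\<^sub>R (G j s x - G j t x)) x =
         (1 / (s - t)) *\<^sub>R (hadj UNIV (G j s) x - hadj UNIV (G j t) x)" for x
        by (rule hadj_eqI[OF closed_csubspace_UNIV])
           (use s jt in \<open>simp_all add: cinner_simps hadj_UNIV_right[OF b]\<close>)
      then show "\<forall>x\<in>UNIV. (1 / (s - t)) *\<^sub>R (hadj UNIV (G j s) x - hadj UNIV (G j t) x) =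
         hadj UNIV (\<lambda>x. (1 / (s - t)) *\<^sub>R (G j s x - G j t x)) x" by simp
    qed simp
  qed (simp add: G(1))
qed

text \<open>Near \<open>t\<close> the operators \<open>F s\<close> inherit a lower bound from the
  invertible \<open>F t\<close>. Hence convergence of \<open>F s\<close> applied to the difference
  quotient \<open>q s\<close> of \<open>f\<close> forces convergence of \<open>q s\<close>
  itself.\<close>

lemma op_apply_differentiable_inverse:
  assumes F: "op_Ck (Suc 0) \<Delta> F" and inv: "boundedly_invertible UNIV UNIV (F t)"
    and f: "(\<lambda>t. F t (f t)) differentiable (at t within \<Delta>)" and t: "t \<in> \<Delta>"
  shows "f differentiable (at t within \<Delta>)"
proof -
  obtain F' where F': "op_Ck 0 \<Delta> F'"
    "\<And>t. t \<in> \<Delta> \<Longrightarrow> op_tendsto UNIV (\<lambda>s x. (1 / (s - t)) *\<^sub>R (F s x - F t x)) (F' t) (at t within \<Delta>)"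
    using op_Ck_Suc[OF F] by blast
  obtain R where R: "bounded_op UNIV UNIV R" "\<And>x. R (F t x) = x" "\<And>x. F t (R x) = x"
    using inv unfolding boundedly_invertible_def by auto
  obtain C where C: "0 < C" "\<And>x. norm (R x) \<le> C * norm x" using bounded_op_bound[OF R(1)] by (metis UNIV_I)
  \<comment> \<open>The value that \<open>F t f'\<close> must take by the product rule.\<close>
  define e where "e = Dt \<Delta> (\<lambda>t. F t (f t)) t - F' t (f t)"
  define q where "q = (\<lambda>s. (1 / (s - t)) *\<^sub>R (f s - f t))"
  have Fc: "op_tendsto UNIV F (F t) (at t within \<Delta>)" by (rule op_Ck_continuous[OF F t])
  have "((\<lambda>s. (1 / (s - t)) *\<^sub>R (F s (f s) - F t (f t)) - (1 / (s - t)) *\<^sub>R (F s (f t) - F t (f t))) \<longlongrightarrow> e) (at t within \<Delta>)"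
    unfolding e_def
    using Dt_has_derivative[OF f]
    by (intro tendsto_diff op_tendsto_apply[OF F'(2)[OF t] op_Ck_bounded[OF F'(1) t] tendsto_const])
       (simp add: has_vector_derivative_iff_quotient)
  then have "((\<lambda>s. F s (q s)) \<longlongrightarrow> e) (at t within \<Delta>)"
  proof (rule Lim_transform_eventually)
    show "\<forall>\<^sub>F s in at t within \<Delta>. (1 / (s - t)) *\<^sub>R (F s (f s) - F t (f t)) - (1 / (s - t)) *\<^sub>R (F s (f t) - F t (f t)) = F s (q s)"
      by (rule eventually_mono[OF eventually_at_in_set])
         (use op_Ck_bounded[OF F] in \<open>simp add: q_def bounded_op_lin scaleR_diff_right\<close>)
  qed
  then have "((\<lambda>s. F s (q s) - F s (R e)) \<longlongrightarrow> e - F t (R e)) (at t within \<Delta>)"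
    by (rule tendsto_diff[OF _ op_tendsto_apply[OF Fc op_Ck_bounded[OF F t] tendsto_const]])
  then have "((\<lambda>s. 2 * C * norm (F s (q s) - F s (R e))) \<longlongrightarrow> 2 * C * norm (e - F t (R e))) (at t within \<Delta>)"
    by (intro tendsto_mult_left tendsto_norm)
  then have lim0: "((\<lambda>s. 2 * C * norm (F s (q s) - F s (R e))) \<longlongrightarrow> 0) (at t within \<Delta>)" by (simp add: R)
  have "((\<lambda>s. q s - R e) \<longlongrightarrow> 0) (at t within \<Delta>)"
  proof (rule Lim_null_comparison[OF _ lim0])
    have "0 < 1 / (2 * C)" using C by simp
    from op_tendstoD[OF Fc this] eventually_at_in_set[of \<Delta> t]
    show "\<forall>\<^sub>F s in at t within \<Delta>. norm (q s - R e) \<le> 2 * C * norm (F s (q s) - F s (R e))"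
    proof eventually_elim
      case (elim s)
      define g where "g = q s - R e"
      have "norm g \<le> C * norm (F t g)" using C(2)[of "F t g"] by (simp add: R)
      also have "\<dots> \<le> C * (norm (F s g) + norm (F s g - F t g))"
        using C(1) norm_triangle_sub[of "F t g" "F s g"] by (intro mult_left_mono) (auto simp: norm_minus_commute)
      also have "\<dots> \<le> C * (norm (F s g) + 1 / (2 * C) * norm g)"
        using C(1) elim by (intro mult_left_mono add_left_mono) auto
      finally have "norm g \<le> 2 * C * norm (F s g)" using C(1) by (simp add: field_simps)
      then show ?case using op_Ck_bounded[OF F] elim by (simp add: g_def bounded_op_lin)
    qed
  qed
  then have "(f has_vector_derivative R e) (at t within \<Delta>)"
    unfolding has_vector_derivative_iff_quotient q_def by (simp only: LIM_zero_iff)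
  then show ?thesis by (rule differentiableI_vd)
qed

text \<open>Solves the product rule for \<open>F f' = (F f)' - F' f\<close> and applies the
  induction hypothesis to \<open>f'\<close>. With \<open>F = p 0\<close> this recovers
  \<open>D^n y\<close> from the quasi-derivative of order n.\<close>

lemma reg_op_inverse:
  assumes T: "T \<subseteq> \<Delta>"
  shows "op_Ck (Suc m) \<Delta> F \<Longrightarrow> (\<And>t. t \<in> \<Delta> \<Longrightarrow> boundedly_invertible UNIV UNIV (F t)) \<Longrightarrow>
    reg (diff_at T) m (\<lambda>t. F t (f t)) \<Longrightarrow> reg (diff_at T) m f"
proof (induction m arbitrary: f)
  case 0
  have "f differentiable (at t within \<Delta>)" if "t \<in> T" for t
    using op_apply_differentiable_inverse[OF 0(1) 0(2), of t f] 0(3) that T by (auto simp: diff_at_def)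
  then show ?case by (simp add: diff_at_def)
next
  case (Suc m)
  note P = base_class_diff_at[OF T]
  have F: "op_Ck (Suc 0) \<Delta> F" "op_Ck (Suc m) \<Delta> F" using op_Ck_mono[OF Suc.prems(1)] by auto
  obtain F' where F': "op_Ck (Suc m) \<Delta> F'"
    "\<And>t. t \<in> \<Delta> \<Longrightarrow> op_tendsto UNIV (\<lambda>s x. (1 / (s - t)) *\<^sub>R (F s x - F t x)) (F' t) (at t within \<Delta>)"
    using op_Ck_Suc[OF Suc.prems(1)] by blast
  have df: "f differentiable (at t within \<Delta>)" if "t \<in> \<Delta>" for t
    by (rule op_apply_differentiable_inverse[OF F(1) Suc.prems(2)[OF that] _ that]) (use Suc.prems(3) that in simp)
  have f: "reg (diff_at T) m f"
    by (rule Suc.IH[OF F(2) Suc.prems(2) reg_SucD[OF P Suc.prems(3)]])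
  have D: "Dt \<Delta> (\<lambda>t. F t (f t)) t = F' t (f t) + F t (Dt \<Delta> f t)" if t: "t \<in> \<Delta>" for t
    by (rule Dt_eqI[OF has_vector_derivative_op_apply[OF F'(2)[OF t] op_Ck_continuous[OF F(1) t] op_Ck_bounded[OF F(1) t]
        op_Ck_bounded[OF F'(1) t] op_Ck_bounded[OF F(1)] Dt_has_derivative[OF df[OF t]]] t])
  have m1: "op_Ck (m + Suc 0) \<Delta> (\<lambda>t x. - x)" "op_Ck (m + Suc 0) \<Delta> F'"
    using op_Ck_const[OF bounded_op_minus[OF bounded_op_id]] F'(1) by auto
  have "reg (diff_at T) m (\<lambda>t. Dt \<Delta> (\<lambda>t. F t (f t)) t + - F' t (f t))"
    using Suc.prems(3) by (intro reg_add[OF P] reg_op[OF P m1(1)] reg_op[OF P m1(2)] f) auto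
  then have "reg (diff_at T) m (\<lambda>t. F t (Dt \<Delta> f t))"
    by (rule reg_cong[OF P, rotated]) (simp add: D)
  then have "reg (diff_at T) m (Dt \<Delta> f)" using Suc.IH[of "Dt \<Delta> f", OF F(2)] Suc.prems(2) by blast
  then show ?case using df by simp
qed

end

subsection \<open>The fundamental theorem of calculus for absolutely continuous functions\<close>

definition ac_small :: "real \<Rightarrow> real \<Rightarrow> (real \<Rightarrow> 'h::real_normed_vector) \<Rightarrow> real \<Rightarrow> real \<Rightarrow> bool" where
  "ac_small c d f \<delta> \<epsilon> \<longleftrightarrow> (\<forall>I. finite I \<and>
      (\<forall>(x, y)\<in>I. c \<le> x \<and> x \<le> y \<and> y \<le> d) \<and>
      pairwise (\<lambda>(x, y) (x', y'). {x<..<y} \<inter> {x'<..<y'} = {}) I \<and>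
      (\<Sum>(x, y)\<in>I. y - x) < \<delta> \<longrightarrow> (\<Sum>(x, y)\<in>I. norm (f y - f x)) < \<epsilon>)"

definition AC_on :: "real \<Rightarrow> real \<Rightarrow> (real \<Rightarrow> 'h::real_normed_vector) \<Rightarrow> bool" where
  "AC_on c d f \<longleftrightarrow> (\<forall>\<epsilon>>0. \<exists>\<delta>>0. ac_small c d f \<delta> \<epsilon>)"

lemma locally_AC_iff: "locally_AC \<Delta> f \<longleftrightarrow> (\<forall>c d. {c..d} \<subseteq> \<Delta> \<longrightarrow> AC_on c d f)"
  by (simp add: locally_AC_def AC_on_def ac_small_def)

lemma AC_onD:
  assumes "AC_on c d f" "0 < \<epsilon>"
  obtains \<delta> where "0 < \<delta>" "ac_small c d f \<delta> \<epsilon>"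
  using assms unfolding AC_on_def by blast

lemma ac_smallD:
  assumes "ac_small c d f \<delta> \<epsilon>" "finite I" "\<And>x y. (x, y) \<in> I \<Longrightarrow> c \<le> x \<and> x \<le> y \<and> y \<le> d"
    "pairwise (\<lambda>(x, y) (x', y'). {x<..<y} \<inter> {x'<..<y'} = {}) I" "(\<Sum>(x, y)\<in>I. y - x) < \<delta>"
  shows "(\<Sum>(x, y)\<in>I. norm (f y - f x)) < \<epsilon>"
  using assms unfolding ac_small_def by auto

text \<open>Absolute continuity in the language of divisions: cells inside a set of measure below
  \<open>\<delta>\<close> are disjoint intervals of small total length. Degenerate cells count as 0,
  the form in which \<open>sum.over_tagged_division_lemma\<close> passes from tagged cells to
  cells.\<close>

lemma AC_on_division_small:
  fixes f :: "real \<Rightarrow> 'h::real_normed_vector"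
  assumes K: "K division_of (\<Union>K)" "\<Union>K \<subseteq> {c..d}" "\<Union>K \<subseteq> U" and U: "U \<in> lmeasurable" "measure lebesgue U < \<delta>"
    and \<delta>: "ac_small c d f \<delta> (\<epsilon>)"
  shows "(\<Sum>k\<in>K. if measure lborel k = 0 then 0 else norm (f (Sup k) - f (Inf k))) < \<epsilon>"
proof -
  define K' where "K' = {k\<in>K. measure lborel k \<noteq> 0}"
  have fin: "finite K" using K(1) by (rule division_of_finite)
  then have fin': "finite K'" by (simp add: K'_def)
  have ex: "\<exists>u v. u < v \<and> k = {u..v}" if "k \<in> K'" for k
  proof -
    have kK: "k \<in> K" and ne: "measure lborel k \<noteq> 0" using that by (auto simp: K'_def)
    obtain u v where "k = cbox u v" using K(1) kK by (meson division_ofD(4))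
    then show ?thesis using ne by (auto simp: box_real content_real_if split: if_splits intro!: exI[of _ u] exI[of _ v])
  qed
  have k_eq: "k = {Inf k..Sup k}" "Inf k < Sup k" if "k \<in> K'" for k
    using ex[OF that] by auto
  have inj: "inj_on (\<lambda>k. (Inf k, Sup k)) K'"
    by (rule inj_onI) (metis k_eq(1) prod.inject)
  define I where "I = (\<lambda>k. (Inf k, Sup k)) ` K'"
  have sub: "k \<subseteq> {c..d}" if "k \<in> K'" for k using that K(2) by (auto simp: K'_def)
  have "(\<Sum>(x, y)\<in>I. norm (f y - f x)) < \<epsilon>"
  proof (rule ac_smallD[OF \<delta>])
    show "finite I" using fin' by (simp add: I_def)
    show "c \<le> x \<and> x \<le> y \<and> y \<le> d" if "(x, y) \<in> I" for x y
    proof -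
      obtain k where "k \<in> K'" "(x, y) = (Inf k, Sup k)" using \<open>(x, y) \<in> I\<close> unfolding I_def by (rule imageE)
      then have k: "k \<in> K'" "x = Inf k" "y = Sup k" by auto
      obtain u v where "u < v" "k = {u..v}" using ex[OF k(1)] by blast
      then show ?thesis using sub[OF k(1)] k by auto
    qed
    show "pairwise (\<lambda>(x, y) (x', y'). {x<..<y} \<inter> {x'<..<y'} = {}) I"
    proof (rule pairwiseI)
      fix p p' assume p: "p \<in> I" "p' \<in> I" "p \<noteq> p'"
      then obtain k k' where k: "k \<in> K'" "k' \<in> K'" "p = (Inf k, Sup k)" "p' = (Inf k', Sup k')" "k \<noteq> k'"
        by (auto simp: I_def)
      then have "interior k \<inter> interior k' = {}" using K(1) by (auto simp: K'_def dest: division_ofD(5))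
      moreover have "{Inf k<..<Sup k} = interior k" "{Inf k'<..<Sup k'} = interior k'"
        using k_eq(1)[OF k(1)] k_eq(1)[OF k(2)] by (metis interior_atLeastAtMost_real)+
      ultimately have E: "{Inf k<..<Sup k} \<inter> {Inf k'<..<Sup k'} = {}" by (simp only:)
      show "(case p of (x, y) \<Rightarrow> (\<lambda>(x', y'). {x<..<y} \<inter> {x'<..<y'} = {})) p'"
        unfolding k(3,4) prod.case by (rule E)
    qed
    have neg: "pairwise (\<lambda>S T. negligible (S \<inter> T)) K'"
    proof (rule pairwiseI)
      fix k k' assume k: "k \<in> K'" "k' \<in> K'" "k \<noteq> k'"
      then have "interior k \<inter> interior k' = {}" using K(1) by (auto simp: K'_def dest: division_ofD(5))
      moreover have "k = interior k \<union> frontier k" "k' = interior k' \<union> frontier k'"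
        using ex[OF k(1)] ex[OF k(2)] by (auto simp: frontier_def)
      ultimately have "k \<inter> k' \<subseteq> frontier k \<union> frontier k'" by blast
      moreover have "negligible (frontier k \<union> frontier k')"
        using ex[OF k(1)] ex[OF k(2)] by (auto intro!: negligible_Un negligible_convex_frontier)
      ultimately show "negligible (k \<inter> k')" by (rule negligible_subset[rotated])
    qed
    have "(\<Sum>(x, y)\<in>I. y - x) = (\<Sum>k\<in>K'. measure lebesgue k)"
    proof -
      have "Sup k - Inf k = measure lebesgue k" if "k \<in> K'" for k
        using ex[OF that] by auto
      then show ?thesis unfolding I_def by (simp add: sum.reindex[OF inj])
    qed
    also have "\<dots> = measure lebesgue (\<Union>K')"
      by (rule measure_negligible_finite_Union[symmetric]) (use fin' neg ex in auto)
    also have "\<dots> \<le> measure lebesgue U"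
    proof (rule measure_mono_fmeasurable)
      show "\<Union>K' \<subseteq> U" using K(3) by (auto simp: K'_def)
      have "k \<in> sets lebesgue" if "k \<in> K'" for k using ex[OF that] by auto
      then show "\<Union>K' \<in> sets lebesgue" using fin' by (intro sets.finite_Union) auto
    qed (rule U)
    finally show "(\<Sum>(x, y)\<in>I. y - x) < \<delta>" using U by simp
  qed
  also have "(\<Sum>(x, y)\<in>I. norm (f y - f x)) = (\<Sum>k\<in>K'. norm (f (Sup k) - f (Inf k)))"
    unfolding I_def by (simp add: sum.reindex[OF inj])
  also have "\<dots> = (\<Sum>k\<in>K. if measure lborel k = 0 then 0 else norm (f (Sup k) - f (Inf k)))"
    unfolding K'_def by (rule sum.mono_neutral_cong_left[OF fin]) auto
  finally show ?thesis .
qed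

lemma vector_derivative_gauge:
  fixes f :: "real \<Rightarrow> 'h::real_normed_vector"
  assumes "(f has_vector_derivative g) (at t within S)" "0 < e"
  obtains r where "0 < r" "\<And>s. s \<in> S \<Longrightarrow> dist s t < r \<Longrightarrow> norm (f s - f t - (s - t) *\<^sub>R g) \<le> e * \<bar>s - t\<bar>"
proof -
  have "\<forall>\<^sub>F s in at t within S. norm (f s - f t - (s - t) *\<^sub>R g) \<le> e * norm (s - t)"
    using assms unfolding has_vector_derivative_def has_derivative_within_alt2 by blast
  then obtain r where r: "0 < r" "\<And>s. s \<in> S \<Longrightarrow> s \<noteq> t \<Longrightarrow> dist s t < r \<Longrightarrow> norm (f s - f t - (s - t) *\<^sub>R g) \<le> e * norm (s - t)"
    unfolding eventually_at by blast
  show ?thesis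
  proof (rule that[OF r(1)])
    fix s assume "s \<in> S" "dist s t < r"
    then show "norm (f s - f t - (s - t) *\<^sub>R g) \<le> e * \<bar>s - t\<bar>" using r(2)[of s] by (cases "s = t") auto
  qed
qed

text \<open>Riemann sums are split by their tags. Off \<open>N\<close> the differentiability
  estimate bounds the error of a cell by a multiple of its length; on \<open>N\<close> the gauge
  keeps the cells inside an open set of small measure, where absolute continuity controls the
  increments of \<open>f\<close>. This needs no theory of vector-valued Lebesgue
  differentiation.\<close>

theorem fundamental_theorem_AC:
  fixes f :: "real \<Rightarrow> 'h::banach"
  assumes cd: "c \<le> d" and AC: "AC_on c d f" and N: "negligible N"
    and deriv: "\<And>t. t \<in> {c..d} - N \<Longrightarrow> (f has_vector_derivative g t) (at t within {c..d})"
  shows "(g has_integral (f d - f c)) {c..d}"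
proof -
  \<comment> \<open>With the value 0 on \<open>N\<close>, cells tagged there contribute nothing but
    the increment of \<open>f\<close>. The true \<open>g\<close> returns at the end, as
    \<open>N\<close> is negligible.\<close>
  define g' where "g' = (\<lambda>t. if t \<in> N then 0 else g t)"
  have "(g' has_integral (f d - f c)) {c..d}"
    unfolding has_integral_real
  proof (intro allI impI)
    fix e :: real assume e: "0 < e"
    \<comment> \<open>Half of \<open>e\<close> goes to each kind of tag; the added 1 covers the case
      \<open>c = d\<close>.\<close>
    define e' where "e' = e / (2 * (d - c + 1))"
    have e': "0 < e'" "e' * (d - c) < e / 2" using e cd by (auto simp: e'_def field_simps)
    obtain \<delta> where \<delta>: "0 < \<delta>" "ac_small c d f \<delta> (e / 2)"
      by (rule AC_onD[OF AC half_gt_zero[OF e]])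
    obtain U where U: "open U" "N \<subseteq> U" "U \<in> lmeasurable" "measure lebesgue U < \<delta>"
    proof -
      have Nl: "N \<in> sets lebesgue" using N by (simp add: negligible_iff_null_sets null_sets_def)
      obtain U where U: "open U" "N \<subseteq> U" "U - N \<in> lmeasurable" "emeasure lebesgue (U - N) < ennreal \<delta>"
        using sets_lebesgue_outer_open[OF Nl \<delta>(1)] by metis
      have "N \<in> lmeasurable" "measure lebesgue N = 0" using N by (auto simp: negligible_imp_measurable negligible_imp_measure0)
      then have "U \<in> lmeasurable" "measure lebesgue U \<le> measure lebesgue (U - N) + measure lebesgue N"
        using U(2,3) fmeasurable.Un[of "U - N" lebesgue N] measure_Un_le[of "U - N" lebesgue N]
        by (auto simp: Un_absorb2 fmeasurableD)
      then show ?thesis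
        using U \<open>measure lebesgue N = 0\<close> that[of U] by (simp add: emeasure_eq_measure2 ennreal_less_iff)
    qed
    have "\<exists>r>0. (t \<in> N \<longrightarrow> ball t r \<subseteq> U) \<and> (t \<in> {c..d} - N \<longrightarrow>
       (\<forall>s\<in>{c..d}. dist s t < r \<longrightarrow> norm (f s - f t - (s - t) *\<^sub>R g t) \<le> e' * \<bar>s - t\<bar>))" for t
    proof (cases "t \<in> N")
      case True
      then obtain r where "0 < r" "ball t r \<subseteq> U" using U(1,2) unfolding open_contains_ball by blast
      then show ?thesis using True by blast
    next
      case False
      then show ?thesis
      proof (cases "t \<in> {c..d}")
        case True
        then show ?thesis using vector_derivative_gauge[OF deriv e'(1)] False by (metis DiffI)
      qed (use zero_less_one in blast)
    qed
    then obtain r where r: "\<And>t. 0 < r t" "\<And>t. t \<in> N \<Longrightarrow> ball t (r t) \<subseteq> U"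
      "\<And>t s. t \<in> {c..d} \<Longrightarrow> t \<notin> N \<Longrightarrow> s \<in> {c..d} \<Longrightarrow> dist s t < r t \<Longrightarrow> norm (f s - f t - (s - t) *\<^sub>R g t) \<le> e' * \<bar>s - t\<bar>"
      by (metis DiffI)
    show "\<exists>\<gamma>. gauge \<gamma> \<and> (\<forall>\<D>. \<D> tagged_division_of {c..d} \<and> \<gamma> fine \<D> \<longrightarrow>
            norm ((\<Sum>(x, k)\<in>\<D>. measure lborel k *\<^sub>R g' x) - (f d - f c)) < e)"
    proof (intro exI[of _ "\<lambda>t. ball t (r t)"] conjI allI impI)
      show "gauge (\<lambda>t. ball t (r t))" using r(1) by (simp add: gauge_def)
      fix D assume D: "D tagged_division_of {c..d} \<and> (\<lambda>t. ball t (r t)) fine D"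
      have finD: "finite D" using D by blast
      define D1 where "D1 = {(x, k)\<in>D. x \<notin> N}"
      define D2 where "D2 = {(x, k)\<in>D. x \<in> N}"
      have D12: "D = D1 \<union> D2" "D1 \<inter> D2 = {}" by (auto simp: D1_def D2_def)
      have fin12: "finite D1" "finite D2" using finD D12 by auto
      have DD: "\<exists>u v. k = {u..v} \<and> u \<le> x \<and> x \<le> v \<and> u \<in> {c..d} \<and> v \<in> {c..d} \<and> k \<subseteq> ball x (r x)" if xk: "(x, k) \<in> D" for x k
      proof -
        obtain u v where uv: "k = cbox u v" using D xk by (meson tagged_division_ofD(4))
        moreover have "x \<in> k" "k \<subseteq> {c..d}" "k \<subseteq> ball x (r x)"
          using D xk tagged_division_ofD(2,3)[of D "{c..d}" x k] by (auto simp: fine_def)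
        ultimately show ?thesis by (auto simp: box_real intro!: exI[of _ u] exI[of _ v])
      qed
      define h where "h = (\<lambda>k. f (Sup k) - f (Inf k))"
      have sum_h: "(\<Sum>(x, k)\<in>D. h k) = f d - f c"
        unfolding h_def using additive_tagged_division_1[OF cd] D by blast
      have b1: "norm (measure lborel k *\<^sub>R g' x - h k) \<le> e' * measure lborel k" if "(x, k) \<in> D1" for x k
      proof -
        have xk: "(x, k) \<in> D" "x \<notin> N" using that by (auto simp: D1_def)
        obtain u v where uv: "k = {u..v}" "u \<le> x" "x \<le> v" "u \<in> {c..d}" "v \<in> {c..d}" "k \<subseteq> ball x (r x)"
          using DD[OF xk(1)] by blast
        then have x: "x \<in> {c..d}" and uk: "dist u x < r x" "dist v x < r x"
            using mem_ball[of u x "r x"] mem_ball[of v x "r x"] by (auto simp: dist_commute subset_eq)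
        have "norm (f v - f x - (v - x) *\<^sub>R g x) \<le> e' * \<bar>v - x\<bar>" "norm (f u - f x - (u - x) *\<^sub>R g x) \<le> e' * \<bar>u - x\<bar>"
          using r(3)[OF x xk(2)] uv uk by blast+
        then have "norm ((f u - f x - (u - x) *\<^sub>R g x) - (f v - f x - (v - x) *\<^sub>R g x)) \<le> e' * (v - u)"
          using norm_triangle_ineq4[of "f u - f x - (u - x) *\<^sub>R g x" "f v - f x - (v - x) *\<^sub>R g x"] uv
          by (simp add: algebra_simps)
        moreover have "(f u - f x - (u - x) *\<^sub>R g x) - (f v - f x - (v - x) *\<^sub>R g x) = measure lborel k *\<^sub>R g' x - h k"
          using uv xk(2) by (simp add: h_def g'_def algebra_simps)
        ultimately show ?thesis using uv by simp
      qed
      have b2: "norm (measure lborel k *\<^sub>R g' x - h k) = (if measure lborel k = 0 then 0 else norm (f (Sup k) - f (Inf k)))" if "(x, k) \<in> D2" for x k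
      proof -
        have xk: "(x, k) \<in> D" "x \<in> N" using that by (auto simp: D2_def)
        obtain u v where uv: "k = {u..v}" "u \<le> x" "x \<le> v" using DD[OF xk(1)] by blast
        then show ?thesis using xk(2) by (auto simp: g'_def h_def norm_minus_commute)
      qed
      have "norm ((\<Sum>(x, k)\<in>D. measure lborel k *\<^sub>R g' x) - (f d - f c)) = norm (\<Sum>(x, k)\<in>D. measure lborel k *\<^sub>R g' x - h k)"
        by (simp add: sum_h[symmetric] sum_subtractf split_def)
      also have "\<dots> \<le> (\<Sum>(x, k)\<in>D. norm (measure lborel k *\<^sub>R g' x - h k))"
        by (rule sum_norm_le) auto
      also have "\<dots> = (\<Sum>(x, k)\<in>D1. norm (measure lborel k *\<^sub>R g' x - h k)) + (\<Sum>(x, k)\<in>D2. norm (measure lborel k *\<^sub>R g' x - h k))"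
        unfolding D12(1) by (rule sum.union_disjoint[OF fin12 D12(2)])
      also have "\<dots> < e / 2 + e / 2"
      proof (rule add_le_less_mono[OF less_imp_le])
        have "(\<Sum>(x, k)\<in>D1. norm (measure lborel k *\<^sub>R g' x - h k)) \<le> (\<Sum>(x, k)\<in>D1. e' * measure lborel k)"
          by (rule sum_mono) (use b1 in auto)
        also have "\<dots> \<le> (\<Sum>(x, k)\<in>D. e' * measure lborel k)"
          by (rule sum_mono2[OF finD]) (use D12 e' in auto)
        also have "\<dots> = e' * measure lborel {c..d}"
          using additive_content_tagged_division[of D c d] D by (simp add: sum_distrib_left[symmetric] split_def box_real)
        also have "\<dots> < e / 2" using e' cd by simp
        finally show "(\<Sum>(x, k)\<in>D1. norm (measure lborel k *\<^sub>R g' x - h k)) < e / 2" .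
      next
        have tp: "D2 tagged_partial_division_of {c..d}"
          using D tagged_partial_division_subset[of D "{c..d}" D2] D12(1) by (auto simp: tagged_division_of_def)
        have td: "D2 tagged_division_of \<Union>(snd ` D2)" using tagged_partial_division_of_Union_self[OF tp] .
        have dv: "snd ` D2 division_of \<Union>(snd ` D2)" by (rule division_of_tagged_division[OF td])
        have "(\<Sum>(x, k)\<in>D2. norm (measure lborel k *\<^sub>R g' x - h k)) =
              (\<Sum>(x, k)\<in>D2. if measure lborel k = 0 then 0 else norm (f (Sup k) - f (Inf k)))"
          by (rule sum.cong) (use b2 in auto)
        also have "\<dots> = (\<Sum>k\<in>snd ` D2. if measure lborel k = 0 then 0 else norm (f (Sup k) - f (Inf k)))"
          by (rule sum.over_tagged_division_lemma[OF td]) (simp add: content_eq_0_interior)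
        also have "\<dots> < e / 2"
        proof (rule AC_on_division_small[OF dv _ _ U(3,4) \<delta>(2)])
          show "\<Union>(snd ` D2) \<subseteq> {c..d}" using tagged_division_ofD(3)[of D "{c..d}"] D D12 by fastforce
          show "\<Union>(snd ` D2) \<subseteq> U"
          proof
            fix s assume "s \<in> \<Union>(snd ` D2)"
            then obtain x k where "(x, k) \<in> D" "x \<in> N" "s \<in> k" by (auto simp: D2_def)
            then show "s \<in> U" using DD[of x k] r(2)[of x] by blast
          qed
        qed
        finally show "(\<Sum>(x, k)\<in>D2. norm (measure lborel k *\<^sub>R g' x - h k)) < e / 2" .
      qed
      finally show "norm ((\<Sum>(x, k)\<in>D. measure lborel k *\<^sub>R g' x) - (f d - f c)) < e" by simp
    qed
  qed
  then show ?thesis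
    by (rule has_integral_spike[OF N, rotated]) (auto simp: g'_def)
qed

lemma AC_on_imp_continuous_on:
  fixes f :: "real \<Rightarrow> 'h::real_normed_vector"
  assumes AC: "AC_on c d f"
  shows "continuous_on {c..d} f"
  unfolding continuous_on_iff
proof (intro ballI allI impI)
  fix t and e :: real assume t: "t \<in> {c..d}" and e: "0 < e"
  obtain \<delta> where \<delta>: "0 < \<delta>" "ac_small c d f \<delta> (e)"
    by (rule AC_onD[OF AC e])
  have "dist (f s) (f t) < e" if s: "s \<in> {c..d}" "dist s t < \<delta>" for s
  proof (cases "s \<le> t")
    case True
    then show ?thesis using ac_smallD[OF \<delta>(2), of "{(s, t)}"] s t by (simp add: dist_norm norm_minus_commute)
  next
    case False
    then show ?thesis using ac_smallD[OF \<delta>(2), of "{(t, s)}"] s t by (simp add: dist_norm)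
  qed
  then show "\<exists>\<delta>>0. \<forall>s\<in>{c..d}. dist s t < \<delta> \<longrightarrow> dist (f s) (f t) < e" using \<delta>(1) by blast
qed

text \<open>All closure properties of absolute continuity below reduce to this: an increment is
  bounded by the increments of two absolutely continuous functions.\<close>

lemma AC_onI_dominated:
  fixes f :: "real \<Rightarrow> 'h::real_normed_vector" and u :: "real \<Rightarrow> 'a::real_normed_vector" and v :: "real \<Rightarrow> 'b::real_normed_vector"
  assumes u: "AC_on c d u" and v: "AC_on c d v" and B: "0 \<le> B"
    and le: "\<And>x y. x \<in> {c..d} \<Longrightarrow> y \<in> {c..d} \<Longrightarrow> norm (f y - f x) \<le> B * norm (u y - u x) + B * norm (v y - v x)"
  shows "AC_on c d f"
  unfolding AC_on_def ac_small_def
proof (intro allI impI)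
  fix e :: real assume e: "0 < e"
  have e': "0 < e / (2 * (B + 1))" using e B by simp
  obtain \<delta>1 where \<delta>1: "0 < \<delta>1" "ac_small c d u \<delta>1 (e / (2 * (B + 1)))"
    by (rule AC_onD[OF u e'])
  obtain \<delta>2 where \<delta>2: "0 < \<delta>2" "ac_small c d v \<delta>2 (e / (2 * (B + 1)))"
    by (rule AC_onD[OF v e'])
  show "\<exists>\<delta>>0. \<forall>I. finite I \<and> (\<forall>(x, y)\<in>I. c \<le> x \<and> x \<le> y \<and> y \<le> d) \<and>
      pairwise (\<lambda>(x, y) (x', y'). {x<..<y} \<inter> {x'<..<y'} = {}) I \<and>
      (\<Sum>(x, y)\<in>I. y - x) < \<delta> \<longrightarrow> (\<Sum>(x, y)\<in>I. norm (f y - f x)) < e"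
  proof (intro exI[of _ "min \<delta>1 \<delta>2"] conjI allI impI)
    fix I assume I: "finite I \<and> (\<forall>(x, y)\<in>I. c \<le> x \<and> x \<le> y \<and> y \<le> d) \<and>
      pairwise (\<lambda>(x, y) (x', y'). {x<..<y} \<inter> {x'<..<y'} = {}) I \<and>
      (\<Sum>(x, y)\<in>I. y - x) < min \<delta>1 \<delta>2"
    have s: "(\<Sum>(x, y)\<in>I. norm (u y - u x)) < e / (2 * (B + 1))" "(\<Sum>(x, y)\<in>I. norm (v y - v x)) < e / (2 * (B + 1))"
      using ac_smallD[OF \<delta>1(2), of I] ac_smallD[OF \<delta>2(2), of I] I by auto
    have "(\<Sum>(x, y)\<in>I. norm (f y - f x)) \<le> (\<Sum>(x, y)\<in>I. B * norm (u y - u x) + B * norm (v y - v x))"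
      by (rule sum_mono) (use I le in fastforce)
    also have "\<dots> = B * (\<Sum>(x, y)\<in>I. norm (u y - u x)) + B * (\<Sum>(x, y)\<in>I. norm (v y - v x))"
      by (simp add: sum.distrib sum_distrib_left split_def)
    also have "\<dots> \<le> B * (e / (2 * (B + 1))) + B * (e / (2 * (B + 1)))"
      using s B by (intro add_mono mult_left_mono) auto
    also have "\<dots> < e"
    proof -
      have "B * (e / (2 * (B + 1))) = (e / 2) * (B / (B + 1))" by simp
      also have "\<dots> < (e / 2) * 1" using e B by (intro mult_strict_left_mono) (auto simp: divide_less_eq)
      finally show ?thesis by linarith
    qed
    finally show "(\<Sum>(x, y)\<in>I. norm (f y - f x)) < e" .
  qed (use \<delta>1 \<delta>2 in simp)
qed

lemma AC_on_id: "AC_on c d (\<lambda>t. t)"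
  unfolding AC_on_def ac_small_def
proof (intro allI impI)
  fix e :: real assume "0 < e"
  moreover have "(\<Sum>(x, y)\<in>I. norm (y - x)) = (\<Sum>(x, y)\<in>I. y - x)" if "\<forall>(x, y)\<in>I. c \<le> x \<and> x \<le> y \<and> y \<le> d" for I
    by (rule sum.cong) (use that in auto)
  ultimately show "\<exists>\<delta>>0. \<forall>I. finite I \<and> (\<forall>(x, y)\<in>I. c \<le> x \<and> x \<le> y \<and> y \<le> d) \<and>
      pairwise (\<lambda>(x, y) (x', y'). {x<..<y} \<inter> {x'<..<y'} = {}) I \<and>
      (\<Sum>(x, y)\<in>I. y - x) < \<delta> \<longrightarrow> (\<Sum>(x, y)\<in>I. norm (y - x)) < e"
    by (intro exI[of _ e]) auto
qed

lemma AC_on_Lipschitz: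
  fixes f :: "real \<Rightarrow> 'h::real_normed_vector"
  assumes "0 \<le> B" "\<And>x y. x \<in> {c..d} \<Longrightarrow> y \<in> {c..d} \<Longrightarrow> norm (f y - f x) \<le> B * \<bar>y - x\<bar>"
  shows "AC_on c d f"
proof (rule AC_onI_dominated[OF AC_on_id AC_on_id assms(1)])
  fix x y assume "x \<in> {c..d}" "y \<in> {c..d}"
  moreover have "0 \<le> B * \<bar>y - x\<bar>" using assms(1) by simp
  ultimately show "norm (f y - f x) \<le> B * norm (y - x) + B * norm (y - x)" using assms(2)[of x y] by simp
qed

lemma AC_on_bilinear:
  fixes prod :: "'a::real_normed_vector \<Rightarrow> 'b::real_normed_vector \<Rightarrow> 'h::real_normed_vector"
  assumes bil: "bounded_bilinear prod" and u: "AC_on c d u" and v: "AC_on c d v"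
  shows "AC_on c d (\<lambda>t. prod (u t) (v t))"
proof -
  interpret bounded_bilinear prod by fact
  obtain K where K: "0 < K" "\<And>a b. norm (prod a b) \<le> norm a * norm b * K" using pos_bounded by blast
  have "bounded (u ` {c..d})" "bounded (v ` {c..d})"
    using AC_on_imp_continuous_on[OF u] AC_on_imp_continuous_on[OF v]
    by (auto intro!: compact_imp_bounded compact_continuous_image)
  then obtain A B where AB: "0 < A" "\<And>t. t \<in> {c..d} \<Longrightarrow> norm (u t) \<le> A" "0 < B" "\<And>t. t \<in> {c..d} \<Longrightarrow> norm (v t) \<le> B"
    unfolding bounded_pos by blast
  show ?thesis
  proof (rule AC_onI_dominated[OF u v])
    show "0 \<le> (A + B) * K" using AB K by simp
    fix x y assume xy: "x \<in> {c..d}" "y \<in> {c..d}"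
    have "prod (u y) (v y) - prod (u x) (v x) = prod (u y - u x) (v y) + prod (u x) (v y - v x)"
      by (simp add: diff_left diff_right)
    also have "norm \<dots> \<le> norm (u y - u x) * norm (v y) * K + norm (u x) * norm (v y - v x) * K"
      by (rule norm_triangle_le[OF add_mono[OF K(2) K(2)]])
    also have "\<dots> \<le> norm (u y - u x) * (A + B) * K + (A + B) * norm (v y - v x) * K"
      using AB(2)[OF xy(1)] AB(4)[OF xy(2)] AB(1,3) K(1)
      by (intro add_mono mult_right_mono mult_left_mono) auto
    finally show "norm (prod (u y) (v y) - prod (u x) (v x)) \<le> (A + B) * K * norm (u y - u x) + (A + B) * K * norm (v y - v x)"
      by (simp add: ac_simps)
  qed
qed

lemma AC_on_add:
  assumes "AC_on c d u" "AC_on c d v"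
  shows "AC_on c d (\<lambda>t. u t + v t)"
  by (rule AC_onI_dominated[OF assms, of 1])
     (auto simp: add_diff_add intro: norm_triangle_ineq)

lemma AC_on_linear:
  assumes h: "bounded_linear h" and u: "AC_on c d u"
  shows "AC_on c d (\<lambda>t. h (u t))"
proof -
  obtain K where K: "0 < K" "\<And>x. norm (h x) \<le> norm x * K" using bounded_linear.pos_bounded[OF h] by blast
  show ?thesis
    by (rule AC_onI_dominated[OF u u, of K])
       (use K in \<open>auto simp: linear_simps[OF h, symmetric] mult.commute intro: order_trans[OF K(2)]\<close>)
qed

lemma AC_on_const: "AC_on c d (\<lambda>t. k)"
  by (rule AC_on_Lipschitz[of 0]) auto

lemma AC_on_sum: "finite A \<Longrightarrow> (\<And>i. i \<in> A \<Longrightarrow> AC_on c d (u i)) \<Longrightarrow> AC_on c d (\<lambda>t. \<Sum>i\<in>A. u i t)"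
  by (induction A rule: finite_induct) (auto intro: AC_on_const AC_on_add)

lemma AC_on_C1:
  fixes f :: "real \<Rightarrow> 'h::real_normed_vector"
  assumes d: "\<And>t. t \<in> {c..d} \<Longrightarrow> (f has_vector_derivative f' t) (at t within {c..d})" and f': "continuous_on {c..d} f'"
  shows "AC_on c d f"
proof -
  have "bounded (f' ` {c..d})" using f' by (auto intro!: compact_imp_bounded compact_continuous_image)
  then obtain B where B: "0 < B" "\<And>t. t \<in> {c..d} \<Longrightarrow> norm (f' t) \<le> B" unfolding bounded_pos by blast
  show ?thesis
  proof (rule AC_on_Lipschitz)
    show "0 \<le> B" using B by simp
    fix x y assume xy: "x \<in> {c..d}" "y \<in> {c..d}"
    have "norm (f y - f x) \<le> B * norm (y - x)"
    proof (rule differentiable_bound[of "{c..d}" f "\<lambda>t h. h *\<^sub>R f' t"])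
      show "onorm (\<lambda>h. h *\<^sub>R f' t) \<le> B" if "t \<in> {c..d}" for t
        using B(2)[OF that] by (intro onorm_le) (metis mult.commute mult_right_mono norm_ge_zero norm_scaleR real_norm_def)
    qed (use d xy in \<open>auto simp: has_vector_derivative_def\<close>)
    then show "norm (f y - f x) \<le> B * \<bar>y - x\<bar>" by simp
  qed
qed

subsection \<open>Square integrable functions\<close>

lemma AE_lebesgue_on_iff:
  assumes "S \<in> sets lebesgue"
  shows "(AE t in lebesgue_on S. P t) \<longleftrightarrow> negligible {t\<in>S. \<not> P t}"
proof -
  have "(AE t in lebesgue_on S. P t) \<longleftrightarrow> (AE t in lebesgue. t \<in> S \<longrightarrow> P t)"
    by (rule AE_restrict_space_iff) (use assms in simp)
  also have "\<dots> \<longleftrightarrow> negligible {t\<in>S. \<not> P t}"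
  proof
    assume "AE t in lebesgue. t \<in> S \<longrightarrow> P t"
    then obtain N where N: "\<And>t. t \<notin> N \<Longrightarrow> t \<in> S \<longrightarrow> P t" "N \<in> null_sets lebesgue"
      by (rule AE_E3) auto
    then have "negligible N" by (simp add: negligible_iff_null_sets)
    moreover have "{t\<in>S. \<not> P t} \<subseteq> N" using N(1) by blast
    ultimately show "negligible {t\<in>S. \<not> P t}" by (rule negligible_subset)
  next
    assume "negligible {t\<in>S. \<not> P t}"
    then show "AE t in lebesgue. t \<in> S \<longrightarrow> P t"
      by (intro AE_I'[of "{t\<in>S. \<not> P t}"]) (auto simp: negligible_iff_null_sets)
  qed
  finally show ?thesis .
qed

text \<open>Lebesgue measure is complete: all subsets of the exceptional null set are
  measurable.\<close>

lemma borel_measurable_lebesgue_on_cong_AE: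
  fixes f g :: "real \<Rightarrow> 'a::topological_space"
  assumes S: "S \<in> sets lebesgue" and f: "f \<in> borel_measurable (lebesgue_on S)"
    and ae: "AE t in lebesgue_on S. f t = g t"
  shows "g \<in> borel_measurable (lebesgue_on S)"
proof (rule measurableI)
  fix A :: "'a set" assume A: "A \<in> sets borel"
  define N where "N = {t\<in>S. f t \<noteq> g t}"
  have N: "negligible N" using ae by (simp add: AE_lebesgue_on_iff[OF S] N_def)
  then have meas: "B \<in> sets lebesgue" if "B \<subseteq> N" for B
    using negligible_subset[OF N that] by (simp add: negligible_imp_sets)
  have "f -` A \<inter> S \<in> sets (lebesgue_on S)" using measurable_sets[OF f A] by simp
  then have fA: "f -` A \<inter> S \<in> sets lebesgue" using S by (simp add: sets_restrict_space_iff)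
  have "g -` A \<inter> S = (f -` A \<inter> S - N) \<union> (g -` A \<inter> N)" by (auto simp: N_def)
  also have "\<dots> \<in> sets lebesgue" using fA meas[of N] meas[of "g -` A \<inter> N"] by auto
  finally show "g -` A \<inter> space (lebesgue_on S) \<in> sets (lebesgue_on S)"
    using S by (simp add: sets_restrict_space_iff)
qed simp

definition ip :: "real set \<Rightarrow> (real \<Rightarrow> 'h::complex_inner) \<Rightarrow> (real \<Rightarrow> 'h) \<Rightarrow> complex" where
  "ip \<Delta> y z = (LINT t|lebesgue_on \<Delta>. cinner (y t) (z t))"

definition nrm :: "real set \<Rightarrow> (real \<Rightarrow> 'h::complex_inner) \<Rightarrow> real" where
  "nrm \<Delta> y = sqrt (LINT t|lebesgue_on \<Delta>. (norm (y t))\<^sup>2)"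

lemma L2_cong_AE:
  fixes f g :: "real \<Rightarrow> 'h::{complex_inner, second_countable_topology}"
  assumes S: "S \<in> sets lebesgue" and f: "L2 S f" and ae: "AE t in lebesgue_on S. f t = g t"
  shows "L2 S g"
proof -
  have g: "g \<in> borel_measurable (lebesgue_on S)"
    using borel_measurable_lebesgue_on_cong_AE[OF S _ ae] f by (simp add: L2_def)
  moreover have "integrable (lebesgue_on S) (\<lambda>t. (norm (g t))\<^sup>2)"
    by (rule integrable_cong_AE_imp[of _ "\<lambda>t. (norm (f t))\<^sup>2"])
       (use f g ae in \<open>auto simp: L2_def elim: eventually_mono\<close>)
  ultimately show ?thesis by (simp add: L2_def)
qed

context
  fixes S :: "real set"
begin

text \<open>Second countability of the space, that is separability, makes the pairing of two
  measurable functions measurable; the sum of the squared norms dominates it.\<close>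

lemma L2_integrable_cinner:
  fixes y z :: "real \<Rightarrow> 'h::{complex_inner, second_countable_topology}"
  assumes "L2 S y" "L2 S z"
  shows "integrable (lebesgue_on S) (\<lambda>t. cinner (y t) (z t))"
proof (rule Bochner_Integration.integrable_bound)
  show "integrable (lebesgue_on S) (\<lambda>t. (norm (y t))\<^sup>2 + (norm (z t))\<^sup>2)"
    using assms by (simp add: L2_def)
  show "(\<lambda>t. cinner (y t) (z t)) \<in> borel_measurable (lebesgue_on S)"
    by (rule borel_measurable_continuous_Pair)
       (use assms in \<open>auto simp: L2_def split_def intro!: bounded_bilinear.continuous_on[OF bounded_bilinear_cinner]
         continuous_intros\<close>)
  have "norm (cinner (y t) (z t)) \<le> (norm (y t))\<^sup>2 + (norm (z t))\<^sup>2" for t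
  proof -
    have "norm (cinner (y t) (z t)) \<le> norm (y t) * norm (z t)" by (rule cinner_Cauchy_Schwarz)
    also have "\<dots> \<le> (norm (y t))\<^sup>2 + (norm (z t))\<^sup>2"
      using sum_squares_bound[of "norm (y t)" "norm (z t)"] by (simp add: mult.assoc)
        (smt (verit) mult_nonneg_nonneg norm_ge_zero)
    finally show ?thesis .
  qed
  then show "AE t in lebesgue_on S. norm (cinner (y t) (z t)) \<le> norm ((norm (y t))\<^sup>2 + (norm (z t))\<^sup>2)"
    by (intro AE_I2) simp
qed

lemma L2_scaleC:
  fixes y :: "real \<Rightarrow> 'h::{complex_inner, second_countable_topology}"
  assumes "L2 S y"
  shows "L2 S (\<lambda>t. c *\<^sub>C y t)"
proof -
  have "continuous_on UNIV (\<lambda>x::'h. c *\<^sub>C x)" by (rule linear_continuous_on[OF bounded_linear_scaleC])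
  then have "(\<lambda>t. c *\<^sub>C y t) \<in> borel_measurable (lebesgue_on S)"
    using assms borel_measurable_continuous_on by (auto simp: L2_def)
  then show ?thesis using assms by (simp add: L2_def power_mult_distrib)
qed

lemma L2_add:
  fixes y :: "real \<Rightarrow> 'h::{complex_inner, second_countable_topology}"
  assumes "L2 S y" "L2 S z"
  shows "L2 S (\<lambda>t. y t + z t)"
proof -
  have m: "(\<lambda>t. y t + z t) \<in> borel_measurable (lebesgue_on S)" using assms by (auto simp: L2_def)
  have "integrable (lebesgue_on S) (\<lambda>t. (norm (y t + z t))\<^sup>2)"
  proof (rule Bochner_Integration.integrable_bound)
    show "integrable (lebesgue_on S) (\<lambda>t. 2 * (norm (y t))\<^sup>2 + 2 * (norm (z t))\<^sup>2)"
      using assms by (simp add: L2_def)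
    have "(norm (y t + z t))\<^sup>2 \<le> 2 * (norm (y t))\<^sup>2 + 2 * (norm (z t))\<^sup>2" for t
    proof -
      have "0 \<le> (norm (y t - z t))\<^sup>2" by simp
      then show ?thesis by (simp add: power2_norm_eq_inner inner_add inner_diff inner_commute)
    qed
    then show "AE t in lebesgue_on S. norm ((norm (y t + z t))\<^sup>2) \<le> norm (2 * (norm (y t))\<^sup>2 + 2 * (norm (z t))\<^sup>2)"
      by (intro AE_I2) simp
  qed (use m in simp)
  then show ?thesis using m by (simp add: L2_def)
qed

lemma nrm_nonneg: "0 \<le> nrm S y"
  by (simp add: nrm_def)

lemma nrm_sq: "(nrm S y)\<^sup>2 = (LINT t|lebesgue_on S. (norm (y t))\<^sup>2)"
  by (simp add: nrm_def)

lemma ip_self: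
  fixes y :: "real \<Rightarrow> 'h::{complex_inner, second_countable_topology}"
  shows "ip S y y = of_real ((nrm S y)\<^sup>2)"
  unfolding ip_def nrm_sq cinner_self by (rule integral_complex_of_real)

lemma nrm_cong_AE:
  assumes "AE t in lebesgue_on S. f t = g t" "L2 S f" "L2 S g"
  shows "nrm S f = nrm S g"
  unfolding nrm_def
  by (intro arg_cong[where f = sqrt] integral_cong_AE) (use assms in \<open>auto simp: L2_def elim: eventually_mono\<close>)

lemma nrm_scaleC: "nrm S (\<lambda>t. c *\<^sub>C y t) = cmod c * nrm S y"
  by (simp add: nrm_def power_mult_distrib real_sqrt_mult)

lemma ip_add_left:
  fixes y :: "real \<Rightarrow> 'h::{complex_inner, second_countable_topology}"
  shows "L2 S y \<Longrightarrow> L2 S z \<Longrightarrow> L2 S w \<Longrightarrow> ip S (\<lambda>t. y t + z t) w = ip S y w + ip S z w"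
  by (simp add: ip_def cinner_add_left L2_integrable_cinner)

lemma ip_scaleC_left: "ip S (\<lambda>t. c *\<^sub>C y t) w = c * ip S y w"
  by (simp add: ip_def cinner_scaleC_left)

lemma ip_scaleC_right: "ip S y (\<lambda>t. c *\<^sub>C w t) = cnj c * ip S y w"
  by (simp add: ip_def cinner_scaleC_right)

lemma ip_cong_AE:
  fixes f g z :: "real \<Rightarrow> 'h::{complex_inner, second_countable_topology}"
  assumes "AE t in lebesgue_on S. f t = g t" "L2 S f" "L2 S g" "L2 S z"
  shows "ip S f z = ip S g z" "ip S z f = ip S z g"
  unfolding ip_def
  using L2_integrable_cinner[OF assms(2,4)] L2_integrable_cinner[OF assms(3,4)]
    L2_integrable_cinner[OF assms(4,2)] L2_integrable_cinner[OF assms(4,3)] assms(1)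
  by (auto intro!: integral_cong_AE elim: eventually_mono)

text \<open>Turns a weighted arithmetic-geometric inequality, which can be integrated pointwise,
  into the Cauchy-Schwarz form.\<close>

lemma AM_GM_all_imp:
  assumes "\<And>s. 0 < s \<Longrightarrow> 2 * a \<le> s * A\<^sup>2 + B\<^sup>2 / s" "0 \<le> A" "0 \<le> (B::real)"
  shows "a \<le> A * B"
proof (rule field_le_epsilon)
  fix e :: real assume e: "0 < e"
  define d where "d = (e / 2) / (A + B + 1)"
  have AB: "0 < A + B + 1" using assms by linarith
  have d: "0 < d" using e AB by (simp add: d_def)
  \<comment> \<open>The optimal weight is \<open>B / A\<close>; shifting both by \<open>d\<close>
    avoids division by zero and costs at most \<open>d * (A + B)\<close>.\<close>
  define s where "s = (B + d) / (A + d)"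
  have s: "0 < s" using assms d by (simp add: s_def add_nonneg_pos)
  have "A\<^sup>2 \<le> A * (A + d)" "B\<^sup>2 \<le> B * (B + d)" using assms d by (auto simp: power2_eq_square intro!: mult_left_mono)
  have "s * A\<^sup>2 \<le> s * (A * (A + d))" using s \<open>A\<^sup>2 \<le> A * (A + d)\<close> by (intro mult_left_mono) auto
  also have "\<dots> = A * (B + d)" using assms d by (simp add: s_def field_simps add_nonneg_eq_0_iff)
  finally have 1: "s * A\<^sup>2 \<le> A * (B + d)" .
  have "B\<^sup>2 / s \<le> B * (B + d) / s" using s \<open>B\<^sup>2 \<le> B * (B + d)\<close> by (intro divide_right_mono) auto
  also have "\<dots> = B * (A + d)" using assms d by (simp add: s_def field_simps add_nonneg_eq_0_iff)
  finally have "2 * a \<le> 2 * (A * B) + d * (A + B)" using 1 assms(1)[OF s] by (simp add: algebra_simps)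
  moreover have "d * (A + B) \<le> d * (A + B + 1)" using d by (intro mult_left_mono) auto
  moreover have "d * (A + B + 1) = e / 2" unfolding d_def using AB by (intro nonzero_eq_divide_eq[THEN iffD1]) auto
  ultimately show "a \<le> A * B + e" using e by linarith
qed

lemma norm_integral_mult_le:
  fixes y z :: "real \<Rightarrow> 'h::{complex_inner, second_countable_topology}"
  assumes "L2 S y" "L2 S z"
  shows "(LINT t|lebesgue_on S. norm (cinner (y t) (z t))) \<le> nrm S y * nrm S z"
proof (rule AM_GM_all_imp)
  fix s :: real assume s: "0 < s"
  have i: "integrable (lebesgue_on S) (\<lambda>t. norm (cinner (y t) (z t)))"
    using L2_integrable_cinner[OF assms] by simp
  have "2 * (LINT t|lebesgue_on S. norm (cinner (y t) (z t))) = (LINT t|lebesgue_on S. 2 * norm (cinner (y t) (z t)))"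
    by simp
  also have "\<dots> \<le> (LINT t|lebesgue_on S. s * (norm (y t))\<^sup>2 + (norm (z t))\<^sup>2 / s)"
  proof (rule integral_mono)
    fix t
    have "norm (cinner (y t) (z t)) \<le> norm (y t) * norm (z t)" by (rule cinner_Cauchy_Schwarz)
    moreover have "2 * (norm (y t) * norm (z t)) \<le> s * (norm (y t))\<^sup>2 + (norm (z t))\<^sup>2 / s"
    proof -
      have "0 \<le> (s * norm (y t) - norm (z t))\<^sup>2 / s" using s by simp
      also have "\<dots> = s * (norm (y t))\<^sup>2 - 2 * (norm (y t) * norm (z t)) + (norm (z t))\<^sup>2 / s"
        using s by (simp add: power2_eq_square field_simps)
      finally show ?thesis by simp
    qed
    ultimately show "2 * norm (cinner (y t) (z t)) \<le> s * (norm (y t))\<^sup>2 + (norm (z t))\<^sup>2 / s" by linarith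
  qed (use i assms in \<open>auto simp: L2_def\<close>)
  also have "\<dots> = s * (nrm S y)\<^sup>2 + (nrm S z)\<^sup>2 / s"
    using assms by (simp add: nrm_sq L2_def)
  finally show "2 * (LINT t|lebesgue_on S. norm (cinner (y t) (z t))) \<le> s * (nrm S y)\<^sup>2 + (nrm S z)\<^sup>2 / s" .
qed (auto simp: nrm_nonneg)

lemma ip_Cauchy_Schwarz:
  fixes y z :: "real \<Rightarrow> 'h::{complex_inner, second_countable_topology}"
  assumes "L2 S y" "L2 S z"
  shows "cmod (ip S y z) \<le> nrm S y * nrm S z"
  unfolding ip_def using integral_norm_bound norm_integral_mult_le[OF assms] by (rule order_trans)

lemma nrm_triangle:
  fixes y z :: "real \<Rightarrow> 'h::{complex_inner, second_countable_topology}"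
  assumes "L2 S y" "L2 S z"
  shows "nrm S (\<lambda>t. y t + z t) \<le> nrm S y + nrm S z"
proof (rule power2_le_imp_le)
  have "(nrm S (\<lambda>t. y t + z t))\<^sup>2 = (LINT t|lebesgue_on S. (norm (y t))\<^sup>2 + (2 * Re (cinner (y t) (z t)) + (norm (z t))\<^sup>2))"
    unfolding nrm_sq norm_add_sq by (simp add: add.assoc)
  also have "\<dots> = (nrm S y)\<^sup>2 + (2 * Re (ip S y z) + (nrm S z)\<^sup>2)"
    using assms L2_integrable_cinner[OF assms] by (simp add: nrm_sq ip_def L2_def)
  also have "\<dots> \<le> (nrm S y)\<^sup>2 + (2 * (nrm S y * nrm S z) + (nrm S z)\<^sup>2)"
    using complex_Re_le_cmod[of "ip S y z"] ip_Cauchy_Schwarz[OF assms] by linarith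
  also have "\<dots> = (nrm S y + nrm S z)\<^sup>2" by (simp add: power2_eq_square algebra_simps)
  finally show "(nrm S (\<lambda>t. y t + z t))\<^sup>2 \<le> (nrm S y + nrm S z)\<^sup>2" .
qed (simp add: nrm_nonneg)

end

subsection \<open>Improper integrals\<close>

lemma interval_uptoD:
  assumes "interval_upto b \<Delta>"
  shows "0 \<in> \<Delta>" "t \<in> \<Delta> \<Longrightarrow> 0 \<le> t" "t \<in> \<Delta> \<Longrightarrow> ereal t \<le> b" "0 \<le> t \<Longrightarrow> ereal t < b \<Longrightarrow> t \<in> \<Delta>"
    "\<Delta> \<in> sets lebesgue" "ereal t < b \<Longrightarrow> {0..t} \<subseteq> \<Delta>" "0 < b" "{c..d} \<subseteq> {0..} \<Longrightarrow> d \<in> \<Delta> \<Longrightarrow> {c..d} \<subseteq> \<Delta>"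
proof -
  have b: "0 < b" and cases: "\<Delta> = {t. 0 \<le> t \<and> ereal t < b} \<or> b < \<infinity> \<and> \<Delta> = {t. 0 \<le> t \<and> ereal t \<le> b}"
    using assms by (auto simp: interval_upto_def)
  show "0 \<in> \<Delta>" "t \<in> \<Delta> \<Longrightarrow> 0 \<le> t" "t \<in> \<Delta> \<Longrightarrow> ereal t \<le> b" "0 \<le> t \<Longrightarrow> ereal t < b \<Longrightarrow> t \<in> \<Delta>" "0 < b"
    using cases b by (auto simp flip: zero_ereal_def)
  show "ereal t < b \<Longrightarrow> {0..t} \<subseteq> \<Delta>" "{c..d} \<subseteq> {0..} \<Longrightarrow> d \<in> \<Delta> \<Longrightarrow> {c..d} \<subseteq> \<Delta>"
  proof -
    have *: "ereal x < b" if "ereal y < b" "x \<le> y" for x y using that by (meson ereal_less_eq(3) le_less_trans)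
    have **: "ereal x \<le> b" if "ereal y \<le> b" "x \<le> y" for x y using that by (meson ereal_less_eq(3) order_trans)
    show "{0..t} \<subseteq> \<Delta>" if "ereal t < b"
    proof
      fix x assume "x \<in> {0..t}"
      then have "0 \<le> x" "ereal x < b" using *[OF that] by auto
      then show "x \<in> \<Delta>" using cases by auto
    qed
    show "{c..d} \<subseteq> {0..} \<Longrightarrow> d \<in> \<Delta> \<Longrightarrow> {c..d} \<subseteq> \<Delta>" using cases * ** by (auto dest: less_imp_le)
  qed
  have "\<Delta> = {0..} \<or> \<Delta> = {0..<real_of_ereal b} \<or> \<Delta> = {0..real_of_ereal b}"
    using cases b by (cases b) auto
  then show "\<Delta> \<in> sets lebesgue" by auto
qed

lemma left_of_eventually:
  assumes "0 < b"
  shows "\<forall>\<^sub>F \<eta> in left_of b. 0 \<le> \<eta> \<and> ereal \<eta> < b"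
    "ereal c < b \<Longrightarrow> \<forall>\<^sub>F \<eta> in left_of b. c < \<eta>"
proof -
  show ev: "\<forall>\<^sub>F \<eta> in left_of b. c < \<eta>" if "ereal c < b" for c
  proof (cases b)
    case (real r)
    then have "c < r" using that by simp
    then show ?thesis using real eventually_at_left[of c r] by (auto simp: left_of_def)
  qed (use that in \<open>auto simp: left_of_def eventually_gt_at_top\<close>)
  have "\<forall>\<^sub>F \<eta> in left_of b. ereal \<eta> < b"
  proof (cases b)
    case (real r)
    then show ?thesis by (auto simp: left_of_def eventually_at_filter)
  qed (use assms in auto)
  with ev[of 0] assms show "\<forall>\<^sub>F \<eta> in left_of b. 0 \<le> \<eta> \<and> ereal \<eta> < b"
    by (auto simp flip: zero_ereal_def elim: eventually_elim2)
qed

lemma left_of_nontrivial: "left_of b \<noteq> bot"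
  by (auto simp: left_of_def trivial_limit_at_top_linorder)

lemma integral_upto_eq:
  fixes F :: "real \<Rightarrow> complex"
  assumes I: "interval_upto b \<Delta>" and F: "integrable (lebesgue_on \<Delta>) F" and \<eta>: "ereal \<eta> < b"
  shows "integral {0..\<eta>} F = (LINT t|lebesgue_on \<Delta>. indicator {0..\<eta>} t *\<^sub>R F t)"
proof -
  note S = interval_uptoD[OF I]
  have sub: "{0..\<eta>} \<subseteq> \<Delta>" by (rule S(6)[OF \<eta>])
  have meas: "{0..\<eta>} \<in> sets (lebesgue_on \<Delta>)"
    using sub S(5) by (simp add: sets_restrict_space_iff)
  have "(LINT t|lebesgue_on \<Delta>. indicator {0..\<eta>} t *\<^sub>R F t) = integral \<Delta> (\<lambda>t. indicator {0..\<eta>} t *\<^sub>R F t)"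
    by (rule lebesgue_integral_eq_integral[OF integrable_mult_indicator[OF meas F] S(5)])
  also have "\<dots> = integral \<Delta> (\<lambda>t. if t \<in> {0..\<eta>} then F t else 0)"
    by (rule integral_cong) (simp add: indicator_def)
  also have "\<dots> = integral {0..\<eta>} F"
    using Henstock_Kurzweil_Integration.integral_restrict_Int[of \<Delta> "{0..\<eta>}" F] sub by (simp add: Int_absorb2)
  finally show ?thesis ..
qed

text \<open>Dominated convergence along an arbitrary sequence that approaches \<open>b\<close>, the
  integrand itself being the dominating function.\<close>

lemma tendsto_integral_upto:
  fixes F :: "real \<Rightarrow> complex"
  assumes I: "interval_upto b \<Delta>" and F: "integrable (lebesgue_on \<Delta>) F"
  shows "((\<lambda>\<eta>. integral {0..\<eta>} F) \<longlongrightarrow> (LINT t|lebesgue_on \<Delta>. F t)) (left_of b)"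
proof -
  note S = interval_uptoD[OF I]
  have key: "(\<lambda>n. integral {0..X n} F) \<longlonglongrightarrow> (LINT t|lebesgue_on \<Delta>. F t)"
    if X: "\<And>n. ereal (X n) < b" "\<And>t. ereal t < b \<Longrightarrow> \<forall>\<^sub>F n in sequentially. t \<le> X n" for X :: "nat \<Rightarrow> real"
  proof -
    have m: "{0..X n} \<in> sets (lebesgue_on \<Delta>)" for n
      using S(5) S(6)[OF X(1)] by (simp add: sets_restrict_space_iff)
    have "(\<lambda>n. LINT t|lebesgue_on \<Delta>. indicator {0..X n} t *\<^sub>R F t) \<longlonglongrightarrow> (LINT t|lebesgue_on \<Delta>. F t)"
    proof (rule integral_dominated_convergence[where w = "\<lambda>t. norm (F t)"])
      show "(\<lambda>t. indicator {0..X n} t *\<^sub>R F t) \<in> borel_measurable (lebesgue_on \<Delta>)" for n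
        using integrable_mult_indicator[OF m F] by auto
      show "AE t in lebesgue_on \<Delta>. (\<lambda>n. indicator {0..X n} t *\<^sub>R F t) \<longlonglongrightarrow> F t"
        unfolding AE_lebesgue_on_iff[OF S(5)]
      \<comment> \<open>If \<Delta> contains its end point \<open>b\<close>, that point is in none
        of the intervals \<open>{0..X n}\<close>. For infinite \<open>b\<close> the exceptional set
        is \<open>{0}\<close>, which is harmless.\<close>
      proof (rule negligible_subset[of "{real_of_ereal b}"])
        show "{t \<in> \<Delta>. \<not> (\<lambda>n. indicator {0..X n} t *\<^sub>R F t) \<longlonglongrightarrow> F t} \<subseteq> {real_of_ereal b}"
        proof (rule subsetI, rule ccontr)
          fix t assume t: "t \<in> {t \<in> \<Delta>. \<not> (\<lambda>n. indicator {0..X n} t *\<^sub>R F t) \<longlonglongrightarrow> F t}" and "t \<notin> {real_of_ereal b}"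
          then have "ereal t \<noteq> b" by auto
          then have "ereal t < b" using S(3)[of t] t by auto
          then have "\<forall>\<^sub>F n in sequentially. indicator {0..X n} t *\<^sub>R F t = F t"
          proof (rule eventually_mono[OF X(2)])
            fix n assume "t \<le> X n"
            moreover have "0 \<le> t" using S(2)[of t] t by simp
            ultimately show "indicator {0..X n} t *\<^sub>R F t = F t" by simp
          qed
          then have "(\<lambda>n. indicator {0..X n} t *\<^sub>R F t) \<longlonglongrightarrow> F t" by (rule tendsto_eventually)
          then show False using t by simp
        qed
      qed simp
    qed (use F in \<open>auto split: split_indicator\<close>)
    then show ?thesis by (simp add: integral_upto_eq[OF I F X(1)])
  qed
  show ?thesis
  proof (cases b)
    case (real r)
    then have "0 < r" using S(7) by simp
    have "((\<lambda>\<eta>. integral {0..\<eta>} F) \<longlongrightarrow> (LINT t|lebesgue_on \<Delta>. F t)) (at_left r)"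
    proof (rule tendsto_at_left_sequentially[OF \<open>0 < r\<close>])
      fix X :: "nat \<Rightarrow> real" assume X: "\<And>n. X n < r" "incseq X" "X \<longlonglongrightarrow> r"
      show "(\<lambda>n. integral {0..X n} F) \<longlonglongrightarrow> (LINT t|lebesgue_on \<Delta>. F t)"
      proof (rule key)
        show "ereal (X n) < b" for n using X(1)[of n] real by simp
        show "\<forall>\<^sub>F n in sequentially. t \<le> X n" if "ereal t < b" for t
        proof -
          have "t < r" using that real by simp
          from order_tendstoD(1)[OF X(3) this] show ?thesis by (rule eventually_mono) simp
        qed
      qed
    qed
    then show ?thesis using real by (simp add: left_of_def)
  next
    case PInf
    have "((\<lambda>\<eta>. integral {0..\<eta>} F) \<longlongrightarrow> (LINT t|lebesgue_on \<Delta>. F t)) at_top"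
    proof (rule tendsto_at_topI_sequentially)
      fix X :: "nat \<Rightarrow> real" assume X: "filterlim X at_top sequentially"
      show "(\<lambda>n. integral {0..X n} F) \<longlonglongrightarrow> (LINT t|lebesgue_on \<Delta>. F t)"
      proof (rule key)
        show "\<forall>\<^sub>F n in sequentially. t \<le> X n" for t using X unfolding filterlim_at_top by blast
      qed (simp add: PInf)
    qed
    then show ?thesis using PInf by (simp add: left_of_def)
  qed (use S(7) in auto)
qed

subsection \<open>Quasi-derivatives\<close>

lemma interval_upto_no_isolated:
  assumes I: "interval_upto b \<Delta>" and t: "t \<in> \<Delta>"
  shows "at t within \<Delta> \<noteq> bot"
proof -
  note S = interval_uptoD[OF I]
  have "\<exists>c d. c < d \<and> t \<in> {c..d} \<and> {c..d} \<subseteq> \<Delta>"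
  proof (cases "t = 0")
    case True
    obtain d where "0 < d" "ereal d < b" using S(7) ereal_dense2[of 0 b] by (auto simp flip: zero_ereal_def)
    then show ?thesis using True S(6)[of d] by (intro exI[of _ 0] exI[of _ d]) auto
  next
    case False
    then show ?thesis using S(2)[OF t] S(8)[of 0 t] t by (intro exI[of _ 0] exI[of _ t]) auto
  qed
  then obtain c d where cd: "c < d" "t \<in> {c..d}" "{c..d} \<subseteq> \<Delta>" by blast
  then have "at t within {c..d} \<noteq> bot" using trivial_limit_within islimpt_Icc[of c d t] by (metis trivial_limit_def)
  then show ?thesis using at_le[OF cd(3), of t] by (metis bot.extremum_uniqueI)
qed

locale quasi =
  fixes n :: nat and b :: ereal and \<Delta> :: "real set"
    and p q :: "nat \<Rightarrow> real \<Rightarrow> 'h::{chilbert_space, second_countable_topology} \<Rightarrow> 'h"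
  assumes n: "0 < n" and I: "interval_upto b \<Delta>" and coeffs: "admissible_coeffs n \<Delta> p q"
begin

sublocale nontrivial_interval \<Delta>
  by unfold_locales (rule interval_upto_no_isolated[OF I])

lemmas \<Delta>D = interval_uptoD[OF I]

text \<open>The coefficients \<open>q\<close> continued by 0 at index n; likewise \<open>qs\<close>
  vanishes at index 0. Then one recursion covers the quasi-derivatives of all orders n to
  2n.\<close>

definition qq :: "nat \<Rightarrow> real \<Rightarrow> 'h \<Rightarrow> 'h" where
  "qq j t x = (if j < n then q j t x else 0)"

definition qs :: "nat \<Rightarrow> real \<Rightarrow> 'h \<Rightarrow> 'h" where
  "qs j t x = (if j = 0 then 0 else hadj UNIV (q (j - 1) t) x)"

text \<open>The part of the recursion that involves no quasi-derivative. For \<open>j = 0\<close>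
  the derivative of order n + 1 occurs formally but meets \<open>qs 0 = 0\<close>; for
  \<open>j = n\<close> the truncated order \<open>n - j - 1 = 0\<close> meets
  \<open>qq n = 0\<close>.\<close>

definition rr :: "nat \<Rightarrow> (real \<Rightarrow> 'h) \<Rightarrow> real \<Rightarrow> 'h" where
  "rr j y t = p j t (Dpow \<Delta> (n - j) y t) + (\<i> / 2) *\<^sub>C qs j t (Dpow \<Delta> (n - j + 1) y t)
     + (- (\<i> / 2)) *\<^sub>C qq j t (Dpow \<Delta> (n - j - 1) y t)"

text \<open>\<open>aa k y\<close> is \<open>y\<^sup>[\<^sup>n\<^sup>+\<^sup>k\<^sup>]\<close> for all \<open>k \<le> n\<close>; in particular \<open>aa n y\<close> is \<open>y\<^sup>[\<^sup>2\<^sup>n\<^sup>] = l[y]\<close>.\<close>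

primrec aa :: "nat \<Rightarrow> (real \<Rightarrow> 'h) \<Rightarrow> real \<Rightarrow> 'h" where
  "aa 0 y = rr 0 y"
| "aa (Suc k) y = (\<lambda>t. - Dt \<Delta> (aa k y) t + rr (Suc k) y t)"

lemma quasi_upper_eq: "k < n \<Longrightarrow> quasi_upper n \<Delta> p q k y = aa k y"
proof (induction k)
  case 0
  then show ?case using n by (simp add: fun_eq_iff rr_def qs_def qq_def scaleC_minus_left)
next
  case (Suc k)
  then have "quasi_upper n \<Delta> p q k y = aa k y" by simp
  with Suc.prems show ?case
    by (intro ext) (simp add: rr_def qs_def qq_def scaleC_minus_left scaleC_diff_right)
qed

lemma quasi_deriv_eq: "k < 2 * n \<Longrightarrow> quasi_deriv n \<Delta> p q k y = (if k < n then Dpow \<Delta> k y else aa (k - n) y)"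
  by (auto simp: quasi_deriv_def intro!: quasi_upper_eq)

lemma p_Ck: "k \<le> n \<Longrightarrow> op_Ck (n - k) \<Delta> (p k)"
  and q_Ck: "k < n \<Longrightarrow> op_Ck (n - k) \<Delta> (q k)"
  and p_hadj: "k \<le> n \<Longrightarrow> t \<in> \<Delta> \<Longrightarrow> hadj UNIV (p k t) = p k t"
  and p0_invertible: "t \<in> \<Delta> \<Longrightarrow> boundedly_invertible UNIV UNIV (p 0 t)"
  using coeffs by (auto simp: admissible_coeffs_def)

lemma qq_Ck: "k \<le> n \<Longrightarrow> op_Ck (n - k) \<Delta> (qq k)"
proof (cases "k < n")
  case True
  moreover have "qq k = q k" using True by (simp add: qq_def fun_eq_iff)
  ultimately show ?thesis using q_Ck by simp
next
  case False
  then have "qq k = (\<lambda>t x. 0)" by (simp add: qq_def fun_eq_iff)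
  then show ?thesis using op_Ck_const[OF bounded_op_zero] by simp
qed

lemma qs_Ck: "k \<le> n \<Longrightarrow> op_Ck (n - k) \<Delta> (qs k)"
proof (cases "k = 0")
  case False
  assume "k \<le> n"
  have "op_Ck (n - (k - 1)) \<Delta> (\<lambda>t. hadj UNIV (q (k - 1) t))" by (rule op_Ck_hadj[OF q_Ck]) (use False \<open>k \<le> n\<close> in simp)
  then have "op_Ck (n - k) \<Delta> (\<lambda>t. hadj UNIV (q (k - 1) t))" by (rule op_Ck_mono) simp
  moreover have "qs k = (\<lambda>t. hadj UNIV (q (k - 1) t))" using False by (simp add: qs_def fun_eq_iff)
  ultimately show ?thesis by simp
next
  case True
  then have "qs k = (\<lambda>t x. 0)" by (simp add: qs_def fun_eq_iff)
  then show ?thesis using op_Ck_const[OF bounded_op_zero] by simp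
qed

lemmas p_b = op_Ck_bounded[OF p_Ck] and qq_b = op_Ck_bounded[OF qq_Ck] and qs_b = op_Ck_bounded[OF qs_Ck]

lemma scaleC_Ck: "op_Ck m \<Delta> (\<lambda>t x. c *\<^sub>C x)"
  by (rule op_Ck_const[OF bounded_op_scaleC_const])

lemma reg_scaleC: "base_class P s \<Longrightarrow> reg P m f \<Longrightarrow> reg P m (\<lambda>t. c *\<^sub>C f t)"
  using reg_op[of P s m "\<lambda>t x. c *\<^sub>C x" f] scaleC_Ck by blast

lemma reg_rr:
  assumes P: "base_class P s" and j: "j \<le> n" "m + s \<le> n - j"
    and y: "reg P (m + (if j = 0 then n else n - j + 1)) y"
  shows "reg P m (rr j y)"
proof -
  have D: "reg P m (Dpow \<Delta> k y)" if "k \<le> (if j = 0 then n else n - j + 1)" for k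
    by (rule reg_Dpow[OF P], rule reg_mono[OF P y]) (use that in simp)
  have 1: "reg P m (\<lambda>t. p j t (Dpow \<Delta> (n - j) y t))"
    by (intro reg_op[OF P op_Ck_mono[OF p_Ck]] D) (use j in auto)
  have 2: "reg P m (\<lambda>t. qq j t (Dpow \<Delta> (n - j - 1) y t))"
    by (intro reg_op[OF P op_Ck_mono[OF qq_Ck]] D) (use j in auto)
  have 3: "reg P m (\<lambda>t. qs j t (Dpow \<Delta> (n - j + 1) y t))"
  proof (cases "j = 0")
    case True
    \<comment> \<open>As \<open>qs 0 = 0\<close>, a derivative of order 0 may stand in for the one
      of order n + 1, for which no regularity is available.\<close>
    have "reg P m (\<lambda>t. qs j t (Dpow \<Delta> 0 y t))"
      by (intro reg_op[OF P op_Ck_mono[OF qs_Ck]] D) (use j in auto)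
    then show ?thesis using True by (simp add: qs_def)
  next
    case False
    show ?thesis by (intro reg_op[OF P op_Ck_mono[OF qs_Ck]] D) (use j False in auto)
  qed
  show ?thesis
    using reg_add[OF P reg_add[OF P 1 reg_scaleC[OF P 3, of "\<i> / 2"]] reg_scaleC[OF P 2, of "- (\<i> / 2)"]]
    by (simp add: rr_def[abs_def])
qed

text \<open>Outside these points the value of \<open>lexpr\<close> is arbitrary, so all identities
  for l[y] are confined to them.\<close>

definition dpts :: "(real \<Rightarrow> 'h) \<Rightarrow> real set" where
  "dpts y = {t\<in>\<Delta>. aa (n - 1) y differentiable (at t within \<Delta>)}"

lemma dpts_subset: "dpts y \<subseteq> \<Delta>"
  by (auto simp: dpts_def)

text \<open>The everywhere clauses of \<open>maxdom\<close>; square integrability and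
  differentiability almost everywhere are kept apart, as only linear combinations of both need
  them.\<close>

definition smooth_dom :: "(real \<Rightarrow> 'h) \<Rightarrow> bool" where
  "smooth_dom y \<longleftrightarrow> (\<forall>k<n. C1_on \<Delta> (Dpow \<Delta> k y)) \<and> (\<forall>k<n - 1. C1_on \<Delta> (aa k y)) \<and>
     (\<forall>c d. {c..d} \<subseteq> \<Delta> \<longrightarrow> AC_on c d (aa (n - 1) y))"

lemma maxdom_iff: "y \<in> maxdom n \<Delta> p q \<longleftrightarrow> L2 \<Delta> y \<and> smooth_dom y \<and> negligible (\<Delta> - dpts y) \<and> L2 \<Delta> (lexpr n \<Delta> p q y)"
proof -
  have "(\<forall>k\<le>2 * n - 2. C1_on \<Delta> (quasi_deriv n \<Delta> p q k y)) \<longleftrightarrow>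
     (\<forall>k<n. C1_on \<Delta> (Dpow \<Delta> k y)) \<and> (\<forall>k<n - 1. C1_on \<Delta> (aa k y))" (is "?L \<longleftrightarrow> ?R")
  proof
    assume L: ?L
    have "C1_on \<Delta> (Dpow \<Delta> k y)" if "k < n" for k
      using L[rule_format, of k] that n quasi_deriv_eq[of k y] by simp
    moreover have "C1_on \<Delta> (aa k y)" if "k < n - 1" for k
      using L[rule_format, of "n + k"] that n quasi_deriv_eq[of "n + k" y] by simp
    ultimately show ?R by blast
  next
    assume R: ?R
    show ?L
    proof (intro allI impI)
      fix k assume k: "k \<le> 2 * n - 2"
      then show "C1_on \<Delta> (quasi_deriv n \<Delta> p q k y)"
        using R quasi_deriv_eq[of k y] n by (cases "k < n") auto
    qed
  qed
  moreover have "quasi_deriv n \<Delta> p q (2 * n - 1) y = aa (n - 1) y"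
  proof -
    have "\<not> 2 * n - 1 < n" "2 * n - 1 - n = n - 1" "2 * n - 1 < 2 * n" using n by auto
    then show ?thesis using quasi_deriv_eq[of "2 * n - 1" y] by simp
  qed
  moreover have "{t \<in> \<Delta>. \<not> aa (n - 1) y differentiable at t within \<Delta>} = \<Delta> - dpts y"
    by (auto simp: dpts_def)
  ultimately show ?thesis
    unfolding maxdom_def by (auto simp: AE_lebesgue_on_iff[OF \<Delta>D(5)] locally_AC_iff smooth_dom_def)
qed

lemma Dpow_diff: "smooth_dom y \<Longrightarrow> k < n \<Longrightarrow> t \<in> \<Delta> \<Longrightarrow> Dpow \<Delta> k y differentiable (at t within \<Delta>)"
  by (auto simp: smooth_dom_def C1_on_def)

lemma aa_diff:
  assumes y: "smooth_dom y" and k: "k < n" and t: "t \<in> \<Delta>" "k = n - 1 \<Longrightarrow> t \<in> dpts y"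
  shows "aa k y differentiable (at t within \<Delta>)"
proof (cases "k = n - 1")
  case True
  then show ?thesis using t by (simp add: dpts_def)
next
  case False
  then show ?thesis using y k t by (auto simp: smooth_dom_def C1_on_def)
qed

lemma Dt_aa: "Dt \<Delta> (aa k y) t = rr (Suc k) y t - aa (Suc k) y t"
  by simp

text \<open>Bootstraps ordinary derivatives from quasi-derivatives. With \<open>n + m - 1\<close>
  derivatives of \<open>y\<close> known, the terms \<open>rr\<close> are regular enough to make the
  quasi-derivative of order n regular of class m; this quasi-derivative is \<open>p 0\<close>
  applied to \<open>D^n y\<close> up to a known term, and inverting \<open>p 0\<close> gains one
  derivative of \<open>y\<close>.\<close>

lemma smooth_dom_reg:
  assumes y: "smooth_dom y" and m: "m \<le> n"
  shows "reg (diff_at (dpts y)) (n + m - 1) y"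
  using m
proof (induction m)
  case 0
  let ?P = "diff_at (dpts y)"
  have "Dpow \<Delta> (n - 1) y differentiable (at t within \<Delta>)" if "t \<in> dpts y" for t
    using Dpow_diff[OF y, of "n - 1" t] n that dpts_subset by auto
  then show ?case unfolding reg_iff using Dpow_diff[OF y] by (auto simp: diff_at_def)
next
  case (Suc m)
  let ?P = "diff_at (dpts y)"
  note P = base_class_diff_at[OF dpts_subset, of y]
  have IH: "reg ?P (n + m - 1) y" using Suc by simp
  \<comment> \<open>Downwards in the index: the derivative of one \<open>aa\<close> is an
    \<open>rr\<close> minus the next \<open>aa\<close>, so each step down gains one order.\<close>
  have aa: "reg ?P i (aa (m - i) y)" if "i \<le> m" for i
    using that
  proof (induction i)
    case 0
    have "aa m y differentiable (at t within \<Delta>)" if "t \<in> dpts y" for t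
      by (rule aa_diff[OF y]) (use Suc.prems that dpts_subset in auto)
    then show ?case by (simp add: diff_at_def)
  next
    case (Suc i)
    define k where "k = m - Suc i"
    have k: "Suc k = m - i" "k < n - 1" using Suc.prems \<open>Suc m \<le> n\<close> by (auto simp: k_def)
    have "reg ?P i (rr (m - i) y)"
      by (rule reg_rr[OF P _ _ reg_mono[OF P IH]]) (use Suc.prems \<open>Suc m \<le> n\<close> in auto)
    moreover have "reg ?P i (\<lambda>t. (- 1) *\<^sub>C aa (m - i) y t)"
      by (rule reg_scaleC[OF P Suc.IH]) (use Suc.prems in simp)
    ultimately have "reg ?P i (\<lambda>t. rr (m - i) y t + (- 1) *\<^sub>C aa (m - i) y t)" by (rule reg_add[OF P])
    then have "reg ?P i (Dt \<Delta> (aa k y))"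
      by (rule reg_cong[OF P, rotated]) (simp add: Dt_aa k(1)[symmetric] scaleC_minus_one del: aa.simps)
    moreover have "aa k y differentiable (at t within \<Delta>)" if "t \<in> \<Delta>" for t
      by (rule aa_diff[OF y]) (use k that in auto)
    ultimately show ?case unfolding k_def by (intro reg_Suc_of_Dt)
  qed
  have "reg ?P m (aa 0 y)" using aa[of m] by simp
  moreover have "reg ?P m (\<lambda>t. qq 0 t (Dpow \<Delta> (n - 1) y t))"
    by (rule reg_op[OF P op_Ck_mono[OF qq_Ck] reg_Dpow[OF P reg_mono[OF P IH]]]) (use Suc.prems n in auto)
  ultimately have "reg ?P m (\<lambda>t. aa 0 y t + (\<i> / 2) *\<^sub>C qq 0 t (Dpow \<Delta> (n - 1) y t))"
    by (intro reg_add[OF P] reg_scaleC[OF P])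
  then have pw: "reg ?P m (\<lambda>t. p 0 t (Dpow \<Delta> n y t))"
    by (rule reg_cong[OF P, rotated]) (simp add: rr_def qs_def scaleC_minus_left)
  have w: "reg ?P m (Dpow \<Delta> n y)"
  proof (rule reg_op_inverse[OF dpts_subset])
    show "op_Ck (Suc m) \<Delta> (p 0)" by (rule op_Ck_mono[OF p_Ck[OF le0]]) (use Suc.prems in simp)
  qed (rule p0_invertible, assumption, rule pw)
  show ?case
    unfolding reg_iff
  proof (intro conjI allI impI ballI)
    fix k t assume k: "k < n + Suc m - 1" and t: "t \<in> \<Delta>"
    show "Dpow \<Delta> k y differentiable (at t within \<Delta>)"
    proof (cases "k < n")
      case False
      have "Dpow \<Delta> (k - n) (Dpow \<Delta> n y) differentiable (at t within \<Delta>)"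
        by (rule Dpow_differentiable[OF w _ t]) (use k False in simp)
      then show ?thesis using False by (simp add: Dpow_Dpow)
    qed (use Dpow_diff[OF y] t in auto)
  next
    show "?P (Dpow \<Delta> (n + Suc m - 1) y)" using reg_base[OF w] by (simp add: Dpow_Dpow add.commute)
  qed
qed

lemma smooth_dom_reg': "smooth_dom y \<Longrightarrow> reg (diff_at (dpts y)) (2 * n - 1) y"
  using smooth_dom_reg[of y n] by (simp add: mult_2)

lemma reg_diff_atD:
  assumes "reg (diff_at T) m f" "T \<subseteq> \<Delta>" "t \<in> \<Delta>" "k \<le> m" "k = m \<Longrightarrow> t \<in> T"
  shows "Dpow \<Delta> k f differentiable (at t within \<Delta>)"
proof (cases "k = m")
  case True
  then show ?thesis using reg_base[OF assms(1)] assms(5) by (simp add: diff_at_def)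
next
  case False
  then show ?thesis using Dpow_differentiable[OF assms(1)] assms by simp
qed

lemma Dpow_add_reg:
  assumes T: "T \<subseteq> \<Delta>" and "0 < k \<Longrightarrow> reg (diff_at T) (k - 1) f" "0 < k \<Longrightarrow> reg (diff_at T) (k - 1) g" "t \<in> T"
  shows "Dpow \<Delta> k (\<lambda>t. f t + g t) t = Dpow \<Delta> k f t + Dpow \<Delta> k g t"
proof -
  have "Dpow \<Delta> j h differentiable (at s within \<Delta>)"
    if "reg (diff_at T) (k - 1) h" "j < k" "s \<in> \<Delta>" "Suc j = k \<Longrightarrow> s \<in> T" for h j s
    by (rule reg_diff_atD[OF that(1) T that(3)]) (use that in auto)
  then show ?thesis using assms by (intro Dpow_add) auto
qed

lemma Dpow_scaleC_reg:
  assumes T: "T \<subseteq> \<Delta>" and "0 < k \<Longrightarrow> reg (diff_at T) (k - 1) f" "t \<in> T"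
  shows "Dpow \<Delta> k (\<lambda>t. c *\<^sub>C f t) t = c *\<^sub>C Dpow \<Delta> k f t"
proof -
  have "Dpow \<Delta> j h differentiable (at s within \<Delta>)"
    if "reg (diff_at T) (k - 1) h" "j < k" "s \<in> \<Delta>" "Suc j = k \<Longrightarrow> s \<in> T" for h j s
    by (rule reg_diff_atD[OF that(1) T that(3)]) (use that in auto)
  then show ?thesis using assms by (intro Dpow_linear bounded_linear_scaleC) auto
qed

text \<open>The recursion for \<open>aa\<close> unrolled. At \<open>k = n\<close> one
  differentiation exists only on \<open>dpts y\<close>, hence the restriction on
  \<open>t\<close>.\<close>

lemma aa_sum:
  assumes y: "smooth_dom y" and k: "k \<le> n" and t: "t \<in> \<Delta>" "k = n \<Longrightarrow> t \<in> dpts y"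
  shows "aa k y t = (\<Sum>j\<le>k. (-1) ^ (k - j) *\<^sub>R Dpow \<Delta> (k - j) (rr j y) t)"
  using k t
proof (induction k arbitrary: t)
  case 0
  then show ?case by simp
next
  case (Suc k)
  let ?P = "diff_at (dpts y)"
  note P = base_class_diff_at[OF dpts_subset, of y]
  have rj: "Dpow \<Delta> (k - j) (rr j y) differentiable (at t within \<Delta>)" if "j \<le> k" for j
  proof (rule reg_diff_atD[OF _ dpts_subset Suc.prems(2)])
    show "reg ?P (n - j - 1) (rr j y)"
      by (rule reg_rr[OF P _ _ reg_mono[OF P smooth_dom_reg'[OF y]]]) (use that Suc.prems in auto)
  qed (use that Suc.prems in auto)
  have "Dt \<Delta> (aa k y) t = Dt \<Delta> (\<lambda>t. \<Sum>j\<le>k. (-1) ^ (k - j) *\<^sub>R Dpow \<Delta> (k - j) (rr j y) t) t"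
    by (rule Dt_cong) (use Suc in auto)
  also have "\<dots> = (\<Sum>j\<le>k. (-1) ^ (k - j) *\<^sub>R Dpow \<Delta> (Suc (k - j)) (rr j y) t)"
    by (rule Dt_eqI[OF has_vector_derivative_sum Suc.prems(2)])
       (use rj in \<open>auto intro!: bounded_linear.has_vector_derivative[OF bounded_linear_scaleR_right] Dt_has_derivative\<close>)
  also have "- \<dots> = (\<Sum>j\<le>k. (-1) ^ (Suc k - j) *\<^sub>R Dpow \<Delta> (Suc k - j) (rr j y) t)"
    unfolding sum_negf[symmetric] by (rule sum.cong) (auto simp: Suc_diff_le)
  finally show ?case by simp
qed

text \<open>By \<open>aa_sum\<close> the left-over is to distribute the derivatives of each
  \<open>rr\<close> over its three terms, as \<open>lexpr\<close> does. That is legitimate where the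
  terms are differentiable separately, and \<open>smooth_dom_reg\<close> guarantees this on
  \<open>dpts y\<close>.\<close>

lemma lexpr_eq_aa:
  assumes y: "smooth_dom y" and t: "t \<in> dpts y"
  shows "lexpr n \<Delta> p q y t = aa n y t"
proof -
  let ?P = "diff_at (dpts y)"
  note P = base_class_diff_at[OF dpts_subset, of y]
  note R = smooth_dom_reg'[OF y]
  define X where "X = (\<lambda>k s. p (n - k) s (Dpow \<Delta> k y s))"
  define Y where "Y = (\<lambda>k s. hadj UNIV (q (n - k) s) (Dpow \<Delta> k y s))"
  define Z where "Z = (\<lambda>k s. q (n - k) s (Dpow \<Delta> (k - 1) y s))"
  have tD: "t \<in> \<Delta>" using t dpts_subset by blast
  \<comment> \<open>The adjoint term of \<open>rr (n - k)\<close> belongs to the summand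
    \<open>k + 1\<close> of \<open>lexpr\<close> and vanishes for \<open>k = n\<close>; the term
    with \<open>q\<close> keeps its index and vanishes for \<open>k = 0\<close>.\<close>
  define Y' where "Y' = (\<lambda>k s. qs (n - k) s (Dpow \<Delta> (k + 1) y s))"
  define Z' where "Z' = (\<lambda>k s. qq (n - k) s (Dpow \<Delta> (k - 1) y s))"
  have rr_eq: "rr (n - k) y = (\<lambda>s. X k s + (\<i> / 2) *\<^sub>C Y' k s + (- (\<i> / 2)) *\<^sub>C Z' k s)" if "k \<le> n" for k
    using that by (simp add: rr_def X_def Y'_def Z'_def fun_eq_iff)
  have DD: "Dpow \<Delta> k (rr (n - k) y) t = Dpow \<Delta> k (X k) t + (\<i> / 2) *\<^sub>C Dpow \<Delta> k (Y' k) t + (- (\<i> / 2)) *\<^sub>C Dpow \<Delta> k (Z' k) t"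
    if k: "k \<le> n" for k
  proof -
    have m: "reg ?P (k - 1) (Dpow \<Delta> j y)" if "j \<le> (if k = n then k else k + 1)" "0 < k" for j
      by (rule reg_Dpow[OF P reg_mono[OF P R]]) (use that k in \<open>auto split: if_splits\<close>)
    have rX: "reg ?P (k - 1) (X k)" if "0 < k"
      unfolding X_def by (rule reg_op[OF P op_Ck_mono[OF p_Ck] m]) (use k that in auto)
    have rZ: "reg ?P (k - 1) (Z' k)" if "0 < k"
      unfolding Z'_def by (rule reg_op[OF P op_Ck_mono[OF qq_Ck] m]) (use k that in auto)
    have rY: "reg ?P (k - 1) (Y' k)" if k0: "0 < k"
    proof (cases "k = n")
      case True
      have "reg ?P (k - 1) (\<lambda>s. qs 0 s (Dpow \<Delta> 0 y s))"
        by (rule reg_op[OF P op_Ck_mono[OF qs_Ck] m]) (use k k0 in auto)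
      then show ?thesis using True by (simp add: Y'_def qs_def)
    next
      case False
      then show ?thesis unfolding Y'_def
        by (intro reg_op[OF P op_Ck_mono[OF qs_Ck]] m) (use k k0 in auto)
    qed
    show ?thesis
      unfolding rr_eq[OF k]
      by (simp only: Dpow_add_reg[OF dpts_subset reg_add[OF P rX reg_scaleC[OF P rY]] reg_scaleC[OF P rZ] t]
          Dpow_add_reg[OF dpts_subset rX reg_scaleC[OF P rY] t]
          Dpow_scaleC_reg[OF dpts_subset rY t] Dpow_scaleC_reg[OF dpts_subset rZ t])
  qed
  have eY: "Dpow \<Delta> k (Y' k) t = (if k < n then Dpow \<Delta> k (Y (Suc k)) t else 0)" if "k \<le> n" for k
  proof (cases "k < n")
    case True
    then have "Y' k = Y (Suc k)" by (simp add: Y'_def Y_def qs_def)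
    then show ?thesis using True by simp
  next
    case False
    then have "Y' k = (\<lambda>s. 0 *\<^sub>C y s)" by (simp add: Y'_def qs_def)
    moreover have "Dpow \<Delta> k (\<lambda>s. 0 *\<^sub>C y s) t = 0 *\<^sub>C Dpow \<Delta> k y t"
      by (rule Dpow_scaleC_reg[OF dpts_subset _ t]) (use that in \<open>auto intro!: reg_mono[OF P R]\<close>)
    ultimately show ?thesis using False by (simp only: scaleC_zero_left if_False)
  qed
  have eZ: "Dpow \<Delta> k (Z' k) t = (if 0 < k then Dpow \<Delta> k (Z k) t else 0)" if "k \<le> n" for k
  proof (cases "0 < k")
    case True
    then have "Z' k = Z k" using that by (simp add: Z'_def Z_def qq_def)
    then show ?thesis using True by simp
  qed (simp add: Z'_def qq_def)
  have "aa n y t = (\<Sum>j\<le>n. (-1) ^ (n - j) *\<^sub>R Dpow \<Delta> (n - j) (rr j y) t)"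
    by (rule aa_sum[OF y]) (use t tD in auto)
  also have "\<dots> = (\<Sum>k\<le>n. (-1) ^ k *\<^sub>R Dpow \<Delta> k (rr (n - k) y) t)"
    by (rule sum.reindex_bij_witness[of _ "\<lambda>k. n - k" "\<lambda>j. n - j"]) auto
  also have "\<dots> = (\<Sum>k\<le>n. (-1) ^ k *\<^sub>R Dpow \<Delta> k (X k) t
      + ((if k < n then (\<i> / 2) *\<^sub>C (-1) ^ k *\<^sub>R Dpow \<Delta> k (Y (Suc k)) t else 0)
      + (if 0 < k then (- (\<i> / 2)) *\<^sub>C (-1) ^ k *\<^sub>R Dpow \<Delta> k (Z k) t else 0)))"
    by (rule sum.cong) (auto simp: DD eY eZ scaleR_add_right scaleC_scaleR add.assoc)
  also have "\<dots> = (\<Sum>k\<le>n. (-1) ^ k *\<^sub>R Dpow \<Delta> k (X k) t)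
      + ((\<Sum>k\<le>n. if k < n then (\<i> / 2) *\<^sub>C (-1) ^ k *\<^sub>R Dpow \<Delta> k (Y (Suc k)) t else 0)
      + (\<Sum>k\<le>n. if 0 < k then (- (\<i> / 2)) *\<^sub>C (-1) ^ k *\<^sub>R Dpow \<Delta> k (Z k) t else 0))"
    by (simp only: sum.distrib)
  also have "(\<Sum>k\<le>n. if k < n then (\<i> / 2) *\<^sub>C (-1) ^ k *\<^sub>R Dpow \<Delta> k (Y (Suc k)) t else 0)
      = (\<Sum>k<n. (\<i> / 2) *\<^sub>C (-1) ^ k *\<^sub>R Dpow \<Delta> k (Y (Suc k)) t)"
    by (simp add: lessThan_Suc_atMost[symmetric])
  \<comment> \<open>Shifting the index by one reverses the sign of \<open>(-1) ^ k\<close>, which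
    brings the coefficient to that of the other term.\<close>
  also have "\<dots> = (\<Sum>k=1..n. (- (\<i> / 2)) *\<^sub>C (-1) ^ k *\<^sub>R Dpow \<Delta> (k - 1) (Y k) t)"
    by (rule sum.reindex_bij_witness[of _ "\<lambda>k. k - 1" Suc]) (auto simp: scaleC_minus_left scaleC_minus_right)
  also have "(\<Sum>k\<le>n. if 0 < k then (- (\<i> / 2)) *\<^sub>C (-1) ^ k *\<^sub>R Dpow \<Delta> k (Z k) t else 0)
      = (\<Sum>k=1..n. (- (\<i> / 2)) *\<^sub>C (-1) ^ k *\<^sub>R Dpow \<Delta> k (Z k) t)"
    by (rule sum.mono_neutral_cong_right) auto
  also have "(\<Sum>k\<le>n. (-1) ^ k *\<^sub>R Dpow \<Delta> k (X k) t) = X 0 t + (\<Sum>k=1..n. (-1) ^ k *\<^sub>R Dpow \<Delta> k (X k) t)"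
    by (simp add: atMost_atLeast0 sum.atLeast_Suc_atMost)
  finally have "aa n y t = (\<Sum>k=1..n. (-1) ^ k *\<^sub>R (Dpow \<Delta> k (X k) t
      - (\<i> / 2) *\<^sub>C (Dpow \<Delta> (k - 1) (Y k) t + Dpow \<Delta> k (Z k) t))) + X 0 t"
    by (simp add: sum.distrib[symmetric] scaleC_minus_left scaleC_add_right scaleR_diff_right scaleR_add_right
        scaleC_scaleR sum_subtractf algebra_simps sum_negf)
  then show ?thesis by (simp add: lexpr_def X_def Y_def Z_def)
qed

section \<open>Linearity of the maximal operator\<close>

lemma Dpow_lin:
  assumes "smooth_dom y" "smooth_dom z" "k \<le> n" "t \<in> \<Delta>"
  shows "Dpow \<Delta> k (\<lambda>t. \<alpha> *\<^sub>C y t + \<beta> *\<^sub>C z t) t = \<alpha> *\<^sub>C Dpow \<Delta> k y t + \<beta> *\<^sub>C Dpow \<Delta> k z t"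
proof -
  have 1: "Dpow \<Delta> j (\<lambda>t. c *\<^sub>C w t) s = c *\<^sub>C Dpow \<Delta> j w s" if "smooth_dom w" "j \<le> k" "s \<in> \<Delta>" for c w j s
    by (rule Dpow_linear[OF bounded_linear_scaleC]) (use that assms Dpow_diff in auto)
  have 2: "Dpow \<Delta> j (\<lambda>t. c *\<^sub>C w t) differentiable (at s within \<Delta>)" if "smooth_dom w" "j < k" "s \<in> \<Delta>" for c w j s
    using differentiable_linear[OF bounded_linear_scaleC Dpow_diff[OF that(1) _ that(3), of j], of c]
      differentiable_cong[of "Dpow \<Delta> j (\<lambda>t. c *\<^sub>C w t)" "\<lambda>s. c *\<^sub>C Dpow \<Delta> j w s" s] 1[OF that(1)] that assms(3)
    by simp
  show ?thesis
    using Dpow_add[of k "\<lambda>t. \<alpha> *\<^sub>C y t" t "\<lambda>t. \<beta> *\<^sub>C z t"] 2 1 assms by simp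
qed

lemma rr_lin:
  assumes "smooth_dom y" "smooth_dom z" "k \<le> n" "t \<in> \<Delta>"
  shows "rr k (\<lambda>t. \<alpha> *\<^sub>C y t + \<beta> *\<^sub>C z t) t = \<alpha> *\<^sub>C rr k y t + \<beta> *\<^sub>C rr k z t"
proof -
  note b = bounded_op_lin[OF p_b[OF assms(3,4)]] bounded_op_lin[OF qq_b[OF assms(3,4)]] bounded_op_lin[OF qs_b[OF assms(3,4)]]
  have q: "qs k t (Dpow \<Delta> (n - k + 1) (\<lambda>t. \<alpha> *\<^sub>C y t + \<beta> *\<^sub>C z t) t) =
     \<alpha> *\<^sub>C qs k t (Dpow \<Delta> (n - k + 1) y t) + \<beta> *\<^sub>C qs k t (Dpow \<Delta> (n - k + 1) z t)"
  proof (cases "k = 0")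
    case False
    then show ?thesis using assms by (subst Dpow_lin) (auto simp: b)
  qed (simp add: qs_def)
  show ?thesis
    unfolding rr_def q
    by (simp add: Dpow_lin[OF assms(1,2) _ assms(4)] b scaleC_add_right scaleC_scaleC mult.commute algebra_simps)
qed

lemma aa_lin:
  assumes "smooth_dom y" "smooth_dom z" "k \<le> n" "t \<in> \<Delta>" "k = n \<Longrightarrow> t \<in> dpts y \<inter> dpts z"
  shows "aa k (\<lambda>t. \<alpha> *\<^sub>C y t + \<beta> *\<^sub>C z t) t = \<alpha> *\<^sub>C aa k y t + \<beta> *\<^sub>C aa k z t"
  using assms(3-)
proof (induction k arbitrary: t)
  case 0
  then show ?case using rr_lin[OF assms(1,2)] by simp
next
  case (Suc k)
  have d: "aa k y differentiable (at t within \<Delta>)" "aa k z differentiable (at t within \<Delta>)"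
    using aa_diff[OF assms(1), of k t] aa_diff[OF assms(2), of k t] Suc.prems by auto
  have "Dt \<Delta> (aa k (\<lambda>t. \<alpha> *\<^sub>C y t + \<beta> *\<^sub>C z t)) t = Dt \<Delta> (\<lambda>t. \<alpha> *\<^sub>C aa k y t + \<beta> *\<^sub>C aa k z t) t"
    by (rule Dt_cong) (use Suc in auto)
  also have "\<dots> = \<alpha> *\<^sub>C Dt \<Delta> (aa k y) t + \<beta> *\<^sub>C Dt \<Delta> (aa k z) t"
    using d Suc.prems by (simp add: Dt_add Dt_linear differentiable_linear bounded_linear_scaleC)
  finally show ?case
    using rr_lin[OF assms(1,2) Suc.prems(1,2)] by (simp add: scaleC_add_right scaleC_diff_right)
qed

lemma dpts_lin:
  assumes "smooth_dom y" "smooth_dom z"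
  shows "dpts y \<inter> dpts z \<subseteq> dpts (\<lambda>t. \<alpha> *\<^sub>C y t + \<beta> *\<^sub>C z t)"
proof
  fix t assume t: "t \<in> dpts y \<inter> dpts z"
  then have tD: "t \<in> \<Delta>" using dpts_subset by blast
  have "aa (n - 1) (\<lambda>t. \<alpha> *\<^sub>C y t + \<beta> *\<^sub>C z t) s = \<alpha> *\<^sub>C aa (n - 1) y s + \<beta> *\<^sub>C aa (n - 1) z s" if "s \<in> \<Delta>" for s
    using aa_lin[OF assms, of "n - 1"] that n by simp
  moreover have "(\<lambda>s. \<alpha> *\<^sub>C aa (n - 1) y s + \<beta> *\<^sub>C aa (n - 1) z s) differentiable (at t within \<Delta>)"
    using t by (auto simp: dpts_def intro!: differentiable_add differentiable_linear[OF bounded_linear_scaleC])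
  ultimately show "t \<in> dpts (\<lambda>t. \<alpha> *\<^sub>C y t + \<beta> *\<^sub>C z t)"
    using differentiable_cong[of "aa (n - 1) (\<lambda>t. \<alpha> *\<^sub>C y t + \<beta> *\<^sub>C z t)" _ t] tD by (simp add: dpts_def)
qed

lemma C1_on_cong: "C1_on \<Delta> f \<Longrightarrow> (\<And>t. t \<in> \<Delta> \<Longrightarrow> g t = f t) \<Longrightarrow> C1_on \<Delta> g"
  unfolding C1_on_def using differentiable_cong[of f g] Dt_cong[of f g] continuous_on_cong[of \<Delta> \<Delta> "Dt \<Delta> f" "Dt \<Delta> g"]
  by simp

lemma C1_on_lin:
  assumes "C1_on \<Delta> f" "C1_on \<Delta> g"
  shows "C1_on \<Delta> (\<lambda>t. \<alpha> *\<^sub>C f t + \<beta> *\<^sub>C (g t :: 'h))"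
proof -
  have d: "f differentiable (at t within \<Delta>)" "g differentiable (at t within \<Delta>)" if "t \<in> \<Delta>" for t
    using that assms by (auto simp: C1_on_def)
  have "continuous_on \<Delta> (\<lambda>t. \<alpha> *\<^sub>C Dt \<Delta> f t + \<beta> *\<^sub>C Dt \<Delta> g t)"
    using assms by (intro continuous_on_add bounded_linear.continuous_on[OF bounded_linear_scaleC]) (auto simp: C1_on_def)
  also have "?this \<longleftrightarrow> continuous_on \<Delta> (Dt \<Delta> (\<lambda>t. \<alpha> *\<^sub>C f t + \<beta> *\<^sub>C g t))"
    by (rule continuous_on_cong) (use d in \<open>simp_all add: Dt_add Dt_linear differentiable_linear bounded_linear_scaleC\<close>)
  finally show ?thesis
    using d by (auto simp: C1_on_def intro!: differentiable_add differentiable_linear[OF bounded_linear_scaleC])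
qed

lemma AC_on_diff:
  assumes "AC_on c d u" "AC_on c d v"
  shows "AC_on c d (\<lambda>t. u t - v t)"
  using AC_on_add[OF assms(1) AC_on_linear[OF bounded_linear_minus[OF bounded_linear_ident] assms(2)]] by simp

lemma AC_on_cong:
  assumes "AC_on c d f" "\<And>t. t \<in> {c..d} \<Longrightarrow> g t = f t"
  shows "AC_on c d g"
  by (rule AC_onI_dominated[OF assms(1) assms(1), of 1]) (use assms(2) in auto)

lemma smooth_dom_lin:
  assumes "smooth_dom y" "smooth_dom z"
  shows "smooth_dom (\<lambda>t. \<alpha> *\<^sub>C y t + \<beta> *\<^sub>C z t)"
  unfolding smooth_dom_def
proof (intro conjI allI impI)
  fix k assume k: "k < n"
  then have "C1_on \<Delta> (Dpow \<Delta> k y)" "C1_on \<Delta> (Dpow \<Delta> k z)" using assms by (simp_all add: smooth_dom_def)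
  from C1_on_lin[OF this] show "C1_on \<Delta> (Dpow \<Delta> k (\<lambda>t. \<alpha> *\<^sub>C y t + \<beta> *\<^sub>C z t))"
    by (rule C1_on_cong) (rule Dpow_lin[OF assms less_imp_le[OF k]])
next
  fix k assume k: "k < n - 1"
  then have "C1_on \<Delta> (aa k y)" "C1_on \<Delta> (aa k z)" using assms by (simp_all add: smooth_dom_def)
  from C1_on_lin[OF this] show "C1_on \<Delta> (aa k (\<lambda>t. \<alpha> *\<^sub>C y t + \<beta> *\<^sub>C z t))"
    by (rule C1_on_cong) (rule aa_lin[OF assms], use k in auto)
next
  fix c d assume cd: "{c..d} \<subseteq> \<Delta>"
  have "AC_on c d (\<lambda>t. \<alpha> *\<^sub>C aa (n - 1) y t + \<beta> *\<^sub>C aa (n - 1) z t)"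
    by (intro AC_on_add AC_on_linear[OF bounded_linear_scaleC]) (use assms cd in \<open>simp_all add: smooth_dom_def\<close>)
  then show "AC_on c d (aa (n - 1) (\<lambda>t. \<alpha> *\<^sub>C y t + \<beta> *\<^sub>C z t))"
  proof (rule AC_on_cong)
    fix t assume "t \<in> {c..d}"
    then have "t \<in> \<Delta>" using cd by blast
    then show "aa (n - 1) (\<lambda>t. \<alpha> *\<^sub>C y t + \<beta> *\<^sub>C z t) t = \<alpha> *\<^sub>C aa (n - 1) y t + \<beta> *\<^sub>C aa (n - 1) z t"
      using aa_lin[OF assms, of "n - 1" t] n by simp
  qed
qed

abbreviation "D \<equiv> maxdom n \<Delta> p q"
abbreviation "L \<equiv> lexpr n \<Delta> p q"

text \<open>\<open>L\<close> is linear only almost everywhere: where \<open>y\<close> or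
  \<open>z\<close> lacks the last derivative, the total function \<open>lexpr\<close> takes an
  arbitrary value.\<close>

lemma maxdom_lin:
  assumes y: "y \<in> D" and z: "z \<in> D"
  shows "(\<lambda>t. \<alpha> *\<^sub>C y t + \<beta> *\<^sub>C z t) \<in> D"
    and "AE t in lebesgue_on \<Delta>. L (\<lambda>t. \<alpha> *\<^sub>C y t + \<beta> *\<^sub>C z t) t = \<alpha> *\<^sub>C L y t + \<beta> *\<^sub>C L z t"
proof -
  let ?w = "\<lambda>t. \<alpha> *\<^sub>C y t + \<beta> *\<^sub>C z t"
  have s: "smooth_dom y" "smooth_dom z" "smooth_dom ?w" using y z smooth_dom_lin by (auto simp: maxdom_iff)
  have neg: "negligible (\<Delta> - dpts y \<inter> dpts z)"
    using negligible_Un[of "\<Delta> - dpts y" "\<Delta> - dpts z"] y z by (simp add: maxdom_iff Diff_Int)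
  have eq: "L ?w t = \<alpha> *\<^sub>C L y t + \<beta> *\<^sub>C L z t" if "t \<in> dpts y \<inter> dpts z" for t
    using that dpts_lin[OF s(1,2), of \<alpha> \<beta>] dpts_subset[of y] aa_lin[OF s(1,2), of n t]
    by (auto simp: lexpr_eq_aa s subset_iff)
  show ae: "AE t in lebesgue_on \<Delta>. L ?w t = \<alpha> *\<^sub>C L y t + \<beta> *\<^sub>C L z t"
    unfolding AE_lebesgue_on_iff[OF \<Delta>D(5)] by (rule negligible_subset[OF neg]) (use eq in auto)
  have "L2 \<Delta> (L ?w)"
    by (rule L2_cong_AE[OF \<Delta>D(5) L2_add[OF L2_scaleC L2_scaleC, of _ "L y" "L z" \<alpha> \<beta>]])
       (use y z ae in \<open>auto simp: maxdom_iff elim: eventually_mono\<close>)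
  moreover have "negligible (\<Delta> - dpts ?w)"
    by (rule negligible_subset[OF neg]) (use dpts_lin[OF s(1,2), of \<alpha> \<beta>] in blast)
  moreover have "L2 \<Delta> ?w" using y z by (auto simp: maxdom_iff intro: L2_add L2_scaleC)
  ultimately show "?w \<in> D" using s(3) by (simp add: maxdom_iff)
qed

section \<open>The Lagrange bracket and Green's formula\<close>

definition LL :: "(real \<Rightarrow> 'h) \<Rightarrow> (real \<Rightarrow> 'h) \<Rightarrow> real \<Rightarrow> complex" where
  "LL y z t = (\<Sum>i<n. cinner (Dpow \<Delta> i y t) (aa (n - 1 - i) z t) - cinner (aa (n - 1 - i) y t) (Dpow \<Delta> i z t))"

text \<open>
  The summands of the derivative of the Lagrange bracket are differences \<open>G (i + 1) - G i\<close>, with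
  \<open>G n = 0\<close>.
\<close>

lemma LL_has_derivative:
  assumes s: "smooth_dom y" "smooth_dom z" and t: "t \<in> dpts y" "t \<in> dpts z"
  shows "(LL y z has_vector_derivative (cinner (L y t) (z t) - cinner (y t) (L z t))) (at t within \<Delta>)"
proof -
  have tD: "t \<in> \<Delta>" using t dpts_subset by blast
  define w v where "w = (\<lambda>i. Dpow \<Delta> i y t)" and "v = (\<lambda>i. Dpow \<Delta> i z t)"
  define a c where "a = (\<lambda>k. aa k y t)" and "c = (\<lambda>k. aa k z t)"
  define G where "G = (\<lambda>i. cinner (w i) (c (n - i)) - cinner (a (n - i)) (v i)
      - (\<i> / 2) * (cinner (qq (n - i) t (w (i - 1))) (v i) + cinner (w i) (qq (n - i) t (v (i - 1)))))"
  have dD: "(Dpow \<Delta> i y has_vector_derivative w (Suc i)) (at t within \<Delta>)"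
       "(Dpow \<Delta> i z has_vector_derivative v (Suc i)) (at t within \<Delta>)" if "i < n" for i
    using Dt_has_derivative[OF Dpow_diff[OF s(1) that tD]] Dt_has_derivative[OF Dpow_diff[OF s(2) that tD]]
    by (auto simp: w_def v_def)
  have dA: "(aa (n - 1 - i) y has_vector_derivative (rr (n - i) y t - a (n - i))) (at t within \<Delta>)"
       "(aa (n - 1 - i) z has_vector_derivative (rr (n - i) z t - c (n - i))) (at t within \<Delta>)" if "i < n" for i
  proof -
    have e: "Suc (n - 1 - i) = n - i" using that by simp
    show "(aa (n - 1 - i) y has_vector_derivative (rr (n - i) y t - a (n - i))) (at t within \<Delta>)"
      using Dt_has_derivative[OF aa_diff[OF s(1), of "n - 1 - i" t]] Dt_aa[of "n - 1 - i" y t] t tD that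
      unfolding e a_def by simp
    show "(aa (n - 1 - i) z has_vector_derivative (rr (n - i) z t - c (n - i))) (at t within \<Delta>)"
      using Dt_has_derivative[OF aa_diff[OF s(2), of "n - 1 - i" t]] Dt_aa[of "n - 1 - i" z t] t tD that
      unfolding e c_def by simp
  qed
  have summand: "((\<lambda>t. cinner (Dpow \<Delta> i y t) (aa (n - 1 - i) z t) - cinner (aa (n - 1 - i) y t) (Dpow \<Delta> i z t))
     has_vector_derivative G (Suc i) - G i) (at t within \<Delta>)" if i: "i < n" for i
  proof -
    have j: "n - Suc i < n" "n - i \<noteq> 0" "n - i - 1 = n - Suc i" "n - (n - i) = i" "n - Suc i + 1 = n - i" using i by auto
    have qb: "bounded_op UNIV UNIV (q (n - Suc i) t)" by (rule op_Ck_bounded[OF q_Ck[OF j(1)] tD])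
    have ps: "cinner x (p (n - i) t x') = cinner (p (n - i) t x) x'" for x x'
      using hadj_UNIV_left[OF p_b[of "n - i", OF _ tD], of x x'] p_hadj[of "n - i" t] tD by simp
    \<comment> \<open>The symmetric \<open>p\<close> cancels. The terms with \<open>q\<close> and
      its adjoint pair off into the correction terms that \<open>G\<close> contains at the indices
      \<open>i\<close> and \<open>i + 1\<close>.\<close>
    have rr: "cinner (w i) (rr (n - i) z t) - cinner (rr (n - i) y t) (v i) =
        - (\<i> / 2) * (cinner (q (n - Suc i) t (w i)) (v (Suc i)) + cinner (w (Suc i)) (q (n - Suc i) t (v i)))
        + (\<i> / 2) * (cinner (qq (n - i) t (w (i - 1))) (v i) + cinner (w i) (qq (n - i) t (v (i - 1))))"
    proof -
      have 1: "rr (n - i) z t = p (n - i) t (v i) + (\<i> / 2) *\<^sub>C hadj UNIV (q (n - Suc i) t) (v (Suc i))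
        + (- (\<i> / 2)) *\<^sub>C qq (n - i) t (v (i - 1))"
        using j by (simp add: rr_def v_def qs_def)
      have 2: "rr (n - i) y t = p (n - i) t (w i) + (\<i> / 2) *\<^sub>C hadj UNIV (q (n - Suc i) t) (w (Suc i))
        + (- (\<i> / 2)) *\<^sub>C qq (n - i) t (w (i - 1))"
        using j by (simp add: rr_def w_def qs_def)
      show ?thesis
        unfolding 1 2 cinner_add_left cinner_add_right cinner_scaleC_left cinner_scaleC_right ps
          hadj_UNIV_right[OF qb] hadj_UNIV_left[OF qb]
        by (simp add: algebra_simps)
    qed
    have "((\<lambda>t. cinner (Dpow \<Delta> i y t) (aa (n - 1 - i) z t) - cinner (aa (n - 1 - i) y t) (Dpow \<Delta> i z t))
      has_vector_derivative
        (cinner (w i) (rr (n - i) z t - c (n - i)) + cinner (w (Suc i)) (c (n - 1 - i)))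
        - (cinner (a (n - 1 - i)) (v (Suc i)) + cinner (rr (n - i) y t - a (n - i)) (v i))) (at t within \<Delta>)"
      using has_vector_derivative_diff[OF
          bounded_bilinear.has_vector_derivative[OF bounded_bilinear_cinner dD(1)[OF i] dA(2)[OF i]]
          bounded_bilinear.has_vector_derivative[OF bounded_bilinear_cinner dA(1)[OF i] dD(2)[OF i]]]
      by (simp add: w_def v_def a_def c_def)
    moreover have "(cinner (w i) (rr (n - i) z t - c (n - i)) + cinner (w (Suc i)) (c (n - 1 - i)))
        - (cinner (a (n - 1 - i)) (v (Suc i)) + cinner (rr (n - i) y t - a (n - i)) (v i)) = G (Suc i) - G i"
      using rr j(1) by (simp add: G_def cinner_diff_left cinner_diff_right qq_def[of "n - Suc i"] algebra_simps)
    ultimately show ?thesis by simp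
  qed
  have "(LL y z has_vector_derivative (\<Sum>i<n. G (Suc i) - G i)) (at t within \<Delta>)"
    unfolding LL_def[abs_def] by (rule has_vector_derivative_sum) (use summand in auto)
  moreover have "(\<Sum>i<n. G (Suc i) - G i) = G n - G 0" by (rule sum_lessThan_telescope)
  \<comment> \<open>At index n the quasi-derivatives are \<open>aa 0\<close>; after cancellation of
    \<open>p 0\<close> only terms with \<open>q 0\<close> are left, and the correction in
    \<open>G\<close> removes them.\<close>
  moreover have "G n = 0"
  proof -
    have ps: "cinner x (p 0 t x') = cinner (p 0 t x) x'" for x x'
      using hadj_UNIV_left[OF p_b[of 0, OF _ tD], of x x'] p_hadj[of 0 t] tD by simp
    show ?thesis
      unfolding G_def a_def c_def w_def v_def by (simp add: rr_def qs_def cinner_simps ps algebra_simps)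
  qed
  moreover have "G 0 = cinner (y t) (L z t) - cinner (L y t) (z t)"
    by (simp add: G_def w_def v_def a_def c_def qq_def lexpr_eq_aa s t)
  ultimately show ?thesis by simp
qed

text \<open>Only the summand \<open>i = 0\<close> contains the quasi-derivative of order 2n - 1,
  which is merely absolutely continuous; all other factors are of class C^1.\<close>

lemma LL_AC:
  assumes s: "smooth_dom y" "smooth_dom z" and cd: "{c..d} \<subseteq> \<Delta>"
  shows "AC_on c d (LL y z)"
proof -
  have C1: "AC_on c d f" if f: "C1_on \<Delta> f" for f :: "real \<Rightarrow> 'h"
  proof (rule AC_on_C1)
    show "(f has_vector_derivative Dt \<Delta> f t) (at t within {c..d})" if "t \<in> {c..d}" for t
      using Dt_has_derivative[of f t] f cd that
      by (auto simp: C1_on_def intro!: has_vector_derivative_within_subset[OF _ cd])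
    show "continuous_on {c..d} (Dt \<Delta> f)" using f cd continuous_on_subset by (auto simp: C1_on_def)
  qed
  have 1: "AC_on c d (Dpow \<Delta> i x)" if "smooth_dom x" "i < n" for x i
    using that by (intro C1) (auto simp: smooth_dom_def)
  have 2: "AC_on c d (aa (n - 1 - i) x)" if "smooth_dom x" "i < n" for x i
  proof (cases "i = 0")
    case True
    then show ?thesis using that cd by (simp add: smooth_dom_def)
  next
    case False
    then show ?thesis using that by (intro C1) (auto simp: smooth_dom_def)
  qed
  show ?thesis
    unfolding LL_def[abs_def]
  proof (rule AC_on_sum)
    fix i assume "i \<in> {..<n}"
    then have i: "i < n" by simp
    show "AC_on c d (\<lambda>t. cinner (Dpow \<Delta> i y t) (aa (n - 1 - i) z t) - cinner (aa (n - 1 - i) y t) (Dpow \<Delta> i z t))"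
      by (rule AC_on_diff[OF AC_on_bilinear[OF bounded_bilinear_cinner 1[OF s(1) i] 2[OF s(2) i]]
            AC_on_bilinear[OF bounded_bilinear_cinner 2[OF s(1) i] 1[OF s(2) i]]])
  qed simp
qed

lemma Green_interval:
  assumes y: "y \<in> D" and z: "z \<in> D" and \<eta>: "0 \<le> \<eta>" "ereal \<eta> < b"
  shows "((\<lambda>t. cinner (L y t) (z t) - cinner (y t) (L z t)) has_integral (LL y z \<eta> - LL y z 0)) {0..\<eta>}"
proof (rule fundamental_theorem_AC[OF \<eta>(1)])
  have s: "smooth_dom y" "smooth_dom z" using y z by (auto simp: maxdom_iff)
  have sub: "{0..\<eta>} \<subseteq> \<Delta>" by (rule \<Delta>D(6)[OF \<eta>(2)])
  show "AC_on 0 \<eta> (LL y z)" by (rule LL_AC[OF s sub])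
  show "negligible (\<Delta> - dpts y \<inter> dpts z)"
    using negligible_Un[of "\<Delta> - dpts y" "\<Delta> - dpts z"] y z by (simp add: maxdom_iff Diff_Int)
  show "(LL y z has_vector_derivative cinner (L y t) (z t) - cinner (y t) (L z t)) (at t within {0..\<eta>})"
    if "t \<in> {0..\<eta>} - (\<Delta> - dpts y \<inter> dpts z)" for t
    using that sub by (intro has_vector_derivative_within_subset[OF LL_has_derivative[OF s] sub]) auto
qed

lemma maxdom_L2: "y \<in> D \<Longrightarrow> L2 \<Delta> y" "y \<in> D \<Longrightarrow> L2 \<Delta> (L y)"
  by (auto simp: maxdom_iff)

lemma Green_limit:
  assumes y: "y \<in> D" and z: "z \<in> D"
  shows "(LL y z \<longlongrightarrow> LL y z 0 + (ip \<Delta> (L y) z - ip \<Delta> y (L z))) (left_of b)"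
proof -
  have i: "integrable (lebesgue_on \<Delta>) (\<lambda>t. cinner (L y t) (z t))" "integrable (lebesgue_on \<Delta>) (\<lambda>t. cinner (y t) (L z t))"
    using y z by (auto intro!: L2_integrable_cinner maxdom_L2)
  have "((\<lambda>\<eta>. LL y z 0 + integral {0..\<eta>} (\<lambda>t. cinner (L y t) (z t) - cinner (y t) (L z t))) \<longlongrightarrow>
     LL y z 0 + (LINT t|lebesgue_on \<Delta>. cinner (L y t) (z t) - cinner (y t) (L z t))) (left_of b)"
    by (intro tendsto_add tendsto_const tendsto_integral_upto[OF I]) (use i in simp)
  then have "(LL y z \<longlongrightarrow> LL y z 0 + (LINT t|lebesgue_on \<Delta>. cinner (L y t) (z t) - cinner (y t) (L z t))) (left_of b)"
  proof (rule Lim_transform_eventually)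
    show "\<forall>\<^sub>F \<eta> in left_of b. LL y z 0 + integral {0..\<eta>} (\<lambda>t. cinner (L y t) (z t) - cinner (y t) (L z t)) = LL y z \<eta>"
      by (rule eventually_mono[OF left_of_eventually(1)[OF \<Delta>D(7)]])
         (use integral_unique[OF Green_interval[OF y z]] in auto)
  qed
  then show ?thesis using i by (simp add: ip_def)
qed

end

lemma bij_betw_idx: "bij_betw (idx :: 'n::{finite,linorder} \<Rightarrow> nat) UNIV {..<CARD('n)}"
proof -
  have mono: "idx i < idx j" if "i < j" for i j :: 'n
    unfolding idx_def by (rule psubset_card_mono) (use that in auto)
  have inj: "inj (idx :: 'n \<Rightarrow> nat)"
    by (rule injI) (metis mono less_irrefl linorder_neqE)
  moreover have "idx i < CARD('n)" for i :: 'n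
    unfolding idx_def by (rule psubset_card_mono) auto
  then have "range (idx :: 'n \<Rightarrow> nat) \<subseteq> {..<CARD('n)}" by auto
  moreover have "card (range (idx :: 'n \<Rightarrow> nat)) = card {..<CARD('n)}" using card_image[OF inj] by simp
  ultimately show ?thesis by (simp add: bij_betw_def card_subset_eq)
qed

lemma (in quasi) lagrange_eq:
  fixes y z :: "real \<Rightarrow> 'h"
  assumes "n = CARD('n::{finite,linorder})"
  shows "lagrange TYPE('n) \<Delta> p q y z t = LL y z t"
proof -
  have q1: "quasi_deriv n \<Delta> p q k x = Dpow \<Delta> k x" if "k < n" for k and x :: "real \<Rightarrow> 'h" using quasi_deriv_eq[of k x] that by simp
  have q2: "quasi_deriv n \<Delta> p q (2 * n - 1 - k) x = aa (n - 1 - k) x" if "k < n" for k and x :: "real \<Rightarrow> 'h"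
  proof -
    have "\<not> 2 * n - 1 - k < n" "2 * n - 1 - k - n = n - 1 - k" "2 * n - 1 - k < 2 * n" using that by auto
    then show ?thesis using quasi_deriv_eq[of "2 * n - 1 - k" x] by simp
  qed
  have "lagrange TYPE('n) \<Delta> p q y z t = (\<Sum>i\<in>(UNIV::'n set). cinner (quasi_deriv n \<Delta> p q (idx i) y t) (quasi_deriv n \<Delta> p q (2 * n - 1 - idx i) z t)
       - cinner (quasi_deriv n \<Delta> p q (2 * n - 1 - idx i) y t) (quasi_deriv n \<Delta> p q (idx i) z t))"
    by (simp add: lagrange_def cinner_vec_def qvec1_def qvec2_def assms sum_subtractf)
  also have "\<dots> = (\<Sum>k<n. cinner (quasi_deriv n \<Delta> p q k y t) (quasi_deriv n \<Delta> p q (2 * n - 1 - k) z t)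
       - cinner (quasi_deriv n \<Delta> p q (2 * n - 1 - k) y t) (quasi_deriv n \<Delta> p q k z t))"
    using sum.reindex_bij_betw[OF bij_betw_idx[where 'n='n], of "\<lambda>k. cinner (quasi_deriv n \<Delta> p q k y t) (quasi_deriv n \<Delta> p q (2 * n - 1 - k) z t)
       - cinner (quasi_deriv n \<Delta> p q (2 * n - 1 - k) y t) (quasi_deriv n \<Delta> p q k z t)"] by (simp add: assms)
  also have "\<dots> = LL y z t"
    unfolding LL_def by (rule sum.cong) (use q1 q2 in auto)
  finally show ?thesis .
qed

subsection \<open>Test functions\<close>

lemma dvd_pderiv_of_power:
  fixes r :: "real poly"
  assumes "r ^ Suc k dvd q"
  shows "r ^ k dvd pderiv q"
proof -
  obtain s where q: "q = r ^ Suc k * s" using assms by (auto simp: dvd_def)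
  have "pderiv q = r ^ k * (smult (of_nat (Suc k)) (pderiv r) * s + r * pderiv s)"
    unfolding q pderiv_mult pderiv_power_Suc by (simp add: algebra_simps)
  then show ?thesis by simp
qed

lemma coeff_funpow_pderiv_eq_0_iff:
  fixes q :: "real poly"
  shows "coeff ((pderiv ^^ j) q) i = 0 \<longleftrightarrow> coeff q (i + j) = 0"
  by (induction j arbitrary: i) (auto simp: coeff_pderiv simp del: of_nat_Suc)

lemma poly_funpow_pderiv_eq_0:
  fixes q :: "real poly"
  assumes "[:-c, 1:] ^ Suc N dvd q" "j \<le> N"
  shows "poly ((pderiv ^^ j) q) c = 0"
proof -
  have "[:-c, 1:] ^ (Suc N - j) dvd (pderiv ^^ j) q"
    using assms(2)
  proof (induction j)
    case (Suc j)
    have "Suc N - j = Suc (Suc N - Suc j)" using Suc.prems by simp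
    then have "[:-c, 1:] ^ Suc (Suc N - Suc j) dvd (pderiv ^^ j) q" using Suc by (metis Suc_leD)
    then show ?case unfolding funpow.simps o_apply by (rule dvd_pderiv_of_power)
  qed (use assms(1) in simp)
  moreover have "[:-c, 1:] dvd [:-c, 1:] ^ (Suc N - j)" using assms(2) by (intro dvd_power) simp
  ultimately show ?thesis by (metis dvd_trans poly_eq_0_iff_dvd)
qed

text \<open>At \<open>c\<close> the difference quotient of the truncation is dominated by that of
  \<open>f\<close>, which tends to \<open>f' c = 0\<close>.\<close>

lemma has_field_derivative_cutoff:
  fixes f :: "real \<Rightarrow> real"
  assumes f: "\<And>t. (f has_real_derivative f' t) (at t)" and c: "f c = 0" "f' c = 0"
  shows "((\<lambda>t. if t < c then f t else 0) has_real_derivative (if t < c then f' t else 0)) (at t)"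
proof -
  let ?g = "\<lambda>t. if t < c then f t else 0"
  consider "t < c" | "c < t" | "t = c" by linarith
  then show ?thesis
  proof cases
    case 1
    then show ?thesis
      using has_field_derivative_transform_within_open[OF f[of t], of "{..<c}" ?g] by simp
  next
    case 2
    then show ?thesis
      using has_field_derivative_transform_within_open[OF DERIV_const[of "0::real" "at t"], of "{c<..}" ?g] by simp
  next
    case 3
    have q: "((\<lambda>y. (f y - f c) / (y - c)) \<longlongrightarrow> 0) (at c)"
      using f[of c] c by (simp add: has_field_derivative_iff)
    have "((\<lambda>y. (?g y - ?g c) / (y - c)) \<longlongrightarrow> 0) (at c)"
    proof (rule Lim_null_comparison[OF always_eventually tendsto_norm_zero[OF q]], intro allI)
      show "norm ((?g y - ?g c) / (y - c)) \<le> norm ((f y - f c) / (y - c))" for y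
        using c by simp
    qed
    then show ?thesis using 3 by (simp add: has_field_derivative_iff)
  qed
qed

text \<open>The derivatives of \<open>t^m (t - c)^(N+1)\<close>, cut off at \<open>c\<close>. The
  second factor makes all derivatives up to order \<open>N\<close> vanish at \<open>c\<close>, the
  first makes \<open>m\<close> the leading order at 0.\<close>

lemma ex_test_function:
  fixes c :: real
  assumes c: "0 < c" and m: "m \<le> N"
  shows "\<exists>\<phi> :: nat \<Rightarrow> real \<Rightarrow> real. (\<forall>j<N. \<forall>t. (\<phi> j has_real_derivative \<phi> (Suc j) t) (at t)) \<and>
    continuous_on UNIV (\<phi> N) \<and> (\<forall>j t. c < t \<longrightarrow> \<phi> j t = 0) \<and> (\<forall>j<m. \<phi> j 0 = 0) \<and> \<phi> m 0 \<noteq> 0"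
proof -
  define q where "q = monom 1 m * [:-c, 1:] ^ Suc N"
  define \<phi> where "\<phi> = (\<lambda>j t. if t < c then poly ((pderiv ^^ j) q) t else 0)"
  have zero: "poly ((pderiv ^^ j) q) c = 0" if "j \<le> N" for j
    by (rule poly_funpow_pderiv_eq_0[OF _ that]) (simp add: q_def del: power_Suc)
  show ?thesis
  proof (intro exI[of _ \<phi>] conjI allI impI)
    fix j t assume j: "j < N"
    show "(\<phi> j has_real_derivative \<phi> (Suc j) t) (at t)"
      unfolding \<phi>_def
      by (rule has_field_derivative_cutoff) (use j zero[of j] zero[of "Suc j"] poly_DERIV in auto)
  next
    have "continuous_on ({..c} \<union> {c..}) (\<phi> N)"
    proof (rule continuous_on_closed_Un)
      have "continuous_on {..c} (poly ((pderiv ^^ N) q))" by (intro continuous_intros)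
      then show "continuous_on {..c} (\<phi> N)"
        by (rule continuous_on_eq) (use zero[of N] in \<open>auto simp: \<phi>_def\<close>)
      show "continuous_on {c..} (\<phi> N)"
        by (rule continuous_on_eq[OF continuous_on_const[of _ 0]]) (auto simp: \<phi>_def)
    qed auto
    also have "{..c} \<union> {c..} = UNIV" by auto
    finally show "continuous_on UNIV (\<phi> N)" .
  next
    have *: "\<phi> j 0 = 0 \<longleftrightarrow> coeff q j = 0" for j
      using c coeff_funpow_pderiv_eq_0_iff[of j q 0] by (simp add: \<phi>_def poly_0_coeff_0)
    show "\<phi> j 0 = 0" if "j < m" for j using that unfolding * by (simp add: q_def coeff_monom_mult)
    have "coeff q m = poly ([:-c, 1:] ^ Suc N) 0" by (simp only: q_def coeff_monom_mult poly_0_coeff_0) simp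
    then show "\<phi> m 0 \<noteq> 0" using c unfolding * by simp
  qed (use c in \<open>auto simp: \<phi>_def\<close>)
qed

context quasi
begin

abbreviation "cont \<equiv> (continuous_on \<Delta> :: (real \<Rightarrow> 'h) \<Rightarrow> bool)"

lemmas cont_base = base_class_continuous[where 'h = 'h]

lemma aa_reg_cont:
  assumes z: "reg cont (2 * n) z" and "k \<le> n"
  shows "reg cont (n - k) (aa k z)"
  using assms(2)
proof (induction k)
  case 0
  have "reg cont n (rr 0 z)" by (rule reg_rr[OF cont_base]) (use z in \<open>auto simp: mult_2\<close>)
  then show ?case by simp
next
  case (Suc k)
  have e: "n - k = Suc (n - Suc k)" using Suc by simp
  have "reg cont (n - Suc k) (\<lambda>t. (- 1) *\<^sub>C Dt \<Delta> (aa k z) t)"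
    by (rule reg_scaleC[OF cont_base]) (use Suc e in simp)
  moreover have "reg cont (n - Suc k) (rr (Suc k) z)"
    by (rule reg_rr[OF cont_base _ _ reg_mono[OF cont_base z]]) (use Suc in auto)
  ultimately show ?case using reg_add[OF cont_base] by (fastforce simp: scaleC_minus_one)
qed

lemma C1_on_AC: "C1_on \<Delta> f \<Longrightarrow> {c..d} \<subseteq> \<Delta> \<Longrightarrow> AC_on c d (f :: real \<Rightarrow> 'h)"
proof (rule AC_on_C1)
  assume f: "C1_on \<Delta> f" and cd: "{c..d} \<subseteq> \<Delta>"
  show "(f has_vector_derivative Dt \<Delta> f t) (at t within {c..d})" if "t \<in> {c..d}" for t
    using Dt_has_derivative[of f t] f cd that
    by (auto simp: C1_on_def intro!: has_vector_derivative_within_subset[OF _ cd])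
  show "continuous_on {c..d} (Dt \<Delta> f)" using f cd continuous_on_subset by (auto simp: C1_on_def)
qed

lemma C1_on_iff_reg: "C1_on \<Delta> f \<longleftrightarrow> reg cont 1 f"
  by (simp add: C1_on_def)

lemma smooth_dom_of_reg:
  assumes z: "reg cont (2 * n) z"
  shows "smooth_dom z" "dpts z = \<Delta>"
proof -
  have aaC1: "C1_on \<Delta> (aa k z)" if "k < n" for k
    unfolding C1_on_iff_reg by (rule reg_mono[OF cont_base aa_reg_cont[OF z]]) (use that in auto)
  then show "smooth_dom z"
    unfolding smooth_dom_def C1_on_iff_reg[of "Dpow \<Delta> _ z"]
    using n by (auto intro!: C1_on_AC reg_Dpow[OF cont_base] reg_mono[OF cont_base z] simp del: reg.simps)
  show "dpts z = \<Delta>" using aaC1[of "n - 1"] n by (auto simp: dpts_def C1_on_def)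
qed

definition vanishes_beyond :: "real \<Rightarrow> (real \<Rightarrow> 'h) \<Rightarrow> bool" where
  "vanishes_beyond c f \<longleftrightarrow> (\<forall>t\<in>\<Delta>. c < t \<longrightarrow> f t = 0)"

lemma vanishes_Dt: "vanishes_beyond c f \<Longrightarrow> vanishes_beyond c (Dt \<Delta> f)"
  unfolding vanishes_beyond_def
proof (intro ballI impI)
  fix t assume f: "\<forall>t\<in>\<Delta>. c < t \<longrightarrow> f t = 0" and t: "t \<in> \<Delta>" "c < t"
  have "(f has_vector_derivative 0) (at t within \<Delta>)"
  proof (rule has_vector_derivative_transform_within[OF has_vector_derivative_const[of 0]])
    show "0 < t - c" using t by simp
    show "0 = f s" if "s \<in> \<Delta>" "dist s t < t - c" for s using f that by (auto simp: dist_real_def)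
  qed (rule t)
  then show "Dt \<Delta> f t = 0" by (rule Dt_eqI[OF _ t(1)])
qed

lemma vanishes_Dpow: "vanishes_beyond c f \<Longrightarrow> vanishes_beyond c (Dpow \<Delta> k f)"
  by (induction k) (auto intro: vanishes_Dt)

lemma vanishes_rr:
  assumes "vanishes_beyond c f" "k \<le> n"
  shows "vanishes_beyond c (rr k f)"
  using vanishes_Dpow[OF assms(1)] bounded_op_lin(5)[OF p_b[OF assms(2)]] bounded_op_lin(5)[OF qq_b[OF assms(2)]]
    bounded_op_lin(5)[OF qs_b[OF assms(2)]]
  by (auto simp: vanishes_beyond_def rr_def simp del: funpow.simps)

lemma vanishes_aa: "vanishes_beyond c f \<Longrightarrow> k \<le> n \<Longrightarrow> vanishes_beyond c (aa k f)"
proof (induction k)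
  case (Suc k)
  then have "vanishes_beyond c (Dt \<Delta> (aa k f))" "vanishes_beyond c (rr (Suc k) f)"
    using vanishes_Dt vanishes_rr by auto
  then show ?case by (simp add: vanishes_beyond_def)
qed (simp add: vanishes_rr)

lemma LL_vanishes:
  assumes "vanishes_beyond c z" "t \<in> \<Delta>" "c < t"
  shows "LL y z t = 0"
proof -
  have "Dpow \<Delta> i z t = 0" "aa (n - 1 - i) z t = 0" for i
    using vanishes_Dpow[OF assms(1)] vanishes_aa[OF assms(1), of "n - 1 - i"] assms(2,3)
    by (auto simp: vanishes_beyond_def)
  then show ?thesis by (simp add: LL_def)
qed

lemma L2_of_vanishing:
  assumes f: "cont f" "vanishes_beyond c f" and c: "ereal c < b"
  shows "L2 \<Delta> f"
proof -
  note sub = \<Delta>D(6)[OF c]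
  have m: "f \<in> borel_measurable (lebesgue_on \<Delta>)"
    by (rule continuous_imp_measurable_on_sets_lebesgue[OF f(1) \<Delta>D(5)])
  have "bounded (f ` {0..c})"
    using continuous_on_subset[OF f(1) sub] by (auto intro!: compact_imp_bounded compact_continuous_image)
  then obtain B where B: "0 < B" "\<And>t. t \<in> {0..c} \<Longrightarrow> norm (f t) \<le> B" unfolding bounded_pos by blast
  have ind: "integrable (lebesgue_on \<Delta>) (indicator {0..c} :: real \<Rightarrow> real)"
  proof (rule integrable_real_indicator)
    show "{0..c} \<in> sets (lebesgue_on \<Delta>)" using sub \<Delta>D(5) by (simp add: sets_restrict_space_iff)
    have "emeasure (lebesgue_on \<Delta>) {0..c} = emeasure lebesgue {0..c}"
      by (rule emeasure_restrict_space) (use \<Delta>D(5) sub in auto)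
    also have "\<dots> < \<infinity>" by (simp add: emeasure_lborel_Icc_eq)
    finally show "emeasure (lebesgue_on \<Delta>) {0..c} < \<infinity>" .
  qed
  have "integrable (lebesgue_on \<Delta>) (\<lambda>t. (norm (f t))\<^sup>2)"
  proof (rule Bochner_Integration.integrable_bound)
    show "integrable (lebesgue_on \<Delta>) (\<lambda>t. B\<^sup>2 * indicator {0..c} t)" using ind by simp
    have "norm ((norm (f t))\<^sup>2) \<le> norm (B\<^sup>2 * indicator {0..c} t)" if "t \<in> \<Delta>" for t
    proof (cases "t \<le> c")
      case True
      then show ?thesis using B(2)[of t] \<Delta>D(2)[OF that] by (simp add: power_mono)
    qed (use f(2) that in \<open>simp add: vanishes_beyond_def\<close>)
    then show "AE t in lebesgue_on \<Delta>. norm ((norm (f t))\<^sup>2) \<le> norm (B\<^sup>2 * indicator {0..c} t)"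
      by (intro AE_I2) (simp add: space_restrict_space)
  qed (use m in measurable)
  then show ?thesis using m by (simp add: L2_def)
qed

definition test_fun :: "(real \<Rightarrow> 'h) \<Rightarrow> bool" where
  "test_fun z \<longleftrightarrow> z \<in> D \<and> (\<exists>c. ereal c < b \<and> vanishes_beyond c z)"

lemma test_fun_lin: "test_fun y \<Longrightarrow> test_fun z \<Longrightarrow> test_fun (\<lambda>t. \<alpha> *\<^sub>C y t + \<beta> *\<^sub>C z t)"
  unfolding test_fun_def
proof (elim conjE exE, intro conjI maxdom_lin(1))
  fix c d assume *: "ereal c < b" "vanishes_beyond c y" "ereal d < b" "vanishes_beyond d z"
  show "\<exists>c. ereal c < b \<and> vanishes_beyond c (\<lambda>t. \<alpha> *\<^sub>C y t + \<beta> *\<^sub>C z t)"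
    by (rule exI[of _ "max c d"]) (use * in \<open>auto simp: vanishes_beyond_def max_def\<close>)
qed

lemma test_fun_of_reg:
  assumes z: "reg cont (2 * n) z" "vanishes_beyond c z" "ereal c < b"
  shows "test_fun z"
proof -
  note s = smooth_dom_of_reg[OF z(1)]
  have "cont z" using reg_mono[OF cont_base z(1), of 0] by simp
  then have "L2 \<Delta> z" by (rule L2_of_vanishing[OF _ z(2,3)])
  moreover have "L2 \<Delta> (L z)"
  proof (rule L2_cong_AE[OF \<Delta>D(5)])
    show "L2 \<Delta> (aa n z)"
      using aa_reg_cont[OF z(1), of n] vanishes_aa[OF z(2), of n] z(3) by (intro L2_of_vanishing) auto
    show "AE t in lebesgue_on \<Delta>. aa n z t = L z t"
      by (rule AE_I2) (simp add: lexpr_eq_aa[OF s(1)] s(2) space_restrict_space)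
  qed
  ultimately have "z \<in> D" using s by (simp add: maxdom_iff)
  then show ?thesis using z by (auto simp: test_fun_def)
qed

text \<open>In the Leibniz expansion every term with a differentiated operator carries a derivative
  of \<open>f\<close> of order below \<open>i\<close>, which vanishes at 0.\<close>

lemma Dpow_op_leading:
  assumes "op_Ck i \<Delta> F" "reg cont i f" "\<And>l. l < i \<Longrightarrow> Dpow \<Delta> l f 0 = 0"
  shows "Dpow \<Delta> i (\<lambda>t. F t (f t)) 0 = F 0 (Dpow \<Delta> i f 0)"
  using assms
proof (induction i arbitrary: F f)
  case (Suc i)
  note zero = \<Delta>D(1)
  obtain F' where F': "op_Ck i \<Delta> F'"
    "\<And>t. t \<in> \<Delta> \<Longrightarrow> op_tendsto UNIV (\<lambda>s x. (1 / (s - t)) *\<^sub>R (F s x - F t x)) (F' t) (at t within \<Delta>)"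
    using op_Ck_Suc[OF Suc.prems(1)] by blast
  have F: "op_Ck i \<Delta> F" by (rule op_Ck_mono[OF Suc.prems(1)]) simp
  have df: "f differentiable (at t within \<Delta>)" if "t \<in> \<Delta>" for t using Suc.prems(2) that by simp
  have f: "reg cont i f" by (rule reg_SucD[OF cont_base Suc.prems(2)])
  have f': "reg cont i (Dt \<Delta> f)" using Suc.prems(2) by simp
  have d: "Dt \<Delta> (\<lambda>t. F t (f t)) t = F' t (f t) + F t (Dt \<Delta> f t)" if t: "t \<in> \<Delta>" for t
    by (rule Dt_eqI[OF has_vector_derivative_op_apply[OF F'(2)[OF t] op_Ck_continuous[OF F t] op_Ck_bounded[OF F t]
        op_Ck_bounded[OF F'(1) t] op_Ck_bounded[OF F] Dt_has_derivative[OF df[OF t]]] t])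
  have 1: "reg cont i (\<lambda>t. F' t (f t))" "reg cont i (\<lambda>t. F t (Dt \<Delta> f t))"
    using reg_op[OF cont_base _ f, of F'] reg_op[OF cont_base _ f', of F] F' F by auto
  have "Dpow \<Delta> (Suc i) (\<lambda>t. F t (f t)) 0 = Dpow \<Delta> i (\<lambda>t. F' t (f t) + F t (Dt \<Delta> f t)) 0"
    unfolding Dpow_Suc_shift by (rule Dpow_cong[OF d zero])
  also have "\<dots> = Dpow \<Delta> i (\<lambda>t. F' t (f t)) 0 + Dpow \<Delta> i (\<lambda>t. F t (Dt \<Delta> f t)) 0"
    by (rule Dpow_add) (use Dpow_differentiable[OF 1(1)] Dpow_differentiable[OF 1(2)] zero in auto)
  also have "Dpow \<Delta> i (\<lambda>t. F' t (f t)) 0 = F' 0 (Dpow \<Delta> i f 0)"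
    by (rule Suc.IH[OF F'(1) f]) (use Suc.prems in simp)
  also have "Dpow \<Delta> i f 0 = 0" using Suc.prems(3)[of i] by simp
  also have "F' 0 0 = 0" by (rule bounded_op_lin(5)[OF op_Ck_bounded[OF F'(1) zero]])
  also have "Dpow \<Delta> i (\<lambda>t. F t (Dt \<Delta> f t)) 0 = F 0 (Dpow \<Delta> i (Dt \<Delta> f) 0)"
    by (rule Suc.IH[OF F f']) (use Suc.prems(3)[of "Suc _"] in \<open>simp add: Dpow_Suc_shift[symmetric] del: funpow.simps\<close>)
  finally show ?case by (simp only: Dpow_Suc_shift add_0)
qed simp

text \<open>A count of orders. For \<open>j > 0\<close> the i-th derivative of \<open>rr j z\<close>
  contains derivatives of \<open>z\<close> up to order \<open>n - j + 1 + i\<close>, below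
  \<open>n + j + i\<close> and hence below \<open>m\<close>. For \<open>j = 0\<close> only the term
  with \<open>p 0\<close> reaches order \<open>n + i\<close>.\<close>

lemma rr_leading:
  assumes z: "reg cont (2 * n) z" and van: "\<And>l. l < m \<Longrightarrow> Dpow \<Delta> l z 0 = 0"
    and j: "j \<le> n" "i \<le> n - j" "n + j + i \<le> m"
  shows "Dpow \<Delta> i (rr j z) 0 = (if j = 0 then p 0 0 (Dpow \<Delta> (n + i) z 0) else 0)"
proof -
  note zero = \<Delta>D(1)
  have lead: "Dpow \<Delta> i (\<lambda>t. F t (Dpow \<Delta> k z t)) 0 = F 0 (Dpow \<Delta> (k + i) z 0) \<and> reg cont i (\<lambda>t. F t (Dpow \<Delta> k z t))"
    if F: "op_Ck (n - j) \<Delta> F" and k: "k \<le> (if j = 0 then n else n - j + 1)" for F k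
  proof -
    have Fi: "op_Ck i \<Delta> F" by (rule op_Ck_mono[OF F j(2)])
    have r: "reg cont i (Dpow \<Delta> k z)"
      by (rule reg_Dpow[OF cont_base reg_mono[OF cont_base z]]) (use j k in \<open>auto split: if_splits\<close>)
    have "Dpow \<Delta> i (\<lambda>t. F t (Dpow \<Delta> k z t)) 0 = F 0 (Dpow \<Delta> i (Dpow \<Delta> k z) 0)"
      by (rule Dpow_op_leading[OF Fi r]) (use van j k in \<open>auto simp: Dpow_Dpow split: if_splits\<close>)
    then show ?thesis using reg_op[OF cont_base _ r, of F] Fi by (simp add: Dpow_Dpow add.commute)
  qed
  note X = lead[OF p_Ck[OF j(1)], of "n - j"]
  have Z_le: "n - j - 1 \<le> (if j = 0 then n else n - j + 1)" by (cases "j = 0") auto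
  note Z = lead[OF qq_Ck[OF j(1)] Z_le]
  \<comment> \<open>For \<open>j = 0\<close> the operator \<open>qs 0\<close> is zero, and order 0
    replaces the formal order n + 1.\<close>
  define k' where "k' = (if j = 0 then 0 else n - j + 1)"
  have k': "(\<lambda>t. qs j t (Dpow \<Delta> (n - j + 1) z t)) = (\<lambda>t. qs j t (Dpow \<Delta> k' z t))"
    by (auto simp: k'_def qs_def)
  note Y = lead[OF qs_Ck[OF j(1)], of k']
  have k'_le: "k' \<le> (if j = 0 then n else n - j + 1)" by (simp add: k'_def)
  note rX = conjunct2[OF X] and rY = conjunct2[OF Y[OF k'_le]] and rZ = conjunct2[OF Z]
  have sY: "reg cont i (\<lambda>t. (\<i> / 2) *\<^sub>C qs j t (Dpow \<Delta> k' z t))" by (rule reg_scaleC[OF cont_base rY])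
  have sZ: "reg cont i (\<lambda>t. (- (\<i> / 2)) *\<^sub>C qq j t (Dpow \<Delta> (n - j - 1) z t))" by (rule reg_scaleC[OF cont_base rZ])
  have sX: "reg cont i (\<lambda>t. p j t (Dpow \<Delta> (n - j) z t))" by (rule rX) simp
  have "Dpow \<Delta> i (rr j z) 0 = Dpow \<Delta> i (\<lambda>t. p j t (Dpow \<Delta> (n - j) z t)) 0
      + Dpow \<Delta> i (\<lambda>t. (\<i> / 2) *\<^sub>C qs j t (Dpow \<Delta> k' z t)) 0
      + Dpow \<Delta> i (\<lambda>t. (- (\<i> / 2)) *\<^sub>C qq j t (Dpow \<Delta> (n - j - 1) z t)) 0"
  proof -
    have "rr j z = (\<lambda>t. (p j t (Dpow \<Delta> (n - j) z t) + (\<i> / 2) *\<^sub>C qs j t (Dpow \<Delta> k' z t))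
         + (- (\<i> / 2)) *\<^sub>C qq j t (Dpow \<Delta> (n - j - 1) z t))"
      using fun_cong[OF k'] by (simp add: rr_def[abs_def])
    then show ?thesis
      by (simp only: Dpow_add[OF Dpow_differentiable[OF reg_add[OF cont_base sX sY] _ zero] Dpow_differentiable[OF sZ _ zero]
            Dpow_differentiable[OF reg_add[OF cont_base sX sY] Suc_lessD] Dpow_differentiable[OF sZ Suc_lessD] zero]
          Dpow_add[OF Dpow_differentiable[OF sX _ zero] Dpow_differentiable[OF sY _ zero]
            Dpow_differentiable[OF sX Suc_lessD] Dpow_differentiable[OF sY Suc_lessD] zero])
  qed
  also have "Dpow \<Delta> i (\<lambda>t. (\<i> / 2) *\<^sub>C qs j t (Dpow \<Delta> k' z t)) 0 = (\<i> / 2) *\<^sub>C Dpow \<Delta> i (\<lambda>t. qs j t (Dpow \<Delta> k' z t)) 0"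
    by (rule Dpow_linear[OF bounded_linear_scaleC Dpow_differentiable[OF rY _ zero] Dpow_differentiable[OF rY Suc_lessD] zero])
  also have "Dpow \<Delta> i (\<lambda>t. (- (\<i> / 2)) *\<^sub>C qq j t (Dpow \<Delta> (n - j - 1) z t)) 0 = (- (\<i> / 2)) *\<^sub>C Dpow \<Delta> i (\<lambda>t. qq j t (Dpow \<Delta> (n - j - 1) z t)) 0"
    by (rule Dpow_linear[OF bounded_linear_scaleC Dpow_differentiable[OF rZ _ zero] Dpow_differentiable[OF rZ Suc_lessD] zero])
  also have "Dpow \<Delta> i (\<lambda>t. qs j t (Dpow \<Delta> k' z t)) 0 = 0"
  proof (cases "j = 0")
    case True
    then show ?thesis using Y[OF k'_le] by (simp add: qs_def)
  next
    case False
    then have "Dpow \<Delta> (k' + i) z 0 = 0" using j by (intro van) (simp add: k'_def)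
    then show ?thesis using Y[OF k'_le] bounded_op_lin(5)[OF qs_b[OF j(1) zero]] by simp
  qed
  also have "Dpow \<Delta> i (\<lambda>t. qq j t (Dpow \<Delta> (n - j - 1) z t)) 0 = 0"
  proof -
    have "Dpow \<Delta> (n - j - 1 + i) z 0 = 0" using j n by (intro van) simp
    then show ?thesis using Z bounded_op_lin(5)[OF qq_b[OF j(1) zero]] by simp
  qed
  also have "Dpow \<Delta> i (\<lambda>t. p j t (Dpow \<Delta> (n - j) z t)) 0 = (if j = 0 then p 0 0 (Dpow \<Delta> (n + i) z 0) else 0)"
  proof (cases "j = 0")
    case False
    then have "Dpow \<Delta> (n - j + i) z 0 = 0" using j n by (intro van) simp
    then show ?thesis using X False bounded_op_lin(5)[OF p_b[OF j(1) zero]] by simp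
  qed (use X in simp)
  finally show ?thesis by simp
qed

text \<open>The passage from ordinary to quasi-derivatives at 0 is triangular, with the invertible
  operator \<open>p 0 0\<close> up to sign on the diagonal in the upper half. This is what makes the
  initial values of test functions arbitrary.\<close>

lemma aa_leading:
  assumes z: "reg cont (2 * n) z" and van: "\<And>l. l < m \<Longrightarrow> Dpow \<Delta> l z 0 = 0"
    and "k \<le> n" "i \<le> n - k" "n + k + i \<le> m"
  shows "Dpow \<Delta> i (aa k z) 0 = (-1) ^ k *\<^sub>R p 0 0 (Dpow \<Delta> (n + k + i) z 0)"
  using assms(3-)
proof (induction k arbitrary: i)
  case 0
  then show ?case using rr_leading[where j = 0 and i = i and m = m, OF z van] by simp
next
  case (Suc k)
  note zero = \<Delta>D(1)
  have "reg cont (Suc i) (aa k z)" by (rule reg_mono[OF cont_base aa_reg_cont[OF z]]) (use Suc.prems in auto)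
  then have r: "reg cont i (Dt \<Delta> (aa k z))" by simp
  have rm: "reg cont i (\<lambda>t. - Dt \<Delta> (aa k z) t)" using reg_scaleC[OF cont_base r, of "-1"] by (simp add: scaleC_minus_one)
  have rr: "reg cont i (rr (Suc k) z)"
    by (rule reg_rr[OF cont_base _ _ reg_mono[OF cont_base z]]) (use Suc.prems in auto)
  have "Dpow \<Delta> i (aa (Suc k) z) 0 = Dpow \<Delta> i (\<lambda>t. - Dt \<Delta> (aa k z) t) 0 + Dpow \<Delta> i (rr (Suc k) z) 0"
    unfolding aa.simps
    by (rule Dpow_add[OF Dpow_differentiable[OF rm _ zero] Dpow_differentiable[OF rr _ zero]
            Dpow_differentiable[OF rm Suc_lessD] Dpow_differentiable[OF rr Suc_lessD] zero])
  also have "Dpow \<Delta> i (rr (Suc k) z) 0 = 0" using rr_leading[where j = "Suc k" and i = i and m = m, OF z van] Suc.prems by simp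
  also have "Dpow \<Delta> i (\<lambda>t. - Dt \<Delta> (aa k z) t) 0 = - Dpow \<Delta> i (Dt \<Delta> (aa k z)) 0"
    by (rule Dpow_linear[OF bounded_linear_minus[OF bounded_linear_ident] Dpow_differentiable[OF r _ zero]
          Dpow_differentiable[OF r Suc_lessD] zero])
  also have "Dpow \<Delta> i (Dt \<Delta> (aa k z)) 0 = Dpow \<Delta> (Suc i) (aa k z) 0" by (simp only: Dpow_Suc_shift)
  also have "\<dots> = (-1) ^ k *\<^sub>R p 0 0 (Dpow \<Delta> (n + k + Suc i) z 0)" by (rule Suc.IH) (use Suc.prems in auto)
  finally show ?case by simp
qed

text \<open>The initial values \<open>y\<^sup>[\<^sup>k\<^sup>](0)\<close>, \<open>k < 2 n\<close>.\<close>

definition qd0 :: "(real \<Rightarrow> 'h) \<Rightarrow> nat \<Rightarrow> 'h" where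
  "qd0 y k = (if k < n then Dpow \<Delta> k y 0 else aa (k - n) y 0)"

lemma qd0_lin:
  assumes "y \<in> D" "z \<in> D" "k < 2 * n"
  shows "qd0 (\<lambda>t. \<alpha> *\<^sub>C y t + \<beta> *\<^sub>C z t) k = \<alpha> *\<^sub>C qd0 y k + \<beta> *\<^sub>C qd0 z k"
  using assms Dpow_lin[of y z k 0] aa_lin[of y z "k - n" 0] \<Delta>D(1) by (auto simp: qd0_def maxdom_iff)

text \<open>One column of the triangular system: a scalar test function of leading order
  \<open>m\<close> times a fixed vector. The values of index above \<open>m\<close> are left
  uncontrolled.\<close>

lemma ex_test_fun_leading:
  assumes m: "m < 2 * n"
  shows "\<exists>z. test_fun z \<and> (\<forall>k<m. qd0 z k = 0) \<and> qd0 z m = v"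
proof -
  note zero = \<Delta>D(1)
  obtain c where c: "0 < c" "ereal c < b" using \<Delta>D(7) ereal_dense2[of 0 b] by (auto simp flip: zero_ereal_def)
  obtain \<phi> :: "nat \<Rightarrow> real \<Rightarrow> real" where \<phi>:
    "\<And>j t. j < 2 * n \<Longrightarrow> (\<phi> j has_real_derivative \<phi> (Suc j) t) (at t)" "continuous_on UNIV (\<phi> (2 * n))"
    "\<And>j t. c < t \<Longrightarrow> \<phi> j t = 0" "\<And>j. j < m \<Longrightarrow> \<phi> j 0 = 0" "\<phi> m 0 \<noteq> 0"
    using ex_test_function[OF c(1) less_imp_le[OF m]] by blast
  obtain R where R: "bounded_op UNIV UNIV R" "\<And>x. p 0 0 (R x) = x"
    using p0_invertible[OF zero] by (auto simp: boundedly_invertible_def)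
  have plin: "bounded_op UNIV UNIV (p 0 0)" using p_b[of 0, OF _ zero] by simp
  \<comment> \<open>Divides out the leading value of the scalar function and, for
    \<open>m \<ge> n\<close>, the diagonal entry of the triangular system.\<close>
  define h where "h = (1 / \<phi> m 0) *\<^sub>R (if m < n then v else (-1) ^ (m - n) *\<^sub>R R v)"
  define z where "z = (\<lambda>t. \<phi> 0 t *\<^sub>R h)"
  have dphi: "((\<lambda>t. \<phi> j t *\<^sub>R h) has_vector_derivative \<phi> (Suc j) t *\<^sub>R h) (at t within \<Delta>)" if "j < 2 * n" for j t
  proof -
    have "(\<phi> j has_vector_derivative \<phi> (Suc j) t) (at t within \<Delta>)"
      using \<phi>(1)[OF that, of t] has_vector_derivative_at_within
      unfolding has_real_derivative_iff_has_vector_derivative by blast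
    then show ?thesis by (rule bounded_linear.has_vector_derivative[OF bounded_linear_scaleR_left])
  qed
  have Dz: "Dpow \<Delta> j z t = \<phi> j t *\<^sub>R h" if "j \<le> 2 * n" "t \<in> \<Delta>" for j t
    using that
  proof (induction j arbitrary: t)
    case (Suc j)
    have "Dpow \<Delta> (Suc j) z t = Dt \<Delta> (\<lambda>t. \<phi> j t *\<^sub>R h) t"
      unfolding funpow.simps o_apply by (rule Dt_cong) (use Suc in auto)
    also have "\<dots> = \<phi> (Suc j) t *\<^sub>R h" by (rule Dt_eqI[OF dphi]) (use Suc.prems in auto)
    finally show ?case .
  qed (simp add: z_def)
  have z: "reg cont (2 * n) z"
    unfolding reg_iff
  proof (intro conjI allI impI ballI)
    fix k t assume k: "k < 2 * n" and t: "t \<in> \<Delta>"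
    show "Dpow \<Delta> k z differentiable (at t within \<Delta>)"
      using differentiable_cong[of "Dpow \<Delta> k z" "\<lambda>t. \<phi> k t *\<^sub>R h" t] Dz[of k] differentiableI_vd[OF dphi[OF k]] k t by simp
  next
    have "cont (\<lambda>t. \<phi> (2 * n) t *\<^sub>R h)" using \<phi>(2) by (intro continuous_intros) (auto intro: continuous_on_subset)
    then show "cont (Dpow \<Delta> (2 * n) z)" using Dz[of "2 * n"] by (simp cong: continuous_on_cong)
  qed
  have "test_fun z" by (rule test_fun_of_reg[OF z _ c(2)]) (simp add: vanishes_beyond_def z_def \<phi>(3))
  moreover have van: "Dpow \<Delta> l z 0 = 0" if "l < m" for l using Dz[of l 0] zero that m \<phi>(4)[OF that] by simp
  have "qd0 z k = 0" if k: "k < m" for k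
  proof (cases "k < n")
    case False
    have "aa (k - n) z 0 = (-1) ^ (k - n) *\<^sub>R p 0 0 (Dpow \<Delta> k z 0)"
      using aa_leading[where k = "k - n" and i = 0 and m = m, OF z van] k m False by simp
    then show ?thesis using False van[OF k] bounded_op_lin(5)[OF plin] by (simp add: qd0_def)
  qed (use van[OF k] in \<open>simp add: qd0_def\<close>)
  moreover have "qd0 z m = v"
  proof (cases "m < n")
    case True
    then show ?thesis using Dz[of m 0] zero \<phi>(5) m by (simp add: qd0_def h_def)
  next
    case False
    have "aa (m - n) z 0 = (-1) ^ (m - n) *\<^sub>R p 0 0 (Dpow \<Delta> m z 0)"
      using aa_leading[where k = "m - n" and i = 0 and m = m, OF z van] m False by simp
    also have "Dpow \<Delta> m z 0 = (-1) ^ (m - n) *\<^sub>R R v" using Dz[of m 0] zero \<phi>(5) m False by (simp add: h_def)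
    also have "(-1) ^ (m - n) *\<^sub>R p 0 0 \<dots> = v"
      by (simp add: bounded_op_lin[OF plin] R(2) flip: power_add mult_2)
    finally show ?thesis using False by (simp add: qd0_def)
  qed
  ultimately show ?thesis by blast
qed

text \<open>Forward substitution: a correction with leading index \<open>j\<close> leaves the values
  already attained unchanged.\<close>

lemma ex_test_fun_initial_values:
  "\<exists>z. test_fun z \<and> (\<forall>k<2 * n. qd0 z k = v k)"
proof -
  have "\<exists>z. test_fun z \<and> (\<forall>k<j. qd0 z k = v k)" if "j \<le> 2 * n" for j
    using that
  proof (induction j)
    case 0
    then show ?case using ex_test_fun_leading[of 0] n by auto
  next
    case (Suc j)
    then obtain z where z: "test_fun z" "\<forall>k<j. qd0 z k = v k" by auto
    obtain w where w: "test_fun w" "\<forall>k<j. qd0 w k = 0" "qd0 w j = v j - qd0 z j"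
      using ex_test_fun_leading[of j "v j - qd0 z j"] Suc.prems by auto
    show ?case
    proof (intro exI conjI allI impI)
      show "test_fun (\<lambda>t. 1 *\<^sub>C z t + 1 *\<^sub>C w t)" by (rule test_fun_lin[OF z(1) w(1)])
      fix k assume "k < Suc j"
      then show "qd0 (\<lambda>t. 1 *\<^sub>C z t + 1 *\<^sub>C w t) k = v k"
        using z w Suc.prems by (subst qd0_lin) (auto simp: test_fun_def less_Suc_eq simp del: scaleC_one, auto)
    qed
  qed
  then show ?thesis by blast
qed

end

subsection \<open>Abstract boundary triplets\<close>

text \<open>All that the operator theory uses of the differential operator: linearity, Green's
  identity at both ends at once, and surjectivity. Linearity of \<open>L\<close> is required only
  almost everywhere.\<close>

locale btriplet =
  fixes \<Delta> :: "real set" and D :: "(real \<Rightarrow> 'h::{chilbert_space, second_countable_topology}) set"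
    and L :: "(real \<Rightarrow> 'h) \<Rightarrow> real \<Rightarrow> 'h" and H1 :: "'e::chilbert_space set" and G0 G1 :: "(real \<Rightarrow> 'h) \<Rightarrow> 'e"
  assumes H1: "closed_csubspace H1"
    and D_lin: "\<And>y z \<alpha> \<beta>. y \<in> D \<Longrightarrow> z \<in> D \<Longrightarrow> (\<lambda>t. \<alpha> *\<^sub>C y t + \<beta> *\<^sub>C z t) \<in> D"
    and L_lin: "\<And>y z \<alpha> \<beta>. y \<in> D \<Longrightarrow> z \<in> D \<Longrightarrow>
      AE t in lebesgue_on \<Delta>. L (\<lambda>t. \<alpha> *\<^sub>C y t + \<beta> *\<^sub>C z t) t = \<alpha> *\<^sub>C L y t + \<beta> *\<^sub>C L z t"
    and D_L2: "\<And>y. y \<in> D \<Longrightarrow> L2 \<Delta> y" and L_L2: "\<And>y. y \<in> D \<Longrightarrow> L2 \<Delta> (L y)"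
    and G0_lin: "\<And>y z \<alpha> \<beta>. y \<in> D \<Longrightarrow> z \<in> D \<Longrightarrow> G0 (\<lambda>t. \<alpha> *\<^sub>C y t + \<beta> *\<^sub>C z t) = \<alpha> *\<^sub>C G0 y + \<beta> *\<^sub>C G0 z"
    and G1_lin: "\<And>y z \<alpha> \<beta>. y \<in> D \<Longrightarrow> z \<in> D \<Longrightarrow> G1 (\<lambda>t. \<alpha> *\<^sub>C y t + \<beta> *\<^sub>C z t) = \<alpha> *\<^sub>C G1 y + \<beta> *\<^sub>C G1 z"
    and G1_mem: "\<And>y. y \<in> D \<Longrightarrow> G1 y \<in> H1"
    and surj: "\<And>e0 e1. e1 \<in> H1 \<Longrightarrow> \<exists>y\<in>D. G0 y = e0 \<and> G1 y = e1"
    and Green: "\<And>y z. y \<in> D \<Longrightarrow> z \<in> D \<Longrightarrow> cinner (G1 y) (G0 z) - cinner (G0 y) (G1 z)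
      + \<i> * cinner (oproj (ocompl H1) (G0 y)) (oproj (ocompl H1) (G0 z)) = ip \<Delta> (L y) z - ip \<Delta> y (L z)"
begin

abbreviation "P1 \<equiv> oproj H1"
abbreviation "P2 \<equiv> oproj (ocompl H1)"

lemma H2: "closed_csubspace (ocompl H1)"
  by (rule closed_csubspace_ocompl)

lemma P12: "P1 x + P2 x = x"
  by (simp add: oproj_ocompl[OF H1])

lemma cinner_H1_H2: "x \<in> H1 \<Longrightarrow> cinner x (P2 y) = 0" "x \<in> H1 \<Longrightarrow> cinner (P2 y) x = 0"
proof -
  assume x: "x \<in> H1"
  show "cinner (P2 y) x = 0" using oproj_mem[OF H2, of y] x by (auto simp: ocompl_def)
  then show "cinner x (P2 y) = 0" by (metis cnj_cinner complex_cnj_zero)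
qed

lemma P2_H1: "x \<in> H1 \<Longrightarrow> P2 x = 0"
  by (simp add: oproj_ocompl[OF H1] oproj_id[OF H1])

lemma norm_P12: "(norm (P1 x))\<^sup>2 + (norm (P2 x))\<^sup>2 = (norm x)\<^sup>2"
  using norm_add_sq[of "P1 x" "P2 x"] cinner_H1_H2(1)[OF oproj_mem[OF H1], of x x] by (simp add: P12)

text \<open>
  The boundary operators are bounded in the graph norm of \<open>L\<close>: by Green's identity and surjectivity the
  functionals \<open>[y, \<cdot>]\<close> are pointwise bounded, so uniform boundedness applies.
\<close>

lemma graph_bound:
  obtains C where "0 < C" "\<And>y. y \<in> D \<Longrightarrow> norm (G0 y) \<le> C * (nrm \<Delta> y + nrm \<Delta> (L y))"
    "\<And>y. y \<in> D \<Longrightarrow> norm (G1 y) \<le> C * (nrm \<Delta> y + nrm \<Delta> (L y))"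
proof -
  define a where "a = (\<lambda>y. nrm \<Delta> y + nrm \<Delta> (L y))"
  \<comment> \<open>The boundary form of \<open>y\<close> as a functional on all of the product;
    inserting \<open>P1\<close> makes the second argument admissible for surjectivity.\<close>
  define T where "T = (\<lambda>y (e0, e1). cinner (G1 y) e0 - cinner (G0 y) (P1 e1) + \<i> * cinner (P2 (G0 y)) (P2 e0))"
  have a0: "0 \<le> a y" for y by (simp add: a_def nrm_nonneg)
  have Tbl: "bounded_linear (T y)" for y
  proof (rule bounded_linear_intro[where K = "norm (G1 y) + 2 * norm (G0 y)"])
    fix e e' :: "'e \<times> 'e" and r :: real
    show "T y (e + e') = T y e + T y e'"
      by (cases e; cases e') (simp add: T_def cinner_add_right oproj_add[OF H1] oproj_add[OF H2] algebra_simps)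
    show "T y (r *\<^sub>R e) = r *\<^sub>R T y e"
      using oproj_scaleC[OF H1, of "of_real r"] oproj_scaleC[OF H2, of "of_real r"]
      by (cases e) (simp add: T_def scaleC_of_real cinner_scaleR_right scaleR_conv_of_real algebra_simps)
    obtain e0 e1 where e: "e = (e0, e1)" by fastforce
    have n: "norm e0 \<le> norm e" "norm e1 \<le> norm e" using norm_fst_le[of e0 e1] norm_snd_le[of e1 e0] by (auto simp: e)
    have "norm (T y e) \<le> cmod (cinner (G1 y) e0) + cmod (cinner (G0 y) (P1 e1)) + cmod (cinner (P2 (G0 y)) (P2 e0))"
      unfolding T_def e prod.case
      by (rule order_trans[OF norm_triangle_ineq add_mono[OF norm_triangle_ineq4]]) (simp add: norm_mult)
    also have "\<dots> \<le> norm (G1 y) * norm e0 + norm (G0 y) * norm (P1 e1) + norm (P2 (G0 y)) * norm (P2 e0)"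
      by (intro add_mono cinner_Cauchy_Schwarz)
    also have "\<dots> \<le> norm (G1 y) * norm e + norm (G0 y) * norm e + norm (G0 y) * norm e"
      using norm_oproj_le[OF H1, of e1] norm_oproj_le[OF H2, of e0] norm_oproj_le[OF H2, of "G0 y"] n
      by (intro add_mono mult_mono) auto
    finally show "norm (T y e) \<le> norm e * (norm (G1 y) + 2 * norm (G0 y))" by (simp add: algebra_simps)
  qed
  have ptw: "\<exists>B. \<forall>y\<in>D. norm (T y e) \<le> B * a y" for e
  proof -
    obtain e0 e1 where e: "e = (e0, e1)" by fastforce
    obtain z where z: "z \<in> D" "G0 z = e0" "G1 z = P1 e1" using surj[OF oproj_mem[OF H1]] by blast
    have "norm (T y e) \<le> (nrm \<Delta> z + nrm \<Delta> (L z)) * a y" if y: "y \<in> D" for y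
    proof -
      have "T y e = ip \<Delta> (L y) z - ip \<Delta> y (L z)" using Green[OF y z(1)] by (simp add: T_def e z)
      then have "norm (T y e) \<le> norm (ip \<Delta> (L y) z) + norm (ip \<Delta> y (L z))" by (simp add: norm_triangle_ineq4)
      also have "\<dots> \<le> nrm \<Delta> (L y) * nrm \<Delta> z + nrm \<Delta> y * nrm \<Delta> (L z)"
        using y z(1) by (intro add_mono ip_Cauchy_Schwarz D_L2 L_L2)
      also have "\<dots> \<le> (nrm \<Delta> z + nrm \<Delta> (L z)) * a y"
        using nrm_nonneg[of \<Delta> y] nrm_nonneg[of \<Delta> z] nrm_nonneg[of \<Delta> "L y"] nrm_nonneg[of \<Delta> "L z"]
        by (simp add: a_def algebra_simps)
      finally show ?thesis .
    qed
    then show ?thesis by blast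
  qed
  obtain B where B: "0 \<le> B" "\<And>y e. y \<in> D \<Longrightarrow> norm (T y e) \<le> B * a y * norm e"
    using uniform_boundedness_weighted[of D T a, OF Tbl a0 ptw] by blast
  have sq: "x \<le> B * a y" if "x\<^sup>2 \<le> B * a y * x" "0 \<le> x" for x y
    using that B(1) a0[of y] by (cases "x = 0") (auto simp: power2_eq_square)
  have b: "norm (P1 (G0 y)) \<le> B * a y" "norm (P2 (G0 y)) \<le> B * a y" "norm (G1 y) \<le> B * a y" if y: "y \<in> D" for y
  proof -
    have "cmod (T y (0, P1 (G0 y))) = (norm (P1 (G0 y)))\<^sup>2"
      using oproj_id[OF H1 oproj_mem[OF H1], of "G0 y"] oproj_id[OF H2 closed_csubspaceD(2)[OF H2]]
        cinner_oproj_right[OF H1, of "G0 y" "G0 y"]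
      by (simp add: T_def norm_cinner_self)
    then show "norm (P1 (G0 y)) \<le> B * a y" using B(2)[OF y, of "(0, P1 (G0 y))"] by (intro sq) (auto simp: norm_Pair)
    define u where "u = P2 (G0 y)"
    \<comment> \<open>A test vector that detects two components at once: \<open>G1 y\<close> and
      \<open>u\<close> are orthogonal, and the factor \<open>\<i>\<close> cancels the one in the
      boundary form, so that \<open>T y (e0, 0)\<close> is the squared norm of
      \<open>e0\<close>.\<close>
    define e0 where "e0 = G1 y + \<i> *\<^sub>C u"
    have "P2 (\<i> *\<^sub>C u) = \<i> *\<^sub>C u" using oproj_id[OF H2 oproj_mem[OF H2], of "G0 y"] by (simp add: u_def oproj_scaleC[OF H2])
    then have P2e: "P2 e0 = \<i> *\<^sub>C u" by (simp add: e0_def oproj_add[OF H2] P2_H1[OF G1_mem[OF y]])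
    have P10: "P1 0 = 0" by (rule oproj_id[OF H1 closed_csubspaceD(2)[OF H1]])
    have orth: "cinner (G1 y) u = 0" using cinner_H1_H2(1)[OF G1_mem[OF y]] by (simp add: u_def)
    have n: "(norm e0)\<^sup>2 = (norm (G1 y))\<^sup>2 + (norm u)\<^sup>2"
      unfolding e0_def norm_add_sq by (simp add: cinner_scaleC_right orth)
    have "T y (e0, 0) = of_real ((norm e0)\<^sup>2)"
      unfolding n using orth by (simp add: T_def P2e P10 cinner_scaleC_right u_def[symmetric] cinner_self)
        (simp add: e0_def cinner_add_right cinner_scaleC_right orth cinner_self)
    then have "cmod (T y (e0, 0)) = (norm e0)\<^sup>2" by (simp only: norm_of_real) simp
    then have e: "norm e0 \<le> B * a y" using B(2)[OF y, of "(e0, 0)"] by (intro sq) (auto simp: norm_Pair)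
    have "norm (G1 y) \<le> norm e0" "norm u \<le> norm e0" by (rule power2_le_imp_le; simp add: n)+
    then show "norm (P2 (G0 y)) \<le> B * a y" "norm (G1 y) \<le> B * a y" using e by (auto simp: u_def)
  qed
  show thesis
  proof (rule that[of "2 * B + 1"])
    show "0 < 2 * B + 1" using B by simp
    fix y assume y: "y \<in> D"
    have le: "2 * B * a y \<le> (2 * B + 1) * a y" "B * a y \<le> (2 * B + 1) * a y"
      using a0[of y] B(1) by (auto intro!: mult_right_mono)
    have "norm (G0 y) \<le> norm (P1 (G0 y)) + norm (P2 (G0 y))" by (metis P12 norm_triangle_ineq)
    also have "\<dots> \<le> 2 * B * a y" using b[OF y] by simp
    finally show "norm (G0 y) \<le> (2 * B + 1) * (nrm \<Delta> y + nrm \<Delta> (L y))" using le by (simp add: a_def)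
    show "norm (G1 y) \<le> (2 * B + 1) * (nrm \<Delta> y + nrm \<Delta> (L y))" using le b(3)[OF y] by (simp add: a_def)
  qed
qed

definition Nsp :: "complex \<Rightarrow> (real \<Rightarrow> 'h) set" where
  "Nsp lam = {y \<in> D. AE t in lebesgue_on \<Delta>. L y t = lam *\<^sub>C y t}"

lemma Nsp_D: "y \<in> Nsp lam \<Longrightarrow> y \<in> D"
  by (simp add: Nsp_def)

lemma Nsp_lin: "y \<in> Nsp lam \<Longrightarrow> z \<in> Nsp lam \<Longrightarrow> (\<lambda>t. \<alpha> *\<^sub>C y t + \<beta> *\<^sub>C z t) \<in> Nsp lam"
  unfolding Nsp_def
proof (elim CollectE conjE, intro CollectI conjI D_lin)
  assume y: "y \<in> D" "AE t in lebesgue_on \<Delta>. L y t = lam *\<^sub>C y t" and z: "z \<in> D" "AE t in lebesgue_on \<Delta>. L z t = lam *\<^sub>C z t"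
  from L_lin[OF y(1) z(1), of \<alpha> \<beta>] y(2) z(2)
  show "AE t in lebesgue_on \<Delta>. L (\<lambda>t. \<alpha> *\<^sub>C y t + \<beta> *\<^sub>C z t) t = lam *\<^sub>C (\<alpha> *\<^sub>C y t + \<beta> *\<^sub>C z t)"
    by eventually_elim (simp add: scaleC_add_right scaleC_scaleC mult.commute)
qed

lemma ip_L_left:
  assumes "v \<in> D" "AE t in lebesgue_on \<Delta>. L v t = \<kappa> *\<^sub>C v t + g t" "L2 \<Delta> g" "L2 \<Delta> z"
  shows "ip \<Delta> (L v) z = \<kappa> * ip \<Delta> v z + ip \<Delta> g z"
proof -
  have l: "L2 \<Delta> (\<lambda>t. \<kappa> *\<^sub>C v t)" "L2 \<Delta> v" by (auto intro: L2_scaleC D_L2 assms)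
  have "ip \<Delta> (L v) z = ip \<Delta> (\<lambda>t. \<kappa> *\<^sub>C v t + g t) z"
    by (rule ip_cong_AE(1)[OF assms(2) L_L2[OF assms(1)] L2_add[OF l(1) assms(3)] assms(4)])
  then show ?thesis using ip_add_left[OF l(1) assms(3,4)] by (simp add: ip_scaleC_left)
qed

lemma Nsp_Green:
  assumes y: "y \<in> Nsp \<mu>" and z: "z \<in> Nsp lam"
  shows "cinner (G1 y) (G0 z) - cinner (G0 y) (G1 z) + \<i> * cinner (P2 (G0 y)) (P2 (G0 z)) = (\<mu> - cnj lam) * ip \<Delta> y z"
proof -
  have yz: "L2 \<Delta> y" "L2 \<Delta> z" "L2 \<Delta> (L y)" "L2 \<Delta> (L z)" "L2 \<Delta> (\<lambda>t. lam *\<^sub>C z t)" "L2 \<Delta> (\<lambda>t. \<mu> *\<^sub>C y t)"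
    using y z by (auto intro!: D_L2 L_L2 L2_scaleC Nsp_D)
  have "ip \<Delta> (L y) z = \<mu> * ip \<Delta> y z"
    using ip_cong_AE(1)[OF _ yz(3,6,2)] y by (simp add: Nsp_def ip_scaleC_left)
  moreover have "ip \<Delta> y (L z) = cnj lam * ip \<Delta> y z"
    using ip_cong_AE(2)[OF _ yz(4,5,1)] z by (simp add: Nsp_def ip_scaleC_right)
  ultimately show ?thesis using Green[OF Nsp_D[OF y] Nsp_D[OF z]] by (simp add: algebra_simps)
qed

lemma nrm_L_Nsp:
  assumes y: "y \<in> Nsp lam"
  shows "nrm \<Delta> (L y) = cmod lam * nrm \<Delta> y"
  using nrm_cong_AE[of "L y" "\<lambda>t. lam *\<^sub>C y t" \<Delta>] y L_L2[OF Nsp_D[OF y]] L2_scaleC[OF D_L2[OF Nsp_D[OF y]], of lam]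
  by (simp add: Nsp_def nrm_scaleC)

text \<open>The imaginary part of Green's identity for \<open>v\<close> with itself. When
  \<open>G0 v\<close> is small and \<open>G1 v\<close> stays bounded, it bounds \<open>v\<close> by
  \<open>g\<close> in norm, as a resolvent would.\<close>

lemma dissipative_estimate:
  assumes v: "v \<in> D" and Lv: "AE t in lebesgue_on \<Delta>. L v t = \<kappa> *\<^sub>C v t + g t" and g: "L2 \<Delta> g"
  shows "Im \<kappa> * (nrm \<Delta> v)\<^sup>2 \<le> nrm \<Delta> g * nrm \<Delta> v + (norm (G0 v) * norm (G1 v) + (norm (G0 v))\<^sup>2)"
proof -
  define I where "I = ip \<Delta> (L v) v"
  have I: "I = \<kappa> * of_real ((nrm \<Delta> v)\<^sup>2) + ip \<Delta> g v"
    unfolding I_def using ip_L_left[OF v Lv g D_L2[OF v]] by (simp add: ip_self)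
  have "ip \<Delta> v (L v) = cnj I"
    unfolding I_def ip_def using Bochner_Integration.integral_cnj[of "lebesgue_on \<Delta>" "\<lambda>t. cinner (L v t) (v t)"] by simp
  then have "cinner (G1 v) (G0 v) - cinner (G0 v) (G1 v) + \<i> * cinner (P2 (G0 v)) (P2 (G0 v)) = I - cnj I"
    using Green[OF v v] by (simp add: I_def)
  then have "Im (cinner (G1 v) (G0 v)) - Im (cinner (G0 v) (G1 v)) + (norm (P2 (G0 v)))\<^sup>2 = 2 * Im I"
    by (drule_tac arg_cong[where f = Im]) (simp add: cinner_self)
  moreover have "Im (cinner (G0 v) (G1 v)) = - Im (cinner (G1 v) (G0 v))"
    by (metis cinner_commute cnj.sel(2))
  moreover have "Im (cinner (G1 v) (G0 v)) \<le> norm (G0 v) * norm (G1 v)"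
    using abs_Im_le_cmod[of "cinner (G1 v) (G0 v)"] cinner_Cauchy_Schwarz[of "G1 v" "G0 v"] by (simp add: mult.commute)
  moreover have "(norm (P2 (G0 v)))\<^sup>2 \<le> (norm (G0 v))\<^sup>2" by (intro power_mono norm_oproj_le[OF H2]) simp
  moreover have "Im I = Im \<kappa> * (nrm \<Delta> v)\<^sup>2 + Im (ip \<Delta> g v)" by (simp add: I)
  moreover have "- Im (ip \<Delta> g v) \<le> nrm \<Delta> g * nrm \<Delta> v"
    using abs_Im_le_cmod[of "ip \<Delta> g v"] ip_Cauchy_Schwarz[OF g D_L2[OF v]] by linarith
  moreover have "0 \<le> (norm (G0 v))\<^sup>2" by simp
  ultimately show ?thesis by linarith
qed

end

text \<open>\<open>M_unique\<close> is the sole source of elements in the defect spaces. It says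
  nothing when \<open>H1\<close> is zero, and \<open>H1_trivial\<close> settles that case: then the
  whole boundary space is zero.\<close>

locale weyl = btriplet \<Delta> D L H1 G0 G1
  for \<Delta> :: "real set" and D :: "(real \<Rightarrow> 'h::{chilbert_space, second_countable_topology}) set"
    and L :: "(real \<Rightarrow> 'h) \<Rightarrow> real \<Rightarrow> 'h" and H1 :: "'e::chilbert_space set" and G0 G1 :: "(real \<Rightarrow> 'h) \<Rightarrow> 'e" +
  fixes M :: "complex \<Rightarrow> 'e \<Rightarrow> 'e"
  assumes M_op: "\<And>lam. 0 < Im lam \<Longrightarrow> bounded_op UNIV H1 (M lam)"
    and M_eq: "\<And>lam y. 0 < Im lam \<Longrightarrow> y \<in> Nsp lam \<Longrightarrow> G1 y = M lam (G0 y)"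
    and M_unique: "\<And>lam T. 0 < Im lam \<Longrightarrow> bounded_op UNIV H1 T \<Longrightarrow> (\<And>y. y \<in> Nsp lam \<Longrightarrow> G1 y = T (G0 y)) \<Longrightarrow> T = M lam"
    and H1_trivial: "\<And>e. (\<And>x. x \<in> H1 \<Longrightarrow> x = 0) \<Longrightarrow> e = (0 :: 'e)"
begin

lemma M_op': "0 < Im lam \<Longrightarrow> bounded_op UNIV UNIV (M lam)"
  using M_op bounded_op_subset by blast

text \<open>If \<open>e\<close> is orthogonal to all \<open>G0 y\<close>, adding to
  \<open>M lam\<close> the rank one operator that sends \<open>f\<close> to
  \<open>cinner f e\<close> times a nonzero \<open>x\<close> of \<open>H1\<close> does not change
  its values on the \<open>G0 y\<close>. Uniqueness then forces \<open>e = 0\<close>.\<close>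

lemma G0_Nsp_dense:
  assumes lam: "0 < Im lam" and \<epsilon>: "0 < \<epsilon>"
  shows "\<exists>y\<in>Nsp lam. norm (G0 y - f) < \<epsilon>"
proof -
  define K where "K = closure (G0 ` Nsp lam)"
  have ne: "\<exists>y. y \<in> Nsp lam"
  proof -
    obtain y where y: "y \<in> D" using surj[OF closed_csubspaceD(2)[OF H1]] by blast
    have "(\<lambda>t. 0 *\<^sub>C y t + 0 *\<^sub>C y t) \<in> Nsp lam"
      unfolding Nsp_def using D_lin[OF y y, of 0 0] L_lin[OF y y, of 0 0] by simp
    then show ?thesis by blast
  qed
  have lin: "\<alpha> *\<^sub>C x + \<beta> *\<^sub>C x' \<in> G0 ` Nsp lam" if x: "x \<in> G0 ` Nsp lam" and x': "x' \<in> G0 ` Nsp lam" for x x' \<alpha> \<beta>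
  proof -
    obtain y where y: "y \<in> Nsp lam" "x = G0 y" using x by (rule imageE) blast
    obtain y' where y': "y' \<in> Nsp lam" "x' = G0 y'" using x' by (rule imageE) blast
    show ?thesis
      by (rule image_eqI[OF _ Nsp_lin[OF y(1) y'(1), of \<alpha> \<beta>]])
         (simp add: y(2) y'(2) G0_lin[OF Nsp_D[OF y(1)] Nsp_D[OF y'(1)]])
  qed
  have linK: "\<alpha> *\<^sub>C x + \<beta> *\<^sub>C x' \<in> K" if x: "x \<in> K" "x' \<in> K" for x x' \<alpha> \<beta>
  proof -
    obtain s where s1: "\<forall>k::nat. s k \<in> G0 ` Nsp lam" "s \<longlonglongrightarrow> x" using x(1) unfolding K_def closure_sequential by (elim exE conjE)
    obtain s' where s2: "\<forall>k::nat. s' k \<in> G0 ` Nsp lam" "s' \<longlonglongrightarrow> x'" using x(2) unfolding K_def closure_sequential by (elim exE conjE)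
    note s = s1(1)[rule_format] s1(2) s2(1)[rule_format] s2(2)
    have "(\<lambda>k. \<alpha> *\<^sub>C s k + \<beta> *\<^sub>C s' k) \<longlonglongrightarrow> \<alpha> *\<^sub>C x + \<beta> *\<^sub>C x'"
      by (intro tendsto_add bounded_linear.tendsto[OF bounded_linear_scaleC] s)
    moreover have "\<forall>k. \<alpha> *\<^sub>C s k + \<beta> *\<^sub>C s' k \<in> G0 ` Nsp lam" using lin[OF s(1,3)] by blast
    ultimately show ?thesis unfolding K_def closure_sequential by (intro exI[of _ "\<lambda>k. \<alpha> *\<^sub>C s k + \<beta> *\<^sub>C s' k"]) simp
  qed
  have K: "closed_csubspace K"
    unfolding closed_csubspace_def
  proof (intro conjI ballI allI)
    obtain y where "y \<in> Nsp lam" using ne by blast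
    then obtain x where "x \<in> K" using subsetD[OF closure_subset imageI[of y "Nsp lam" G0]] by (simp add: K_def)
    then show "0 \<in> K" using linK[of x x 0 0] by simp
    show "x + y \<in> K" if "x \<in> K" "y \<in> K" for x y using linK[of x y 1 1] that by simp
    show "c *\<^sub>C x \<in> K" if "x \<in> K" for x c using linK[of x x c 0] that by simp
  qed (simp add: K_def)
  have "e = 0" if e: "e \<in> ocompl K" for e
  proof (cases "\<exists>x\<in>H1. x \<noteq> 0")
    case True
    then obtain x where x: "x \<in> H1" "x \<noteq> 0" by blast
    define T where "T = (\<lambda>f. M lam f + cinner f e *\<^sub>C x)"
    note Mop = M_op'[OF lam]
    have "bounded_op UNIV UNIV (\<lambda>f. cinner f e *\<^sub>C x)"
    proof (rule bounded_opI[where B = "norm e * norm x"])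
      show "norm (cinner f e *\<^sub>C x) \<le> norm e * norm x * norm f" for f
        using mult_right_mono[OF cinner_Cauchy_Schwarz[of f e] norm_ge_zero[of x]] by (simp add: ac_simps)
    qed (auto simp: cinner_add_left cinner_scaleC_left scaleC_add_left scaleC_scaleC)
    then have "bounded_op UNIV UNIV T" unfolding T_def by (rule bounded_op_add[OF Mop])
    moreover have "T f \<in> H1" for f
      unfolding T_def using bounded_opD(1)[OF M_op[OF lam]] x closed_csubspaceD[OF H1] by simp
    ultimately have "bounded_op UNIV H1 T" by (simp add: bounded_op_def)
    moreover have "G1 y = T (G0 y)" if y: "y \<in> Nsp lam" for y
    proof -
      have "G0 y \<in> K" unfolding K_def by (rule subsetD[OF closure_subset imageI[OF y]])
      then have "cinner e (G0 y) = 0" using e by (simp add: ocompl_def)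
      then have "cinner (G0 y) e = 0" by (metis cnj_cinner complex_cnj_zero)
      then show ?thesis by (simp add: T_def M_eq[OF lam y])
    qed
    ultimately have "T = M lam" by (rule M_unique[OF lam])
    then have "T e = M lam e" by simp
    then have "cinner e e *\<^sub>C x = 0" by (simp add: T_def)
    then have "norm (cinner e e *\<^sub>C x) = 0" by simp
    then show ?thesis using x(2) by (simp add: norm_cinner_self)
  qed (use H1_trivial in blast)
  then have "f - oproj K f = 0" using oproj_diff_mem[OF K] by blast
  then have "f \<in> K" using oproj_mem[OF K, of f] by simp
  then obtain x where "x \<in> G0 ` Nsp lam" "dist x f < \<epsilon>" using \<epsilon> unfolding K_def closure_approachable by blast
  then show ?thesis by (auto simp: dist_norm)
qed

lemma ex_approx_sequence:
  assumes lam: "0 < Im lam"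
  shows "\<exists>Y. (\<forall>k. Y k \<in> Nsp lam) \<and> (\<lambda>k. G0 (Y k)) \<longlonglongrightarrow> f"
proof -
  have "\<exists>y\<in>Nsp lam. norm (G0 y - f) < inverse (real (Suc k))" for k
    by (rule G0_Nsp_dense[OF lam]) simp
  then obtain Y where Y: "\<And>k. Y k \<in> Nsp lam" "\<And>k. norm (G0 (Y k) - f) < inverse (real (Suc k))" by metis
  have "(\<lambda>k. G0 (Y k) - f) \<longlonglongrightarrow> 0"
    by (rule Lim_null_comparison[OF always_eventually LIMSEQ_inverse_real_of_nat]) (simp add: less_imp_le[OF Y(2)] del: of_nat_Suc)
  then have "(\<lambda>k. G0 (Y k)) \<longlonglongrightarrow> f" by (rule LIM_zero_cancel)
  then show ?thesis using Y(1) by (intro exI[of _ Y]) simp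
qed

text \<open>Green's identity for \<open>y\<close> with itself, divided by \<open>\<i>\<close> and
  expressed through \<open>M\<close> alone, so that it makes sense for every \<open>f\<close> and
  not only for values of \<open>G0\<close>.\<close>

definition qf :: "complex \<Rightarrow> 'e \<Rightarrow> real" where
  "qf lam f = 2 * Im (cinner (M lam f) f) + (norm (P2 f))\<^sup>2"

lemma qf_Nsp:
  assumes lam: "0 < Im lam" and y: "y \<in> Nsp lam"
  shows "qf lam (G0 y) = 2 * Im lam * (nrm \<Delta> y)\<^sup>2"
proof -
  have "cinner (G1 y) (G0 y) - cinner (G0 y) (G1 y) + \<i> * cinner (P2 (G0 y)) (P2 (G0 y)) = (lam - cnj lam) * of_real ((nrm \<Delta> y)\<^sup>2)"
    using Nsp_Green[OF y y] by (simp add: ip_self)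
  then have "Im (cinner (G1 y) (G0 y)) - Im (cinner (G0 y) (G1 y)) + (norm (P2 (G0 y)))\<^sup>2 = 2 * Im lam * (nrm \<Delta> y)\<^sup>2"
    by (drule_tac arg_cong[where f = Im]) (simp add: cinner_self)
  moreover have "Im (cinner (G0 y) (G1 y)) = - Im (cinner (G1 y) (G0 y))"
    by (metis cinner_commute cnj.sel(2))
  ultimately show ?thesis by (simp add: qf_def M_eq[OF lam y])
qed

lemma tendsto_qf:
  assumes lam: "0 < Im lam" and x: "x \<longlonglongrightarrow> f"
  shows "(\<lambda>k. qf lam (x k)) \<longlonglongrightarrow> qf lam f"
  unfolding qf_def
  by (intro tendsto_intros tendsto_Im bounded_bilinear.tendsto[OF bounded_bilinear_cinner]
      bounded_linear.tendsto[OF bounded_op_lin(1)[OF M_op'[OF lam]]] x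
      bounded_linear.tendsto[OF bounded_op_lin(1)[OF bounded_op_subset[OF bounded_op_oproj[OF H2] order_refl subset_UNIV]]])

text \<open>On the defect space \<open>qf\<close> is \<open>2 Im lam\<close> times the squared norm
  of \<open>y\<close>, which the graph bound estimates from below by \<open>G0 y\<close>; density
  extends this to all \<open>f\<close>.\<close>

lemma qf_coercive:
  assumes lam: "0 < Im lam"
  obtains c where "0 < c" "\<And>f. c * (norm f)\<^sup>2 \<le> qf lam f"
proof -
  obtain C where C: "0 < C" "\<And>y. y \<in> D \<Longrightarrow> norm (G0 y) \<le> C * (nrm \<Delta> y + nrm \<Delta> (L y))"
    using graph_bound by metis
  define A where "A = C * (1 + cmod lam)"
  have A: "0 < A" using C by (simp add: A_def add_pos_nonneg)
  define c where "c = 2 * Im lam / A\<^sup>2"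
  have "c * (norm (G0 y))\<^sup>2 \<le> qf lam (G0 y)" if y: "y \<in> Nsp lam" for y
  proof -
    have "norm (G0 y) \<le> A * nrm \<Delta> y" using C(2)[OF Nsp_D[OF y]] by (simp add: nrm_L_Nsp[OF y] A_def algebra_simps)
    then have "(norm (G0 y))\<^sup>2 \<le> (A * nrm \<Delta> y)\<^sup>2" by (rule power_mono) simp
    then have "c * (norm (G0 y))\<^sup>2 \<le> c * (A * nrm \<Delta> y)\<^sup>2" using lam A by (intro mult_left_mono) (auto simp: c_def)
    also have "\<dots> = 2 * Im lam * (nrm \<Delta> y)\<^sup>2" using A by (simp add: c_def power_mult_distrib)
    finally show ?thesis by (simp add: qf_Nsp[OF lam y])
  qed
  note dense = this
  have "c * (norm f)\<^sup>2 \<le> qf lam f" for f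
  proof -
    obtain Y where Y: "\<And>k. Y k \<in> Nsp lam" "(\<lambda>k. G0 (Y k)) \<longlonglongrightarrow> f" using ex_approx_sequence[OF lam] by blast
    have "(\<lambda>k. c * (norm (G0 (Y k)))\<^sup>2) \<longlonglongrightarrow> c * (norm f)\<^sup>2" by (intro tendsto_intros Y)
    then show ?thesis by (rule LIMSEQ_le[OF _ tendsto_qf[OF lam Y(2)]]) (use dense Y(1) in blast)
  qed
  moreover have "0 < c" using lam A by (simp add: c_def)
  ultimately show thesis by (rule that[rotated])
qed

text \<open>The bound is split so that it tends to \<open>B / a\<close> when the error term
  \<open>d\<close> tends to 0.\<close>

lemma quadratic_bound:
  fixes x :: real
  assumes "a * x\<^sup>2 \<le> B * x + d" "0 < a" "0 \<le> B" "0 \<le> d" "0 \<le> x"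
  shows "x \<le> B / a + sqrt (d / a)"
proof (rule ccontr)
  define s where "s = sqrt (d / a)"
  assume "\<not> ?thesis"
  then have x: "B / a + s < x" by (simp add: s_def)
  have s: "0 \<le> s" "a * s\<^sup>2 = d" using assms by (auto simp: s_def)
  have sx: "s \<le> x" using x assms by (smt (verit) divide_nonneg_pos)
  have "B * x + d = a * x * (B / a) + a * (s * s)" using assms s(2) by (simp add: power2_eq_square)
  also have "\<dots> \<le> a * x * (B / a) + a * (x * s)" using sx s(1) assms by (intro add_left_mono mult_left_mono mult_right_mono) auto
  also have "\<dots> = a * x * (B / a + s)" by (simp add: algebra_simps)
  also have "\<dots> < a * x * x"
  proof (rule mult_strict_left_mono[OF x])
    have "0 \<le> B / a" using assms by simp
    then have "0 < x" using x s(1) by linarith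
    then show "0 < a * x" using assms by simp
  qed
  finally show False using assms(1) by (simp add: power2_eq_square)
qed

end

section \<open>Holomorphy of the Weyl function\<close>

context weyl
begin

text \<open>The reverse of the graph bound on a defect space: the squared norm of \<open>y\<close>
  is \<open>qf\<close> up to a factor, and \<open>qf\<close> is bounded because \<open>M lam\<close>
  is.\<close>

lemma nrm_Nsp_le:
  assumes lam: "0 < Im lam"
  obtains Y where "0 \<le> Y" "\<And>y. y \<in> Nsp lam \<Longrightarrow> nrm \<Delta> y \<le> Y * norm (G0 y)"
proof -
  obtain m where m: "0 < m" "\<And>f. norm (M lam f) \<le> m * norm f"
    using bounded_op_bound[OF M_op'[OF lam]] by (metis UNIV_I)
  define Y where "Y = sqrt ((2 * m + 1) / (2 * Im lam))"
  have "nrm \<Delta> y \<le> Y * norm (G0 y)" if y: "y \<in> Nsp lam" for y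
  proof (rule power2_le_imp_le)
    define f where "f = G0 y"
    have "Im (cinner (M lam f) f) \<le> cmod (cinner (M lam f) f)" using abs_Im_le_cmod[of "cinner (M lam f) f"] by linarith
    also have "\<dots> \<le> norm (M lam f) * norm f" by (rule cinner_Cauchy_Schwarz)
    also have "\<dots> \<le> m * norm f * norm f" by (intro mult_right_mono m) simp
    finally have "2 * Im lam * (nrm \<Delta> y)\<^sup>2 \<le> (2 * m + 1) * (norm f)\<^sup>2"
      using qf_Nsp[OF lam y] power_mono[OF norm_oproj_le[OF H2, of f], of 2]
      by (simp add: qf_def f_def[symmetric] power2_eq_square algebra_simps)
    then show "(nrm \<Delta> y)\<^sup>2 \<le> (Y * norm (G0 y))\<^sup>2"
      using lam m by (simp add: Y_def power_mult_distrib f_def field_simps)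
  qed (simp add: Y_def lam m less_imp_le)
  moreover have "0 \<le> Y" using lam m by (simp add: Y_def)
  ultimately show thesis by (rule that[rotated])
qed

text \<open>
  For \<open>y\<^sub>w\<close>, \<open>y\<^sub>k\<close>, \<open>y\<^sub>\<lambda>\<close> in the defect spaces put \<open>q\<^sub>w = (y\<^sub>w - y\<^sub>\<lambda>) / (w - \<lambda>)\<close>.  Then
  \<open>(L - w) q\<^sub>w = y\<^sub>\<lambda>\<close> and \<open>(L - w) (q\<^sub>w - q\<^sub>k) = (w - k) q\<^sub>k\<close>.
\<close>

lemma quotient_L:
  assumes yw: "yw \<in> Nsp w" and yk: "yk \<in> Nsp k" and yl: "yl \<in> Nsp lam" and ne: "w \<noteq> lam" "k \<noteq> lam"
  defines "q \<equiv> \<lambda>t. (1 / (k - lam)) *\<^sub>C yk t + (- (1 / (k - lam))) *\<^sub>C yl t"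
  defines "u \<equiv> \<lambda>t. 1 *\<^sub>C ((1 / (w - lam)) *\<^sub>C yw t + (- (1 / (w - lam))) *\<^sub>C yl t) + (-1) *\<^sub>C q t"
  shows "q \<in> D" "AE t in lebesgue_on \<Delta>. L q t = k *\<^sub>C q t + yl t"
    and "u \<in> D" "AE t in lebesgue_on \<Delta>. L u t = w *\<^sub>C u t + (w - k) *\<^sub>C q t"
    and "G0 q = (1 / (k - lam)) *\<^sub>C (G0 yk - G0 yl)" "G1 q = (1 / (k - lam)) *\<^sub>C (G1 yk - G1 yl)"
    and "G0 u = (1 / (w - lam)) *\<^sub>C (G0 yw - G0 yl) - G0 q" "G1 u = (1 / (w - lam)) *\<^sub>C (G1 yw - G1 yl) - G1 q"
proof -
  note yD = Nsp_D[OF yw] Nsp_D[OF yk] Nsp_D[OF yl]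
  define q' where "q' = (\<lambda>t. (1 / (w - lam)) *\<^sub>C yw t + (- (1 / (w - lam))) *\<^sub>C yl t)"
  have u: "u = (\<lambda>t. 1 *\<^sub>C q' t + (-1) *\<^sub>C q t)" by (simp add: u_def q'_def)
  show qD: "q \<in> D" unfolding q_def by (rule D_lin[OF yD(2,3)])
  have q'D: "q' \<in> D" unfolding q'_def by (rule D_lin[OF yD(1,3)])
  show "u \<in> D" unfolding u by (rule D_lin[OF q'D qD])
  have ae: "AE t in lebesgue_on \<Delta>. L yw t = w *\<^sub>C yw t" "AE t in lebesgue_on \<Delta>. L yk t = k *\<^sub>C yk t"
    "AE t in lebesgue_on \<Delta>. L yl t = lam *\<^sub>C yl t" using yw yk yl by (auto simp: Nsp_def)
  have alg: "(1 / (a - lam)) *\<^sub>C (a *\<^sub>C x) + (- (1 / (a - lam))) *\<^sub>C (lam *\<^sub>C y)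
     = a *\<^sub>C ((1 / (a - lam)) *\<^sub>C x + (- (1 / (a - lam))) *\<^sub>C y) + y" if "a \<noteq> lam" for a and x y :: 'h
  proof -
    have "(- (1 / (a - lam))) * lam = a * (- (1 / (a - lam))) + 1" using that by (simp add: field_simps)
    then have "(- (1 / (a - lam))) *\<^sub>C (lam *\<^sub>C y) = a *\<^sub>C ((- (1 / (a - lam))) *\<^sub>C y) + y"
      by (simp only: scaleC_scaleC scaleC_add_left scaleC_one)
    then show ?thesis by (simp only: scaleC_add_right scaleC_scaleC mult.commute add.assoc)
  qed
  have aeq: "AE t in lebesgue_on \<Delta>. L q t = k *\<^sub>C q t + yl t"
    using L_lin[OF yD(2,3), of "1 / (k - lam)" "- (1 / (k - lam))"] ae(2,3) unfolding q_def[symmetric]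
  proof eventually_elim
    case (elim t)
    then show ?case using alg[OF ne(2), of "yk t" "yl t"] by (simp only: q_def)
  qed
  then show "AE t in lebesgue_on \<Delta>. L q t = k *\<^sub>C q t + yl t" .
  have aeq': "AE t in lebesgue_on \<Delta>. L q' t = w *\<^sub>C q' t + yl t"
    using L_lin[OF yD(1,3), of "1 / (w - lam)" "- (1 / (w - lam))"] ae(1,3) unfolding q'_def[symmetric]
  proof eventually_elim
    case (elim t)
    then show ?case using alg[OF ne(1), of "yw t" "yl t"] by (simp only: q'_def)
  qed
  show "AE t in lebesgue_on \<Delta>. L u t = w *\<^sub>C u t + (w - k) *\<^sub>C q t"
    using L_lin[OF q'D qD, of 1 "-1"] aeq aeq' unfolding u[symmetric]
  proof eventually_elim
    case (elim t)
    then show ?case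
      by (simp add: u scaleC_minus_one scaleC_minus_left scaleC_add_right scaleC_minus_right scaleC_diff_left
          scaleC_diff_right)
  qed
  show "G0 q = (1 / (k - lam)) *\<^sub>C (G0 yk - G0 yl)" "G1 q = (1 / (k - lam)) *\<^sub>C (G1 yk - G1 yl)"
    unfolding q_def G0_lin[OF yD(2,3)] G1_lin[OF yD(2,3)] by (simp_all only: scaleC_minus_left scaleC_diff_right) simp_all
  show "G0 u = (1 / (w - lam)) *\<^sub>C (G0 yw - G0 yl) - G0 q" "G1 u = (1 / (w - lam)) *\<^sub>C (G1 yw - G1 yl) - G1 q"
    unfolding u G0_lin[OF q'D qD] G1_lin[OF q'D qD] unfolding q'_def G0_lin[OF yD(1,3)] G1_lin[OF yD(1,3)]
    by (simp_all add: scaleC_minus_one scaleC_minus_left scaleC_diff_right)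
qed

text \<open>A given \<open>f\<close> need not be a value of \<open>G0\<close>, so sequences with
  \<open>G0\<close> tending to \<open>f\<close> are used for \<open>w\<close>, \<open>k\<close> and
  \<open>lam\<close>. The quotients \<open>q j\<close> and \<open>u j\<close> then have
  \<open>G0\<close> tending to 0, and \<open>dissipative_estimate\<close> bounds first
  \<open>q j\<close> by \<open>yl j\<close>, then \<open>u j\<close> by \<open>(w - k) q j\<close>.
  The factor \<open>cmod (w - k)\<close> gained here reaches the Weyl function through the graph
  bound for \<open>G1\<close>.\<close>

lemma M_quotient_estimate:
  assumes lam: "0 < Im lam" and w: "0 < Im w" "w \<noteq> lam" and k: "0 < Im k" "k \<noteq> lam"
    and C: "0 < C" "\<And>y. y \<in> D \<Longrightarrow> norm (G1 y) \<le> C * (nrm \<Delta> y + nrm \<Delta> (L y))"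
    and Y: "0 \<le> Y" "\<And>y. y \<in> Nsp lam \<Longrightarrow> nrm \<Delta> y \<le> Y * norm (G0 y)"
  shows "norm ((1 / (w - lam)) *\<^sub>C (M w f - M lam f) - (1 / (k - lam)) *\<^sub>C (M k f - M lam f))
     \<le> C * ((1 + cmod w) / Im w + 1) * cmod (w - k) * (Y * norm f / Im k)"
proof -
  obtain yw where yw: "\<And>j. yw j \<in> Nsp w" "(\<lambda>j. G0 (yw j)) \<longlonglongrightarrow> f" using ex_approx_sequence[OF w(1)] by blast
  obtain yk where yk: "\<And>j. yk j \<in> Nsp k" "(\<lambda>j. G0 (yk j)) \<longlonglongrightarrow> f" using ex_approx_sequence[OF k(1)] by blast
  obtain yl where yl: "\<And>j. yl j \<in> Nsp lam" "(\<lambda>j. G0 (yl j)) \<longlonglongrightarrow> f" using ex_approx_sequence[OF lam] by blast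
  define q where "q = (\<lambda>j t. (1 / (k - lam)) *\<^sub>C yk j t + (- (1 / (k - lam))) *\<^sub>C yl j t)"
  define u where "u = (\<lambda>j t. 1 *\<^sub>C ((1 / (w - lam)) *\<^sub>C yw j t + (- (1 / (w - lam))) *\<^sub>C yl j t) + (-1) *\<^sub>C q j t)"
  have q_pt: "(1 / (k - lam)) *\<^sub>C yk j t + (- (1 / (k - lam))) *\<^sub>C yl j t = q j t" for j t by (simp add: q_def)
  have u_pt: "1 *\<^sub>C ((1 / (w - lam)) *\<^sub>C yw j t + (- (1 / (w - lam))) *\<^sub>C yl j t) + (-1) *\<^sub>C q j t = u j t" for j t
    by (simp only: u_def)
  have Q: "q j \<in> D" "AE t in lebesgue_on \<Delta>. L (q j) t = k *\<^sub>C q j t + yl j t"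
    "u j \<in> D" "AE t in lebesgue_on \<Delta>. L (u j) t = w *\<^sub>C u j t + (w - k) *\<^sub>C q j t"
    "G0 (q j) = (1 / (k - lam)) *\<^sub>C (G0 (yk j) - G0 (yl j))" "G1 (q j) = (1 / (k - lam)) *\<^sub>C (G1 (yk j) - G1 (yl j))"
    "G0 (u j) = (1 / (w - lam)) *\<^sub>C (G0 (yw j) - G0 (yl j)) - G0 (q j)"
    "G1 (u j) = (1 / (w - lam)) *\<^sub>C (G1 (yw j) - G1 (yl j)) - G1 (q j)" for j
    using quotient_L[OF yw(1)[of j] yk(1)[of j] yl(1)[of j] w(2) k(2)] unfolding q_pt u_pt by blast+
  have G1lim: "(\<lambda>j. G1 (yw j)) \<longlonglongrightarrow> M w f" "(\<lambda>j. G1 (yk j)) \<longlonglongrightarrow> M k f" "(\<lambda>j. G1 (yl j)) \<longlonglongrightarrow> M lam f"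
    using bounded_linear.tendsto[OF bounded_op_lin(1)[OF M_op'[OF w(1)]] yw(2)]
      bounded_linear.tendsto[OF bounded_op_lin(1)[OF M_op'[OF k(1)]] yk(2)]
      bounded_linear.tendsto[OF bounded_op_lin(1)[OF M_op'[OF lam]] yl(2)]
    by (simp_all add: M_eq[OF w(1) yw(1)] M_eq[OF k(1) yk(1)] M_eq[OF lam yl(1)])
  note sC = bounded_linear.tendsto[OF bounded_linear_scaleC]
  have G0q: "(\<lambda>j. G0 (q j)) \<longlonglongrightarrow> 0"
    unfolding Q(5) using sC[OF tendsto_diff[OF yk(2) yl(2)], of "1 / (k - lam)"] by simp
  have G1q: "(\<lambda>j. G1 (q j)) \<longlonglongrightarrow> (1 / (k - lam)) *\<^sub>C (M k f - M lam f)"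
    unfolding Q(6) by (rule sC[OF tendsto_diff[OF G1lim(2,3)]])
  have G0u: "(\<lambda>j. G0 (u j)) \<longlonglongrightarrow> 0"
    unfolding Q(7) using tendsto_diff[OF sC[OF tendsto_diff[OF yw(2) yl(2)], of "1 / (w - lam)"] G0q] by simp
  have G1u: "(\<lambda>j. G1 (u j)) \<longlonglongrightarrow> (1 / (w - lam)) *\<^sub>C (M w f - M lam f) - (1 / (k - lam)) *\<^sub>C (M k f - M lam f)"
    unfolding Q(8) by (rule tendsto_diff[OF sC[OF tendsto_diff[OF G1lim(1,3)]] G1q])
  define d1 where "d1 = (\<lambda>j. norm (G0 (q j)) * norm (G1 (q j)) + (norm (G0 (q j)))\<^sup>2)"
  define d2 where "d2 = (\<lambda>j. norm (G0 (u j)) * norm (G1 (u j)) + (norm (G0 (u j)))\<^sup>2)"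
  have d1: "d1 \<longlonglongrightarrow> 0" unfolding d1_def
    using tendsto_add[OF tendsto_mult[OF tendsto_norm[OF G0q] tendsto_norm[OF G1q]] tendsto_power[OF tendsto_norm[OF G0q], of 2]] by simp
  have d2: "d2 \<longlonglongrightarrow> 0" unfolding d2_def
    using tendsto_add[OF tendsto_mult[OF tendsto_norm[OF G0u] tendsto_norm[OF G1u]] tendsto_power[OF tendsto_norm[OF G0u], of 2]] by simp
  have d_nonneg: "0 \<le> d1 j" "0 \<le> d2 j" for j by (simp_all add: d1_def d2_def)
  \<comment> \<open>The bounds of \<open>quadratic_bound\<close>; their square roots collect the
    boundary errors, which vanish in the limit.\<close>
  define B1 where "B1 = (\<lambda>j. Y * norm (G0 (yl j)) / Im k + sqrt (d1 j / Im k))"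
  define B2 where "B2 = (\<lambda>j. cmod (w - k) * B1 j / Im w + sqrt (d2 j / Im w))"
  have L2q: "L2 \<Delta> (q j)" "L2 \<Delta> (yl j)" for j by (rule D_L2[OF Q(1)]) (rule D_L2[OF Nsp_D[OF yl(1)]])
  have nq: "nrm \<Delta> (q j) \<le> B1 j" for j
  proof -
    have "Im k * (nrm \<Delta> (q j))\<^sup>2 \<le> nrm \<Delta> (yl j) * nrm \<Delta> (q j) + d1 j"
      using dissipative_estimate[OF Q(1,2) L2q(2)] by (simp add: d1_def)
    then have "nrm \<Delta> (q j) \<le> nrm \<Delta> (yl j) / Im k + sqrt (d1 j / Im k)"
      by (rule quadratic_bound) (use k d_nonneg nrm_nonneg in auto)
    also have "\<dots> \<le> B1 j"
      unfolding B1_def using k Y(2)[OF yl(1)] by (intro add_right_mono divide_right_mono) auto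
    finally show ?thesis .
  qed
  have ng: "nrm \<Delta> (\<lambda>t. (w - k) *\<^sub>C q j t) \<le> cmod (w - k) * B1 j" for j
    using nq by (simp add: nrm_scaleC mult_left_mono)
  have L2g: "L2 \<Delta> (\<lambda>t. (w - k) *\<^sub>C q j t)" for j by (rule L2_scaleC[OF L2q(1)])
  have nu: "nrm \<Delta> (u j) \<le> B2 j" for j
  proof -
    have "Im w * (nrm \<Delta> (u j))\<^sup>2 \<le> nrm \<Delta> (\<lambda>t. (w - k) *\<^sub>C q j t) * nrm \<Delta> (u j) + d2 j"
      using dissipative_estimate[OF Q(3,4) L2g] by (simp add: d2_def)
    then have "nrm \<Delta> (u j) \<le> nrm \<Delta> (\<lambda>t. (w - k) *\<^sub>C q j t) / Im w + sqrt (d2 j / Im w)"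
      by (rule quadratic_bound) (use w d_nonneg nrm_nonneg in auto)
    also have "\<dots> \<le> B2 j"
      unfolding B2_def using w ng by (intro add_right_mono divide_right_mono) auto
    finally show ?thesis .
  qed
  have nLu: "nrm \<Delta> (L (u j)) \<le> cmod w * B2 j + cmod (w - k) * B1 j" for j
  proof -
    have l: "L2 \<Delta> (\<lambda>t. w *\<^sub>C u j t)" by (rule L2_scaleC[OF D_L2[OF Q(3)]])
    have "nrm \<Delta> (L (u j)) = nrm \<Delta> (\<lambda>t. w *\<^sub>C u j t + (w - k) *\<^sub>C q j t)"
      by (rule nrm_cong_AE[OF Q(4) L_L2[OF Q(3)] L2_add[OF l L2g]])
    also have "\<dots> \<le> nrm \<Delta> (\<lambda>t. w *\<^sub>C u j t) + nrm \<Delta> (\<lambda>t. (w - k) *\<^sub>C q j t)" by (rule nrm_triangle[OF l L2g])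
    also have "\<dots> \<le> cmod w * B2 j + cmod (w - k) * B1 j"
      using nu ng by (intro add_mono) (auto simp: nrm_scaleC mult_left_mono)
    finally show ?thesis .
  qed
  have bound: "norm (G1 (u j)) \<le> C * (B2 j + (cmod w * B2 j + cmod (w - k) * B1 j))" for j
  proof -
    have "norm (G1 (u j)) \<le> C * (nrm \<Delta> (u j) + nrm \<Delta> (L (u j)))" by (rule C(2)[OF Q(3)])
    also have "\<dots> \<le> C * (B2 j + (cmod w * B2 j + cmod (w - k) * B1 j))"
      using C(1) nu nLu by (intro mult_left_mono add_mono) auto
    finally show ?thesis .
  qed
  have B1: "B1 \<longlonglongrightarrow> Y * norm f / Im k + sqrt (0 / Im k)"
    unfolding B1_def using k by (intro tendsto_intros yl d1) auto
  have B2: "B2 \<longlonglongrightarrow> cmod (w - k) * (Y * norm f / Im k + sqrt (0 / Im k)) / Im w + sqrt (0 / Im w)"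
    unfolding B2_def using w by (intro tendsto_intros B1 d2) auto
  define b1 where "b1 = Y * norm f / Im k"
  have "(\<lambda>j. C * (B2 j + (cmod w * B2 j + cmod (w - k) * B1 j))) \<longlonglongrightarrow>
     C * (cmod (w - k) * b1 / Im w + (cmod w * (cmod (w - k) * b1 / Im w) + cmod (w - k) * b1))"
    using B1 B2 unfolding b1_def[symmetric] by (intro tendsto_intros) simp_all
  then have "norm ((1 / (w - lam)) *\<^sub>C (M w f - M lam f) - (1 / (k - lam)) *\<^sub>C (M k f - M lam f)) \<le>
     C * (cmod (w - k) * b1 / Im w + (cmod w * (cmod (w - k) * b1 / Im w) + cmod (w - k) * b1))"
    by (rule LIMSEQ_le[OF tendsto_norm[OF G1u]]) (use bound in blast)
  also have "\<dots> = C * ((1 + cmod w) / Im w + 1) * cmod (w - k) * b1"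
    using w by (simp add: field_simps)
  finally show ?thesis by (simp add: b1_def)
qed

text \<open>Holomorphy is not part of the definition of \<open>M\<close>. It follows since
  difference quotients at \<open>lam\<close> are Lipschitz in operator norm on a punctured
  ball.\<close>

lemma M_holomorphic: "op_holomorphic {z. 0 < Im z} UNIV UNIV M"
  unfolding op_holomorphic_def
proof (intro ballI conjI)
  fix lam assume "lam \<in> {z. 0 < Im z}"
  then have lam: "0 < Im lam" by simp
  show "bounded_op UNIV UNIV (M lam)" by (rule M_op'[OF lam])
  obtain C where C: "0 < C" "\<And>y. y \<in> D \<Longrightarrow> norm (G1 y) \<le> C * (nrm \<Delta> y + nrm \<Delta> (L y))"
    using graph_bound by metis
  obtain Y where Y: "0 \<le> Y" "\<And>y. y \<in> Nsp lam \<Longrightarrow> nrm \<Delta> y \<le> Y * norm (G0 y)" using nrm_Nsp_le[OF lam] by metis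
  \<comment> \<open>Half the distance to the real axis keeps all imaginary parts above
    \<open>r\<close>, so the constant of the estimate is uniform on the ball.\<close>
  define r where "r = Im lam / 2"
  have r: "0 < r" using lam by (simp add: r_def)
  have ball: "r \<le> Im w" "cmod w \<le> cmod lam + r" if "w \<in> ball lam r - {lam}" for w
  proof -
    have d: "cmod (lam - w) < r" using that by (simp add: dist_norm)
    show "r \<le> Im w" using abs_Im_le_cmod[of "lam - w"] d by (simp add: r_def)
    show "cmod w \<le> cmod lam + r" using norm_triangle_sub[of w lam] d by (simp add: norm_minus_commute)
  qed
  show "\<exists>T'. bounded_op UNIV UNIV T' \<and>
     op_tendsto UNIV (\<lambda>w x. (1 / (w - lam)) *\<^sub>C (M w x - M lam x)) T' (at lam within {z. 0 < Im z})"
  proof (rule op_tendsto_of_Lipschitz[OF r])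
    fix w assume "w \<in> ball lam r - {lam}"
    then have "0 < Im w" using ball(1) r by fastforce
    then show "bounded_op UNIV UNIV (\<lambda>x. (1 / (w - lam)) *\<^sub>C (M w x - M lam x))"
      by (intro bounded_op_scaleC bounded_op_diff M_op' lam)
  next
    fix w k x assume w: "w \<in> ball lam r - {lam}" and k: "k \<in> ball lam r - {lam}"
    have pos: "0 < Im w" "0 < Im k" using ball(1)[OF w] ball(1)[OF k] r by auto
    have "norm ((1 / (w - lam)) *\<^sub>C (M w x - M lam x) - (1 / (k - lam)) *\<^sub>C (M k x - M lam x))
       \<le> C * ((1 + cmod w) / Im w + 1) * cmod (w - k) * (Y * norm x / Im k)"
      by (rule M_quotient_estimate[OF lam pos(1) _ pos(2) _ C Y]) (use w k in auto)
    also have "\<dots> \<le> C * ((1 + (cmod lam + r)) / r + 1) * cmod (w - k) * (Y * norm x / r)"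
      using C(1) Y(1) r pos ball[OF w] ball[OF k]
      by (intro mult_mono mult_left_mono mult_right_mono add_right_mono frac_le) auto
    finally show "norm ((1 / (w - lam)) *\<^sub>C (M w x - M lam x) - (1 / (k - lam)) *\<^sub>C (M k x - M lam x))
       \<le> C * ((1 + (cmod lam + r)) / r + 1) * Y / r * dist w k * norm x"
      by (simp add: dist_norm ac_simps)
  qed
qed

end

subsection \<open>Boundary parameters\<close>

text \<open>
  With \<open>W = - X\<^sup>-\<^sup>1 (C\<^sub>0\<^sub>1 + \<i> C\<^sub>1)\<close>, \<open>X = C\<^sub>0 - \<i> C\<^sub>1 P\<^sub>1\<close>, the relation is a Cayley transform of a contraction; here this is
  expressed by pairing with \<open>k\<close> such that \<open>X\<^sup>* k = (P\<^sub>1 h\<^sub>0 + \<i> h\<^sub>1) + P\<^sub>2 h\<^sub>0\<close>.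
\<close>

lemma boundary_pair_dissipative:
  fixes C0 C1 :: "'e::chilbert_space \<Rightarrow> 'k::chilbert_space"
  assumes H1: "closed_csubspace H1" and C0: "bounded_op UNIV UNIV C0" and C1: "bounded_op H1 UNIV C1"
    and nonneg: "nonneg_op UNIV (\<lambda>k. 2 *\<^sub>R op_Im UNIV (\<lambda>k. C1 (hadj H1 C0 k)) k + C0 (hadj (ocompl H1) C0 k))"
    and inv: "boundedly_invertible UNIV UNIV (\<lambda>h. C0 h - \<i> *\<^sub>C C1 (oproj H1 h))"
    and h: "h1 \<in> H1" "C0 h0 + C1 h1 = 0"
  shows "(norm (oproj (ocompl H1) h0))\<^sup>2 \<le> 2 * Im (cinner h1 h0)"
proof -
  note H2 = closed_csubspace_ocompl[of H1]
  note C0' = bounded_op_subset[OF C0 subset_UNIV order_refl]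
  define a c d where "a = oproj H1 h0" and "c = oproj (ocompl H1) h0" and "d = h1"
  have a: "a \<in> H1" and c: "c \<in> ocompl H1" and d: "d \<in> H1" using oproj_mem[OF H1] oproj_mem[OF H2] h by (auto simp: a_def c_def d_def)
  have h0: "h0 = a + c" by (simp add: a_def c_def oproj_ocompl[OF H1])
  have id: "\<i> *\<^sub>C d \<in> H1" "a + \<i> *\<^sub>C d \<in> H1" "a - \<i> *\<^sub>C d \<in> H1" using a d closed_csubspaceD[OF H1] by auto
  define X where "X = (\<lambda>h. C0 h - \<i> *\<^sub>C C1 (oproj H1 h))"
  have X: "bounded_op UNIV UNIV X" using inv by (simp add: boundedly_invertible_def X_def)
  obtain k where k: "hadj UNIV X k = (a + \<i> *\<^sub>C d) + c" using hadj_compose_invertible[OF inv] unfolding X_def by blast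
  define s where "s = hadj H1 C0 k"
  define e where "e = hadj H1 C1 k"
  have s: "s \<in> H1" "cinner z s = cinner (C0 z) k" if "z \<in> H1" for z
    using hadj_mem[OF H1 C0'] cinner_hadj_right[OF H1 C0' that] by (auto simp: s_def)
  have s': "s \<in> H1" and e': "e \<in> H1" using hadj_mem[OF H1 C0'] hadj_mem[OF H1 C1] by (auto simp: s_def e_def)
  have e: "cinner z e = cinner (C1 z) k" if "z \<in> H1" for z using cinner_hadj_right[OF H1 C1 that] by (simp add: e_def)
  have C1z: "C1 (oproj H1 z) = 0" if "z \<in> ocompl H1" for z
  proof -
    have "oproj H1 z = 0" by (rule oproj_unique[OF H1 closed_csubspaceD(2)[OF H1]]) (use that in simp)
    moreover have "C1 (0 *\<^sub>C a) = 0 *\<^sub>C C1 a" by (rule bounded_opD(3)[OF C1 a])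
    ultimately show ?thesis by simp
  qed
  have r: "hadj (ocompl H1) C0 k = c"
  proof (rule hadj_eqI[OF H2 c])
    fix z assume z: "z \<in> ocompl H1"
    have "cinner (C0 z) k = cinner (X z) k" by (simp add: X_def C1z[OF z])
    also have "\<dots> = cinner z ((a + \<i> *\<^sub>C d) + c)" using hadj_UNIV_right[OF X, of z k] by (simp add: k)
    also have "\<dots> = cinner z c" using z id(2) by (simp add: cinner_add_right[of z "a + \<i> *\<^sub>C d" c] ocompl_def)
    finally show "cinner (C0 z) k = cinner z c" .
  qed
  \<comment> \<open>The component in \<open>H1\<close> of the adjoint of \<open>X\<close> at
    \<open>k\<close>, computed from the blocks and compared with its prescribed value; the component
    in the complement is given by \<open>r\<close>.\<close>
  have se: "s + \<i> *\<^sub>C e = a + \<i> *\<^sub>C d"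
  proof -
    have m: "s + \<i> *\<^sub>C e \<in> H1" using s' e' closed_csubspaceD[OF H1] by auto
    define v where "v = (s + \<i> *\<^sub>C e) - (a + \<i> *\<^sub>C d)"
    have v: "v \<in> H1" using m id closed_csubspaceD(7)[OF H1] by (simp add: v_def)
    have "cinner v (s + \<i> *\<^sub>C e) = cinner (X v) k"
      using s(2)[OF v] e[OF v] by (simp add: X_def oproj_id[OF H1 v] cinner_add_right cinner_scaleC_right cinner_diff_left cinner_scaleC_left)
    also have "\<dots> = cinner v ((a + \<i> *\<^sub>C d) + c)" using hadj_UNIV_right[OF X, of v k] by (simp add: k)
    also have "\<dots> = cinner v (a + \<i> *\<^sub>C d)"
    proof -
      have "cinner c v = 0" using c v by (simp add: ocompl_def)
      then have "cinner v c = 0" by (metis cnj_cinner complex_cnj_zero)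
      then show ?thesis by (simp add: cinner_add_right[of v "a + \<i> *\<^sub>C d" c])
    qed
    finally have "cinner v v = 0" by (simp add: v_def[symmetric] cinner_diff_right[of v "s + \<i> *\<^sub>C e" "a + \<i> *\<^sub>C d", folded v_def])
    then show ?thesis by (simp add: cinner_self v_def)
  qed
  define g where "g = s - \<i> *\<^sub>C e"
  have C1s: "bounded_op UNIV UNIV (\<lambda>k. C1 (hadj H1 C0 k))" by (rule bounded_op_compose[OF C1 bounded_op_hadj[OF H1 C0']])
  have "0 \<le> Re (cinner (2 *\<^sub>R op_Im UNIV (\<lambda>k. C1 (hadj H1 C0 k)) k + C0 (hadj (ocompl H1) C0 k)) k)"
    using nonneg by (simp add: nonneg_op_def)
  also have "cinner (2 *\<^sub>R op_Im UNIV (\<lambda>k. C1 (hadj H1 C0 k)) k + C0 (hadj (ocompl H1) C0 k)) k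
    = 2 * ((1 / (2 * \<i>)) * (cinner (C1 s) k - cinner k (C1 s))) + cinner (C0 c) k"
    by (simp add: op_Im_def cinner_add_left cinner_scaleC_left cinner_scaleR_left cinner_diff_left hadj_UNIV_left[OF C1s] r s_def)
  also have "cinner (C1 s) k = cinner s e" using e[OF s'] by simp
  also have "cinner k (C1 s) = cinner e s" using e[OF s'] by (metis cnj_cinner)
  also have "cinner (C0 c) k = cinner c c"
    using cinner_hadj_right[OF H2 bounded_op_subset[OF C0 subset_UNIV order_refl] c, of k] by (simp add: r)
  finally have ineq: "0 \<le> 2 * Im (cinner s e) + (norm c)\<^sup>2"
  proof -
    have "Re (2 * ((1 / (2 * \<i>)) * (cinner s e - cinner e s))) = 2 * Im (cinner s e)"
    proof -
      have "Im (cinner e s) = - Im (cinner s e)" by (metis cinner_commute cnj.sel(2))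
      then show ?thesis by (simp add: Re_divide Im_divide)
    qed
    then show "0 \<le> Re (2 * ((1 / (2 * \<i>)) * (cinner s e - cinner e s)) + cinner c c) \<Longrightarrow> ?thesis" by (simp add: cinner_self)
  qed
  have nse: "(norm (s + \<i> *\<^sub>C e))\<^sup>2 = (norm s)\<^sup>2 + 2 * Im (cinner s e) + (norm e)\<^sup>2"
    and ng: "(norm g)\<^sup>2 = (norm s)\<^sup>2 - 2 * Im (cinner s e) + (norm e)\<^sup>2"
    using norm_add_sq[of s "\<i> *\<^sub>C e"] norm_add_sq[of s "- (\<i> *\<^sub>C e)"]
    by (simp_all add: g_def cinner_scaleC_right cinner_minus_right)
  have nad: "(norm (a + \<i> *\<^sub>C d))\<^sup>2 = (norm a)\<^sup>2 + 2 * Im (cinner a d) + (norm d)\<^sup>2"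
    and nad': "(norm (a - \<i> *\<^sub>C d))\<^sup>2 = (norm a)\<^sup>2 - 2 * Im (cinner a d) + (norm d)\<^sup>2"
    using norm_add_sq[of a "\<i> *\<^sub>C d"] norm_add_sq[of a "- (\<i> *\<^sub>C d)"]
    by (simp_all add: cinner_scaleC_right cinner_minus_right)
  \<comment> \<open>By \<open>se\<close>, nonnegativity at \<open>k\<close> reads
    \<open>|g|^2 \<le> S\<close>, while pairing \<open>C0 h0 + C1 h1 = 0\<close> with
    \<open>k\<close> gives \<open>S = - cinner (a - i d) g\<close>. Together they give
    \<open>S \<le> |a - i d|^2\<close>, which is the claim.\<close>
  define S where "S = (norm (a + \<i> *\<^sub>C d))\<^sup>2 + 2 * (norm c)\<^sup>2"
  have gS: "(norm g)\<^sup>2 \<le> S" using ineq nse ng by (simp add: S_def se)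
  have "cinner (C0 h0 + C1 h1) k = 0" using h by simp
  then have "cinner (C0 a) k + cinner (C0 c) k + cinner (C1 d) k = 0"
    by (simp add: h0 bounded_op_lin[OF C0] cinner_add_left d_def)
  then have "cinner a s + cinner c c + cinner d e = 0"
    using s(2)[OF a] e[OF d] cinner_hadj_right[OF H2 bounded_op_subset[OF C0 subset_UNIV order_refl] c, of k] by (simp add: r)
  moreover have "2 * (cinner a s + cinner d e) = cinner (a + \<i> *\<^sub>C d) (s + \<i> *\<^sub>C e) + cinner (a - \<i> *\<^sub>C d) g"
    by (simp add: g_def cinner_add_left cinner_add_right cinner_diff_left cinner_diff_right cinner_scaleC_left
        cinner_scaleC_right algebra_simps)
  ultimately have "cinner (a + \<i> *\<^sub>C d) (a + \<i> *\<^sub>C d) + 2 * cinner c c = - cinner (a - \<i> *\<^sub>C d) g"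
    unfolding se by algebra
  then have "of_real S = - cinner (a - \<i> *\<^sub>C d) g" by (simp add: S_def cinner_self)
  then have "cmod (of_real S) = cmod (cinner (a - \<i> *\<^sub>C d) g)" by (metis norm_minus_cancel)
  moreover have S0: "0 \<le> S" by (simp add: S_def)
  ultimately have "S \<le> norm (a - \<i> *\<^sub>C d) * norm g" using cinner_Cauchy_Schwarz[of "a - \<i> *\<^sub>C d" g] by simp
  also have "\<dots> \<le> norm (a - \<i> *\<^sub>C d) * sqrt S" using gS by (intro mult_left_mono real_le_rsqrt) auto
  finally have le: "S \<le> norm (a - \<i> *\<^sub>C d) * sqrt S" .
  have "sqrt S \<le> norm (a - \<i> *\<^sub>C d)"
  proof (cases "S = 0")
    case False
    then have "0 < sqrt S" using S0 by simp
    moreover have "sqrt S * sqrt S \<le> norm (a - \<i> *\<^sub>C d) * sqrt S" using le S0 by simp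
    ultimately show ?thesis using mult_right_le_imp_le by blast
  qed simp
  then have "S \<le> (norm (a - \<i> *\<^sub>C d))\<^sup>2" using S0 by (simp add: real_sqrt_le_iff sqrt_le_D)
  then have "(norm c)\<^sup>2 \<le> - 2 * Im (cinner a d)" using nad nad' by (simp add: S_def)
  moreover have "cinner h1 h0 = cinner d a"
  proof -
    have "cinner c d = 0" using c d by (simp add: ocompl_def)
    then have "cinner d c = 0" by (metis cnj_cinner complex_cnj_zero)
    then show ?thesis by (simp add: h0 d_def cinner_add_right)
  qed
  moreover have "Im (cinner d a) = - Im (cinner a d)" by (metis cinner_commute cnj.sel(2))
  ultimately show ?thesis by (simp add: c_def)
qed

text \<open>Solves \<open>A x = y - E x\<close> by Banach's fixed point theorem; the lower bound of
  \<open>A\<close> makes the contraction constant \<open>e / c\<close>.\<close>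

lemma surj_perturbation:
  fixes A E :: "'a::chilbert_space \<Rightarrow> 'b::complex_inner"
  assumes A: "bounded_op UNIV UNIV A" and c: "0 < c" "\<And>x. c * norm x \<le> norm (A x)" and surj: "surj A"
    and E: "bounded_op UNIV UNIV E" "\<And>x. norm (E x) \<le> e * norm x" and e: "0 \<le> e" "e < c"
  shows "surj (\<lambda>x. A x + E x)"
proof -
  have "inj A"
  proof (rule injI)
    fix x y assume "A x = A y"
    then have "c * norm (x - y) \<le> 0" using c(2)[of "x - y"] by (simp add: bounded_op_lin[OF A])
    then show "x = y" using c(1) by (simp add: mult_le_0_iff)
  qed
  have "\<exists>x. A x + E x = y" for y
  proof -
    define f where "f = (\<lambda>x. inv A (y - E x))"
    have Af: "A (f x) = y - E x" for x unfolding f_def by (rule surj_f_inv_f[OF surj])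
    have "\<exists>!x. f x = x"
    proof (rule banach_fix_type)
      show "0 \<le> e / c" "e / c < 1" using e c by auto
      show "\<forall>x x'. dist (f x) (f x') \<le> e / c * dist x x'"
      proof (intro allI)
        fix x x'
        have "c * norm (f x - f x') \<le> norm (A (f x - f x'))" by (rule c(2))
        also have "A (f x - f x') = - E (x - x')" by (simp add: bounded_op_lin[OF A] bounded_op_lin[OF E(1)] Af)
        also have "norm \<dots> \<le> e * norm (x - x')" using E(2) by simp
        finally show "dist (f x) (f x') \<le> e / c * dist x x'" using c(1) by (simp add: dist_norm field_simps)
      qed
    qed
    then obtain x where "f x = x" by auto
    then have "A x = y - E x" using Af[of x] by simp
    then have "A x + E x = y" by simp
    then show ?thesis ..
  qed
  then show ?thesis by (metis surjI surj_def)
qed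

text \<open>The lower bound is uniform along the segment, so surjectivity can be carried along it in
  \<open>N\<close> steps of equal length, each a perturbation of norm \<open>B / N\<close> below
  \<open>c\<close>.\<close>

lemma method_of_continuity:
  fixes A E :: "'a::chilbert_space \<Rightarrow> 'b::complex_inner"
  assumes A: "bounded_op UNIV UNIV A" and E: "bounded_op UNIV UNIV E" and surj: "surj A" and c: "0 < c"
    and le: "\<And>s x. 0 \<le> s \<Longrightarrow> s \<le> 1 \<Longrightarrow> c * norm x \<le> norm (A x + s *\<^sub>R E x)"
  shows "surj (\<lambda>x. A x + E x)"
proof -
  obtain B where B: "0 < B" "\<And>x. norm (E x) \<le> B * norm x" using bounded_op_bound[OF E] by (metis UNIV_I)
  obtain N :: nat where N: "B / c < real N" using reals_Archimedean2 by blast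
  have N0: "0 < real N" using N B c by (metis divide_pos_pos less_trans)
  have bE: "bounded_op UNIV UNIV (\<lambda>x. s *\<^sub>R E x)" for s
    using bounded_op_scaleC[OF E, of "of_real s"] by (simp add: scaleC_of_real)
  have "surj (\<lambda>x. A x + (real k / real N) *\<^sub>R E x)" if "k \<le> N" for k
    using that
  proof (induction k)
    case (Suc k)
    have "surj (\<lambda>x. (A x + (real k / real N) *\<^sub>R E x) + (1 / real N) *\<^sub>R E x)"
    proof (rule surj_perturbation[OF bounded_op_add[OF A bE] c _ _ bE])
      show "c * norm x \<le> norm (A x + (real k / real N) *\<^sub>R E x)" for x by (rule le) (use Suc.prems N0 in auto)
      show "surj (\<lambda>x. A x + (real k / real N) *\<^sub>R E x)" using Suc by simp
      show "norm ((1 / real N) *\<^sub>R E x) \<le> (B / real N) * norm x" for x using B(2)[of x] N0 by (simp add: field_simps)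
      show "0 \<le> B / real N" "B / real N < c" using N N0 B c by (auto simp: field_simps)
    qed
    moreover have "(A x + (real k / real N) *\<^sub>R E x) + (1 / real N) *\<^sub>R E x = A x + (real (Suc k) / real N) *\<^sub>R E x" for x
      unfolding add.assoc scaleR_add_left[symmetric] add_divide_distrib[symmetric] by simp
    ultimately show ?case by simp
  qed (use surj in simp)
  from this[of N] N0 show ?thesis by simp
qed

section \<open>Boundary relation plus Weyl function: inverse and parametrization\<close>

locale weyl_pair = weyl \<Delta> D L H1 G0 G1 M
  for \<Delta> :: "real set" and D :: "(real \<Rightarrow> 'h::{chilbert_space, second_countable_topology}) set"
    and L :: "(real \<Rightarrow> 'h) \<Rightarrow> real \<Rightarrow> 'h" and H1 :: "'e::chilbert_space set" and G0 G1 :: "(real \<Rightarrow> 'h) \<Rightarrow> 'e"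
    and M :: "complex \<Rightarrow> 'e \<Rightarrow> 'e" +
  fixes C0 C1 :: "complex \<Rightarrow> 'e \<Rightarrow> 'k::chilbert_space" and K0 K1 :: "complex \<Rightarrow> 'l::chilbert_space \<Rightarrow> 'e"
  assumes C0_hol: "op_holomorphic {z. 0 < Im z} UNIV UNIV C0" and C1_hol: "op_holomorphic {z. 0 < Im z} H1 UNIV C1"
    and C_nonneg: "\<And>lam. 0 < Im lam \<Longrightarrow> nonneg_op UNIV (\<lambda>k. 2 *\<^sub>R op_Im UNIV (\<lambda>k. C1 lam (hadj H1 (C0 lam) k)) k
                               + C0 lam (hadj (ocompl H1) (C0 lam) k))"
    and C_inv: "\<And>lam. 0 < Im lam \<Longrightarrow> boundedly_invertible UNIV UNIV (\<lambda>h. C0 lam h - \<i> *\<^sub>C C1 lam (oproj H1 h))"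
    and K_rep: "range_representation H1 (\<lambda>lam. pair_rel H1 (C0 lam) (C1 lam)) K0 K1"
begin

lemma C0_op: "0 < Im lam \<Longrightarrow> bounded_op UNIV UNIV (C0 lam)"
  using op_holomorphic_bounded[OF C0_hol] by simp

lemma C1_op: "0 < Im lam \<Longrightarrow> bounded_op H1 UNIV (C1 lam)"
  using op_holomorphic_bounded[OF C1_hol] by simp

lemma K0_op: "0 < Im lam \<Longrightarrow> bounded_op UNIV UNIV (K0 lam)"
  and K1_op: "0 < Im lam \<Longrightarrow> bounded_op UNIV H1 (K1 lam)"
  using K_rep by (auto simp: range_representation_def intro: op_holomorphic_bounded)

lemma K_pair: "0 < Im lam \<Longrightarrow> (K0 lam k, K1 lam k) \<in> pair_rel H1 (C0 lam) (C1 lam)"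
  and K_ex: "0 < Im lam \<Longrightarrow> (h0, h1) \<in> pair_rel H1 (C0 lam) (C1 lam) \<Longrightarrow> \<exists>k. K0 lam k = h0 \<and> K1 lam k = h1"
  and K_ker: "0 < Im lam \<Longrightarrow> K0 lam k = 0 \<Longrightarrow> K1 lam k = 0 \<Longrightarrow> k = 0"
  using K_rep by (auto simp: range_representation_def)

lemma pair_dissipative:
  assumes "0 < Im lam" "(h0, h1) \<in> pair_rel H1 (C0 lam) (C1 lam)"
  shows "(norm (P2 h0))\<^sup>2 \<le> 2 * Im (cinner h1 h0)"
  using boundary_pair_dissipative[OF H1 C0_op[OF assms(1)] C1_op[OF assms(1)] C_nonneg[OF assms(1)] C_inv[OF assms(1)]] assms(2)
  by (simp add: pair_rel_def)

definition Zop :: "complex \<Rightarrow> 'e \<Rightarrow> 'k" where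
  "Zop lam f = C0 lam f - C1 lam (M lam f)"

text \<open>
  \<open>Zop\<close> is joined to the invertible operator \<open>C\<^sub>0 - \<i> C\<^sub>1 P\<^sub>1\<close> by the segment
  \<open>M\<^sub>s = (1 - s) \<i> P\<^sub>1 + s M\<close>, along which the lower bounds are uniform.
\<close>

lemma Zop_invertible:
  assumes lam: "0 < Im lam"
  shows "boundedly_invertible UNIV UNIV (Zop lam)"
proof -
  define X where "X = (\<lambda>h. C0 lam h - \<i> *\<^sub>C C1 lam (P1 h))"
  obtain R where R: "bounded_op UNIV UNIV R" "\<And>x. R (X x) = x" "\<And>y. X (R y) = y" and Xop: "bounded_op UNIV UNIV X"
    using C_inv[OF lam] by (auto simp: boundedly_invertible_def X_def)
  note C1b = C1_op[OF lam] and C0b = C0_op[OF lam] and Mb = M_op[OF lam]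
  note HI = closed_csubspaceD[OF H1]
  obtain c where c: "0 < c" "\<And>f. c * (norm f)\<^sup>2 \<le> qf lam f" using qf_coercive[OF lam] by metis
  obtain m where m: "0 < m" "\<And>f. norm (M lam f) \<le> m * norm f" using bounded_op_bound[OF Mb] by (metis UNIV_I)
  obtain \<rho> where \<rho>: "0 < \<rho>" "\<And>k. norm (R k) \<le> \<rho> * norm k" using bounded_op_bound[OF R(1)] by (metis UNIV_I)
  \<comment> \<open>A coercivity bound common to both ends of the segment: for
    \<open>\<i> P1\<close> the constant is 1, for \<open>M\<close> it is \<open>c\<close>.\<close>
  define c' where "c' = min 1 c"
  have c': "0 < c'" using c by (simp add: c'_def)
  define Ms where "Ms = (\<lambda>s f. (1 - s) *\<^sub>R (\<i> *\<^sub>C P1 f) + s *\<^sub>R M lam f)"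
  have P1op: "bounded_op UNIV UNIV (\<lambda>f. \<i> *\<^sub>C P1 f)"
    by (intro bounded_op_scaleC bounded_op_subset[OF bounded_op_oproj[OF H1]]) auto
  have iP1: "\<i> *\<^sub>C P1 f \<in> H1" for f by (intro HI oproj_mem[OF H1])
  have Mmem: "M lam f \<in> H1" for f using bounded_opD(1)[OF Mb] by simp
  have Ms_mem: "Ms s f \<in> H1" for s f unfolding Ms_def by (intro HI iP1 Mmem)
  have Ms_lin: "Ms s (f - g) = Ms s f - Ms s g" for s f g
    by (simp add: Ms_def bounded_op_lin[OF P1op] bounded_op_lin[OF M_op'[OF lam]] scaleR_diff_right)
  have C1_sub: "C1 lam (x - y) = C1 lam x - C1 lam y" if "x \<in> H1" "y \<in> H1" for x y
    using bounded_opD(2)[OF C1b that(1), of "(-1) *\<^sub>C y"] bounded_opD(3)[OF C1b that(2), of "-1"] HI(4)[OF that(2), of "-1"]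
    by (simp add: scaleC_minus_one)
  have C1_scaleR: "C1 lam (r *\<^sub>R x) = r *\<^sub>R C1 lam x" if "x \<in> H1" for r x
    using bounded_opD(3)[OF C1b that, of "of_real r"] by (simp add: scaleC_of_real)
  have n_Ms: "norm (Ms s f) \<le> (1 + m) * norm f" if s: "0 \<le> s" "s \<le> 1" for s f
  proof -
    have "norm (Ms s f) \<le> norm ((1 - s) *\<^sub>R (\<i> *\<^sub>C P1 f)) + norm (s *\<^sub>R M lam f)" unfolding Ms_def by (rule norm_triangle_ineq)
    also have "\<dots> = (1 - s) * norm (P1 f) + s * norm (M lam f)" using s by simp
    also have "\<dots> \<le> 1 * norm f + 1 * (m * norm f)"
      using s m(2)[of f] m(1) norm_oproj_le[OF H1, of f] by (intro add_mono mult_mono) auto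
    finally show ?thesis by (simp add: algebra_simps)
  qed
  have coer: "c' * (norm f)\<^sup>2 \<le> 2 * Im (cinner (Ms s f) f) + (norm (P2 f))\<^sup>2" if s: "0 \<le> s" "s \<le> 1" for s f
  proof -
    have "cinner (\<i> *\<^sub>C P1 f) f = \<i> * of_real ((norm (P1 f))\<^sup>2)"
      using cinner_oproj_left[OF H1, of f f] by (simp add: cinner_scaleC_left cinner_self)
    then have "cinner (Ms s f) f = of_real (1 - s) * (\<i> * of_real ((norm (P1 f))\<^sup>2)) + of_real s * cinner (M lam f) f"
      unfolding Ms_def scaleC_of_real[symmetric] by (simp only: cinner_add_left cinner_scaleC_left)
    then have "Im (cinner (Ms s f) f) = (1 - s) * (norm (P1 f))\<^sup>2 + s * Im (cinner (M lam f) f)"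
      by (simp del: of_real_power)
    then have "2 * Im (cinner (Ms s f) f) + (norm (P2 f))\<^sup>2 = (1 - s) * (2 * (norm (P1 f))\<^sup>2 + (norm (P2 f))\<^sup>2) + s * qf lam f"
      by (simp add: qf_def algebra_simps)
    moreover have "c' * (norm f)\<^sup>2 \<le> 2 * (norm (P1 f))\<^sup>2 + (norm (P2 f))\<^sup>2"
      using norm_P12[of f] mult_right_mono[OF min.cobounded1 zero_le_power2, of 1 c "norm f"] zero_le_power2[of "norm (P1 f)"]
      unfolding c'_def by linarith
    moreover have "c' * (norm f)\<^sup>2 \<le> qf lam f"
      using c(2)[of f] mult_right_mono[of c' c "(norm f)\<^sup>2"] unfolding c'_def by fastforce
    ultimately have "(1 - s) * (c' * (norm f)\<^sup>2) + s * (c' * (norm f)\<^sup>2) \<le> 2 * Im (cinner (Ms s f) f) + (norm (P2 f))\<^sup>2"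
      using add_mono[OF mult_left_mono[of _ _ "1 - s"] mult_left_mono[of _ _ s]] s by simp
    then show ?thesis by (simp add: algebra_simps)
  qed
  define E where "E = (\<lambda>f. \<i> *\<^sub>C C1 lam (P1 f) - C1 lam (M lam f))"
  have Eop: "bounded_op UNIV UNIV E"
    unfolding E_def by (intro bounded_op_diff bounded_op_scaleC bounded_op_compose[OF C1b bounded_op_oproj[OF H1]] bounded_op_compose[OF C1b Mb])
  have XE: "X f + s *\<^sub>R E f = C0 lam f - C1 lam (Ms s f)" for s f
  proof -
    have "C1 lam (Ms s f) = (1 - s) *\<^sub>R (\<i> *\<^sub>C C1 lam (P1 f)) + s *\<^sub>R C1 lam (M lam f)"
      unfolding Ms_def using bounded_opD(2)[OF C1b HI(5)[OF iP1] HI(5)[OF Mmem]] C1_scaleR[OF iP1] C1_scaleR[OF Mmem]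
        bounded_opD(3)[OF C1b oproj_mem[OF H1]] by simp
    then show ?thesis by (simp add: X_def E_def algebra_simps)
  qed
  define K where "K = \<rho> * (2 / c' * (2 + m) + 1)"
  have K: "0 < K" using \<rho> c' m by (simp add: K_def add_pos_pos)
  have bound: "norm g \<le> K * norm (X g + s *\<^sub>R E g)" if s: "0 \<le> s" "s \<le> 1" for s g
  proof -
    \<comment> \<open>\<open>R\<close> yields a pair with \<open>C0 e0 + C1 e1 = k\<close>.
      Subtracting it from \<open>(g, - Ms s g)\<close>, which solves the same equation, leaves a
      pair \<open>(h0, h1)\<close> of the relation. Dissipativity of the relation against coercivity
      of \<open>Ms s\<close> bounds \<open>h0\<close> by \<open>e0\<close>, hence \<open>g\<close>
      by \<open>k\<close>.\<close>
    define k where "k = X g + s *\<^sub>R E g"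
    define e0 where "e0 = R k"
    define e1 where "e1 = - (\<i> *\<^sub>C P1 e0)"
    define h0 where "h0 = g - e0"
    define h1 where "h1 = - Ms s g - e1"
    have e1: "e1 \<in> H1" unfolding e1_def by (intro HI iP1)
    have h1: "h1 \<in> H1" unfolding h1_def by (intro HI Ms_mem e1)
    have "C1 lam e1 = - (\<i> *\<^sub>C C1 lam (P1 e0))"
      using C1_sub[OF HI(2) iP1, of e0] C1_sub[OF HI(2) HI(2)] bounded_opD(3)[OF C1b oproj_mem[OF H1]] by (simp add: e1_def)
    then have Xe: "C0 lam e0 + C1 lam e1 = k" using R(3)[of k] by (simp add: e0_def[symmetric] X_def)
    have "C1 lam h1 = - C1 lam (Ms s g) - C1 lam e1"
      using C1_sub[OF HI(6)[OF Ms_mem] e1, of s g] C1_sub[OF HI(2) Ms_mem, of s g] C1_sub[OF HI(2) HI(2)] by (simp add: h1_def)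
    moreover have "C0 lam g = C0 lam e0 + C1 lam e1 + C1 lam (Ms s g)"
      using Xe k_def[unfolded XE] by simp
    ultimately have "C0 lam h0 + C1 lam h1 = 0"
      by (simp add: h0_def bounded_op_lin[OF C0b])
    then have pr: "(h0, h1) \<in> pair_rel H1 (C0 lam) (C1 lam)" using h1 by (simp add: pair_rel_def)
    define v where "v = h1 + Ms s h0"
    have v: "v = - e1 - Ms s e0" by (simp add: v_def h1_def h0_def Ms_lin)
    have "c' * (norm h0)\<^sup>2 \<le> 2 * Im (cinner (Ms s h0) h0) + 2 * Im (cinner h1 h0)"
      using coer[OF s, of h0] pair_dissipative[OF lam pr] by linarith
    also have "\<dots> = 2 * Im (cinner v h0)" by (simp add: v_def cinner_add_left)
    also have "\<dots> \<le> 2 * (norm v * norm h0)"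
      using abs_Im_le_cmod[of "cinner v h0"] cinner_Cauchy_Schwarz[of v h0] by linarith
    finally have "norm h0 \<le> 2 / c' * norm v"
      using c' by (cases "h0 = 0") (auto simp: power2_eq_square field_simps)
    moreover have "norm v \<le> (2 + m) * norm e0"
    proof -
      have "norm v \<le> norm e1 + norm (Ms s e0)" unfolding v using norm_triangle_ineq4[of "- e1" "Ms s e0"] by simp
      also have "\<dots> \<le> norm e0 + (1 + m) * norm e0"
        using n_Ms[OF s, of e0] norm_oproj_le[OF H1, of e0] by (intro add_mono) (auto simp: e1_def)
      finally show ?thesis by (simp add: algebra_simps)
    qed
    ultimately have "norm h0 \<le> 2 / c' * ((2 + m) * norm e0)"
      using c' by (meson divide_nonneg_pos mult_left_mono order_trans zero_le_numeral)
    moreover have "norm g \<le> norm h0 + norm e0" using norm_triangle_ineq[of h0 e0] by (simp add: h0_def)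
    ultimately have "norm g \<le> (2 / c' * (2 + m) + 1) * norm e0"
      unfolding distrib_right[of "2 / c' * (2 + m)" 1] mult_1 mult.assoc by linarith
    also have "\<dots> \<le> (2 / c' * (2 + m) + 1) * (\<rho> * norm k)"
      using \<rho>(2)[of k] c' m by (intro mult_left_mono) (auto simp: e0_def)
    finally show ?thesis by (simp add: K_def k_def ac_simps)
  qed
  have Z_eq: "Zop lam = (\<lambda>f. X f + E f)" using XE[of _ 1] by (auto simp: Zop_def Ms_def)
  have surj: "surj (\<lambda>f. X f + E f)"
  proof (rule method_of_continuity[OF Xop Eop])
    show "surj X" using R(3) by (metis surjI)
    show "0 < 1 / K" using K by simp
    show "1 / K * norm x \<le> norm (X x + s *\<^sub>R E x)" if "0 \<le> s" "s \<le> 1" for s x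
      using bound[OF that, of x] K by (simp add: field_simps)
  qed
  have Zop: "bounded_op UNIV UNIV (Zop lam)" unfolding Z_eq by (rule bounded_op_add[OF Xop Eop])
  have Zb: "norm g \<le> K * norm (Zop lam g)" for g using bound[of 1 g] by (simp add: Z_eq)
  have inj: "inj (Zop lam)"
  proof (rule injI)
    fix x y assume "Zop lam x = Zop lam y"
    then show "x = y" using Zb[of "x - y"] by (simp add: bounded_op_lin[OF Zop])
  qed
  have Zs: "surj (Zop lam)" using surj by (simp add: Z_eq)
  have Zi: "Zop lam (inv (Zop lam) y) = y" for y by (rule surj_f_inv_f[OF Zs])
  have "bounded_op UNIV UNIV (inv (Zop lam))"
  proof (rule bounded_opI[where B = K])
    show "inv (Zop lam) (x + y) = inv (Zop lam) x + inv (Zop lam) y" for x y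
      by (rule injD[OF inj]) (simp add: bounded_op_lin[OF Zop] Zi)
    show "inv (Zop lam) (c *\<^sub>C x) = c *\<^sub>C inv (Zop lam) x" for c x
      by (rule injD[OF inj]) (simp add: bounded_op_lin[OF Zop] Zi)
    show "norm (inv (Zop lam) x) \<le> K * norm x" for x using Zb[of "inv (Zop lam) x"] by (simp add: Zi)
  qed simp
  then show ?thesis
    unfolding boundedly_invertible_def using Zop Zi inv_f_f[OF inj] by blast
qed

lemma Zop_inv:
  assumes "0 < Im lam"
  shows "bounded_op UNIV UNIV (inv (Zop lam))" "inv (Zop lam) (Zop lam x) = x" "Zop lam (inv (Zop lam) y) = y"
proof -
  obtain S where S: "bounded_op UNIV UNIV S" "\<And>x. S (Zop lam x) = x" "\<And>y. Zop lam (S y) = y"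
    using Zop_invertible[OF assms] by (auto simp: boundedly_invertible_def)
  then have "inv (Zop lam) = S" by (intro inv_equality) auto
  then show "bounded_op UNIV UNIV (inv (Zop lam))" "inv (Zop lam) (Zop lam x) = x" "Zop lam (inv (Zop lam) y) = y"
    using S by auto
qed

text \<open>\<open>Top\<close> is \<open>(\<tau>\<^sub>+ + M\<^sub>+)\<^sup>-\<^sup>1\<close> on \<open>\<H>\<^sub>1\<close>, extended by zero to the orthogonal complement.\<close>

definition Top :: "complex \<Rightarrow> 'e \<Rightarrow> 'e" where
  "Top lam h = - inv (Zop lam) (C1 lam (P1 h))"

lemma Zop_hol: "op_holomorphic {z. 0 < Im z} UNIV UNIV Zop"
proof -
  have hol: "op_holomorphic {z. 0 < Im z} UNIV UNIV (\<lambda>z f. C0 z f - C1 z (P1 (M z f)))"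
    by (rule op_holomorphic_diff[OF C0_hol op_holomorphic_compose[OF op_holomorphic_oproj[OF H1 C1_hol] M_holomorphic]])
  have eq: "Zop z = (\<lambda>f. C0 z f - C1 z (P1 (M z f)))" if "z \<in> {z. 0 < Im z}" for z
    using bounded_opD(1)[OF M_op] that by (simp add: Zop_def[abs_def] oproj_id[OF H1])
  show ?thesis unfolding op_holomorphic_def
    by (intro ballI op_holomorphic_local[OF hol open_halfspace_Im_gt order_refl eq])
qed

lemma Top_hol: "op_holomorphic {z. 0 < Im z} UNIV UNIV Top"
proof -
  have "op_holomorphic {z. 0 < Im z} UNIV UNIV (\<lambda>z. inv (Zop z))"
    by (rule op_holomorphic_inverse[OF Zop_hol]) (auto intro: Zop_inv)
  then show ?thesis unfolding Top_def[abs_def]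
    by (rule op_holomorphic_minus[OF op_holomorphic_compose[OF _ op_holomorphic_oproj[OF H1 C1_hol]]])
qed

lemma Top_op: "0 < Im lam \<Longrightarrow> bounded_op UNIV UNIV (Top lam)"
  using op_holomorphic_bounded[OF Top_hol] by simp

lemma M_mem: "0 < Im lam \<Longrightarrow> M lam f \<in> H1"
  using bounded_opD(1)[OF M_op] by simp

lemma C1_lin:
  assumes "0 < Im lam" "x \<in> H1" "y \<in> H1"
  shows "C1 lam (x - y) = C1 lam x - C1 lam y" "C1 lam (x + y) = C1 lam x + C1 lam y" "C1 lam (- x) = - C1 lam x"
proof -
  note C1b = C1_op[OF assms(1)]
  have m: "C1 lam (- z) = - C1 lam z" if "z \<in> H1" for z
    using bounded_opD(3)[OF C1b that, of "-1"] by (simp add: scaleC_minus_one)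
  show "C1 lam (x + y) = C1 lam x + C1 lam y" by (rule bounded_opD(2)[OF C1b assms(2,3)])
  show "C1 lam (x - y) = C1 lam x - C1 lam y"
    using bounded_opD(2)[OF C1b assms(2) closed_csubspaceD(6)[OF H1 assms(3)]] m[OF assms(3)] by simp
  show "C1 lam (- x) = - C1 lam x" by (rule m[OF assms(2)])
qed

text \<open>Together with \<open>Top_pair\<close> this shows that \<open>Top\<close> on
  \<open>H1\<close> is the inverse of the relation sum, which so far is a relation only.\<close>

lemma Top_unique:
  assumes lam: "0 < Im lam" and pr: "(h0, h1) \<in> pair_rel H1 (C0 lam) (C1 lam)"
  shows "Top lam (h1 + M lam h0) = h0"
proof -
  have h1: "h1 \<in> H1" "C0 lam h0 + C1 lam h1 = 0" using pr by (auto simp: pair_rel_def)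
  have "P1 (h1 + M lam h0) = h1 + M lam h0"
    by (rule oproj_id[OF H1 closed_csubspaceD(3)[OF H1 h1(1) M_mem[OF lam]]])
  moreover have "C1 lam (h1 + M lam h0) = - Zop lam h0"
    using h1(2) C1_lin(2)[OF lam h1(1) M_mem[OF lam]] by (simp add: Zop_def algebra_simps eq_neg_iff_add_eq_0)
  ultimately show ?thesis
    by (simp add: Top_def bounded_op_lin[OF Zop_inv(1)[OF lam]] Zop_inv(2)[OF lam])
qed

lemma Top_pair:
  assumes lam: "0 < Im lam" and h: "h \<in> H1"
  shows "(Top lam h, h - M lam (Top lam h)) \<in> pair_rel H1 (C0 lam) (C1 lam)"
proof -
  have "Zop lam (Top lam h) = - C1 lam h"
    using Zop_inv(1)[OF lam] Zop_invertible[OF lam]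
    by (simp add: Top_def boundedly_invertible_def bounded_op_lin oproj_id[OF H1 h] Zop_inv(3)[OF lam])
  then have "C0 lam (Top lam h) + (C1 lam h - C1 lam (M lam (Top lam h))) = 0"
    unfolding Zop_def by (simp add: algebra_simps)
  then show ?thesis
    using C1_lin(1)[OF lam h M_mem[OF lam]] closed_csubspaceD(7)[OF H1 h M_mem[OF lam]]
    by (simp add: pair_rel_def)
qed

lemma rel_op_eq_Top:
  assumes lam: "0 < Im lam" and h: "h \<in> H1"
  shows "rel_op ((rel_add_op (pair_rel H1 (C0 lam) (C1 lam)) (M lam))\<inverse>) h = Top lam h"
  unfolding rel_op_def
proof (rule the_equality)
  show "(h, Top lam h) \<in> (rel_add_op (pair_rel H1 (C0 lam) (C1 lam)) (M lam))\<inverse>"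
    unfolding rel_add_op_def converse_iff using Top_pair[OF lam h]
    by (intro CollectI exI[of _ "Top lam h"] exI[of _ "h - M lam (Top lam h)"]) simp
  fix y assume "(h, y) \<in> (rel_add_op (pair_rel H1 (C0 lam) (C1 lam)) (M lam))\<inverse>"
  then show "y = Top lam h" using Top_unique[OF lam] by (auto simp: rel_add_op_def)
qed

definition Bop :: "complex \<Rightarrow> 'e \<Rightarrow> 'l" where
  "Bop lam = inv (\<lambda>k. K1 lam k + M lam (K0 lam k))"

text \<open>\<open>K1 + M K0\<close> is injective by \<open>Top_unique\<close> and the trivial
  common kernel of \<open>K0\<close> and \<open>K1\<close>. Therefore \<open>inv\<close> recovers
  the parameter of the pair that \<open>Top_pair\<close> provides for \<open>h\<close>.\<close>

lemma Bop_eq: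
  assumes lam: "0 < Im lam" and h: "h \<in> H1"
  shows "K0 lam (Bop lam h) = Top lam h" "K1 lam (Bop lam h) = h - M lam (Top lam h)"
proof -
  obtain k where k: "K0 lam k = Top lam h" "K1 lam k = h - M lam (Top lam h)"
    using K_ex[OF lam Top_pair[OF lam h]] by blast
  have "inj (\<lambda>k. K1 lam k + M lam (K0 lam k))"
  proof (rule injI)
    fix x y assume eq: "K1 lam x + M lam (K0 lam x) = K1 lam y + M lam (K0 lam y)"
    have "K0 lam x = K0 lam y"
      using Top_unique[OF lam K_pair[OF lam, of x]] Top_unique[OF lam K_pair[OF lam, of y]] eq by simp
    moreover from this have "K1 lam x = K1 lam y" using eq by simp
    ultimately have "K0 lam (x - y) = 0" "K1 lam (x - y) = 0"
      using K0_op[OF lam] bounded_op_subset[OF K1_op[OF lam] order_refl subset_UNIV] by (simp_all add: bounded_op_lin)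
    then show "x = y" using K_ker[OF lam] by fastforce
  qed
  then have "Bop lam (K1 lam k + M lam (K0 lam k)) = k" unfolding Bop_def by (rule inv_f_f)
  then have "Bop lam h = k" by (simp add: k)
  then show "K0 lam (Bop lam h) = Top lam h" "K1 lam (Bop lam h) = h - M lam (Top lam h)" using k by auto
qed

text \<open>\<open>gsol\<close> is the value of \<open>\<Gamma>\<^sub>0\<close> on the solution \<open>U\<^sub>\<tau> x\<close>.\<close>

definition gsol :: "complex \<Rightarrow> 'e \<Rightarrow> 'e \<Rightarrow> 'e" where
  "gsol lam e1 e2 = Top lam (M lam e1) - e1 - Top lam e2"

definition bsol :: "complex \<Rightarrow> 'e \<Rightarrow> 'e \<Rightarrow> 'l" where
  "bsol lam e1 e2 = - Bop lam (M lam e1) + Bop lam e2"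

text \<open>For the solution \<open>y\<close> belonging to \<open>e1\<close>, \<open>e2\<close>,
  this says that \<open>bsol\<close> is the parameter of the element
  \<open>(- (G0 y + e1), G1 y + e2)\<close> of the boundary relation.\<close>

lemma K_bsol:
  assumes lam: "0 < Im lam" and e2: "e2 \<in> H1"
  shows "K0 lam (bsol lam e1 e2) = - (gsol lam e1 e2 + e1)" "K1 lam (bsol lam e1 e2) = e2 + M lam (gsol lam e1 e2)"
proof -
  note K1' = bounded_op_subset[OF K1_op[OF lam] order_refl subset_UNIV]
  show "K0 lam (bsol lam e1 e2) = - (gsol lam e1 e2 + e1)"
    using Bop_eq(1)[OF lam M_mem[OF lam], of e1] Bop_eq(1)[OF lam e2]
    by (simp add: bsol_def gsol_def bounded_op_lin[OF K0_op[OF lam]])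
  show "K1 lam (bsol lam e1 e2) = e2 + M lam (gsol lam e1 e2)"
    unfolding bsol_def gsol_def bounded_op_lin[OF K1'] bounded_op_lin[OF M_op'[OF lam]]
      Bop_eq(2)[OF lam M_mem[OF lam], of e1] Bop_eq(2)[OF lam e2] by simp
qed

lemma gsol_bound:
  assumes lam: "0 < Im lam"
  shows "\<exists>B. \<forall>e1 e2. norm (gsol lam e1 e2) \<le> B * (norm e1 + norm e2)"
proof -
  obtain m where m: "0 < m" "\<And>f. norm (M lam f) \<le> m * norm f" using bounded_op_bound[OF M_op[OF lam]] by (metis UNIV_I)
  obtain k where k: "0 < k" "\<And>f. norm (Top lam f) \<le> k * norm f" using bounded_op_bound[OF Top_op[OF lam]] by (metis UNIV_I)
  have "norm (gsol lam e1 e2) \<le> (k * m + 1 + k) * (norm e1 + norm e2)" for e1 e2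
  proof -
    have "norm (gsol lam e1 e2) \<le> norm (Top lam (M lam e1) - e1) + norm (Top lam e2)"
      unfolding gsol_def by (rule norm_triangle_ineq4)
    also have "\<dots> \<le> (k * (m * norm e1) + norm e1) + k * norm e2"
      using norm_triangle_ineq4[of "Top lam (M lam e1)" e1] k(2)[of "M lam e1"] k(2)[of e2] mult_left_mono[OF m(2)[of e1], of k] k(1)
      by linarith
    also have "\<dots> \<le> (k * m + 1 + k) * (norm e1 + norm e2)"
      using k(1) m(1) mult_nonneg_nonneg[of "k * m" "norm e2"] mult_nonneg_nonneg[of k "norm e1"] by (simp add: algebra_simps)
    finally show ?thesis .
  qed
  then show ?thesis by blast
qed

text \<open>\<open>ga\<close> and \<open>gb\<close> are the values of \<open>G0\<close> on the parts
  of the solution coming from \<open>u1\<close> and \<open>u2\<close>. The second is solved by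
  writing \<open>C0 e1\<close> as \<open>Zop e1 + C1 (M e1)\<close>.\<close>

lemma gsol_of_boundary_condition:
  assumes lam: "0 < Im lam" and e1: "e1 \<in> H1" and e2: "e2 \<in> H1"
    and z: "Zop lam ga = C1 lam e2" and w: "Zop lam gb = - C0 lam e1"
  shows "gb + ga = gsol lam e1 e2"
proof -
  note lR = bounded_op_lin[OF Zop_inv(1)[OF lam]]
  have "ga = - Top lam e2" using Zop_inv(2)[OF lam, of ga] z by (simp add: Top_def oproj_id[OF H1 e2])
  moreover have "- C0 lam e1 = - Zop lam e1 - C1 lam (P1 (M lam e1))" by (simp add: Zop_def oproj_id[OF H1 M_mem[OF lam]])
  then have "gb = - e1 + Top lam (M lam e1)"
    using Zop_inv(2)[OF lam, of gb] w by (simp add: Top_def lR Zop_inv(2)[OF lam])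
  ultimately show ?thesis by (simp add: gsol_def)
qed

text \<open>The projection \<open>P1\<close> in the form may be dropped, since \<open>K1\<close>
  takes values in \<open>H1\<close>.\<close>

lemma K_form_cinner:
  assumes lam: "0 < Im lam" "0 < Im \<mu>"
  shows "cinner (K_form H1 K0 K1 lam \<mu> k) k' = cinner (K1 \<mu> k) (K0 lam k') - cinner (K0 \<mu> k) (K1 lam k')
     - \<i> * cinner (P2 (K0 \<mu> k)) (P2 (K0 lam k'))"
proof -
  note P1' = bounded_op_subset[OF bounded_op_oproj[OF H1] order_refl subset_UNIV]
    and P2' = bounded_op_subset[OF bounded_op_oproj[OF H2] order_refl subset_UNIV]
  have b: "bounded_op UNIV UNIV (\<lambda>k. P1 (K0 lam k))" "bounded_op UNIV UNIV (\<lambda>k. P2 (K0 lam k))" "bounded_op UNIV UNIV (K1 lam)"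
    by (auto intro: bounded_op_compose[OF P1' K0_op[OF lam(1)]] bounded_op_compose[OF P2' K0_op[OF lam(1)]]
        bounded_op_subset[OF K1_op[OF lam(1)]])
  have K1m: "K1 lam k \<in> H1" "K1 \<mu> k \<in> H1" for k using bounded_opD(1)[OF K1_op] lam by auto
  have 1: "cinner (K1 \<mu> k) (P1 x) = cinner (K1 \<mu> k) x" for x
    using cinner_H1_H2(1)[OF K1m(2), of k x] P12[of x] by (metis add.right_neutral cinner_add_right)
  have 2: "cinner (P1 x) (K1 lam k') = cinner x (K1 lam k')" for x
    using cinner_H1_H2(2)[OF K1m(1), of x k'] P12[of x] by (metis add.right_neutral cinner_add_left)
  show ?thesis
    by (simp add: K_form_def cinner_diff_left cinner_scaleC_left hadj_UNIV_left[OF b(1)] hadj_UNIV_left[OF b(2)]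
        hadj_UNIV_left[OF b(3)] 1 2)
qed

text \<open>With the values from \<open>K_bsol\<close>, the form expands into the negative of the
  boundary form of \<open>y\<close> and \<open>z\<close> plus cross terms in \<open>e1\<close>,
  \<open>e2\<close>, \<open>f1\<close>, \<open>f2\<close>. Green's identity cancels the former, the
  cross terms are the left side, and \<open>P2\<close> ignores \<open>e1\<close>, \<open>f1\<close>
  because they lie in \<open>H1\<close>.\<close>

lemma key_identity:
  assumes lam: "0 < Im lam" and mu: "0 < Im \<mu>"
    and e: "e1 \<in> H1" "e2 \<in> H1" "f1 \<in> H1" "f2 \<in> H1"
    and y: "y \<in> Nsp \<mu>" "G0 y = gsol \<mu> e1 e2" and z: "z \<in> Nsp lam" "G0 z = gsol lam f1 f2"
  shows "cinner (- G1 y - (1/2) *\<^sub>R e2) f1 + cinner (G0 y + (1/2) *\<^sub>R e1) f2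
      - (cinner e1 (- G1 z - (1/2) *\<^sub>R f2) + cinner e2 (G0 z + (1/2) *\<^sub>R f1))
    = (\<mu> - cnj lam) * ip \<Delta> y z + cinner (K_form H1 K0 K1 lam \<mu> (bsol \<mu> e1 e2)) (bsol lam f1 f2)"
proof -
  have K: "K0 \<mu> (bsol \<mu> e1 e2) = - (G0 y + e1)" "K1 \<mu> (bsol \<mu> e1 e2) = e2 + G1 y"
    "K0 lam (bsol lam f1 f2) = - (G0 z + f1)" "K1 lam (bsol lam f1 f2) = f2 + G1 z"
    using K_bsol[OF mu e(2), of e1] K_bsol[OF lam e(4), of f1] by (simp_all add: y z M_eq[OF mu y(1)] M_eq[OF lam z(1)])
  have P2m: "P2 (- (x + h)) = - P2 x" if "h \<in> H1" for x h
    using oproj_add[OF H2, of x h] oproj_scaleC[OF H2, of "-1" "x + h"] P2_H1[OF that]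
    by (simp only: scaleC_minus_one) simp
  show ?thesis
    unfolding K_form_cinner[OF lam mu] K Nsp_Green[OF y(1) z(1), symmetric] P2m[OF e(1)] P2m[OF e(3)]
    by (simp add: cinner_simps algebra_simps)
qed

end

section \<open>Projections in the product of H^n with the boundary space at b\<close>

lemma closed_csubspace_UNIV_Times:
  assumes "closed_csubspace S"
  shows "closed_csubspace (UNIV \<times> S)"
  unfolding closed_csubspace_def
  using closed_csubspaceD(2-4)[OF assms] closed_Times[OF closed_UNIV closed_csubspaceD(1)[OF assms]]
  by (auto simp: scaleC_prod_def zero_prod_def)

lemma ocompl_UNIV_Times:
  assumes "closed_csubspace S"
  shows "ocompl (UNIV \<times> S) = {0} \<times> ocompl (S :: 'b::complex_inner set)"
proof -
  have "x = 0" if "\<And>a b. b \<in> S \<Longrightarrow> cinner x a + cinner y b = 0" for x :: 'a and y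
    using that[OF closed_csubspaceD(2)[OF assms], of x] by (simp add: cinner_self cinner_simps)
  then show ?thesis by (fastforce simp: ocompl_def cinner_prod_def cinner_simps)
qed

lemma oproj_UNIV_Times:
  assumes S: "closed_csubspace (S :: 'b::chilbert_space set)"
  shows "oproj (UNIV \<times> S) x = (fst (x :: 'a::chilbert_space \<times> 'b), oproj S (snd x))"
    "oproj (ocompl (UNIV \<times> S)) x = (0, oproj (ocompl S) (snd x))"
proof -
  show 1: "oproj (UNIV \<times> S) x = (fst x, oproj S (snd x))"
    using oproj_mem[OF S] oproj_diff_mem[OF S] closed_csubspaceD(2)[OF S]
    by (intro oproj_unique[OF closed_csubspace_UNIV_Times[OF S]]) (auto simp: ocompl_UNIV_Times[OF S] mem_Times_iff)
  show "oproj (ocompl (UNIV \<times> S)) x = (0, oproj (ocompl S) (snd x))"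
    unfolding oproj_ocompl[OF closed_csubspace_UNIV_Times[OF S]] oproj_ocompl[OF S] 1 by (simp add: prod_eq_iff)
qed

subsection \<open>Strong operator integrals\<close>

text \<open>Each \<open>U t x\<close> is Lipschitz in \<open>t\<close> with a constant depending on
  \<open>x\<close>. Uniform boundedness, with the distance \<open>|s - t|\<close> as weight, makes
  the constant proportional to \<open>norm x\<close>, that is, upgrades strong to norm regularity on
  compact intervals.\<close>

lemma (in quasi) op_family_Lipschitz:
  fixes U :: "real \<Rightarrow> 'x::chilbert_space \<Rightarrow> 'h"
  assumes U: "\<And>t. t \<in> \<Delta> \<Longrightarrow> bounded_op UNIV UNIV (U t)" and C1: "\<And>x. C1_on \<Delta> (\<lambda>t. U t x)" and \<eta>: "ereal \<eta> < b"
  shows "\<exists>B\<ge>0. \<forall>s\<in>{0..\<eta>}. \<forall>t\<in>{0..\<eta>}. \<forall>x. norm (U s x - U t x) \<le> B * \<bar>s - t\<bar> * norm x"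
proof -
  note sub = \<Delta>D(6)[OF \<eta>]
  have "\<exists>B\<ge>0. \<forall>i\<in>{0..\<eta>} \<times> {0..\<eta>}. \<forall>x. norm (U (fst i) x - U (snd i) x) \<le> B * \<bar>fst i - snd i\<bar> * norm x"
  proof (rule uniform_boundedness_weighted)
    fix i assume "i \<in> {0..\<eta>} \<times> {0..\<eta>}"
    then have "fst i \<in> \<Delta>" "snd i \<in> \<Delta>" using sub by auto
    then show "bounded_linear (\<lambda>x. U (fst i) x - U (snd i) x)"
      by (intro bounded_linear_sub bounded_op_lin(1)[OF U])
  next
    fix x
    have dx: "((\<lambda>t. U t x) has_vector_derivative Dt \<Delta> (\<lambda>t. U t x) t) (at t within {0..\<eta>})" if "t \<in> {0..\<eta>}" for t
      using C1[of x] sub that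
      by (intro has_vector_derivative_within_subset[OF Dt_has_derivative sub]) (auto simp: C1_on_def)
    have "continuous_on {0..\<eta>} (Dt \<Delta> (\<lambda>t. U t x))"
      using C1[of x] sub continuous_on_subset by (auto simp: C1_on_def)
    then have "bounded (Dt \<Delta> (\<lambda>t. U t x) ` {0..\<eta>})"
      by (intro compact_imp_bounded compact_continuous_image) auto
    then obtain B where "\<forall>t\<in>{0..\<eta>}. norm (Dt \<Delta> (\<lambda>t. U t x) t) \<le> B"
      unfolding bounded_iff by auto
    note B = this[rule_format]
    have on: "onorm (\<lambda>h. h *\<^sub>R Dt \<Delta> (\<lambda>t. U t x) t) \<le> B" if "t \<in> {0..\<eta>}" for t
      by (rule onorm_le) (use mult_left_mono[OF B[OF that] abs_ge_zero] in \<open>simp add: mult.commute\<close>)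
    have "norm (U s x - U t x) \<le> B * norm (s - t)" if "s \<in> {0..\<eta>}" "t \<in> {0..\<eta>}" for s t
      by (rule differentiable_bound[OF convex_real_interval(5) dx[unfolded has_vector_derivative_def] on])
        (use that in auto)
    then show "\<exists>B. \<forall>i\<in>{0..\<eta>} \<times> {0..\<eta>}. norm (U (fst i) x - U (snd i) x) \<le> B * \<bar>fst i - snd i\<bar>"
      by (intro exI[of _ B]) auto
  qed simp
  then show ?thesis by fastforce
qed

text \<open>Norm continuity of \<open>U\<close> passes to the adjoints, which strong continuity
  would not do.\<close>

lemma (in quasi) continuous_on_hadj_apply:
  fixes U :: "real \<Rightarrow> 'x::chilbert_space \<Rightarrow> 'h"
  assumes U: "\<And>t. t \<in> \<Delta> \<Longrightarrow> bounded_op UNIV UNIV (U t)" and C1: "\<And>x. C1_on \<Delta> (\<lambda>t. U t x)" and \<eta>: "ereal \<eta> < b"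
    and y: "continuous_on \<Delta> y"
  shows "continuous_on {0..\<eta>} (\<lambda>t. hadj UNIV (U t) (y t))"
  unfolding continuous_on_def
proof
  note sub = \<Delta>D(6)[OF \<eta>]
  fix t assume t: "t \<in> {0..\<eta>}"
  obtain B where B: "0 \<le> B" "\<And>s t x. s \<in> {0..\<eta>} \<Longrightarrow> t \<in> {0..\<eta>} \<Longrightarrow> norm (U s x - U t x) \<le> B * \<bar>s - t\<bar> * norm x"
    using op_family_Lipschitz[OF U C1 \<eta>] by blast
  have "op_tendsto UNIV U (U t) (at t within {0..\<eta>})"
    unfolding op_tendsto_def
  proof (intro allI impI)
    fix e :: real assume e: "0 < e"
    have "\<forall>\<^sub>F s in at t within {0..\<eta>}. s \<in> {0..\<eta>} \<and> dist s t < e / (B + 1)"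
      using e B(1) by (auto simp: eventually_at intro!: exI[of _ "e / (B + 1)"])
    then show "\<forall>\<^sub>F s in at t within {0..\<eta>}. \<forall>x\<in>UNIV. norm (U s x - U t x) \<le> e * norm x"
    proof eventually_elim
      case (elim s)
      have "B * \<bar>s - t\<bar> \<le> (B + 1) * (e / (B + 1))" using elim B(1) by (intro mult_mono) (auto simp: dist_real_def)
      then have "B * \<bar>s - t\<bar> \<le> e" using B(1) by simp
      then show ?case using B(2)[of s t] elim t by (meson mult_right_mono norm_ge_zero order_trans)
    qed
  qed
  then have 1: "op_tendsto UNIV (\<lambda>s. hadj UNIV (U s)) (hadj UNIV (U t)) (at t within {0..\<eta>})"
    using t sub by (intro op_tendsto_hadj U eventually_mono[OF eventually_at_in_set]) auto
  have 2: "(y \<longlongrightarrow> y t) (at t within {0..\<eta>})"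
    using continuous_on_subset[OF y sub] t by (simp add: continuous_on_def)
  have 3: "bounded_op UNIV UNIV (hadj UNIV (U t))"
    by (rule bounded_op_hadj[OF closed_csubspace_UNIV U]) (use t sub in blast)
  show "((\<lambda>s. hadj UNIV (U s) (y s)) \<longlongrightarrow> hadj UNIV (U t) (y t)) (at t within {0..\<eta>})"
    by (rule op_tendsto_apply[OF 1 3 2])
qed

text \<open>The squared norm of the tail is the full integral minus the one up to
  \<open>\<eta>\<close>, so \<open>tendsto_integral_upto\<close> applies.\<close>

lemma nrm_tail_tendsto:
  fixes y :: "real \<Rightarrow> 'h::{complex_inner, second_countable_topology}"
  assumes I: "interval_upto b \<Delta>" and y: "L2 \<Delta> y"
  shows "((\<lambda>\<eta>. nrm \<Delta> (\<lambda>t. of_bool (t \<notin> {0..\<eta>}) *\<^sub>C y t)) \<longlongrightarrow> 0) (left_of b)"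
proof -
  note S = interval_uptoD[OF I]
  have int: "integrable (lebesgue_on \<Delta>) (\<lambda>t. cinner (y t) (y t))" by (rule L2_integrable_cinner[OF y y])
  have "(nrm \<Delta> (\<lambda>t. of_bool (t \<notin> {0..\<eta>}) *\<^sub>C y t))\<^sup>2 = Re (ip \<Delta> y y - integral {0..\<eta>} (\<lambda>t. cinner (y t) (y t)))"
    if \<eta>: "ereal \<eta> < b" for \<eta>
  proof -
    have m: "{0..\<eta>} \<in> sets (lebesgue_on \<Delta>)" using S(5) S(6)[OF \<eta>] by (simp add: sets_restrict_space_iff)
    have "ip \<Delta> y y - integral {0..\<eta>} (\<lambda>t. cinner (y t) (y t))
       = (LINT t|lebesgue_on \<Delta>. cinner (y t) (y t) - indicator {0..\<eta>} t *\<^sub>R cinner (y t) (y t))"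
      unfolding integral_upto_eq[OF I int \<eta>] ip_def using integrable_mult_indicator[OF m int] int by simp
    also have "\<dots> = ip \<Delta> (\<lambda>t. of_bool (t \<notin> {0..\<eta>}) *\<^sub>C y t) (\<lambda>t. of_bool (t \<notin> {0..\<eta>}) *\<^sub>C y t)"
      unfolding ip_def by (rule Bochner_Integration.integral_cong) (auto simp: indicator_def scaleC_zero_left)
    finally show ?thesis by (simp add: ip_self del: of_real_power)
  qed
  then have "\<forall>\<^sub>F \<eta> in left_of b. sqrt (Re (ip \<Delta> y y - integral {0..\<eta>} (\<lambda>t. cinner (y t) (y t)))) = nrm \<Delta> (\<lambda>t. of_bool (t \<notin> {0..\<eta>}) *\<^sub>C y t)"
    by (intro eventually_mono[OF left_of_eventually(1)[OF S(7)]] real_sqrt_unique nrm_nonneg) simp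
  moreover have "((\<lambda>\<eta>. sqrt (Re (ip \<Delta> y y - integral {0..\<eta>} (\<lambda>t. cinner (y t) (y t))))) \<longlongrightarrow> sqrt (Re (ip \<Delta> y y - ip \<Delta> y y))) (left_of b)"
    using tendsto_integral_upto[OF I int] unfolding ip_def by (intro tendsto_real_sqrt tendsto_Re tendsto_diff tendsto_const)
  ultimately show ?thesis by (simp add: tendsto_cong)
qed

text \<open>
  The Riesz representative \<open>v\<close> of \<open>w \<mapsto> \<integral> (y, U w)\<close> is the strong integral: the error made at \<open>\<eta>\<close> is
  controlled by the \<open>L\<^sub>2\<close> norm of the tail of \<open>y\<close>.
\<close>

lemma (in quasi) strong_integral_exists:
  fixes U :: "real \<Rightarrow> 'x::chilbert_space \<Rightarrow> 'h"
  assumes U: "\<And>t. t \<in> \<Delta> \<Longrightarrow> bounded_op UNIV UNIV (U t)" and C1: "\<And>x. C1_on \<Delta> (\<lambda>t. U t x)"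
    and L2U: "\<And>x. L2 \<Delta> (\<lambda>t. U t x)" and C: "\<And>x. nrm \<Delta> (\<lambda>t. U t x) \<le> C * norm x" "0 \<le> C"
    and y: "L2 \<Delta> y" "continuous_on \<Delta> y"
  shows "\<exists>v. (\<forall>w. cinner v w = ip \<Delta> y (\<lambda>t. U t w)) \<and>
    ((\<lambda>\<eta>. integral {0..\<eta>} (\<lambda>t. hadj UNIV (U t) (y t))) \<longlongrightarrow> v) (left_of b)"
proof -
  have cong: "ip \<Delta> (\<lambda>t. f t) y = ip \<Delta> g y" if "\<And>t. t \<in> \<Delta> \<Longrightarrow> f t = g t" for f g
    unfolding ip_def by (rule Bochner_Integration.integral_cong) (use that in auto)
  have "\<exists>v. \<forall>w. ip \<Delta> (\<lambda>t. U t w) y = cinner w v"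
  proof (rule Riesz_representation)
    fix w w' c
    show "ip \<Delta> (\<lambda>t. U t (w + w')) y = ip \<Delta> (\<lambda>t. U t w) y + ip \<Delta> (\<lambda>t. U t w') y"
      unfolding ip_add_left[OF L2U L2U y(1), symmetric] by (rule cong) (simp add: bounded_op_lin[OF U])
    show "ip \<Delta> (\<lambda>t. U t (c *\<^sub>C w)) y = c * ip \<Delta> (\<lambda>t. U t w) y"
      unfolding ip_scaleC_left[symmetric] by (rule cong) (simp add: bounded_op_lin[OF U])
    have "cmod (ip \<Delta> (\<lambda>t. U t w) y) \<le> nrm \<Delta> (\<lambda>t. U t w) * nrm \<Delta> y" by (rule ip_Cauchy_Schwarz[OF L2U y(1)])
    also have "\<dots> \<le> (C * norm w) * nrm \<Delta> y" by (intro mult_right_mono C(1) nrm_nonneg)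
    finally show "cmod (ip \<Delta> (\<lambda>t. U t w) y) \<le> (C * nrm \<Delta> y) * norm w" by (simp add: ac_simps)
  qed
  then obtain v where v: "\<And>w. ip \<Delta> (\<lambda>t. U t w) y = cinner w v" by blast
  have ip_cnj: "cnj (ip \<Delta> f g) = ip \<Delta> g f" for f g :: "real \<Rightarrow> 'h" by (simp add: ip_def flip: Bochner_Integration.integral_cnj)
  have v': "cinner v w = ip \<Delta> y (\<lambda>t. U t w)" for w using v[of w] ip_cnj cnj_cinner by metis
  define I where "I = (\<lambda>\<eta>. integral {0..\<eta>} (\<lambda>t. hadj UNIV (U t) (y t)))"
  define tl where "tl = (\<lambda>\<eta> t. of_bool (t \<notin> {0..\<eta>}) *\<^sub>C y t)"
  have bound: "norm (v - I \<eta>) \<le> nrm \<Delta> (tl \<eta>) * C" if \<eta>: "ereal \<eta> < b" for \<eta>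
  proof -
    have m: "{0..\<eta>} \<in> sets (lebesgue_on \<Delta>)" using \<Delta>D(5) \<Delta>D(6)[OF \<eta>] by (simp add: sets_restrict_space_iff)
    have "(\<lambda>t. hadj UNIV (U t) (y t)) integrable_on {0..\<eta>}"
      by (intro integrable_continuous_interval continuous_on_hadj_apply[OF U C1 \<eta> y(2)])
    then have hi: "((\<lambda>t. hadj UNIV (U t) (y t)) has_integral I \<eta>) {0..\<eta>}"
      unfolding I_def by (rule integrable_integral)
    \<comment> \<open>The error is tested against itself, which turns the weak description of
      \<open>v\<close> into a norm estimate.\<close>
    define w where "w = v - I \<eta>"
    have int: "integrable (lebesgue_on \<Delta>) (\<lambda>t. cinner (y t) (U t w))" by (rule L2_integrable_cinner[OF y(1) L2U])
    have "((\<lambda>t. cinner (hadj UNIV (U t) (y t)) w) has_integral cinner (I \<eta>) w) {0..\<eta>}"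
      using has_integral_linear[OF hi bounded_bilinear.bounded_linear_left[OF bounded_bilinear_cinner, of w]] by (simp add: o_def)
    then have "((\<lambda>t. cinner (y t) (U t w)) has_integral cinner (I \<eta>) w) {0..\<eta>}"
      by (rule has_integral_eq[rotated]) (use \<Delta>D(6)[OF \<eta>] in \<open>auto simp: hadj_UNIV_left[OF U]\<close>)
    then have "cinner w w = ip \<Delta> y (\<lambda>t. U t w) - (LINT t|lebesgue_on \<Delta>. indicator {0..\<eta>} t *\<^sub>R cinner (y t) (U t w))"
      using integral_upto_eq[OF I int \<eta>] v'[of w] by (simp add: w_def cinner_diff_left integral_unique)
    also have "\<dots> = (LINT t|lebesgue_on \<Delta>. cinner (y t) (U t w) - indicator {0..\<eta>} t *\<^sub>R cinner (y t) (U t w))"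
      unfolding ip_def using integrable_mult_indicator[OF m int] int by simp
    also have "\<dots> = ip \<Delta> (tl \<eta>) (\<lambda>t. U t w)"
      unfolding ip_def tl_def by (rule Bochner_Integration.integral_cong) (auto simp: indicator_def scaleC_zero_left cinner_simps)
    finally have eq: "cinner w w = ip \<Delta> (tl \<eta>) (\<lambda>t. U t w)" .
    have "tl \<eta> = (\<lambda>t. y t + (-1) *\<^sub>C (indicator {0..\<eta>} t *\<^sub>R y t))"
      by (auto simp: tl_def fun_eq_iff indicator_def scaleC_minus_one scaleC_zero_left)
    moreover have "L2 \<Delta> (\<lambda>t. indicator {0..\<eta>} t *\<^sub>R y t)"
      unfolding L2_def
    proof
      show "(\<lambda>t. indicator {0..\<eta>} t *\<^sub>R y t) \<in> borel_measurable (lebesgue_on \<Delta>)"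
        using y(1) m by (intro borel_measurable_scaleR borel_measurable_indicator) (auto simp: L2_def)
      have "integrable (lebesgue_on \<Delta>) (\<lambda>t. indicator {0..\<eta>} t *\<^sub>R (norm (y t))\<^sup>2)"
        using y(1) by (intro integrable_mult_indicator[OF m]) (simp add: L2_def)
      then show "integrable (lebesgue_on \<Delta>) (\<lambda>t. (norm (indicator {0..\<eta>} t *\<^sub>R y t))\<^sup>2)"
        by (rule Bochner_Integration.integrable_cong[THEN iffD1, OF refl, rotated]) (auto simp: indicator_def)
    qed
    ultimately have L2tl: "L2 \<Delta> (tl \<eta>)" using L2_add[OF y(1) L2_scaleC] by simp
    have "(norm w)\<^sup>2 = cmod (cinner w w)" by (simp add: norm_cinner_self)
    also have "\<dots> \<le> nrm \<Delta> (tl \<eta>) * nrm \<Delta> (\<lambda>t. U t w)" unfolding eq by (rule ip_Cauchy_Schwarz[OF L2tl L2U])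
    also have "\<dots> \<le> nrm \<Delta> (tl \<eta>) * (C * norm w)" by (intro mult_left_mono C(1) nrm_nonneg)
    finally have "norm w * norm w \<le> (nrm \<Delta> (tl \<eta>) * C) * norm w" by (simp add: power2_eq_square ac_simps)
    then show ?thesis
      unfolding w_def[symmetric] using mult_nonneg_nonneg[OF nrm_nonneg[of \<Delta> "tl \<eta>"] C(2)]
      by (cases "norm w = 0") (auto simp: mult_le_cancel_right)
  qed
  have "((\<lambda>\<eta>. v - I \<eta>) \<longlongrightarrow> 0) (left_of b)"
  proof (rule Lim_null_comparison)
    show "\<forall>\<^sub>F \<eta> in left_of b. norm (v - I \<eta>) \<le> nrm \<Delta> (tl \<eta>) * C"
      by (rule eventually_mono[OF left_of_eventually(1)[OF \<Delta>D(7)]]) (simp add: bound)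
    show "((\<lambda>\<eta>. nrm \<Delta> (tl \<eta>) * C) \<longlongrightarrow> 0) (left_of b)"
      using tendsto_mult_right[OF nrm_tail_tendsto[OF quasi.I[OF quasi_axioms] y(1)], of C] by (simp add: tl_def)
  qed
  then have "((\<lambda>\<eta>. v - (v - I \<eta>)) \<longlongrightarrow> v - 0) (left_of b)" by (intro tendsto_diff tendsto_const)
  then show ?thesis using v' by (intro exI[of _ v]) (simp add: I_def)
qed

subsection \<open>The characteristic matrix\<close>

lemma bounded_op_fst: "bounded_op UNIV UNIV (fst :: 'a::complex_inner \<times> 'b::complex_inner \<Rightarrow> 'a)"
  and bounded_op_snd: "bounded_op UNIV UNIV (snd :: 'a \<times> 'b \<Rightarrow> 'b)"
  and bounded_op_inl: "bounded_op UNIV UNIV (\<lambda>x :: 'a. (x, 0 :: 'b))"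
  and bounded_op_inr: "bounded_op UNIV UNIV (\<lambda>y :: 'b. (0 :: 'a, y))"
  by (rule bounded_opI[where B = 1], auto simp: scaleC_prod_def scaleC_zero_right norm_fst_le norm_snd_le norm_Pair)+

section \<open>The triplet and the Weyl function of the differential operator\<close>

locale D_weyl = quasi n b \<Delta> p q
  for n :: nat and b :: ereal and \<Delta> :: "real set"
    and p q :: "nat \<Rightarrow> real \<Rightarrow> 'h::{chilbert_space, second_countable_topology} \<Rightarrow> 'h" +
  fixes H1' :: "'g::chilbert_space set" and \<Gamma>0' \<Gamma>1' :: "(real \<Rightarrow> 'h) \<Rightarrow> 'g"
    and M :: "complex \<Rightarrow> ('h, 'n::{finite,linorder}) vec \<times> 'g \<Rightarrow> ('h, 'n) vec \<times> 'g"
  assumes n_card: "CARD('n) = n"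
    and triplet: "decomposing_D_triplet TYPE('n) b \<Delta> p q H1' \<Gamma>0' \<Gamma>1'"
    and weyl: "weyl_function \<Delta> p q H1' \<Gamma>0' \<Gamma>1' M"
begin

abbreviation H1 :: "(('h, 'n) vec \<times> 'g) set" where "H1 \<equiv> bspace1 H1'"
abbreviation G0 :: "(real \<Rightarrow> 'h) \<Rightarrow> ('h, 'n) vec \<times> 'g" where "G0 \<equiv> Gam0 \<Delta> p q \<Gamma>0'"
abbreviation G1 :: "(real \<Rightarrow> 'h) \<Rightarrow> ('h, 'n) vec \<times> 'g" where "G1 \<equiv> Gam1 \<Delta> p q \<Gamma>1'"
abbreviation P2' :: "'g \<Rightarrow> 'g" where "P2' \<equiv> oproj (ocompl H1')"

lemma H1': "closed_csubspace H1'"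
  and \<Gamma>1'_mem: "y \<in> D \<Longrightarrow> \<Gamma>1' y \<in> H1'"
  and \<Gamma>_surj: "h1 \<in> H1' \<Longrightarrow> \<exists>y\<in>D. \<Gamma>0' y = h0 \<and> \<Gamma>1' y = h1"
  using triplet n_card by (auto simp: decomposing_D_triplet_def Let_def)

lemma \<Gamma>_lim: "y \<in> D \<Longrightarrow> z \<in> D \<Longrightarrow> (LL y z \<longlongrightarrow>
          cinner (\<Gamma>1' y) (\<Gamma>0' z) - cinner (\<Gamma>0' y) (\<Gamma>1' z) + \<i> * cinner (P2' (\<Gamma>0' y)) (P2' (\<Gamma>0' z))) (left_of b)"
  using triplet by (simp add: decomposing_D_triplet_def Let_def lagrange_eq[OF n_card[symmetric], abs_def] n_card)

lemma \<Gamma>_lin: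
  assumes y: "y \<in> D" and z: "z \<in> D" and G: "\<Gamma> \<in> {\<Gamma>0', \<Gamma>1'}"
  shows "\<Gamma> (\<lambda>t. \<alpha> *\<^sub>C y t + \<beta> *\<^sub>C z t) = \<alpha> *\<^sub>C \<Gamma> y + \<beta> *\<^sub>C \<Gamma> z"
proof -
  have add: "\<Gamma> (\<lambda>t. y t + z t) = \<Gamma> y + \<Gamma> z" if "y \<in> D" "z \<in> D" for y z
    using triplet G that n_card by (auto simp: decomposing_D_triplet_def Let_def)
  have scale: "\<Gamma> (\<lambda>t. c *\<^sub>C y t) = c *\<^sub>C \<Gamma> y" if "y \<in> D" for y c
    using triplet G that n_card by (auto simp: decomposing_D_triplet_def Let_def)
  have D: "(\<lambda>t. c *\<^sub>C y t) \<in> D" if "y \<in> D" for y c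
    using maxdom_lin(1)[OF that that, of c 0] by (simp add: scaleC_zero_left)
  show ?thesis by (simp add: add[OF D[OF y] D[OF z]] scale y z)
qed

lemma H1: "closed_csubspace H1"
  unfolding bspace1_def by (rule closed_csubspace_UNIV_Times[OF H1'])

lemma oproj_H1: "oproj H1 x = (fst x, oproj H1' (snd x))" "oproj (ocompl H1) x = (0, P2' (snd x))"
  unfolding bspace1_def by (rule oproj_UNIV_Times[OF H1'])+

lemma idx_less: "idx (i :: 'n) < n"
  using bij_betwE[OF bij_betw_idx[where 'n = 'n]] n_card by blast

lemma qvec_0: "qvec1 \<Delta> p q y 0 $ i = qd0 y (idx (i :: 'n))" "qvec2 \<Delta> p q y 0 $ i = qd0 y (2 * n - 1 - idx (i :: 'n))"
  using idx_less[of i] by (simp_all add: qvec1_def qvec2_def qd0_def quasi_deriv_eq n_card)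

lemma qvec_lin:
  assumes "y \<in> D" "z \<in> D"
  shows "qvec1 \<Delta> p q (\<lambda>t. \<alpha> *\<^sub>C y t + \<beta> *\<^sub>C z t) 0 = (\<alpha> *\<^sub>C qvec1 \<Delta> p q y 0 + \<beta> *\<^sub>C qvec1 \<Delta> p q z 0 :: ('h, 'n) vec)"
    "qvec2 \<Delta> p q (\<lambda>t. \<alpha> *\<^sub>C y t + \<beta> *\<^sub>C z t) 0 = (\<alpha> *\<^sub>C qvec2 \<Delta> p q y 0 + \<beta> *\<^sub>C qvec2 \<Delta> p q z 0 :: ('h, 'n) vec)"
proof -
  have "idx i < 2 * n" "2 * n - 1 - idx i < 2 * n" for i :: 'n
    using idx_less[of i] by auto
  then show "qvec1 \<Delta> p q (\<lambda>t. \<alpha> *\<^sub>C y t + \<beta> *\<^sub>C z t) 0 = (\<alpha> *\<^sub>C qvec1 \<Delta> p q y 0 + \<beta> *\<^sub>C qvec1 \<Delta> p q z 0 :: ('h, 'n) vec)"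
    "qvec2 \<Delta> p q (\<lambda>t. \<alpha> *\<^sub>C y t + \<beta> *\<^sub>C z t) 0 = (\<alpha> *\<^sub>C qvec2 \<Delta> p q y 0 + \<beta> *\<^sub>C qvec2 \<Delta> p q z 0 :: ('h, 'n) vec)"
    by (simp_all add: vec_eq_iff qvec_0 scaleC_vec_def qd0_lin[OF assms])
qed

lemma LL_0: "LL y z 0 = cinner (qvec1 \<Delta> p q y 0 :: ('h, 'n) vec) (qvec2 \<Delta> p q z 0) - cinner (qvec2 \<Delta> p q y 0 :: ('h, 'n) vec) (qvec1 \<Delta> p q z 0)"
  unfolding lagrange_eq[OF n_card[symmetric], symmetric] lagrange_def ..

text \<open>Near \<open>b\<close> the bracket with \<open>z\<close> vanishes, hence so does its
  limit for every \<open>y\<close>. As the boundary values of \<open>y\<close> are arbitrary, they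
  may be chosen as components of those of \<open>z\<close>.\<close>

lemma test_fun_\<Gamma>:
  assumes z: "test_fun z"
  shows "\<Gamma>0' z = 0" "\<Gamma>1' z = 0"
proof -
  obtain c where zD: "z \<in> D" and c: "ereal c < b" "vanishes_beyond c z" using z by (auto simp: test_fun_def)
  have lim: "cinner (\<Gamma>1' y) (\<Gamma>0' z) - cinner (\<Gamma>0' y) (\<Gamma>1' z) + \<i> * cinner (P2' (\<Gamma>0' y)) (P2' (\<Gamma>0' z)) = 0" if y: "y \<in> D" for y
  proof (rule tendsto_unique[OF left_of_nontrivial \<Gamma>_lim[OF y zD]])
    have "\<forall>\<^sub>F \<eta> in left_of b. LL y z \<eta> = 0"
      using left_of_eventually(1)[OF \<Delta>D(7)] left_of_eventually(2)[OF \<Delta>D(7) c(1)]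
      by eventually_elim (rule LL_vanishes[OF c(2) \<Delta>D(4)], auto)
    then show "(LL y z \<longlongrightarrow> 0) (left_of b)" by (rule tendsto_eventually)
  qed
  have P2: "P2' 0 = 0" using oproj_id[OF closed_csubspace_ocompl closed_csubspaceD(2)[OF closed_csubspace_ocompl]] .
  have pairing: "cinner k (\<Gamma>0' z) - cinner h (\<Gamma>1' z) + \<i> * cinner (P2' h) (P2' (\<Gamma>0' z)) = 0" if "k \<in> H1'" for h k
    using \<Gamma>_surj[OF that, of h] lim by blast
  have 1: "oproj H1' (\<Gamma>0' z) = 0"
    using pairing[OF oproj_mem[OF H1'], of "\<Gamma>0' z" 0] cinner_oproj_left[OF H1', of "\<Gamma>0' z" "\<Gamma>0' z"]
    by (simp add: P2 cinner_simps cinner_self)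
  have P2_1: "P2' x = 0" if "x \<in> H1'" for x using oproj_id[OF H1' that] by (simp add: oproj_ocompl[OF H1'])
  show 2: "\<Gamma>1' z = 0"
    using pairing[OF closed_csubspaceD(2)[OF H1'], of "\<Gamma>1' z"] P2_1[OF \<Gamma>1'_mem[OF zD]] by (simp add: cinner_simps cinner_self)
  have "P2' (\<Gamma>0' z) = 0"
    using pairing[OF closed_csubspaceD(2)[OF H1'], of "\<Gamma>0' z"] 2 by (simp add: cinner_simps cinner_self)
  then show "\<Gamma>0' z = 0" using 1 by (simp add: oproj_ocompl[OF H1'])
qed

lemma boundary_maps_surj:
  assumes "e1 \<in> H1"
  shows "\<exists>y\<in>D. G0 y = e0 \<and> G1 y = e1"
proof -
  obtain a g a' g' where e: "e0 = (a, g)" "e1 = (a', g')" by (metis surj_pair)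
  then have "g' \<in> H1'" using assms by (simp add: bspace1_def)
  then obtain y where y: "y \<in> D" "\<Gamma>0' y = g" "\<Gamma>1' y = g'" using \<Gamma>_surj by blast
  define i where "i = inv_into UNIV (idx :: 'n \<Rightarrow> nat)"
  have i: "i (idx j) = j" for j using bij_betw_idx[where 'n = 'n] by (simp add: i_def bij_betw_def)
  \<comment> \<open>The corrections to the initial values of \<open>y\<close>. The vector
    \<open>qvec2\<close> lists its quasi-derivatives in descending order, hence the index
    \<open>2 * n - 1 - k\<close>, and the sign is the one in \<open>Gam1\<close>.\<close>
  define v where "v = (\<lambda>k. (if k < n then - a' $ i k else a $ i (2 * n - 1 - k)) - qd0 y k)"
  obtain z where z: "test_fun z" "\<And>k. k < 2 * n \<Longrightarrow> qd0 z k = v k" using ex_test_fun_initial_values[of v] by blast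
  have zD: "z \<in> D" using z by (simp add: test_fun_def)
  define x where "x = (\<lambda>t. 1 *\<^sub>C y t + 1 *\<^sub>C z t)"
  have qd: "qd0 x k = (if k < n then - a' $ i k else a $ i (2 * n - 1 - k))" if "k < 2 * n" for k
    unfolding x_def using z(2)[OF that] that by (subst qd0_lin[OF y(1) zD]) (simp_all add: v_def)
  have xD: "x \<in> D" unfolding x_def by (rule maxdom_lin(1)[OF y(1) zD])
  have "\<Gamma>0' x = g" "\<Gamma>1' x = g'"
    using \<Gamma>_lin[OF y(1) zD, of \<Gamma>0' 1 1] \<Gamma>_lin[OF y(1) zD, of \<Gamma>1' 1 1] test_fun_\<Gamma>[OF z(1)] y by (simp_all add: x_def scaleC_zero_right)
  moreover have "qvec1 \<Delta> p q x 0 = - a'"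
    by (simp add: vec_eq_iff qvec_0 qd trans_less_add1 mult_2 idx_less i)
  moreover have "qvec2 \<Delta> p q x 0 = a"
  proof -
    have "2 * n - 1 - idx j < 2 * n" "\<not> 2 * n - 1 - idx j < n"
      "2 * n - 1 - (2 * n - 1 - idx j) = idx j" for j :: 'n
      using idx_less[of j] by auto
    then show ?thesis by (simp add: vec_eq_iff qvec_0 qd i)
  qed
  ultimately show ?thesis using xD by (intro bexI[of _ x]) (auto simp: Gam0_def Gam1_def e)
qed

sublocale B: btriplet \<Delta> D L H1 G0 G1
proof unfold_locales
  show "closed_csubspace H1" by (rule H1)
  show "(\<lambda>t. \<alpha> *\<^sub>C y t + \<beta> *\<^sub>C z t) \<in> D"
    "AE t in lebesgue_on \<Delta>. L (\<lambda>t. \<alpha> *\<^sub>C y t + \<beta> *\<^sub>C z t) t = \<alpha> *\<^sub>C L y t + \<beta> *\<^sub>C L z t"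
    "G0 (\<lambda>t. \<alpha> *\<^sub>C y t + \<beta> *\<^sub>C z t) = \<alpha> *\<^sub>C G0 y + \<beta> *\<^sub>C G0 z"
    "G1 (\<lambda>t. \<alpha> *\<^sub>C y t + \<beta> *\<^sub>C z t) = \<alpha> *\<^sub>C G1 y + \<beta> *\<^sub>C G1 z" if "y \<in> D" "z \<in> D" for \<alpha> \<beta> y z
    using maxdom_lin[OF that]
    by (simp_all add: Gam0_def Gam1_def \<Gamma>_lin[OF that] qvec_lin[OF that] scaleC_prod_def scaleC_minus_right)
  show "L2 \<Delta> y" "L2 \<Delta> (L y)" "G1 y \<in> H1" if "y \<in> D" for y
    using maxdom_L2[OF that] \<Gamma>1'_mem[OF that] by (simp_all add: Gam1_def bspace1_def)
  show "\<exists>y\<in>D. G0 y = e0 \<and> G1 y = e1" if "e1 \<in> H1" for e0 e1 by (rule boundary_maps_surj[OF that])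
  show "cinner (G1 y) (G0 z) - cinner (G0 y) (G1 z) + \<i> * cinner (oproj (ocompl H1) (G0 y)) (oproj (ocompl H1) (G0 z))
    = ip \<Delta> (L y) z - ip \<Delta> y (L z)" if yz: "y \<in> D" "z \<in> D" for y z
    \<comment> \<open>\<open>\<Gamma>_lim\<close> and \<open>Green_limit\<close> both give the limit
      of \<open>LL y z\<close> at \<open>b\<close>; the value at 0 supplies the boundary terms on
      H^n.\<close>
    using tendsto_unique[OF left_of_nontrivial \<Gamma>_lim[OF yz] Green_limit[OF yz]] LL_0[of y z]
    by (simp add: oproj_H1 Gam0_def Gam1_def cinner_prod_def cinner_simps algebra_simps)
qed

lemma Nsp_eq: "B.Nsp lam = defect_space n \<Delta> p q lam"
  by (simp add: B.Nsp_def defect_space_def)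

sublocale W: weyl \<Delta> D L H1 G0 G1 M
proof unfold_locales
  fix lam :: complex assume lam: "0 < Im lam"
  note w = weyl[unfolded weyl_function_def Let_def n_card Nsp_eq[symmetric], rule_format, OF lam]
  show "bounded_op UNIV H1 (M lam)" using w by blast
  show "G1 y = M lam (G0 y)" if "y \<in> B.Nsp lam" for y using w that by blast
  show "T = M lam" if "bounded_op UNIV H1 T" "\<And>y. y \<in> B.Nsp lam \<Longrightarrow> G1 y = T (G0 y)" for T
    using w that by blast
next
  fix e :: "('h, 'n) vec \<times> 'g" assume triv: "\<And>x :: ('h, 'n) vec \<times> 'g. x \<in> H1 \<Longrightarrow> x = 0"
  have vec: "a = 0" for a :: "('h, 'n) vec"
    using triv[of "(a, 0)"] closed_csubspaceD(2)[OF H1'] by (simp add: bspace1_def zero_prod_def)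
  \<comment> \<open>\<open>H1\<close> contains H^n, so a zero \<open>H1\<close> forces H to be zero.
    All functions then coincide, and surjectivity of \<open>\<Gamma>0'\<close> makes the second
    component vanish too.\<close>
  have h: "x = 0" for x :: 'h using vec[of "\<chi> i. x"] by (simp add: vec_eq_iff)
  obtain y where y: "y \<in> D" "\<Gamma>0' y = snd e" using \<Gamma>_surj[OF closed_csubspaceD(2)[OF H1']] by blast
  have "y = (\<lambda>t. 0 *\<^sub>C y t + 0 *\<^sub>C y t)" using h by (intro ext) metis
  then have "\<Gamma>0' y = 0 *\<^sub>C \<Gamma>0' y + 0 *\<^sub>C \<Gamma>0' y" using \<Gamma>_lin[OF y(1) y(1), of \<Gamma>0' 0 0] by simp
  then show "e = 0" using y(2) vec[of "fst e"] by (simp add: prod_eq_iff scaleC_zero_left)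
qed

end

section \<open>The given solutions, their integrals and the characteristic matrix\<close>

locale D_weyl_pair = D_weyl n b \<Delta> p q H1' \<Gamma>0' \<Gamma>1' M
  for n :: nat and b :: ereal and \<Delta> :: "real set"
    and p q :: "nat \<Rightarrow> real \<Rightarrow> 'h::{chilbert_space, second_countable_topology} \<Rightarrow> 'h"
    and H1' :: "'g::chilbert_space set" and \<Gamma>0' \<Gamma>1' :: "(real \<Rightarrow> 'h) \<Rightarrow> 'g"
    and M :: "complex \<Rightarrow> ('h, 'n::{finite,linorder}) vec \<times> 'g \<Rightarrow> ('h, 'n) vec \<times> 'g" +
  fixes C0 C1 :: "complex \<Rightarrow> ('h, 'n) vec \<times> 'g \<Rightarrow> 'k::chilbert_space"
    and K0 K1 :: "complex \<Rightarrow> 'l::chilbert_space \<Rightarrow> ('h, 'n) vec \<times> 'g"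
    and u1 u2 :: "complex \<Rightarrow> real \<Rightarrow> ('h, 'n) vec \<Rightarrow> 'h"
  assumes pair: "weyl_pair \<Delta> D L H1 G0 G1 M C0 C1 K0 K1"
    and u1: "\<And>lam. Im lam > 0 \<Longrightarrow> op_solution \<Delta> p q lam (u1 lam) \<and>
               u_boundary_condition \<Delta> p q \<Gamma>0' \<Gamma>1' (C0 lam) (C1 lam) (\<lambda>h. C1 lam (h, 0)) (u1 lam)"
    and u2: "\<And>lam. Im lam > 0 \<Longrightarrow> op_solution \<Delta> p q lam (u2 lam) \<and>
               u_boundary_condition \<Delta> p q \<Gamma>0' \<Gamma>1' (C0 lam) (C1 lam) (\<lambda>h. - C0 lam (h, 0)) (u2 lam)"
begin

sublocale P: weyl_pair \<Delta> D L H1 G0 G1 M C0 C1 K0 K1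
  by (rule pair)

abbreviation sol :: "complex \<Rightarrow> ('h, 'n) vec \<times> ('h, 'n) vec \<Rightarrow> real \<Rightarrow> 'h" where
  "sol lam x \<equiv> (\<lambda>t. U_sol u1 u2 lam t x)"

lemma H1_mem: "(a, 0) \<in> H1"
  using closed_csubspaceD(2)[OF H1'] by (simp add: bspace1_def)

text \<open>The sign of the first component of \<open>G1\<close> turns the left side into
  \<open>C0 (G0 y) - C1 (G1 y)\<close>, and \<open>G1 y = M (G0 y)\<close>.\<close>

lemma boundary_condition_iff:
  assumes lam: "0 < Im lam" and y: "y \<in> B.Nsp lam"
  shows "C1 lam (qvec1 \<Delta> p q y 0, 0) + C0 lam (qvec2 \<Delta> p q y 0, 0) + (C0 lam (0, \<Gamma>0' y) - C1 lam (0, \<Gamma>1' y)) = P.Zop lam (G0 y)"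
proof -
  have yD: "y \<in> D" by (rule B.Nsp_D[OF y])
  have g: "(0, \<Gamma>1' y) \<in> H1" using \<Gamma>1'_mem[OF yD] by (simp add: bspace1_def)
  have 0: "C0 lam (G0 y) = C0 lam (qvec2 \<Delta> p q y 0, 0) + C0 lam (0, \<Gamma>0' y)"
    unfolding bounded_op_lin(2)[OF P.C0_op[OF lam], symmetric] by (simp add: Gam0_def)
  have "C1 lam (qvec1 \<Delta> p q y 0, 0) = - C1 lam (- (qvec1 \<Delta> p q y 0, 0))"
    using P.C1_lin(3)[OF lam H1_mem H1_mem] by simp
  then have "C1 lam (G1 y) = C1 lam (0, \<Gamma>1' y) - C1 lam (qvec1 \<Delta> p q y 0, 0)"
    using P.C1_lin(1)[OF lam g H1_mem, of "qvec1 \<Delta> p q y 0"] by (simp add: Gam1_def)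
  then show ?thesis using W.M_eq[OF lam y] 0 by (simp add: P.Zop_def)
qed

lemma sol:
  assumes lam: "0 < Im lam"
  shows "sol lam x \<in> B.Nsp lam" "G0 (sol lam x) = P.gsol lam (fst x, 0) (snd x, 0)"
proof -
  have N1: "(\<lambda>t. u1 lam t h) \<in> B.Nsp lam" and N2: "(\<lambda>t. u2 lam t h) \<in> B.Nsp lam" for h
    using u1[OF lam] u2[OF lam] by (simp_all add: op_solution_def n_card Nsp_eq)
  have Z1: "P.Zop lam (G0 (\<lambda>t. u1 lam t h)) = C1 lam (h, 0)" for h
    using u1[OF lam] unfolding u_boundary_condition_def Let_def boundary_condition_iff[OF lam N1] by blast
  have Z2: "P.Zop lam (G0 (\<lambda>t. u2 lam t h)) = - C0 lam (h, 0)" for h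
    using u2[OF lam] unfolding u_boundary_condition_def Let_def boundary_condition_iff[OF lam N2] by blast
  have eq: "sol lam x = (\<lambda>t. 1 *\<^sub>C u2 lam t (fst x) + 1 *\<^sub>C u1 lam t (snd x))" by (simp add: U_sol_def split_beta)
  show "sol lam x \<in> B.Nsp lam" unfolding eq by (rule B.Nsp_lin[OF N2 N1])
  show "G0 (sol lam x) = P.gsol lam (fst x, 0) (snd x, 0)"
    using P.gsol_of_boundary_condition[OF lam H1_mem H1_mem Z1 Z2]
    unfolding eq B.G0_lin[OF B.Nsp_D[OF N2] B.Nsp_D[OF N1]] by simp
qed

abbreviation "\<Omega> \<equiv> char_matrix H1' M C0 C1"

text \<open>Write \<open>g\<close> for \<open>gsol\<close>, so that
  \<open>T M e1 - T e2 = g + e1\<close>. The first row of \<open>Omega_ext\<close> becomes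
  \<open>- M g - e2 / 2\<close> and the second \<open>g + e1 / 2\<close>.\<close>

lemma char_matrix_eq:
  assumes lam: "0 < Im lam"
  shows "\<Omega> lam x = (- fst (G1 (sol lam x)) - (1/2) *\<^sub>C snd x, fst (G0 (sol lam x)) + (1/2) *\<^sub>C fst x)"
proof -
  have Meq: "G1 (sol lam x) = M lam (G0 (sol lam x))" by (rule W.M_eq[OF lam sol(1)[OF lam]])
  note lin = bounded_op_lin[OF W.M_op'[OF lam]]
  have half: "(1/2) *\<^sub>C v = (1/2) *\<^sub>R v" for v :: "('h, 'n) vec" using scaleC_of_real[of "1/2" v] by simp
  have half2: "(1/2) *\<^sub>R v + ((1/2) *\<^sub>R v + w) = v + w" for v w :: "('h, 'n) vec"
    using scaleR_half_double[of v] unfolding add.assoc[symmetric] scaleR_add_right[symmetric] by simp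
  show ?thesis
    unfolding char_matrix_def Let_def if_P[OF lam] Omega_ext_def split_beta Meq sol(2)[OF lam]
      P.rel_op_eq_Top[OF lam P.M_mem[OF lam]] P.rel_op_eq_Top[OF lam H1_mem] P.gsol_def lin half
    by (simp add: P.rel_op_eq_Top[OF lam H1_mem] half2 algebra_simps)
qed

lemma sol_D: "0 < Im lam \<Longrightarrow> sol lam x \<in> D"
  using B.Nsp_D[OF sol(1)] .

lemma sol_C1: "0 < Im lam \<Longrightarrow> C1_on \<Delta> (sol lam x)"
  using sol_D[of lam x] n by (auto simp: maxdom_iff smooth_dom_def)

lemma U_op:
  assumes lam: "0 < Im lam" and t: "t \<in> \<Delta>"
  shows "bounded_op UNIV UNIV (U_sol u1 u2 lam t)"
proof -
  have "bounded_op UNIV UNIV (u1 lam t)" "bounded_op UNIV UNIV (u2 lam t)"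
    using u1[OF lam] u2[OF lam] t by (auto simp: op_solution_def)
  then have "bounded_op UNIV UNIV (\<lambda>x. u2 lam t (fst x) + u1 lam t (snd x))"
    by (intro bounded_op_add bounded_op_compose[OF _ bounded_op_fst] bounded_op_compose[OF _ bounded_op_snd])
  then show ?thesis by (simp add: U_sol_def split_beta')
qed

lemma sol_nrm:
  assumes lam: "0 < Im lam"
  shows "\<exists>Y\<ge>0. \<forall>x. nrm \<Delta> (sol lam x) \<le> Y * norm x"
proof -
  obtain Y where Y: "0 \<le> Y" "\<And>y. y \<in> B.Nsp lam \<Longrightarrow> nrm \<Delta> y \<le> Y * norm (G0 y)"
    by (rule W.nrm_Nsp_le[OF lam], rule that, assumption, blast)
  obtain A where A: "\<And>e1 e2. norm (P.gsol lam e1 e2) \<le> A * (norm e1 + norm e2)" using P.gsol_bound[OF lam] by blast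
  have "nrm \<Delta> (sol lam x) \<le> (Y * (2 * \<bar>A\<bar>)) * norm x" for x
  proof -
    have "norm (P.gsol lam (fst x, 0) (snd x, 0)) \<le> A * (norm (fst x) + norm (snd x))"
      using A[of "(fst x, 0)" "(snd x, 0)"] by (simp add: norm_Pair)
    also have "\<dots> \<le> \<bar>A\<bar> * (norm x + norm x)"
      using norm_fst_le[of "fst x" "snd x"] norm_snd_le[of "snd x" "fst x"] by (intro mult_mono add_mono) auto
    finally have "norm (G0 (sol lam x)) \<le> 2 * \<bar>A\<bar> * norm x" by (simp add: sol(2)[OF lam])
    then have "Y * norm (G0 (sol lam x)) \<le> Y * (2 * \<bar>A\<bar> * norm x)" by (rule mult_left_mono[OF _ Y(1)])
    then show ?thesis using Y(2)[OF sol(1)[OF lam], of x] by (simp add: mult.assoc)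
  qed
  then show ?thesis using Y(1) by (intro exI[of _ "Y * (2 * \<bar>A\<bar>)"]) simp
qed

abbreviation "UU \<equiv> \<lambda>lam \<mu> t x. hadj UNIV (U_sol u1 u2 lam t) (U_sol u1 u2 \<mu> t x)"

lemma strong_integral_UU:
  assumes lam: "0 < Im lam" and mu: "0 < Im \<mu>"
  shows "strongly_integrable b (UU lam \<mu>)"
    "cinner (strong_integral b (UU lam \<mu>) x) w = ip \<Delta> (sol \<mu> x) (sol lam w)"
proof -
  obtain Y where Y: "0 \<le> Y" "\<And>x. nrm \<Delta> (sol lam x) \<le> Y * norm x" using sol_nrm[OF lam] by blast
  have cont: "continuous_on \<Delta> (sol \<mu> x)" for x
    using sol_C1[OF mu, of x] differentiable_imp_continuous_within by (auto simp: C1_on_def continuous_on_eq_continuous_within)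
  have ex: "\<exists>v. (\<forall>w. cinner v w = ip \<Delta> (sol \<mu> x) (sol lam w)) \<and>
      ((\<lambda>\<eta>. integral {0..\<eta>} (\<lambda>t. UU lam \<mu> t x)) \<longlongrightarrow> v) (left_of b)" for x
    by (rule strong_integral_exists[OF U_op[OF lam] sol_C1[OF lam] maxdom_L2(1)[OF sol_D[OF lam]] Y(2,1)
        maxdom_L2(1)[OF sol_D[OF mu]] cont])
  show "strongly_integrable b (UU lam \<mu>)"
    unfolding strongly_integrable_def
    using ex integrable_continuous_interval[OF continuous_on_hadj_apply[OF U_op[OF lam] sol_C1[OF lam] _ cont]] by blast
  show "cinner (strong_integral b (UU lam \<mu>) x) w = ip \<Delta> (sol \<mu> x) (sol lam w)"
    using ex[of x] tendsto_Lim[OF left_of_nontrivial] unfolding strong_integral_def by blast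
qed

text \<open>By \<open>char_matrix_eq\<close> the values arise from \<open>M\<close> and
  \<open>Top\<close> by sums and compositions with constant operators, which carry the embeddings of
  H^n.\<close>

lemma char_matrix_holomorphic_upper: "op_holomorphic {z. 0 < Im z} UNIV UNIV \<Omega>"
proof -
  let ?J1 = "\<lambda>x :: ('h, 'n) vec \<times> ('h, 'n) vec. (fst x, 0 :: 'g)" and ?J2 = "\<lambda>x :: ('h, 'n) vec \<times> ('h, 'n) vec. (snd x, 0 :: 'g)"
  let ?A1 = "\<lambda>e :: ('h, 'n) vec \<times> 'g. - (fst e, 0 :: ('h, 'n) vec)" and ?A2 = "\<lambda>e :: ('h, 'n) vec \<times> 'g. (0 :: ('h, 'n) vec, fst e)"
  let ?R = "\<lambda>x :: ('h, 'n) vec \<times> ('h, 'n) vec. (0 :: ('h, 'n) vec, (1/2) *\<^sub>C fst x) - ((1/2) *\<^sub>C snd x, 0 :: ('h, 'n) vec)"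
  let ?g = "\<lambda>z x. P.Top z (M z (?J1 x)) - ?J1 x - P.Top z (?J2 x)"
  note const = op_holomorphic_const
  have J1: "bounded_op UNIV UNIV ?J1" and J2: "bounded_op UNIV UNIV ?J2"
    by (rule bounded_op_compose[OF bounded_op_inl bounded_op_fst], rule bounded_op_compose[OF bounded_op_inl bounded_op_snd])
  have A1: "bounded_op UNIV UNIV ?A1" and A2: "bounded_op UNIV UNIV ?A2"
    by (rule bounded_op_minus[OF bounded_op_compose[OF bounded_op_inl bounded_op_fst]], rule bounded_op_compose[OF bounded_op_inr bounded_op_fst])
  have R: "bounded_op UNIV UNIV ?R"
    by (rule bounded_op_diff[OF bounded_op_compose[OF bounded_op_inr bounded_op_scaleC[OF bounded_op_fst]]
          bounded_op_compose[OF bounded_op_inl bounded_op_scaleC[OF bounded_op_snd]]])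
  have g: "op_holomorphic {z. 0 < Im z} UNIV UNIV ?g"
    by (rule op_holomorphic_diff[OF op_holomorphic_diff[OF op_holomorphic_compose[OF P.Top_hol
          op_holomorphic_compose[OF W.M_holomorphic const[OF J1]]] const[OF J1]] op_holomorphic_compose[OF P.Top_hol const[OF J2]]])
  have F: "op_holomorphic {z. 0 < Im z} UNIV UNIV (\<lambda>z x. ?A1 (M z (?g z x)) + ?A2 (?g z x) + ?R x)"
    by (rule op_holomorphic_add[OF op_holomorphic_add[OF op_holomorphic_compose[OF const[OF A1] op_holomorphic_compose[OF W.M_holomorphic g]]
          op_holomorphic_compose[OF const[OF A2] g]] const[OF R]])
  have eq: "\<Omega> z = (\<lambda>x. ?A1 (M z (?g z x)) + ?A2 (?g z x) + ?R x)" if "z \<in> {z. 0 < Im z}" for z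
  proof
    fix x
    have z: "0 < Im z" using that by simp
    show "\<Omega> z x = ?A1 (M z (?g z x)) + ?A2 (?g z x) + ?R x"
      unfolding char_matrix_eq[OF z] W.M_eq[OF z sol(1)[OF z]] sol(2)[OF z] P.gsol_def by simp
  qed
  show ?thesis unfolding op_holomorphic_def
    by (intro ballI op_holomorphic_local[OF F open_halfspace_Im_gt order_refl eq])
qed

lemma \<Omega>_op: "0 < Im lam \<Longrightarrow> bounded_op UNIV UNIV (\<Omega> lam)"
  using op_holomorphic_bounded[OF char_matrix_holomorphic_upper] by simp

abbreviation "\<beta> \<equiv> beta_op M K0 K1"

lemma cinner_char_matrix_identity:
  assumes lam: "0 < Im lam" and mu: "0 < Im \<mu>"
  shows "cinner (\<Omega> \<mu> x - hadj UNIV (\<Omega> lam) x - (\<mu> - cnj lam) *\<^sub>C strong_integral b (UU lam \<mu>) x) w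
     = cinner (K_form H1 K0 K1 lam \<mu> (\<beta> \<mu> x)) (\<beta> lam w)"
proof -
  have \<beta>: "\<beta> lam x = P.bsol lam (fst x, 0) (snd x, 0)" for lam x
    by (simp add: beta_op_def P.bsol_def P.Bop_def Let_def split_beta)
  have 1: "cinner (\<Omega> \<mu> x) w = cinner (- G1 (sol \<mu> x) - (1/2) *\<^sub>R (snd x, 0)) (fst w, 0) + cinner (G0 (sol \<mu> x) + (1/2) *\<^sub>R (fst x, 0)) (snd w, 0)"
    by (simp add: char_matrix_eq[OF mu] cinner_prod_def scaleC_prod_def cinner_simps)
  have 2: "cinner x (\<Omega> lam w) = cinner (fst x, 0) (- G1 (sol lam w) - (1/2) *\<^sub>R (snd w, 0)) + cinner (snd x, 0) (G0 (sol lam w) + (1/2) *\<^sub>R (fst w, 0))"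
    by (simp add: char_matrix_eq[OF lam] cinner_prod_def scaleC_prod_def cinner_simps)
  have "cinner (\<Omega> \<mu> x) w - cinner x (\<Omega> lam w)
      = (\<mu> - cnj lam) * ip \<Delta> (sol \<mu> x) (sol lam w) + cinner (K_form H1 K0 K1 lam \<mu> (\<beta> \<mu> x)) (\<beta> lam w)"
    unfolding 1 2 \<beta>
    by (rule P.key_identity[OF lam mu H1_mem H1_mem H1_mem H1_mem sol(1)[OF mu] sol(2)[OF mu] sol(1)[OF lam] sol(2)[OF lam]])
  then show ?thesis
    unfolding cinner_diff_left hadj_UNIV_left[OF \<Omega>_op[OF lam]] cinner_scaleC_left strong_integral_UU(2)[OF lam mu] by simp
qed

text \<open>The weak identity exhibits the vector that represents
  \<open>w \<mapsto> cinner (\<beta> lam w)\<close> at the form, and \<open>hadj\<close> is defined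
  as exactly this vector. A separate proof that \<open>\<beta>\<close> is bounded is thus
  avoided.\<close>

lemma char_matrix_identity:
  assumes lam: "0 < Im lam" and mu: "0 < Im \<mu>"
  shows "\<Omega> \<mu> x - hadj UNIV (\<Omega> lam) x =
     (\<mu> - cnj lam) *\<^sub>C strong_integral b (UU lam \<mu>) x + hadj UNIV (\<beta> lam) (K_form H1 K0 K1 lam \<mu> (\<beta> \<mu> x))"
proof -
  have "hadj UNIV (\<beta> lam) (K_form H1 K0 K1 lam \<mu> (\<beta> \<mu> x))
      = \<Omega> \<mu> x - hadj UNIV (\<Omega> lam) x - (\<mu> - cnj lam) *\<^sub>C strong_integral b (UU lam \<mu>) x"
  proof (rule hadj_eqI[OF closed_csubspace_UNIV UNIV_I])
    fix w
    show "cinner (\<beta> lam w) (K_form H1 K0 K1 lam \<mu> (\<beta> \<mu> x))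
        = cinner w (\<Omega> \<mu> x - hadj UNIV (\<Omega> lam) x - (\<mu> - cnj lam) *\<^sub>C strong_integral b (UU lam \<mu>) x)"
      using arg_cong[OF cinner_char_matrix_identity[OF lam mu, of x w], of cnj] unfolding cnj_cinner by (rule sym)
  qed
  then show ?thesis by simp
qed

lemma cinner_excess:
  assumes mu: "0 < Im \<mu>"
  shows "cinner ((1 / Im \<mu>) *\<^sub>R op_Im UNIV (\<Omega> \<mu>) x - strong_integral b (UU \<mu> \<mu>) x) w
     = 1 / (2 * \<i> * Im \<mu>) * cinner (K_form H1 K0 K1 \<mu> \<mu> (\<beta> \<mu> x)) (\<beta> \<mu> w)"
proof -
  have m: "\<mu> - cnj \<mu> = 2 * \<i> * Im \<mu>" by (simp add: complex_eq_iff)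
  have "cinner (\<Omega> \<mu> x - hadj UNIV (\<Omega> \<mu>) x) w = 2 * \<i> * Im \<mu> * cinner (strong_integral b (UU \<mu> \<mu>) x) w
      + cinner (K_form H1 K0 K1 \<mu> \<mu> (\<beta> \<mu> x)) (\<beta> \<mu> w)"
    using cinner_char_matrix_identity[OF mu mu, of x w] unfolding m
    by (simp only: cinner_diff_left cinner_scaleC_left) (simp add: algebra_simps)
  then show ?thesis
    using mu by (simp add: op_Im_def cinner_diff_left[of "_ *\<^sub>R _"] cinner_scaleR_left cinner_scaleC_left field_simps)
qed

text \<open>On the diagonal the form equals \<open>\<i> r\<close> with \<open>r \<ge> 0\<close> by
  dissipativity of the pair \<open>(K0 k, K1 k)\<close>; division by \<open>2 \<i> Im \<mu>\<close>
  leaves a nonnegative real number.\<close>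

lemma excess_nonneg:
  assumes mu: "0 < Im \<mu>"
  shows "nonneg_op UNIV (\<lambda>x. (1 / Im \<mu>) *\<^sub>R op_Im UNIV (\<Omega> \<mu>) x - strong_integral b (UU \<mu> \<mu>) x)"
  unfolding nonneg_op_def
proof (intro ballI)
  fix x
  define k where "k = \<beta> \<mu> x"
  define r where "r = 2 * Im (cinner (K1 \<mu> k) (K0 \<mu> k)) - (norm (oproj (ocompl H1) (K0 \<mu> k)))\<^sup>2"
  have r: "0 \<le> r" using P.pair_dissipative[OF mu P.K_pair[OF mu, of k]] by (simp add: r_def)
  have "cinner (K1 \<mu> k) (K0 \<mu> k) - cinner (K0 \<mu> k) (K1 \<mu> k) = 2 * \<i> * Im (cinner (K1 \<mu> k) (K0 \<mu> k))"
    using complex_diff_cnj[of "cinner (K1 \<mu> k) (K0 \<mu> k)"] by (simp add: mult_ac)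
  then have "cinner (K_form H1 K0 K1 \<mu> \<mu> k) k = \<i> * r"
    unfolding P.K_form_cinner[OF mu mu] cinner_self by (simp add: r_def algebra_simps)
  then have "cinner ((1 / Im \<mu>) *\<^sub>R op_Im UNIV (\<Omega> \<mu>) x - strong_integral b (UU \<mu> \<mu>) x) x = complex_of_real (r / (2 * Im \<mu>))"
    unfolding cinner_excess[OF mu] k_def[symmetric] by simp
  then show "Im (cinner ((1 / Im \<mu>) *\<^sub>R op_Im UNIV (\<Omega> \<mu>) x - strong_integral b (UU \<mu> \<mu>) x) x) = 0 \<and>
      0 \<le> Re (cinner ((1 / Im \<mu>) *\<^sub>R op_Im UNIV (\<Omega> \<mu>) x - strong_integral b (UU \<mu> \<mu>) x) x)"
    using r mu by simp
qed

text \<open>Self-adjointness of the negated relation makes the form vanish for any two parameters,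
  not only on the diagonal. The difference of the two sides is therefore orthogonal to
  itself.\<close>

lemma excess_eq_0:
  assumes mu: "0 < Im \<mu>" and adj: "cross_adj H1 (neg_rel (pair_rel H1 (C0 \<mu>) (C1 \<mu>))) = neg_rel (pair_rel H1 (C0 \<mu>) (C1 \<mu>))"
  shows "(1 / Im \<mu>) *\<^sub>R op_Im UNIV (\<Omega> \<mu>) x = strong_integral b (UU \<mu> \<mu>) x"
proof -
  have "cinner (K_form H1 K0 K1 \<mu> \<mu> k) k' = 0" for k k'
  proof -
    have m: "(K0 \<mu> k, - K1 \<mu> k) \<in> neg_rel (pair_rel H1 (C0 \<mu>) (C1 \<mu>))" for k
      unfolding neg_rel_def using P.K_pair[OF mu] by blast
    have "cinner (- K1 \<mu> k) (K0 \<mu> k') - cinner (K0 \<mu> k) (- K1 \<mu> k')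
        + \<i> * cinner (oproj (ocompl H1) (K0 \<mu> k)) (oproj (ocompl H1) (K0 \<mu> k')) = 0"
      using m[of k] m[of k'] unfolding adj[symmetric, THEN arg_cong[where f = "\<lambda>A. (K0 \<mu> k, - K1 \<mu> k) \<in> A"]]
      unfolding cross_adj_def by blast
    then show ?thesis
      unfolding P.K_form_cinner[OF mu mu] by (simp add: cinner_simps algebra_simps)
  qed
  then have "cinner ((1 / Im \<mu>) *\<^sub>R op_Im UNIV (\<Omega> \<mu>) x - strong_integral b (UU \<mu> \<mu>) x)
      ((1 / Im \<mu>) *\<^sub>R op_Im UNIV (\<Omega> \<mu>) x - strong_integral b (UU \<mu> \<mu>) x) = 0"
    unfolding cinner_excess[OF mu] by simp
  then show ?thesis unfolding cinner_self by simp
qed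

text \<open>Everything is proved in the upper half-plane and reflected, since
  \<open>char_matrix\<close> is defined below the real axis by the adjoint at the conjugate
  point.\<close>

lemma char_matrix_nevanlinna: "nevanlinna_op \<Omega>"
proof -
  have low: "\<Omega> z = hadj UNIV (\<Omega> (cnj z))" if "Im z < 0" for z
    using that by (simp add: char_matrix_def)
  have sym: "hadj UNIV (\<Omega> (cnj z)) = \<Omega> z" if z: "Im z \<noteq> 0" for z
  proof (cases "0 < Im z")
    case True
    then show ?thesis using low[of "cnj z"] hadj_hadj[OF \<Omega>_op[OF True]] by simp
  qed (use low z in auto)
  have U: "{z. 0 < Im z} \<subseteq> {z. Im z \<noteq> 0}" "{z. Im z < 0} \<subseteq> {z. Im z \<noteq> 0}" by auto
  have im: "cnj ` {z. 0 < Im z} = {z. Im z < 0}" by (auto simp: image_iff intro!: exI[of _ "cnj _"])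
  have lowhol: "op_holomorphic {z. Im z < 0} UNIV UNIV (\<lambda>z. hadj UNIV (\<Omega> (cnj z)))"
    using op_holomorphic_hadj_cnj[OF char_matrix_holomorphic_upper] unfolding im .
  have hol: "op_holomorphic {z. Im z \<noteq> 0} UNIV UNIV \<Omega>"
    unfolding op_holomorphic_def
  proof
    fix z assume "z \<in> {z. Im z \<noteq> 0}"
    then consider "z \<in> {z. 0 < Im z}" | "z \<in> {z. Im z < 0}" by fastforce
    then show "bounded_op UNIV UNIV (\<Omega> z) \<and> (\<exists>T'. bounded_op UNIV UNIV T' \<and>
        op_tendsto UNIV (\<lambda>w x. (1 / (w - z)) *\<^sub>C (\<Omega> w x - \<Omega> z x)) T' (at z within {z. Im z \<noteq> 0}))"
    proof cases
      case 1
      show ?thesis by (rule op_holomorphic_local[OF char_matrix_holomorphic_upper open_halfspace_Im_gt U(1) refl 1])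
    next
      case 2
      show ?thesis by (rule op_holomorphic_local[OF lowhol open_halfspace_Im_lt U(2) _ 2]) (simp add: low)
    qed
  qed
  have up: "Im (cinner (Im z *\<^sub>R op_Im UNIV (\<Omega> z) x) x) = 0 \<and> 0 \<le> Re (cinner (Im z *\<^sub>R op_Im UNIV (\<Omega> z) x) x)"
    if z: "0 < Im z" for z x
  proof -
    define e where "e = cinner ((1 / Im z) *\<^sub>R op_Im UNIV (\<Omega> z) x - strong_integral b (UU z z) x) x"
    have e: "Im e = 0" "0 \<le> Re e" using excess_nonneg[OF z, unfolded nonneg_op_def, rule_format, OF UNIV_I, of x] unfolding e_def by blast+
    \<comment> \<open>The integral term is itself nonnegative: its quadratic form is the squared
      norm of the solution.\<close>
    have "cinner ((1 / Im z) *\<^sub>R op_Im UNIV (\<Omega> z) x) x = e + (nrm \<Delta> (sol z x))\<^sup>2"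
      unfolding e_def cinner_diff_left strong_integral_UU(2)[OF z z] ip_self by simp
    then have "cinner (Im z *\<^sub>R op_Im UNIV (\<Omega> z) x) x = (Im z)\<^sup>2 * (e + (nrm \<Delta> (sol z x))\<^sup>2)"
      using z by (simp add: cinner_scaleR_left power2_eq_square field_simps)
    then show ?thesis using e by simp
  qed
  have "nonneg_op UNIV (\<lambda>x. Im z *\<^sub>R op_Im UNIV (\<Omega> z) x)" if z: "Im z \<noteq> 0" for z
    unfolding nonneg_op_def
  proof (intro ballI)
    fix x
    show "Im (cinner (Im z *\<^sub>R op_Im UNIV (\<Omega> z) x) x) = 0 \<and> 0 \<le> Re (cinner (Im z *\<^sub>R op_Im UNIV (\<Omega> z) x) x)"
    proof (cases "0 < Im z")
      case False
      then have z': "0 < Im (cnj z)" "Im z < 0" using z by auto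
      have "op_Im UNIV (\<Omega> z) x = - op_Im UNIV (\<Omega> (cnj z)) x"
        unfolding op_Im_def low[OF z'(2)] hadj_hadj[OF \<Omega>_op[OF z'(1)]] by (simp add: scaleC_minus_right[symmetric])
      then show ?thesis using up[OF z'(1), of x] by simp
    qed (use up in blast)
  qed
  then show ?thesis using hol sym by (simp add: nevanlinna_op_def)
qed

end

theorem proposition5p10:
  fixes b :: ereal and \<Delta> :: "real set"
    and p q :: "nat \<Rightarrow> real \<Rightarrow> 'h::{chilbert_space, second_countable_topology} \<Rightarrow> 'h"
    and H1' :: "'g::chilbert_space set"
    and \<Gamma>0' \<Gamma>1' :: "(real \<Rightarrow> 'h) \<Rightarrow> 'g"
    and M :: "complex \<Rightarrow> ('h, 'n::{finite,linorder}) vec \<times> 'g \<Rightarrow> ('h, 'n) vec \<times> 'g"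
    and C0 C1 :: "complex \<Rightarrow> ('h, 'n) vec \<times> 'g \<Rightarrow> 'k::chilbert_space"
    and D0 D1 :: "complex \<Rightarrow> ('h, 'n) vec \<times> 'g \<Rightarrow> 'm::chilbert_space"
    and K0 K1 :: "complex \<Rightarrow> 'l::chilbert_space \<Rightarrow> ('h, 'n) vec \<times> 'g"
    and u1 u2 :: "complex \<Rightarrow> real \<Rightarrow> ('h, 'n) vec \<Rightarrow> 'h"
  defines "H1 \<equiv> (bspace1 H1' :: (('h, 'n) vec \<times> 'g) set)"
    and "\<Omega> \<equiv> char_matrix H1' M C0 C1"
    and "UU \<equiv> \<lambda>lam \<mu> t x. hadj UNIV (U_sol u1 u2 lam t) (U_sol u1 u2 \<mu> t x)"
    and "\<beta> \<equiv> beta_op M K0 K1"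
  assumes interval: "interval_upto b \<Delta>"
    and coeffs: "admissible_coeffs CARD('n) \<Delta> p q"
    and triplet: "decomposing_D_triplet TYPE('n) b \<Delta> p q H1' \<Gamma>0' \<Gamma>1'"
    and weyl: "weyl_function \<Delta> p q H1' \<Gamma>0' \<Gamma>1' M"
    and tau: "R_class H1 C0 C1 D0 D1"
    and K_rep: "range_representation H1 (\<lambda>lam. pair_rel H1 (C0 lam) (C1 lam)) K0 K1"
    and u1: "\<And>lam. Im lam > 0 \<Longrightarrow> op_solution \<Delta> p q lam (u1 lam) \<and>
               u_boundary_condition \<Delta> p q \<Gamma>0' \<Gamma>1' (C0 lam) (C1 lam) (\<lambda>h. C1 lam (h, 0)) (u1 lam)"
    and u2: "\<And>lam. Im lam > 0 \<Longrightarrow> op_solution \<Delta> p q lam (u2 lam) \<and>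
               u_boundary_condition \<Delta> p q \<Gamma>0' \<Gamma>1' (C0 lam) (C1 lam) (\<lambda>h. - C0 lam (h, 0)) (u2 lam)"
  shows "(\<forall>lam \<mu>. Im lam > 0 \<longrightarrow> Im \<mu> > 0 \<longrightarrow>
            strongly_integrable b (UU lam \<mu>) \<and>
            (\<forall>x. \<Omega> \<mu> x - hadj UNIV (\<Omega> lam) x =
               (\<mu> - cnj lam) *\<^sub>C strong_integral b (UU lam \<mu>) x
               + hadj UNIV (\<beta> lam) (K_form H1 K0 K1 lam \<mu> (\<beta> \<mu> x))))
       \<and> (\<forall>\<mu>. Im \<mu> > 0 \<longrightarrow>
            nonneg_op UNIV
              (\<lambda>x. (1 / Im \<mu>) *\<^sub>R op_Im UNIV (\<Omega> \<mu>) x - strong_integral b (UU \<mu> \<mu>) x))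
       \<and> (R0_class H1 C0 C1 D0 D1 \<longrightarrow>
            (\<forall>\<mu>. Im \<mu> > 0 \<longrightarrow>
               (\<forall>x. (1 / Im \<mu>) *\<^sub>R op_Im UNIV (\<Omega> \<mu>) x = strong_integral b (UU \<mu> \<mu>) x)))
       \<and> nevanlinna_op \<Omega>"
proof -
  have "quasi CARD('n) b \<Delta> p q" by unfold_locales (simp_all add: interval coeffs)
  then interpret T: D_weyl "CARD('n)" b \<Delta> p q H1' \<Gamma>0' \<Gamma>1' M
    by (intro D_weyl.intro D_weyl_axioms.intro refl triplet weyl)
  note R = tau[unfolded R_class_def Let_def H1_def]
  have "weyl_pair \<Delta> T.D T.L (bspace1 H1') T.G0 T.G1 M C0 C1 K0 K1"
    by (intro weyl_pair.intro weyl_pair_axioms.intro T.W.weyl_axioms K_rep[unfolded H1_def]) (use R in auto)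
  then interpret T: D_weyl_pair "CARD('n)" b \<Delta> p q H1' \<Gamma>0' \<Gamma>1' M C0 C1 K0 K1 u1 u2
    by (intro D_weyl_pair.intro D_weyl_pair_axioms.intro T.D_weyl_axioms u1 u2)
  have canonical: "cross_adj (bspace1 H1') (neg_rel (pair_rel (bspace1 H1') (C0 \<mu>) (C1 \<mu>))) = neg_rel (pair_rel (bspace1 H1') (C0 \<mu>) (C1 \<mu>))"
    if "R0_class (bspace1 H1') C0 C1 D0 D1" "0 < Im \<mu>" for \<mu>
    using that unfolding R0_class_def by force
  show ?thesis
    unfolding H1_def \<Omega>_def UU_def \<beta>_def
    by (intro conjI allI impI T.strong_integral_UU(1) T.char_matrix_identity T.excess_nonneg T.excess_eq_0 canonical T.char_matrix_nevanlinna)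
qed

end
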